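(* Let $b\ge 2$ be an integer, let $\Gamma=\Gamma_b$ be the homogeneous rooted metric tree with branching number $b$, and let $\mathbf A_0=-\boldsymbol\Delta$ be the Dirichlet Laplacian on $\Gamma$. Put $R=\frac{b^{1/2}+b^{-1/2}}{2}$ and $\theta=\arccos(1/R)$. Then the spectrum of $\mathbf A_0$ is of infinite multiplicity and consists of the bands $$\mathfrak b_l=\bigl[(\pi(l-1)+\theta)^2,(\pi l-\theta)^2\bigr],\qquad l\in\mathbb N,$$ and the eigenvalues $\lambda_l=(\pi l)^2$, $l\in\mathbb N$.
   Context: Homogeneous tree: $\Gamma_b$ is the rooted metric tree with root $o$ in which every edge is a segment of length $1$, exactly one edge emanates from $o$, and exactly $b$ edges emanate (away from the root) from every vertex $v\ne o$. It carries the natural metric and Lebesgue measure $dx$; $|x|$ is the distance from $x$ to $o$. $\mathsf H^{1,0}(\Gamma)$ is the space of continuous functions $f$ on $\Gamma$ with $f\in \mathsf H^1(e)$ on each edge $e$, $\int_\Gamma(|f'|^2+|f|^2)dx<\infty$ and $f(o)=0$. The Dirichlet Laplacian $-\boldsymbol\Delta$ is the self-adjoint operator in $L^2(\Gamma)$ associated with the quadratic form $\int_\Gamma|f'|^2dx$ with form domain $\mathsf H^{1,0}(\Gamma)$ (equivalently, $-f''$ on each edge, with continuity and $f_1'(v)+\dots+f_b'(v)=f_-'(v)$ at every vertex $v\neq o$, where $f_-$ is the restriction to the edge ending at $v$ and $f_1,\dots,f_b$ are the restrictions to the edges emanating from $v$, and with $f(o)=0$). *)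

theory Defs
  imports "HOL-Analysis.Analysis" "HOL-Library.Sublist"
begin

section \<open>Square-integrable functions and unbounded operators\<close>

text \<open>
  Elements of the Hilbert space \<open>L\<^sup>2(M)\<close> are represented by functions, and equality in
  \<open>L\<^sup>2(M)\<close> is equality almost everywhere.  An unbounded operator in \<open>L\<^sup>2(M)\<close> is
  represented by its graph: \<open>(u, h) \<in> T\<close> means that \<open>u\<close> lies in the domain of \<open>T\<close> and
  \<open>T u = h\<close>.  The graphs constructed below are closed under changing \<open>u\<close> and \<open>h\<close> on
  null sets.
\<close>

type_synonym 'a l2_op = "(('a \<Rightarrow> complex) \<times> ('a \<Rightarrow> complex)) set"

definition L2 :: "'a measure \<Rightarrow> ('a \<Rightarrow> complex) set" where
  "L2 M = {f. f \<in> borel_measurable M \<and> integrable M (\<lambda>x. (cmod (f x))\<^sup>2)}"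

definition l2_inner :: "'a measure \<Rightarrow> ('a \<Rightarrow> complex) \<Rightarrow> ('a \<Rightarrow> complex) \<Rightarrow> complex" where
  "l2_inner M f g = (LINT x|M. f x * cnj (g x))"

definition l2_norm :: "'a measure \<Rightarrow> ('a \<Rightarrow> complex) \<Rightarrow> real" where
  "l2_norm M f = sqrt (LINT x|M. (cmod (f x))\<^sup>2)"

text \<open>
  The operator associated with a sesquilinear form \<open>a\<close> with form domain \<open>D\<close>
  (first representation theorem): \<open>u\<close> is in its domain iff \<open>u \<in> D\<close> and there is an
  \<open>h\<close> in \<open>L\<^sup>2(M)\<close> with \<open>a[u,v] = (h,v)\<close> for all \<open>v \<in> D\<close>.  The function \<open>u\<^sub>0\<close> is the
  representative in \<open>D\<close> of the class of \<open>u\<close>.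
\<close>

definition form_operator ::
  "'a measure \<Rightarrow> ('a \<Rightarrow> complex) set \<Rightarrow> (('a \<Rightarrow> complex) \<Rightarrow> ('a \<Rightarrow> complex) \<Rightarrow> complex) \<Rightarrow> 'a l2_op"
  where
  "form_operator M D a =
     {(u, h). u \<in> L2 M \<and> h \<in> L2 M \<and>
        (\<exists>u\<^sub>0\<in>D. (AE x in M. u x = u\<^sub>0 x) \<and> (\<forall>v\<in>D. a u\<^sub>0 v = l2_inner M h v))}"

text \<open>
  \<open>z\<close> is in the resolvent set iff \<open>T - z\<close> is a bijection of the domain onto
  \<open>L\<^sup>2(M)\<close> with bounded inverse; the lower bound below contains injectivity.
\<close>

definition resolvent_set :: "'a measure \<Rightarrow> 'a l2_op \<Rightarrow> complex set" where
  "resolvent_set M T =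
     {z. (\<exists>C. \<forall>(u, h)\<in>T. l2_norm M u \<le> C * l2_norm M (\<lambda>x. h x - z * u x)) \<and>
         (\<forall>g\<in>L2 M. \<exists>(u, h)\<in>T. AE x in M. h x - z * u x = g x)}"

definition spectrum :: "'a measure \<Rightarrow> 'a l2_op \<Rightarrow> complex set" where
  "spectrum M T = - resolvent_set M T"

definition eigenvalue :: "'a measure \<Rightarrow> 'a l2_op \<Rightarrow> complex \<Rightarrow> bool" where
  "eigenvalue M T z \<longleftrightarrow>
     (\<exists>(u, h)\<in>T. (AE x in M. h x = z * u x) \<and> \<not> (AE x in M. u x = 0))"

definition l2_unitary ::
  "'a measure \<Rightarrow> 'b measure \<Rightarrow> (('a \<Rightarrow> complex) \<Rightarrow> ('b \<Rightarrow> complex)) \<Rightarrow> bool" where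
  "l2_unitary M N U \<longleftrightarrow>
     (\<forall>f\<in>L2 M. U f \<in> L2 N) \<and>
     (\<forall>f\<in>L2 M. \<forall>g\<in>L2 M. AE y in N. U (\<lambda>x. f x + g x) y = U f y + U g y) \<and>
     (\<forall>c. \<forall>f\<in>L2 M. AE y in N. U (\<lambda>x. c * f x) y = c * U f y) \<and>
     (\<forall>f\<in>L2 M. l2_norm N (U f) = l2_norm M f) \<and>
     (\<forall>k\<in>L2 N. \<exists>f\<in>L2 M. AE y in N. U f y = k y)"

definition unitarily_equivalent ::
  "'a measure \<Rightarrow> 'a l2_op \<Rightarrow> 'b measure \<Rightarrow> 'b l2_op \<Rightarrow> bool" where
  "unitarily_equivalent M T N S \<longleftrightarrow>
     (\<exists>U. l2_unitary M N U \<and>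
          (\<forall>u\<in>L2 M. \<forall>h\<in>L2 M. (u, h) \<in> T \<longleftrightarrow> (U u, U h) \<in> S))"

definition multiplication_op :: "'a measure \<Rightarrow> ('a \<Rightarrow> complex) \<Rightarrow> 'a l2_op" where
  "multiplication_op M m =
     {(u, h). u \<in> L2 M \<and> h \<in> L2 M \<and> (AE x in M. h x = m x * u x)}"

text \<open>
  Infinite (uniform) spectral multiplicity of a self-adjoint operator, i.e. the
  multiplicity function of its spectral representation is identically infinite: the
  operator is unitarily equivalent to multiplication by the independent variable in the
  orthogonal sum of countably many copies of \<open>L\<^sup>2(\<real>, \<mu>)\<close>, for one fixed finite Borel
  measure \<open>\<mu>\<close>.  This orthogonal sum is \<open>L\<^sup>2(\<real> \<times> \<nat>)\<close> for the product of \<open>\<mu>\<close> with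
  counting measure.  In particular every eigenvalue then has infinite multiplicity.
\<close>

definition infinite_multiplicity :: "'a measure \<Rightarrow> 'a l2_op \<Rightarrow> bool" where
  "infinite_multiplicity M T \<longleftrightarrow>
     (\<exists>\<mu> :: real measure. sets \<mu> = sets borel \<and> finite_measure \<mu> \<and>
        unitarily_equivalent M T (\<mu> \<Otimes>\<^sub>M count_space (UNIV :: nat set))
          (multiplication_op (\<mu> \<Otimes>\<^sub>M count_space (UNIV :: nat set)) (\<lambda>(s, n). complex_of_real s)))"


section \<open>The Sobolev space \<open>H\<^sup>1\<close> of the unit interval\<close>

abbreviation unit_lebesgue :: "real measure" where
  "unit_lebesgue \<equiv> restrict_space lborel {0<..<1}"

text \<open>\<open>\<phi> \<in> C\<^sup>1\<^sub>c(0,1)\<close>, extended by zero, with derivative \<open>\<psi>\<close>.\<close>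

definition test_function :: "(real \<Rightarrow> real) \<Rightarrow> (real \<Rightarrow> real) \<Rightarrow> bool" where
  "test_function \<phi> \<psi> \<longleftrightarrow>
     (\<forall>t. (\<phi> has_real_derivative \<psi> t) (at t)) \<and> continuous_on UNIV \<psi> \<and>
     (\<exists>c d. 0 < c \<and> d < 1 \<and> (\<forall>t. t \<notin> {c..d} \<longrightarrow> \<phi> t = 0))"

definition has_weak_derivative :: "(real \<Rightarrow> complex) \<Rightarrow> (real \<Rightarrow> complex) \<Rightarrow> bool" where
  "has_weak_derivative f g \<longleftrightarrow>
     (\<forall>\<phi> \<psi>. test_function \<phi> \<psi> \<longrightarrow>
        (LINT t|unit_lebesgue. f t * of_real (\<psi> t)) =
        - (LINT t|unit_lebesgue. g t * of_real (\<phi> t)))"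

definition H1_unit :: "(real \<Rightarrow> complex) set" where
  "H1_unit = {f \<in> L2 unit_lebesgue. \<exists>g\<in>L2 unit_lebesgue. has_weak_derivative f g}"

text \<open>For \<open>f \<in> H1_unit\<close> this is determined up to equality almost everywhere on \<open>(0,1)\<close>.\<close>

definition weak_derivative :: "(real \<Rightarrow> complex) \<Rightarrow> real \<Rightarrow> complex" where
  "weak_derivative f = (SOME g. g \<in> L2 unit_lebesgue \<and> has_weak_derivative f g)"


section \<open>The homogeneous metric tree\<close>

text \<open>
  Edges are indexed by words over \<open>{..<b}\<close>: the empty word is the edge emanating from
  the root, and the \<open>b\<close> edges emanating from the end point of the edge \<open>w\<close> are
  \<open>w @ [i]\<close>, \<open>i < b\<close>.  The pair \<open>(w, t)\<close>, \<open>0 < t \<le> 1\<close>, is the point of the edge \<open>w\<close> at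
  distance \<open>t\<close> from the initial point of that edge; thus \<open>(w, 1)\<close> runs through the
  vertices other than the root, and every point of the tree is represented exactly once.
\<close>

type_synonym tree_point = "nat list \<times> real"

definition tree_root :: tree_point where
  "tree_root = ([], 0)"

definition tree :: "nat \<Rightarrow> tree_point set" where
  "tree b = insert tree_root (lists {..<b} \<times> {0<..1})"

text \<open>The distance \<open>|x|\<close> to the root.\<close>

definition tree_height :: "tree_point \<Rightarrow> real" where
  "tree_height = (\<lambda>(w, t). real (length w) + t)"

text \<open>
  Height of the point at which the paths from the root to \<open>x\<close> and to \<open>y\<close> separate.
  This is \<open>x\<close> or \<open>y\<close> if one of them lies on the path to the other; otherwise it is the
  end point of the edge given by the longest common prefix.
\<close>

definition tree_meet_height :: "tree_point \<Rightarrow> tree_point \<Rightarrow> real" where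
  "tree_meet_height x y =
     min (min (tree_height x) (tree_height y))
         (real (length (longest_common_prefix (fst x) (fst y))) + 1)"

definition tree_dist :: "tree_point \<Rightarrow> tree_point \<Rightarrow> real" where
  "tree_dist x y = tree_height x + tree_height y - 2 * tree_meet_height x y"

definition tree_topology :: "nat \<Rightarrow> tree_point topology" where
  "tree_topology b = Metric_space.mtopology (tree b) tree_dist"

definition tree_measure :: "nat \<Rightarrow> tree_point measure" where
  "tree_measure b = restrict_space (count_space UNIV \<Otimes>\<^sub>M lborel) (tree b)"

text \<open>The edgewise derivative \<open>f'\<close>.\<close>

definition tree_derivative :: "(tree_point \<Rightarrow> complex) \<Rightarrow> tree_point \<Rightarrow> complex" where
  "tree_derivative f = (\<lambda>(w, t). weak_derivative (\<lambda>s. f (w, s)) t)"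

text \<open>The space \<open>H\<^sup>1\<^sup>,\<^sup>0\<close> of the tree.\<close>

definition H10 :: "nat \<Rightarrow> (tree_point \<Rightarrow> complex) set" where
  "H10 b = {f. continuous_map (tree_topology b) euclidean f \<and>
               (\<forall>w\<in>lists {..<b}. (\<lambda>t. f (w, t)) \<in> H1_unit) \<and>
               integrable (tree_measure b) (\<lambda>x. (cmod (tree_derivative f x))\<^sup>2 + (cmod (f x))\<^sup>2) \<and>
               f tree_root = 0}"

definition dirichlet_form ::
  "nat \<Rightarrow> (tree_point \<Rightarrow> complex) \<Rightarrow> (tree_point \<Rightarrow> complex) \<Rightarrow> complex" where
  "dirichlet_form b u v = (LINT x|tree_measure b. tree_derivative u x * cnj (tree_derivative v x))"

definition dirichlet_laplacian :: "nat \<Rightarrow> tree_point l2_op" where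
  "dirichlet_laplacian b = form_operator (tree_measure b) (H10 b) (dirichlet_form b)"


text \<open>The topology above is indeed that of a metric space.\<close>

lemma length_lcp_le:
  "length (longest_common_prefix xs ys) \<le> length xs"
  "length (longest_common_prefix xs ys) \<le> length ys"
  using longest_common_prefix_prefix1[of xs ys] longest_common_prefix_prefix2[of xs ys]
  by (auto dest: prefix_length_le)

lemma lcp_commute: "longest_common_prefix xs ys = longest_common_prefix ys xs"
  by (induction xs ys rule: longest_common_prefix.induct) auto

lemma length_lcp_hyperbolic:
  "min (length (longest_common_prefix xs ys)) (length (longest_common_prefix ys zs))
     \<le> length (longest_common_prefix xs zs)"
proof -
  let ?p = "longest_common_prefix xs ys" and ?q = "longest_common_prefix ys zs"
  have p: "prefix ?p xs" "prefix ?p ys" and q: "prefix ?q ys" "prefix ?q zs"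
    by (simp_all add: longest_common_prefix_prefix1 longest_common_prefix_prefix2)
  then consider "prefix ?p ?q" | "prefix ?q ?p"
    using prefix_same_cases by blast
  then show ?thesis
  proof cases
    case 1
    then have "prefix ?p (longest_common_prefix xs zs)"
      using p q by (meson longest_common_prefix_max_prefix prefix_order.trans)
    then show ?thesis by (auto dest!: prefix_length_le)
  next
    case 2
    then have "prefix ?q (longest_common_prefix xs zs)"
      using p q by (meson longest_common_prefix_max_prefix prefix_order.trans)
    then show ?thesis by (auto dest!: prefix_length_le)
  qed
qed

lemma Metric_space_tree: "Metric_space (tree b) tree_dist"
proof
  show "0 \<le> tree_dist x y" for x y
    by (simp add: tree_dist_def tree_meet_height_def min_def)
  show "tree_dist x y = tree_dist y x" for x y
    by (simp add: tree_dist_def tree_meet_height_def lcp_commute[of "fst x"] min.commute)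
  show "tree_dist x z \<le> tree_dist x y + tree_dist y z" for x y z
    using length_lcp_hyperbolic[of "fst x" "fst y" "fst z"]
    by (auto simp: tree_dist_def tree_meet_height_def min_def split: if_splits)
  show "(tree_dist x y = 0) = (x = y)" if xy: "x \<in> tree b" "y \<in> tree b" for x y
  proof
    obtain w s where x: "x = (w, s)" by force
    obtain w' t where y: "y = (w', t)" by force
    have s: "0 < s \<and> s \<le> 1 \<or> w = [] \<and> s = 0" and t: "0 < t \<and> t \<le> 1 \<or> w' = [] \<and> t = 0"
      using xy by (auto simp: x y tree_def tree_root_def)
    let ?c = "longest_common_prefix w w'"
    have le: "length ?c \<le> length w" "length ?c \<le> length w'" by (rule length_lcp_le)+
    assume "tree_dist x y = 0"
    then have eq: "real (length w) + s = real (length w') + t"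
      and m: "real (length w) + s \<le> real (length ?c) + 1"
      by (auto simp: x y tree_dist_def tree_meet_height_def tree_height_def min_def split: if_splits)
    have "length w = length ?c" "length w' = length ?c"
      using s t eq m le by auto
    then have "w = ?c" "w' = ?c"
      using longest_common_prefix_prefix1[of w w'] longest_common_prefix_prefix2[of w w']
      by (metis append_Nil2 append_eq_append_conv prefix_def)+
    then have "w = w'" by simp
    then show "x = y" using eq by (simp add: x y)
  next
    have self: "longest_common_prefix w w = w" for w :: "nat list"
      by (induction w) auto
    assume "x = y"
    then show "tree_dist x y = 0"
      using xy by (auto simp: tree_dist_def tree_meet_height_def tree_height_def tree_def
        tree_root_def self)
  qed
qed

end

theory Submission
  imports Defs "HOL-Probability.Probability"
begin

text \<open>
  Decompose functions on each generation of edges in an orthonormal basis indexed by the same words, obtained from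
  Householder reflections of \<open>\<real>\<^sup>b\<close> that exchange the first unit vector and the constant one.  The words
  \<open>p @ 0\<^sup>k\<close>, \<open>p\<close> not ending in \<open>0\<close>, then carry the functions that start below one vertex and are radial
  from there on, and all these infinitely many chains give unitarily equivalent half-line problems
  \<open>- \<phi>'' = z \<phi>\<close> with \<open>\<phi>\<^bsub>k+1\<^esub>(0) = b\<^bsup>1/2\<^esup> \<phi>\<^sub>k(1)\<close> and \<open>b\<^bsup>1/2\<^esup> \<phi>'\<^bsub>k+1\<^esub>(0) = \<phi>'\<^sub>k(1)\<close>.
  The Floquet multipliers solve \<open>m + 1/m = 2 R cos \<surd>z\<close>.  If \<open>sin \<surd>z \<noteq> 0\<close> and \<open>|m| < 1\<close>, variation of constants
  bounds the resolvent; \<open>|m| = 1\<close> gives Weyl sequences; and \<open>sin \<surd>z = 0\<close> gives eigenfunctions.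
  For the multiplicity, the half-line operator has the cyclic vector \<open>m\<^sub>0\<^sup>k (1 - t + t/b)\<close>, \<open>m\<^sub>0 = b\<^bsup>-1/2\<^esup>\<close>:
  its cyclic space contains the decaying solutions for \<open>z = - n\<^sup>2\<close>, and orthogonality to these bounds exponential moments
  on the edges one after the other, so that Mikusinski's lemma applies.
  The copies of the cyclic vector have equal spectral moments, and Hausdorff's moment theorem provides the
  common measure.
\<close>

section \<open>The Hilbert space of square-integrable functions\<close>

text \<open>The vertex conditions dictate the basis: continuity forces equal values on the
  \<open>b\<close> children of an edge, while the Kirchhoff condition sees only the sum of their
  slopes. A basis containing the constant vector separates the two; normalising that vector produces
  the factors b^(1/2). In the other directions a function must vanish at the vertex, so every chain
  starts with the Dirichlet condition of the root.

  For the multiplicity the operator is replaced by its inverse: 0 is regular, as b^(-1/2) is a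
  multiplier at z = 0. A scaled inverse S with 0 <= S <= 1 has the moments of a measure on [0,1],
  and s -> 1/(C s) carries this measure back.

  The cyclic vector is the decaying solution at z = 0 with value 1 at the start of the chain. The
  decaying solution at -n^2 with the same starting value violates the Dirichlet condition too, but
  their difference lies in the domain; so the second is (1 + n^2 A_0^(-1))^(-1) applied to the
  first.

  Equality in L^2 is almost everywhere, so operators act on representatives, and even linearity is
  derived, up to null sets, from symmetry.\<close>

lemma borel_measurable_cnj [measurable (raw)]:
  "f \<in> borel_measurable M \<Longrightarrow> (\<lambda>x. cnj (f x)) \<in> borel_measurable M"
  by (rule borel_measurable_continuous_on[where f=cnj]) (auto intro: continuous_intros)

lemma L2_measurable [measurable_dest]: "f \<in> L2 M \<Longrightarrow> f \<in> borel_measurable M"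
  by (simp add: L2_def)

lemma L2_integrable: "f \<in> L2 M \<Longrightarrow> integrable M (\<lambda>x. (cmod (f x))^2)"
  by (simp add: L2_def)

lemma L2_I: "f \<in> borel_measurable M \<Longrightarrow> integrable M (\<lambda>x. (cmod (f x))^2) \<Longrightarrow> f \<in> L2 M"
  by (simp add: L2_def)

lemma L2_scale [intro]:
  assumes "f \<in> L2 M" shows "(\<lambda>x. c * f x) \<in> L2 M"
proof (rule L2_I)
  show "(\<lambda>x. c * f x) \<in> borel_measurable M" using assms by measurable
  show "integrable M (\<lambda>x. (cmod (c * f x))^2)"
    using L2_integrable[OF assms] by (simp add: norm_mult power_mult_distrib)
qed

lemma sum_square_le: "((a::real) + b)^2 \<le> 2 * a\<^sup>2 + 2 * b\<^sup>2"
  using sum_squares_bound[of a b] by (simp add: power2_sum)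

lemma norm_add_square_le: "(norm (a + b :: 'a :: real_normed_vector))^2 \<le> 2 * (norm a)^2 + 2 * (norm b)^2"
proof -
  have "(norm (a + b))^2 \<le> (norm a + norm b)^2"
    by (intro power_mono norm_triangle_ineq norm_ge_zero)
  then show ?thesis using sum_square_le[of "norm a" "norm b"] by linarith
qed

lemma L2_add [intro]:
  assumes "f \<in> L2 M" "g \<in> L2 M" shows "(\<lambda>x. f x + g x) \<in> L2 M"
proof (rule L2_I)
  show [measurable]: "(\<lambda>x. f x + g x) \<in> borel_measurable M" using assms by measurable
  show "integrable M (\<lambda>x. (cmod (f x + g x))^2)"
  proof (rule Bochner_Integration.integrable_bound)
    show "integrable M (\<lambda>x. 2 * (cmod (f x))^2 + 2 * (cmod (g x))^2)"
      using assms by (intro Bochner_Integration.integrable_add integrable_mult_right L2_integrable)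
  qed (auto simp: norm_add_square_le)
qed

lemma L2_zero [simp, intro]: "(\<lambda>x. 0) \<in> L2 M"
  by (simp add: L2_def)

lemma L2_diff [intro]:
  assumes "f \<in> L2 M" "g \<in> L2 M" shows "(\<lambda>x. f x - g x) \<in> L2 M"
  using L2_add[OF assms(1) L2_scale[OF assms(2), of "-1"]] by simp

lemma L2_sum [intro]: "(\<And>i. i \<in> F \<Longrightarrow> f i \<in> L2 M) \<Longrightarrow> (\<lambda>x. \<Sum>i\<in>F. f i x) \<in> L2 M"
  by (induction F rule: infinite_finite_induct) auto

lemma L2_mult_integrable:
  assumes "f \<in> L2 M" "g \<in> L2 M" shows "integrable M (\<lambda>x. f x * cnj (g x))"
proof (rule Bochner_Integration.integrable_bound)
  show "integrable M (\<lambda>x. (cmod (f x))^2 + (cmod (g x))^2)"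
    using assms by (intro Bochner_Integration.integrable_add L2_integrable)
  show "(\<lambda>x. f x * cnj (g x)) \<in> borel_measurable M" using assms by measurable
  have "a * b \<le> a\<^sup>2 + b\<^sup>2" if "a \<ge> 0" "b \<ge> 0" for a b :: real
    using sum_squares_bound[of a b] that mult_nonneg_nonneg[of a b] by linarith
  then show "AE x in M. norm (f x * cnj (g x)) \<le> norm ((cmod (f x))^2 + (cmod (g x))^2)"
    by (auto simp: norm_mult)
qed

lemma inner_add_left:
  assumes "f \<in> L2 M" "g \<in> L2 M" "h \<in> L2 M"
  shows "l2_inner M (\<lambda>x. f x + g x) h = l2_inner M f h + l2_inner M g h"
  unfolding l2_inner_def using assms
  by (simp add: distrib_right L2_mult_integrable)

lemma inner_diff_left:
  assumes "f \<in> L2 M" "g \<in> L2 M" "h \<in> L2 M"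
  shows "l2_inner M (\<lambda>x. f x - g x) h = l2_inner M f h - l2_inner M g h"
  unfolding l2_inner_def using assms
  by (simp add: left_diff_distrib L2_mult_integrable)

lemma inner_add_right:
  assumes "f \<in> L2 M" "g \<in> L2 M" "h \<in> L2 M"
  shows "l2_inner M h (\<lambda>x. f x + g x) = l2_inner M h f + l2_inner M h g"
  unfolding l2_inner_def using assms
  by (simp add: distrib_left L2_mult_integrable)

lemma inner_diff_right:
  assumes "f \<in> L2 M" "g \<in> L2 M" "h \<in> L2 M"
  shows "l2_inner M h (\<lambda>x. f x - g x) = l2_inner M h f - l2_inner M h g"
  unfolding l2_inner_def using assms
  by (simp add: right_diff_distrib L2_mult_integrable)

lemma inner_scale_left: "l2_inner M (\<lambda>x. c * f x) h = c * l2_inner M f h"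
  unfolding l2_inner_def by (simp add: mult.assoc)

lemma inner_scale_right: "l2_inner M h (\<lambda>x. c * f x) = cnj c * l2_inner M h f"
  unfolding l2_inner_def by (simp add: mult.left_commute)

lemma inner_commute_cnj: "l2_inner M g f = cnj (l2_inner M f g)"
  unfolding l2_inner_def by (simp add: mult.commute flip: Bochner_Integration.integral_cnj)

lemma inner_sum_left:
  assumes "\<And>i. i \<in> F \<Longrightarrow> f i \<in> L2 M" "g \<in> L2 M"
  shows "l2_inner M (\<lambda>x. \<Sum>i\<in>F. c i * f i x) g = (\<Sum>i\<in>F. c i * l2_inner M (f i) g)"
  unfolding l2_inner_def sum_distrib_right
  by (subst Bochner_Integration.integral_sum)
     (use assms in \<open>auto simp: mult.assoc intro!: integrable_mult_right L2_mult_integrable\<close>)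

lemma inner_sum_right:
  assumes "\<And>i. i \<in> F \<Longrightarrow> f i \<in> L2 M" "g \<in> L2 M"
  shows "l2_inner M g (\<lambda>x. \<Sum>i\<in>F. c i * f i x) = (\<Sum>i\<in>F. cnj (c i) * l2_inner M g (f i))"
  by (subst inner_commute_cnj, subst inner_sum_left) (use assms in \<open>auto simp: inner_commute_cnj[of M g]\<close>)

lemma inner_zero [simp]: "l2_inner M (\<lambda>x. 0) f = 0" "l2_inner M f (\<lambda>x. 0) = 0"
  by (simp_all add: l2_inner_def)

lemma l2_norm_nonneg [simp]: "0 \<le> l2_norm M f"
  by (simp add: l2_norm_def)

lemma l2_norm_zero [simp]: "l2_norm M (\<lambda>x. 0) = 0"
  by (simp add: l2_norm_def)

lemma l2_norm_power2: "(l2_norm M f)^2 = (LINT x|M. (cmod (f x))^2)"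
  by (simp add: l2_norm_def)

lemma inner_self: "l2_inner M f f = of_real ((l2_norm M f)^2)"
  unfolding l2_norm_power2 l2_inner_def
  by (simp add: complex_norm_square del: of_real_power flip: integral_complex_of_real)

lemma l2_norm_scale: "l2_norm M (\<lambda>x. c * f x) = cmod c * l2_norm M f"
  by (simp add: l2_norm_def norm_mult power_mult_distrib real_sqrt_mult)

lemma l2_norm_minus_commute: "l2_norm M (\<lambda>x. f x - g x) = l2_norm M (\<lambda>x. g x - f x)"
  by (simp add: l2_norm_def norm_minus_commute)

lemma l2_norm_eq_0_iff:
  assumes "f \<in> L2 M" shows "l2_norm M f = 0 \<longleftrightarrow> (AE x in M. f x = 0)"
  unfolding l2_norm_def using integral_nonneg_eq_0_iff_AE[OF L2_integrable[OF assms]] by simp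

lemma inner_cong_AE:
  assumes "AE x in M. f x = f' x" "f \<in> L2 M" "f' \<in> L2 M" "g \<in> L2 M"
  shows "l2_inner M f g = l2_inner M f' g"
proof -
  have [measurable]: "f \<in> borel_measurable M" "f' \<in> borel_measurable M" "g \<in> borel_measurable M"
    using assms by (auto simp: L2_def)
  show ?thesis unfolding l2_inner_def
    by (rule integral_cong_AE) (use assms(1) in auto)
qed

lemma l2_Cauchy_Schwarz:
  assumes f: "f \<in> L2 M" and g: "g \<in> L2 M"
  shows "cmod (l2_inner M f g) \<le> l2_norm M f * l2_norm M g"
proof -
  have [measurable]: "f \<in> borel_measurable M" "g \<in> borel_measurable M"
    using assms by (auto simp: L2_def)
  have sq: "(\<integral>\<^sup>+x. (ennreal (cmod (h x)))^2 \<partial>M) = ennreal ((l2_norm M h)^2)" if "h \<in> L2 M" for h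
    unfolding l2_norm_power2
    by (subst nn_integral_eq_integral[symmetric]) (use that in \<open>auto simp: L2_def ennreal_power\<close>)
  have int: "integrable M (\<lambda>x. f x * cnj (g x))" by (rule L2_mult_integrable[OF f g])
  have "ennreal (cmod (l2_inner M f g)) \<le> ennreal (LINT x|M. cmod (f x * cnj (g x)))"
    unfolding l2_inner_def by (intro ennreal_leI integral_norm_bound)
  also have "\<dots> = (\<integral>\<^sup>+x. ennreal (cmod (f x)) * ennreal (cmod (g x)) \<partial>M)"
    by (subst nn_integral_eq_integral[symmetric])
       (use integrable_norm[OF int] in \<open>auto simp: norm_mult ennreal_mult\<close>)
  finally have "(ennreal (cmod (l2_inner M f g)))^2
      \<le> (\<integral>\<^sup>+x. ennreal (cmod (f x)) * ennreal (cmod (g x)) \<partial>M)^2"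
    by (rule power_mono) simp
  also have "\<dots> \<le> ennreal ((l2_norm M f)^2) * ennreal ((l2_norm M g)^2)"
    using Cauchy_Schwarz_nn_integral[of "\<lambda>x. ennreal (cmod (f x))" M "\<lambda>x. ennreal (cmod (g x))"]
    by (simp add: sq f g)
  finally have "(cmod (l2_inner M f g))^2 \<le> (l2_norm M f * l2_norm M g)^2"
    by (simp add: ennreal_power flip: ennreal_mult power_mult_distrib)
  then show ?thesis by (rule power2_le_imp_le) simp
qed

lemma l2_norm_add_sq:
  assumes "f \<in> L2 M" "g \<in> L2 M"
  shows "(l2_norm M (\<lambda>x. f x + g x))^2 = (l2_norm M f)^2 + 2 * Re (l2_inner M f g) + (l2_norm M g)^2"
proof -
  have "complex_of_real ((l2_norm M (\<lambda>x. f x + g x))^2) =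
     l2_inner M f f + l2_inner M f g + (l2_inner M g f + l2_inner M g g)"
    by (subst inner_self[symmetric]) (use assms in \<open>simp add: inner_add_left inner_add_right L2_add\<close>)
  also have "l2_inner M f g + l2_inner M g f = of_real (2 * Re (l2_inner M f g))"
    by (simp add: inner_commute_cnj[of M g f] complex_add_cnj)
  then have "l2_inner M f f + l2_inner M f g + (l2_inner M g f + l2_inner M g g) =
     l2_inner M f f + of_real (2 * Re (l2_inner M f g)) + l2_inner M g g"
    by (simp add: algebra_simps)
  finally show ?thesis unfolding inner_self by (simp only: of_real_add[symmetric] of_real_eq_iff)
qed

lemma l2_norm_diff_sq:
  assumes "f \<in> L2 M" "g \<in> L2 M"
  shows "(l2_norm M (\<lambda>x. f x - g x))^2 = (l2_norm M f)^2 - 2 * Re (l2_inner M f g) + (l2_norm M g)^2"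
  using l2_norm_add_sq[OF assms(1) L2_scale[OF assms(2), of "-1"]]
    l2_norm_scale[of M "-1" g] inner_scale_right[of M f "-1" g] by simp

lemma l2_norm_triangle:
  assumes "f \<in> L2 M" "g \<in> L2 M"
  shows "l2_norm M (\<lambda>x. f x + g x) \<le> l2_norm M f + l2_norm M g"
proof (rule power2_le_imp_le)
  have "Re (l2_inner M f g) \<le> l2_norm M f * l2_norm M g"
    using l2_Cauchy_Schwarz[OF assms] complex_Re_le_cmod order_trans by blast
  then show "(l2_norm M (\<lambda>x. f x + g x))^2 \<le> (l2_norm M f + l2_norm M g)^2"
    by (simp add: l2_norm_add_sq[OF assms] power2_sum)
qed simp

lemma l2_norm_triangle3:
  assumes "f \<in> L2 M" "g \<in> L2 M" "h \<in> L2 M"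
  shows "l2_norm M (\<lambda>x. f x - h x) \<le> l2_norm M (\<lambda>x. f x - g x) + l2_norm M (\<lambda>x. g x - h x)"
  using l2_norm_triangle[of "\<lambda>x. f x - g x" M "\<lambda>x. g x - h x"] assms by auto

lemma l2_norm_triangle_minus:
  assumes "f \<in> L2 M" "g \<in> L2 M"
  shows "\<bar>l2_norm M f - l2_norm M g\<bar> \<le> l2_norm M (\<lambda>x. f x - g x)"
  using l2_norm_triangle3[of f M g "\<lambda>_. 0"] l2_norm_triangle3[of g M f "\<lambda>_. 0"] assms
  by (auto simp: l2_norm_minus_commute[of M g f])

lemma l2_parallelogram:
  assumes "f \<in> L2 M" "g \<in> L2 M"
  shows "(l2_norm M (\<lambda>x. f x - g x))^2 + (l2_norm M (\<lambda>x. f x + g x))^2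
     = 2 * (l2_norm M f)^2 + 2 * (l2_norm M g)^2"
  by (simp add: l2_norm_add_sq[OF assms] l2_norm_diff_sq[OF assms])

lemma nn_integral_sq_eq:
  assumes "f \<in> L2 M"
  shows "(\<integral>\<^sup>+x. ennreal ((cmod (f x))^2) \<partial>M) = ennreal ((l2_norm M f)^2)"
  unfolding l2_norm_power2 by (rule nn_integral_eq_integral) (use assms in \<open>auto simp: L2_def\<close>)

text \<open>Fatou's lemma applied to the squared moduli in \<open>ennreal\<close>. The bound is
  required eventually only, so that tails of Cauchy sequences can be used.\<close>

lemma l2_norm_Fatou:
  assumes f: "\<And>n::nat. f n \<in> L2 M" and lim: "AE x in M. (\<lambda>n. f n x) \<longlonglongrightarrow> g x"
    and g[measurable]: "g \<in> borel_measurable M"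
    and bd: "\<forall>\<^sub>F n in sequentially. l2_norm M (f n) \<le> B"
  shows "g \<in> L2 M" "l2_norm M g \<le> B"
proof -
  have [measurable]: "\<And>n. f n \<in> borel_measurable M" using f by (auto simp: L2_def)
  have B0: "B \<ge> 0" using bd by (auto simp: eventually_sequentially intro: order_trans[OF l2_norm_nonneg])
  note * = nn_integral_sq_eq[OF f]
  have "(\<integral>\<^sup>+x. ennreal ((cmod (g x))^2) \<partial>M) = (\<integral>\<^sup>+x. liminf (\<lambda>n. ennreal ((cmod (f n x))^2)) \<partial>M)"
  proof (rule nn_integral_cong_AE)
    show "AE x in M. ennreal ((cmod (g x))^2) = liminf (\<lambda>n. ennreal ((cmod (f n x))^2))"
      using lim
    proof eventually_elim
      case (elim x)
      have "(\<lambda>n. ennreal ((cmod (f n x))^2)) \<longlonglongrightarrow> ennreal ((cmod (g x))^2)"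
        by (intro tendsto_ennrealI tendsto_power tendsto_norm elim)
      then show ?case by (intro lim_imp_Liminf[symmetric]) auto
    qed
  qed
  also have "\<dots> \<le> liminf (\<lambda>n. \<integral>\<^sup>+x. ennreal ((cmod (f n x))^2) \<partial>M)"
    by (rule nn_integral_liminf) measurable
  also have "\<dots> \<le> liminf (\<lambda>n. ennreal (B\<^sup>2))"
    unfolding * by (rule Liminf_mono, rule eventually_mono[OF bd]) (auto intro!: ennreal_leI power_mono)
  also have "\<dots> = ennreal (B\<^sup>2)" by (simp add: Liminf_const)
  finally have le: "(\<integral>\<^sup>+x. ennreal ((cmod (g x))^2) \<partial>M) \<le> ennreal (B\<^sup>2)" .
  then have int: "integrable M (\<lambda>x. (cmod (g x))^2)"
    by (intro integrableI_bounded) (auto simp: le_less_trans[OF le])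
  then show gL: "g \<in> L2 M" by (simp add: L2_def)
  have "ennreal ((l2_norm M g)^2) \<le> ennreal (B\<^sup>2)"
    using le unfolding nn_integral_sq_eq[OF gL] .
  then show "l2_norm M g \<le> B" using B0 by (simp add: abs_le_square_iff[symmetric])
qed

text \<open>Lets norms be estimated in \<open>ennreal\<close>, where sums over the tree can be
  rearranged before integrability is known.\<close>

lemma L2_of_nn_integral:
  assumes "f \<in> borel_measurable M" "(\<integral>\<^sup>+x. ennreal ((cmod (f x))^2) \<partial>M) \<le> ennreal (B\<^sup>2)" "B \<ge> 0"
  shows "f \<in> L2 M" "l2_norm M f \<le> B"
proof -
  note [measurable] = assms(1)
  have "integrable M (\<lambda>x. (cmod (f x))^2)"
    by (intro integrableI_bounded) (auto simp: le_less_trans[OF assms(2)])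
  then show L: "f \<in> L2 M" by (simp add: L2_def)
  show "l2_norm M f \<le> B"
    using assms(2,3) unfolding nn_integral_sq_eq[OF L] by (simp add: abs_le_square_iff[symmetric])
qed

text \<open>Along a subsequence with summable increments the total variation
  \<open>\<Sum>\<^sub>k |f\<^bsub>k+1\<^esub> - f\<^sub>k|\<close> is square-integrable by Fatou, so the subsequence converges a.e.\<close>

lemma L2_complete:
  assumes f: "\<And>n::nat. f n \<in> L2 M"
    and Cauchy: "\<And>e. e > 0 \<Longrightarrow> \<exists>N. \<forall>m\<ge>N. \<forall>n\<ge>N. l2_norm M (\<lambda>x. f m x - f n x) < e"
  shows "\<exists>g\<in>L2 M. (\<lambda>n. l2_norm M (\<lambda>x. f n x - g x)) \<longlonglongrightarrow> 0"
proof -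
  have [measurable]: "\<And>n. f n \<in> borel_measurable M" using f by (auto simp: L2_def)
  obtain N where N: "\<And>k m n. m \<ge> N k \<Longrightarrow> n \<ge> N k \<Longrightarrow> l2_norm M (\<lambda>x. f m x - f n x) < (1/2)^k"

  proof -
    have "\<forall>k. \<exists>N. \<forall>m\<ge>N. \<forall>n\<ge>N. l2_norm M (\<lambda>x. f m x - f n x) < (1/2)^k" using Cauchy by simp
    then show ?thesis using that by metis
  qed
  \<comment> \<open>Partial sums of the thresholds: \<open>r\<close> is monotone, and
    \<open>r k\<close> still lies beyond \<open>N k\<close>.\<close>
  define r where "r k = (\<Sum>j\<le>k. N j)" for k
  have rN: "r k \<ge> N k" and rS: "r (Suc k) \<ge> r k" for k
    by (auto simp: r_def intro!: member_le_sum)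
  define d where "d k x = f (r (Suc k)) x - f (r k) x" for k x
  have dL: "d k \<in> L2 M" for k unfolding d_def using f by auto
  have dn: "l2_norm M (d k) < (1/2)^k" for k
    unfolding d_def using N[of k "r (Suc k)" "r k"] rN[of k] rS[of k] by simp
  define D where "D n x = complex_of_real (\<Sum>k<n. cmod (d k x))" for n x
  have absL: "(\<lambda>x. complex_of_real (cmod (g x))) \<in> L2 M \<and> l2_norm M (\<lambda>x. complex_of_real (cmod (g x))) = l2_norm M g"
    if "g \<in> L2 M" for g using that by (auto simp: L2_def l2_norm_def)
  have DL: "D n \<in> L2 M \<and> l2_norm M (D n) \<le> (\<Sum>k<n. (1/2)^k)" for n
  proof (induction n)
    case (Suc n)
    have eq: "D (Suc n) = (\<lambda>x. D n x + complex_of_real (cmod (d n x)))" by (auto simp: D_def)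
    show ?case unfolding eq
      using L2_add[of "D n" M "\<lambda>x. complex_of_real (cmod (d n x))"]
        l2_norm_triangle[of "D n" M "\<lambda>x. complex_of_real (cmod (d n x))"] Suc absL[OF dL[of n]] dn[of n]
      by auto
  qed (auto simp: D_def)
  have D2: "l2_norm M (D n) \<le> 2" for n
  proof -
    have "(\<Sum>k<n. (1/2::real)^k) \<le> 2" using geometric_sum[of "1/2::real" n] by simp
    then show ?thesis using DL[of n] by linarith
  qed
  have [measurable]: "\<And>n. d n \<in> borel_measurable M" "\<And>n. D n \<in> borel_measurable M"
    using DL dL by (auto simp: L2_def)
  have "(\<integral>\<^sup>+x. (SUP n. ennreal ((cmod (D n x))^2)) \<partial>M) = (SUP n. \<integral>\<^sup>+x. ennreal ((cmod (D n x))^2) \<partial>M)"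
  proof (rule nn_integral_monotone_convergence_SUP)
    show "incseq (\<lambda>n x. ennreal ((cmod (D n x))^2))"
      by (intro incseq_SucI le_funI ennreal_leI power_mono) (auto simp: D_def sum_nonneg simp del: of_real_sum of_real_add)
  qed measurable
  also have "\<dots> \<le> ennreal 4"
  proof (rule SUP_least)
    fix n show "(\<integral>\<^sup>+x. ennreal ((cmod (D n x))^2) \<partial>M) \<le> ennreal 4"
      using DL[of n] D2[of n] power_mono[OF D2[of n], of 2] by (simp add: nn_integral_sq_eq del: ennreal_numeral)
  qed
  finally have "(\<integral>\<^sup>+x. (SUP n. ennreal ((cmod (D n x))^2)) \<partial>M) \<noteq> \<infinity>"
    using le_less_trans[OF _ ennreal_less_top[of 4]] by (auto simp: less_top)
  then have "AE x in M. (SUP n. ennreal ((cmod (D n x))^2)) \<noteq> \<infinity>"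
    by (intro nn_integral_PInf_AE) auto
  then have conv: "AE x in M. convergent (\<lambda>k. f (r k) x)"
  proof eventually_elim
    case (elim x)
    then obtain B where B: "(SUP n. ennreal ((cmod (D n x))^2)) = ennreal B" "B \<ge> 0"
      by (metis ennreal_cases infinity_ennreal_def)
    have "(\<Sum>k<n. cmod (d k x)) \<le> sqrt B" for n
    proof -
      have "ennreal ((cmod (D n x))^2) \<le> ennreal B" unfolding B(1)[symmetric] by (rule SUP_upper) simp
      then have "(cmod (D n x))^2 \<le> B" using B(2) by simp
      moreover have "cmod (D n x) = (\<Sum>k<n. cmod (d k x))"
        unfolding D_def norm_of_real by (simp add: sum_nonneg)
      ultimately show ?thesis by (simp add: real_le_rsqrt)
    qed
    then have "summable (\<lambda>k. cmod (d k x))"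
      by (intro summableI_nonneg_bounded) auto
    then have "summable (\<lambda>k. d k x)" by (rule summable_norm_cancel)
    then have "convergent (\<lambda>n. f (r 0) x + (\<Sum>k<n. d k x))"
      by (intro convergent_add convergent_const) (simp add: summable_iff_convergent)
    also have "(\<lambda>n. f (r 0) x + (\<Sum>k<n. d k x)) = (\<lambda>n. f (r n) x)"
      by (auto simp: d_def sum_lessThan_telescope[of "\<lambda>k. f (r k) x"])
    finally show ?case .
  qed
  define g where "g x = lim (\<lambda>k. f (r k) x)" for x
  have [measurable]: "g \<in> borel_measurable M" unfolding g_def by measurable
  have lim: "AE x in M. (\<lambda>k. f (r k) x) \<longlonglongrightarrow> g x"
    using conv by eventually_elim (simp add: g_def convergent_LIMSEQ_iff)
  \<comment> \<open>The terms \<open>f (r j)\<close> converge to \<open>g\<close> pointwise, so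
    Fatou in \<open>j\<close> at fixed \<open>n\<close> bounds \<open>f n - g\<close>; this controls
    the whole sequence and not only the subsequence.\<close>
  have close: "(\<lambda>x. f n x - g x) \<in> L2 M \<and> l2_norm M (\<lambda>x. f n x - g x) \<le> (1/2)^k" if n: "n \<ge> N k" for n k
  proof -
    have rk: "r j \<ge> N k" if "j \<ge> k" for j
      using that by (auto simp: r_def intro!: member_le_sum[of k "{..j}" N])
    have 1: "\<And>j. (\<lambda>x. f n x - f (r j) x) \<in> L2 M" using f by auto
    have 2: "AE x in M. (\<lambda>j. f n x - f (r j) x) \<longlonglongrightarrow> f n x - g x"
      using lim by eventually_elim (intro tendsto_intros)
    have 3: "\<forall>\<^sub>F j in sequentially. l2_norm M (\<lambda>x. f n x - f (r j) x) \<le> (1/2)^k"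
      using eventually_ge_at_top[of k] by eventually_elim (rule less_imp_le, rule N[OF n rk])
    have "(\<lambda>x. f n x - g x) \<in> borel_measurable M" by measurable
    note l2_norm_Fatou[OF 1 2 this 3]
    then show ?thesis by simp
  qed
  have "g \<in> L2 M"
    using L2_diff[OF f[of "N 0"] conjunct1[OF close[of 0 "N 0"]]] by simp
  moreover have "(\<lambda>n. l2_norm M (\<lambda>x. f n x - g x)) \<longlonglongrightarrow> 0"
  proof (rule LIMSEQ_I)
    fix e :: real assume "e > 0"
    then obtain k where "(1/2)^k < e" using real_arch_pow_inv[of e "1/2"] by auto
    then show "\<exists>n0. \<forall>n\<ge>n0. norm (l2_norm M (\<lambda>x. f n x - g x) - 0) < e"
      using close[of k] by (intro exI[of _ "N k"]) (auto intro: le_less_trans)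
  qed
  ultimately show ?thesis by blast
qed

section \<open>Total families, and unitary maps from equal Gram matrices\<close>

definition lin_comb :: "('i \<Rightarrow> 'a \<Rightarrow> complex) \<Rightarrow> ('i \<Rightarrow> complex) \<Rightarrow> 'i set \<Rightarrow> 'a \<Rightarrow> complex" where
  "lin_comb x c F = (\<lambda>w. \<Sum>i\<in>F. c i * x i w)"

text \<open>Coefficients are padded by 0, because the two combinations may run over different index
  sets.\<close>

lemma lin_comb_add:
  assumes "finite F" "finite G"
  shows "lin_comb x (\<lambda>i. (if i \<in> F then c i else 0) + (if i \<in> G then d i else 0)) (F \<union> G)
    = (\<lambda>w. lin_comb x c F w + lin_comb x d G w)"
proof
  fix w
  have "(\<Sum>i\<in>F \<union> G. (if i \<in> F then c i else 0) * x i w) = (\<Sum>i\<in>F. c i * x i w)"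
    "(\<Sum>i\<in>F \<union> G. (if i \<in> G then d i else 0) * x i w) = (\<Sum>i\<in>G. d i * x i w)"
    using assms by (auto intro!: sum.mono_neutral_cong_right)
  then show "lin_comb x (\<lambda>i. (if i \<in> F then c i else 0) + (if i \<in> G then d i else 0)) (F \<union> G) w
    = lin_comb x c F w + lin_comb x d G w"
    by (simp add: lin_comb_def distrib_right sum.distrib)
qed

lemma lin_comb_scale: "lin_comb x (\<lambda>i. a * c i) F = (\<lambda>w. a * lin_comb x c F w)"
  by (simp add: lin_comb_def sum_distrib_left mult.assoc)

lemma lin_comb_L2: "(\<And>i. x i \<in> L2 M) \<Longrightarrow> lin_comb x c F \<in> L2 M"
  unfolding lin_comb_def by (intro L2_sum L2_scale)

lemma lin_comb_single: "lin_comb x (\<lambda>_. 1) {i} = x i"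
  by (simp add: lin_comb_def)

text \<open>The projection argument: a sequence in the span \<open>V\<close> that minimises the
  distance \<open>d\<close> to \<open>f\<close> is Cauchy by the parallelogram law; its limit
  \<open>q\<close> leaves a remainder \<open>f - q\<close> orthogonal to every \<open>x i\<close>,
  which totality annihilates.\<close>

lemma L2_dense_of_total:
  fixes x :: "'i \<Rightarrow> 'a \<Rightarrow> complex"
  assumes x: "\<And>i. x i \<in> L2 M"
    and total: "\<And>f. f \<in> L2 M \<Longrightarrow> (\<And>i. l2_inner M f (x i) = 0) \<Longrightarrow> l2_norm M f = 0"
    and f: "f \<in> L2 M" and e: "e > 0"
  shows "\<exists>c F. finite F \<and> l2_norm M (\<lambda>w. f w - lin_comb x c F w) < e"
proof -
  define V where "V = {lin_comb x c F | c F. finite F}"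
  have VL: "p \<in> L2 M" if "p \<in> V" for p using that x by (auto simp: V_def lin_comb_L2)
  have Vadd: "(\<lambda>w. p w + q w) \<in> V" if "p \<in> V" "q \<in> V" for p q
  proof -
    from that obtain c F d G where "p = lin_comb x c F" "q = lin_comb x d G" "finite F" "finite G"
      by (auto simp: V_def)
    then show ?thesis unfolding V_def using lin_comb_add[of F G x c d, symmetric] by blast
  qed
  have Vscale: "(\<lambda>w. a * p w) \<in> V" if "p \<in> V" for p a
    using that unfolding V_def by (force simp flip: lin_comb_scale)
  have Vx: "x i \<in> V" for i unfolding V_def by (rule CollectI, intro exI[of _ "\<lambda>_. 1"] exI[of _ "{i}"]) (simp add: lin_comb_single)
  define D where "D = (\<lambda>p. l2_norm M (\<lambda>w. f w - p w)) ` V"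
  define d where "d = Inf D"
  have Dne: "D \<noteq> {}" using Vx by (auto simp: D_def)
  have Dbd: "bdd_below D" unfolding D_def by (rule bdd_belowI2[of _ 0]) simp
  have d_le: "d \<le> l2_norm M (\<lambda>w. f w - p w)" if "p \<in> V" for p
    unfolding d_def using that by (intro cInf_lower Dbd) (auto simp: D_def)
  have d0: "d \<ge> 0" unfolding d_def by (rule cInf_greatest[OF Dne]) (auto simp: D_def)
  have "\<exists>p\<in>V. l2_norm M (\<lambda>w. f w - p w) < d + 1 / real (Suc n)" for n
    using cInf_lessD[OF Dne, of "d + 1 / real (Suc n)"] by (auto simp: D_def d_def)
  then obtain p where pV: "\<And>n. p n \<in> V" and pd: "\<And>n. l2_norm M (\<lambda>w. f w - p n w) < d + 1 / real (Suc n)"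
    by metis
  have pL: "p n \<in> L2 M" for n using VL pV by auto
  define a where "a n = l2_norm M (\<lambda>w. f w - p n w)" for n
  have a_lim: "a \<longlonglongrightarrow> d"
  proof (rule real_tendsto_sandwich)
    show "\<forall>\<^sub>F n in sequentially. d \<le> a n"
      unfolding a_def by (intro always_eventually allI d_le pV)
    show "\<forall>\<^sub>F n in sequentially. a n \<le> d + 1 / real (Suc n)"
      unfolding a_def by (intro always_eventually allI less_imp_le pd)
    show "(\<lambda>n. d + 1 / real (Suc n)) \<longlonglongrightarrow> d"
      using tendsto_add[OF tendsto_const LIMSEQ_inverse_real_of_nat, of d] by (simp add: inverse_eq_divide)
  qed simp
  \<comment> \<open>The midpoint of two elements of \<open>V\<close> is again in \<open>V\<close>
    and so has distance at least \<open>d\<close> from \<open>f\<close>.\<close>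
  have diff_le: "(l2_norm M (\<lambda>w. p m w - p n w))^2 \<le> 2 * ((a m)^2 - d\<^sup>2) + 2 * ((a n)^2 - d\<^sup>2)" for m n
  proof -
    let ?u = "\<lambda>w. f w - p n w" and ?v = "\<lambda>w. f w - p m w"
    have uv: "?u \<in> L2 M" "?v \<in> L2 M" using f pL by auto
    have "(\<lambda>w. (1/2) * (p m w + p n w)) \<in> V" by (intro Vscale Vadd pV)
    from d_le[OF this] have "d \<le> l2_norm M (\<lambda>w. (1/2) * (?u w + ?v w))"
      by (simp add: algebra_simps add_divide_distrib)
    also have "\<dots> = (1/2) * l2_norm M (\<lambda>w. ?u w + ?v w)"
      by (subst l2_norm_scale) simp
    finally have "(2 * d)^2 \<le> (l2_norm M (\<lambda>w. ?u w + ?v w))^2"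
      using d0 by (intro power_mono) auto
    then show ?thesis using l2_parallelogram[OF uv] by (simp add: a_def power_mult_distrib)
  qed
  have "\<exists>N. \<forall>m\<ge>N. \<forall>n\<ge>N. l2_norm M (\<lambda>w. p m w - p n w) < r" if "r > 0" for r
  proof -
    have "(\<lambda>n. (a n)^2 - d\<^sup>2) \<longlonglongrightarrow> d\<^sup>2 - d\<^sup>2" by (intro tendsto_intros a_lim)
    then have "\<forall>\<^sub>F n in sequentially. (a n)^2 - d\<^sup>2 < r\<^sup>2 / 4"
      using that by (intro order_tendstoD(2)) auto
    then obtain N where N: "\<And>n. n \<ge> N \<Longrightarrow> (a n)\<^sup>2 - d\<^sup>2 < r\<^sup>2 / 4" by (auto simp: eventually_sequentially)
    have "l2_norm M (\<lambda>w. p m w - p n w) < r" if "m \<ge> N" "n \<ge> N" for m n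
      using diff_le[of m n] N[OF that(1)] N[OF that(2)] \<open>r > 0\<close>
      by (intro power2_less_imp_less[of _ r]) auto
    then show ?thesis by blast
  qed
  from L2_complete[OF pL this] obtain q where q: "q \<in> L2 M"
    and q_lim: "(\<lambda>n. l2_norm M (\<lambda>w. p n w - q w)) \<longlonglongrightarrow> 0" by auto
  define g where "g w = f w - q w" for w
  have gL: "g \<in> L2 M" unfolding g_def using f q by auto
  \<comment> \<open>\<open>g\<close> inherits the distance: \<open>p n + v\<close> stays in
    \<open>V\<close>, and \<open>p n\<close> tends to \<open>q\<close>.\<close>
  have shift: "d \<le> l2_norm M (\<lambda>w. g w - v w)" if v: "v \<in> V" for v
  proof (rule LIMSEQ_le_const)
    show "(\<lambda>n. l2_norm M (\<lambda>w. g w - v w) + l2_norm M (\<lambda>w. p n w - q w)) \<longlonglongrightarrow> l2_norm M (\<lambda>w. g w - v w)"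
      using tendsto_add[OF tendsto_const q_lim] by simp
    show "\<exists>N. \<forall>n\<ge>N. d \<le> l2_norm M (\<lambda>w. g w - v w) + l2_norm M (\<lambda>w. p n w - q w)"
    proof (intro exI[of _ 0] allI impI)
      fix n
      have "d \<le> l2_norm M (\<lambda>w. f w - (p n w + v w))" by (intro d_le Vadd pV v)
      also have "\<dots> \<le> l2_norm M (\<lambda>w. f w - (q w + v w)) + l2_norm M (\<lambda>w. (q w + v w) - (p n w + v w))"
        using f q pL VL[OF v] by (intro l2_norm_triangle3) auto
      finally show "d \<le> l2_norm M (\<lambda>w. g w - v w) + l2_norm M (\<lambda>w. p n w - q w)"
        by (simp add: g_def l2_norm_minus_commute[of M q] algebra_simps)
    qed
  qed
  have g_le: "l2_norm M g \<le> d"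
  proof (rule LIMSEQ_le_const)
    show "(\<lambda>n. a n + l2_norm M (\<lambda>w. p n w - q w)) \<longlonglongrightarrow> d"
      using tendsto_add[OF a_lim q_lim] by simp
    show "\<exists>N. \<forall>n\<ge>N. l2_norm M g \<le> a n + l2_norm M (\<lambda>w. p n w - q w)"
      using l2_norm_triangle3[OF f pL q] by (auto simp: g_def[abs_def] a_def)
  qed
  have "l2_inner M g (x i) = 0" for i
  proof (rule ccontr)
    let ?I = "l2_inner M g (x i)"
    assume nz: "?I \<noteq> 0"
    \<comment> \<open>Subtracting \<open>s * ?I * x i\<close> from \<open>g\<close> changes the
      squared norm by \<open>- 2 s |?I|^2 + s^2 |?I|^2 |x i|^2\<close>; this \<open>s\<close> keeps
      the quadratic term below the linear one, also when \<open>x i\<close> vanishes.\<close>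
    define s where "s = 1 / (1 + (l2_norm M (x i))^2)"
    have s0: "s > 0" by (auto simp: s_def intro!: add_pos_nonneg)
    have "(\<lambda>w. (of_real s * ?I) * x i w) \<in> V" by (intro Vscale Vx)
    from shift[OF this] have "d\<^sup>2 \<le> (l2_norm M (\<lambda>w. g w - (of_real s * ?I) * x i w))^2"
      using d0 by (intro power_mono)
    also have "\<dots> = (l2_norm M g)^2 - 2 * s * (cmod ?I)^2 + s\<^sup>2 * (cmod ?I)^2 * (l2_norm M (x i))^2"
    proof -
      have "cnj ?I * ?I = of_real ((cmod ?I)^2)" by (simp only: complex_norm_square mult.commute)
      then have "Re (l2_inner M g (\<lambda>w. (of_real s * ?I) * x i w)) = s * (cmod ?I)^2"
        unfolding inner_scale_right by (simp add: mult.assoc)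
      then show ?thesis
        by (subst l2_norm_diff_sq[OF gL L2_scale[OF x]])
           (simp add: l2_norm_scale norm_mult power_mult_distrib s0 less_imp_le)
    qed
    also have "(l2_norm M g)^2 \<le> d\<^sup>2" using g_le by (intro power_mono) auto
    finally have "2 * s * (cmod ?I)^2 \<le> s\<^sup>2 * (cmod ?I)^2 * (l2_norm M (x i))^2" by simp
    then have "s * (cmod ?I)^2 * 2 \<le> s * (cmod ?I)^2 * (s * (l2_norm M (x i))^2)"
      by (simp add: power2_eq_square mult_ac)
    then have "2 \<le> s * (l2_norm M (x i))^2"
      using nz s0 by (subst (asm) mult_le_cancel_left_pos) auto
    moreover have "s * (l2_norm M (x i))^2 \<le> 1"
    proof -
      have "1 + (l2_norm M (x i))^2 > 0" using zero_le_power2[of "l2_norm M (x i)"] by linarith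
      then show ?thesis by (simp add: s_def)
    qed
    ultimately show False by simp
  qed
  then have g0: "l2_norm M g = 0" by (intro total gL)
  have "\<forall>\<^sub>F n in sequentially. l2_norm M (\<lambda>w. p n w - q w) < e"
    using q_lim e by (rule order_tendstoD(2))
  then obtain n where n: "l2_norm M (\<lambda>w. p n w - q w) < e" by (auto simp: eventually_sequentially)
  have "l2_norm M (\<lambda>w. f w - p n w) \<le> l2_norm M g + l2_norm M (\<lambda>w. p n w - q w)"
    using l2_norm_triangle3[OF f q pL[of n]] by (simp add: g_def[abs_def] l2_norm_minus_commute[of M q])
  then have "l2_norm M (\<lambda>w. f w - p n w) < e" using g0 n by simp
  moreover obtain c F where "finite F" "p n = lin_comb x c F" using pV[of n] by (auto simp: V_def)
  ultimately show ?thesis by auto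
qed

text \<open>The closure of the correspondence between combinations of the \<open>x i\<close> and of
  the \<open>y i\<close>. It is a relation, since functions represent classes; its symmetry in the
  two sides later yields surjectivity of the unitary map.\<close>

definition l2_graph ::
  "'a measure \<Rightarrow> 'b measure \<Rightarrow> ('i \<Rightarrow> 'a \<Rightarrow> complex) \<Rightarrow> ('i \<Rightarrow> 'b \<Rightarrow> complex) \<Rightarrow> ('a \<Rightarrow> complex) \<Rightarrow> ('b \<Rightarrow> complex) \<Rightarrow> bool"
  where "l2_graph M N x y f g \<longleftrightarrow> f \<in> L2 M \<and> g \<in> L2 N \<and>
    (\<forall>e>0. \<exists>c F. finite F \<and> l2_norm M (\<lambda>w. f w - lin_comb x c F w) < e \<and> l2_norm N (\<lambda>w. g w - lin_comb y c F w) < e)"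

lemma l2_graph_sym: "l2_graph M N x y f g \<longleftrightarrow> l2_graph N M y x g f"
  unfolding l2_graph_def by (simp only: conj_ac)

text \<open>Equal inner products give matching combinations equal norms; hence the correspondence is
  well defined even when the \<open>x i\<close> are linearly dependent.\<close>

locale equal_gram =
  fixes M :: "'a measure" and N :: "'b measure" and x :: "'i \<Rightarrow> 'a \<Rightarrow> complex" and y :: "'i \<Rightarrow> 'b \<Rightarrow> complex"
  assumes x: "\<And>i. x i \<in> L2 M" and y: "\<And>i. y i \<in> L2 N"
    and gram: "\<And>i j. l2_inner M (x i) (x j) = l2_inner N (y i) (y j)"
begin

lemma norm_lin_comb: "l2_norm M (lin_comb x c F) = l2_norm N (lin_comb y c F)" for c :: "'i \<Rightarrow> complex"
proof -
  have "complex_of_real ((l2_norm M (lin_comb x c F))^2) = of_real ((l2_norm N (lin_comb y c F))^2)"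
    unfolding inner_self[symmetric]
    by (simp add: lin_comb_def inner_sum_left inner_sum_right x y gram L2_sum L2_scale)
  then show ?thesis by (simp only: of_real_eq_iff power2_eq_iff_nonneg[OF l2_norm_nonneg l2_norm_nonneg])
qed

lemma graph_add:
  assumes "l2_graph M N x y f g" "l2_graph M N x y f' g'"
  shows "l2_graph M N x y (\<lambda>w. f w + f' w) (\<lambda>w. g w + g' w)"
  unfolding l2_graph_def
proof (intro conjI allI impI)
  show "(\<lambda>w. f w + f' w) \<in> L2 M" "(\<lambda>w. g w + g' w) \<in> L2 N" using assms by (auto simp: l2_graph_def)
  have L: "f \<in> L2 M" "f' \<in> L2 M" "g \<in> L2 N" "g' \<in> L2 N" using assms by (auto simp: l2_graph_def)
  have xL: "lin_comb x c F \<in> L2 M" for c F by (intro lin_comb_L2 x)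
  have yL: "lin_comb y c F \<in> L2 N" for c F by (intro lin_comb_L2 y)
  fix e :: real assume "e > 0"
  then have "e / 2 > 0" by simp
  with assms obtain c F c' F' where F: "finite F" "finite F'"
    and 1: "l2_norm M (\<lambda>w. f w - lin_comb x c F w) < e/2" "l2_norm N (\<lambda>w. g w - lin_comb y c F w) < e/2"
    and 2: "l2_norm M (\<lambda>w. f' w - lin_comb x c' F' w) < e/2" "l2_norm N (\<lambda>w. g' w - lin_comb y c' F' w) < e/2"
    unfolding l2_graph_def by meson
  let ?c = "\<lambda>i. (if i \<in> F then c i else 0) + (if i \<in> F' then c' i else 0)"
  have "l2_norm M (\<lambda>w. (f w + f' w) - lin_comb x ?c (F \<union> F') w) < e"
    unfolding lin_comb_add[OF F]
    using l2_norm_triangle[OF L2_diff[OF L(1) xL[of c F]] L2_diff[OF L(2) xL[of c' F']]] 1 2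
    by (simp add: algebra_simps)
  moreover have "l2_norm N (\<lambda>w. (g w + g' w) - lin_comb y ?c (F \<union> F') w) < e"
    unfolding lin_comb_add[OF F]
    using l2_norm_triangle[OF L2_diff[OF L(3) yL[of c F]] L2_diff[OF L(4) yL[of c' F']]] 1 2
    by (simp add: algebra_simps)
  ultimately show "\<exists>c F. finite F \<and> l2_norm M (\<lambda>w. f w + f' w - lin_comb x c F w) < e \<and>
       l2_norm N (\<lambda>w. g w + g' w - lin_comb y c F w) < e" using F by blast
qed

lemma graph_scale:
  assumes "l2_graph M N x y f g"
  shows "l2_graph M N x y (\<lambda>w. a * f w) (\<lambda>w. a * g w)"
  unfolding l2_graph_def
proof (intro conjI allI impI)
  show "(\<lambda>w. a * f w) \<in> L2 M" "(\<lambda>w. a * g w) \<in> L2 N" using assms by (auto simp: l2_graph_def)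
  fix e :: real assume e: "e > 0"
  have pos: "cmod a + 1 > 0" by (simp add: add_nonneg_pos)
  with e have "e / (cmod a + 1) > 0" by simp
  with assms obtain c F where F: "finite F"
    and 1: "l2_norm M (\<lambda>w. f w - lin_comb x c F w) < e / (cmod a + 1)" "l2_norm N (\<lambda>w. g w - lin_comb y c F w) < e / (cmod a + 1)"
    unfolding l2_graph_def by meson
  have *: "cmod a * r < e" if "r < e / (cmod a + 1)" "r \<ge> 0" for r
    using that e pos by (simp add: pos_less_divide_eq algebra_simps)
  have "l2_norm M (\<lambda>w. a * f w - lin_comb x (\<lambda>i. a * c i) F w) < e"
    unfolding lin_comb_scale right_diff_distrib[symmetric] l2_norm_scale by (rule *[OF 1(1)]) simp
  moreover have "l2_norm N (\<lambda>w. a * g w - lin_comb y (\<lambda>i. a * c i) F w) < e"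
    unfolding lin_comb_scale right_diff_distrib[symmetric] l2_norm_scale by (rule *[OF 1(2)]) simp
  ultimately show "\<exists>c F. finite F \<and> l2_norm M (\<lambda>w. a * f w - lin_comb x c F w) < e \<and>
       l2_norm N (\<lambda>w. a * g w - lin_comb y c F w) < e" using F by blast
qed

lemma graph_norm:
  assumes "l2_graph M N x y f g"
  shows "l2_norm N g = l2_norm M f"
proof -
  have "\<bar>l2_norm N g - l2_norm M f\<bar> \<le> 0"
  proof (rule field_le_epsilon)
    fix e :: real assume "e > 0"
    then have "e / 2 > 0" by simp
    with assms obtain c F where F: "finite F"
      and 1: "l2_norm M (\<lambda>w. f w - lin_comb x c F w) < e/2" "l2_norm N (\<lambda>w. g w - lin_comb y c F w) < e/2"
      unfolding l2_graph_def by meson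
    have "\<bar>l2_norm M f - l2_norm M (lin_comb x c F)\<bar> < e/2"
      using l2_norm_triangle_minus[of f M "lin_comb x c F"] 1 assms by (auto simp: l2_graph_def lin_comb_L2 x)
    moreover have "\<bar>l2_norm N g - l2_norm N (lin_comb y c F)\<bar> < e/2"
      using l2_norm_triangle_minus[of g N "lin_comb y c F"] 1 assms by (auto simp: l2_graph_def lin_comb_L2 y)
    ultimately show "\<bar>l2_norm N g - l2_norm M f\<bar> \<le> 0 + e" using norm_lin_comb[of c F] by linarith
  qed
  then show ?thesis by simp
qed

lemma graph_unique:
  assumes "l2_graph M N x y f g" "l2_graph M N x y f' g'" "AE w in M. f w = f' w"
  shows "AE w in N. g w = g' w"
proof -
  have "l2_graph M N x y (\<lambda>w. f w + (-1) * f' w) (\<lambda>w. g w + (-1) * g' w)"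
    by (intro graph_add graph_scale assms)
  from graph_norm[OF this] have "l2_norm N (\<lambda>w. g w - g' w) = l2_norm M (\<lambda>w. f w - f' w)" by simp
  also have "\<dots> = 0" using assms by (subst l2_norm_eq_0_iff) (auto simp: l2_graph_def)
  finally show ?thesis using assms by (subst (asm) l2_norm_eq_0_iff) (auto simp: l2_graph_def)
qed

text \<open>Combinations that approximate \<open>f\<close> form a Cauchy sequence; the matching
  combinations of the \<open>y i\<close> have the same mutual distances and therefore converge as
  well.\<close>

lemma graph_exists:
  assumes total: "\<And>f. f \<in> L2 M \<Longrightarrow> (\<And>i. l2_inner M f (x i) = 0) \<Longrightarrow> l2_norm M f = 0"
    and f: "f \<in> L2 M"
  shows "\<exists>g. l2_graph M N x y f g"
proof -
  have "\<exists>c F. finite F \<and> l2_norm M (\<lambda>w. f w - lin_comb x c F w) < 1 / real (Suc n)" for n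
    by (intro L2_dense_of_total[OF x total f]) auto
  then obtain c F where F: "\<And>n. finite (F n)"
    and cF: "\<And>n. l2_norm M (\<lambda>w. f w - lin_comb x (c n) (F n) w) < 1 / real (Suc n)" by metis
  have xL: "lin_comb x c F \<in> L2 M" for c F by (intro lin_comb_L2 x)
  have yL: "lin_comb y c F \<in> L2 N" for c F by (intro lin_comb_L2 y)
  have diff: "l2_norm N (\<lambda>w. lin_comb y (c m) (F m) w - lin_comb y (c n) (F n) w)
      = l2_norm M (\<lambda>w. lin_comb x (c m) (F m) w - lin_comb x (c n) (F n) w)" for m n
  proof -
    let ?c = "\<lambda>i. (if i \<in> F m then c m i else 0) + (if i \<in> F n then (-1) * c n i else 0)"
    have "lin_comb x ?c (F m \<union> F n) = (\<lambda>w. lin_comb x (c m) (F m) w - lin_comb x (c n) (F n) w)"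
      "lin_comb y ?c (F m \<union> F n) = (\<lambda>w. lin_comb y (c m) (F m) w - lin_comb y (c n) (F n) w)"
      unfolding lin_comb_add[OF F F] lin_comb_scale by simp_all
    then show ?thesis using norm_lin_comb[of ?c "F m \<union> F n"] by simp
  qed
  have "\<exists>n0. \<forall>m\<ge>n0. \<forall>n\<ge>n0. l2_norm N (\<lambda>w. lin_comb y (c m) (F m) w - lin_comb y (c n) (F n) w) < e"
    if "e > 0" for e
  proof -
    obtain n0 where n0: "1 / real (Suc n0) < e / 2"
      using reals_Archimedean[of "e/2"] \<open>e > 0\<close> unfolding inverse_eq_divide by (metis half_gt_zero)
    have small: "1 / real (Suc n) < e/2" if "n \<ge> n0" for n
      using that n0 by (intro le_less_trans[OF _ n0] divide_left_mono) auto
    have "l2_norm N (\<lambda>w. lin_comb y (c m) (F m) w - lin_comb y (c n) (F n) w) < e" if "m \<ge> n0" "n \<ge> n0" for m n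
      unfolding diff using l2_norm_triangle3[OF xL f xL, of "c m" "F m" "c n" "F n"] cF[of m] cF[of n] small[OF that(1)] small[OF that(2)]
      by (simp add: l2_norm_minus_commute[of M _ f])
    then show ?thesis by blast
  qed
  from L2_complete[OF yL this] obtain g where g: "g \<in> L2 N"
    and lim: "(\<lambda>n. l2_norm N (\<lambda>w. lin_comb y (c n) (F n) w - g w)) \<longlonglongrightarrow> 0" by auto
  have "\<exists>c F. finite F \<and> l2_norm M (\<lambda>w. f w - lin_comb x c F w) < e \<and> l2_norm N (\<lambda>w. g w - lin_comb y c F w) < e"
    if "e > 0" for e
  proof -
    have "\<forall>\<^sub>F n in sequentially. l2_norm N (\<lambda>w. lin_comb y (c n) (F n) w - g w) < e"
      using lim that by (rule order_tendstoD(2))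
    moreover have "\<forall>\<^sub>F n in sequentially. inverse (real (Suc n)) < e"
      using LIMSEQ_inverse_real_of_nat that by (rule order_tendstoD(2))
    ultimately have "\<forall>\<^sub>F n in sequentially. l2_norm N (\<lambda>w. lin_comb y (c n) (F n) w - g w) < e \<and> inverse (real (Suc n)) < e"
      by (rule eventually_conj)
    then obtain n where "l2_norm N (\<lambda>w. lin_comb y (c n) (F n) w - g w) < e" "inverse (real (Suc n)) < e"
      by (auto simp: eventually_sequentially)
    then show ?thesis using cF[of n] F[of n]
      by (intro exI[of _ "c n"] exI[of _ "F n"]) (auto simp: l2_norm_minus_commute[of N g] inverse_eq_divide)
  qed
  then show ?thesis using f g by (auto simp: l2_graph_def)
qed

text \<open>\<open>T\<close> and \<open>X\<close> are merely Lipschitz maps on representatives: it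
  suffices that they send matching combinations to matching combinations, up to functions of norm
  zero, and to pass to the limit.\<close>

lemma graph_intertwine:
  assumes T: "\<And>f. f \<in> L2 M \<Longrightarrow> T f \<in> L2 M" "\<And>f f'. f \<in> L2 M \<Longrightarrow> f' \<in> L2 M \<Longrightarrow> l2_norm M (\<lambda>w. T f w - T f' w) \<le> K * l2_norm M (\<lambda>w. f w - f' w)"
    and X: "\<And>f. f \<in> L2 N \<Longrightarrow> X f \<in> L2 N" "\<And>f f'. f \<in> L2 N \<Longrightarrow> f' \<in> L2 N \<Longrightarrow> l2_norm N (\<lambda>w. X f w - X f' w) \<le> K * l2_norm N (\<lambda>w. f w - f' w)"
    and step: "\<And>c F. finite F \<Longrightarrow> \<exists>c' F'. finite F' \<and> l2_norm M (\<lambda>w. T (lin_comb x c F) w - lin_comb x c' F' w) = 0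
       \<and> l2_norm N (\<lambda>w. X (lin_comb y c F) w - lin_comb y c' F' w) = 0"
    and fg: "l2_graph M N x y f g"
  shows "l2_graph M N x y (T f) (X g)"
  unfolding l2_graph_def
proof (intro conjI allI impI)
  have L: "f \<in> L2 M" "g \<in> L2 N" using fg by (auto simp: l2_graph_def)
  show "T f \<in> L2 M" "X g \<in> L2 N" using L T X by auto
  have xL: "lin_comb x c F \<in> L2 M" for c F by (intro lin_comb_L2 x)
  have yL: "lin_comb y c F \<in> L2 N" for c F by (intro lin_comb_L2 y)
  fix e :: real assume e: "e > 0"
  define \<delta> where "\<delta> = e / (\<bar>K\<bar> + 1)"
  have "\<delta> > 0" using e by (auto simp: \<delta>_def intro!: divide_pos_pos)
  then obtain c F where F: "finite F"
    and 1: "l2_norm M (\<lambda>w. f w - lin_comb x c F w) < \<delta>" "l2_norm N (\<lambda>w. g w - lin_comb y c F w) < \<delta>"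
    using fg unfolding l2_graph_def by meson
  from step[OF F, of c] obtain c' F' where F': "finite F'"
    and 2: "l2_norm M (\<lambda>w. T (lin_comb x c F) w - lin_comb x c' F' w) = 0"
       "l2_norm N (\<lambda>w. X (lin_comb y c F) w - lin_comb y c' F' w) = 0" by blast
  have *: "K * r < e" if "r < \<delta>" "r \<ge> 0" for r
  proof -
    have "K * r \<le> (\<bar>K\<bar> + 1) * r" using that by (intro mult_right_mono) auto
    also have "\<dots> < (\<bar>K\<bar> + 1) * \<delta>" using that by (intro mult_strict_left_mono) auto
    also have "\<dots> = e" by (simp add: \<delta>_def)
    finally show ?thesis .
  qed
  have "l2_norm M (\<lambda>w. T f w - lin_comb x c' F' w) < e"
    using l2_norm_triangle3[OF T(1)[OF L(1)] T(1)[OF xL[of c F]] xL[of c' F']] 2(1) T(2)[OF L(1) xL[of c F]] *[OF 1(1)]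
    by simp
  moreover have "l2_norm N (\<lambda>w. X g w - lin_comb y c' F' w) < e"
    using l2_norm_triangle3[OF X(1)[OF L(2)] X(1)[OF yL[of c F]] yL[of c' F']] 2(2) X(2)[OF L(2) yL[of c F]] *[OF 1(2)]
    by simp
  ultimately show "\<exists>c F. finite F \<and> l2_norm M (\<lambda>w. T f w - lin_comb x c F w) < e \<and>
       l2_norm N (\<lambda>w. X g w - lin_comb y c F w) < e" using F' by blast
qed

text \<open>Totality of the \<open>x i\<close> defines the map everywhere; totality of the
  \<open>y i\<close>, used in the reversed locale, makes it onto.\<close>

lemma unitary_exists:
  assumes total: "\<And>f. f \<in> L2 M \<Longrightarrow> (\<And>i. l2_inner M f (x i) = 0) \<Longrightarrow> l2_norm M f = 0"
    and total': "\<And>f. f \<in> L2 N \<Longrightarrow> (\<And>i. l2_inner N f (y i) = 0) \<Longrightarrow> l2_norm N f = 0"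
  shows "\<exists>U. l2_unitary M N U \<and> (\<forall>f\<in>L2 M. l2_graph M N x y f (U f))"
proof -
  have "\<forall>f. \<exists>g. f \<in> L2 M \<longrightarrow> l2_graph M N x y f g" using graph_exists[OF total] by blast
  then obtain U where U: "\<And>f. f \<in> L2 M \<Longrightarrow> l2_graph M N x y f (U f)" by metis
  interpret op: equal_gram N M y x by unfold_locales (auto simp: x y gram)
  have "l2_unitary M N U" unfolding l2_unitary_def
  proof (intro conjI ballI allI)
    fix f assume f: "f \<in> L2 M"
    show "U f \<in> L2 N" using U[OF f] by (simp add: l2_graph_def)
    show "l2_norm N (U f) = l2_norm M f" by (rule graph_norm[OF U[OF f]])
    show "AE y in N. U (\<lambda>x. c * f x) y = c * U f y" for c
      by (rule graph_unique[OF U[OF L2_scale[OF f]] graph_scale[OF U[OF f]]]) simp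
    show "AE y in N. U (\<lambda>x. f x + g x) y = U f y + U g y" if g: "g \<in> L2 M" for g
      by (rule graph_unique[OF U[OF L2_add[OF f g]] graph_add[OF U[OF f] U[OF g]]]) simp
  next
    fix k assume "k \<in> L2 N"
    from op.graph_exists[OF total' this] obtain f where f: "l2_graph M N x y f k"
      by (auto simp: l2_graph_sym[of N])
    then have "f \<in> L2 M" by (simp add: l2_graph_def)
    moreover have "AE y in N. U f y = k y" by (rule graph_unique[OF U[OF \<open>f \<in> L2 M\<close>] f]) simp
    ultimately show "\<exists>f\<in>L2 M. AE y in N. U f y = k y" by blast
  qed
  then show ?thesis using U by blast
qed

end

section \<open>The Hausdorff moment problem\<close>

text \<open>\<open>mdiff m l k\<close> is \<open>(-1)\<^sup>l\<close> times the \<open>l\<close>-th forward difference of \<open>m\<close> at \<open>k\<close>, that is, the moment of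
  \<open>x\<^sup>k (1 - x)\<^sup>l\<close>.\<close>

primrec mdiff :: "(nat \<Rightarrow> real) \<Rightarrow> nat \<Rightarrow> nat \<Rightarrow> real" where
  "mdiff m 0 k = m k"
| "mdiff m (Suc l) k = mdiff m l k - mdiff m l (Suc k)"

text \<open>The moment identity for \<open>x^j (1 - x)^l\<close> multiplied by
  \<open>1 = (x + (1 - x))^n\<close>.\<close>

lemma mdiff_binomial_sum:
  "(\<Sum>i\<le>n. real (n choose i) * mdiff m (l + (n - i)) (i + j)) = mdiff m l j"
proof (induction n arbitrary: l j)
  case (Suc n)
  define d where "d i = mdiff m (l + (Suc n - i)) (i + j)" for i
  have "(\<Sum>i\<le>Suc n. real (Suc n choose i) * d i)
      = d 0 + (\<Sum>i\<le>n. real (n choose Suc i) * d (Suc i)) + (\<Sum>i\<le>n. real (n choose i) * d (Suc i))"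
    by (subst sum.atMost_Suc_shift) (simp add: sum.distrib algebra_simps)
  also have "d 0 + (\<Sum>i\<le>n. real (n choose Suc i) * d (Suc i)) = (\<Sum>i\<le>Suc n. real (n choose i) * d i)"
    by (subst sum.atMost_Suc_shift) simp
  also have "\<dots> = (\<Sum>i\<le>n. real (n choose i) * d i)" by simp
  also have "\<dots> = (\<Sum>i\<le>n. real (n choose i) * mdiff m (Suc l + (n - i)) (i + j))"
    unfolding d_def by (intro sum.cong refl) (simp add: Suc_diff_le)
  also have "\<dots> = mdiff m (Suc l) j" by (rule Suc)
  also have "(\<Sum>i\<le>n. real (n choose i) * d (Suc i)) = mdiff m l (Suc j)"
    using Suc[of l "Suc j"] by (simp add: d_def)
  finally show ?case by (simp add: d_def)
qed simp

text \<open>Read \<open>(n choose k) * mdiff m (n - k) k\<close> as the integral of a Bernstein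
  polynomial. The identity \<open>(n choose k) (k choose j) = (n choose j) (n - j choose k -
  j)\<close> reduces the sum to the preceding one.\<close>

lemma mdiff_binomial_moment:
  assumes "j \<le> n"
  shows "(\<Sum>k\<le>n. real (n choose k) * mdiff m (n - k) k * real (k choose j)) = real (n choose j) * m j"
proof -
  have "(\<Sum>k\<le>n. real (n choose k) * mdiff m (n - k) k * real (k choose j))
      = (\<Sum>k\<in>{j..n}. real (n choose k) * mdiff m (n - k) k * real (k choose j))"
    by (rule sum.mono_neutral_right) auto
  also have "\<dots> = (\<Sum>k\<in>{j..n}. real (n choose j) * (real ((n - j) choose (k - j)) * mdiff m (n - k) k))"
  proof (rule sum.cong[OF refl])
    fix k assume "k \<in> {j..n}"
    then have "real (n choose k) * real (k choose j) = real (n choose j) * real ((n - j) choose (k - j))"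
      using choose_mult[of j k n] by (simp flip: of_nat_mult)
    then show "real (n choose k) * mdiff m (n - k) k * real (k choose j)
      = real (n choose j) * (real ((n - j) choose (k - j)) * mdiff m (n - k) k)"
      by (simp add: mult_ac)
  qed
  also have "\<dots> = real (n choose j) * (\<Sum>k\<in>{j..n}. real ((n - j) choose (k - j)) * mdiff m (n - k) k)"
    by (simp add: sum_distrib_left)
  also have "(\<Sum>k\<in>{j..n}. real ((n - j) choose (k - j)) * mdiff m (n - k) k)
      = (\<Sum>i\<le>n - j. real ((n - j) choose i) * mdiff m (0 + (n - j - i)) (i + j))"
    by (rule sum.reindex_bij_witness[where i="\<lambda>i. i + j" and j="\<lambda>k. k - j"]) (use assms in auto)
  also have "\<dots> = m j" by (simp only: mdiff_binomial_sum mdiff.simps)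
  finally show ?thesis .
qed

text \<open>The factors \<open>(k - i) / (n - i)\<close> are compared with \<open>k / n\<close> one
  by one. The assumption \<open>2 * j < n\<close> keeps each of them at most 1 in modulus, also when
  \<open>k < i\<close>.\<close>

lemma binomial_ratio_approx:
  assumes "k \<le> n" "2 * j < n"
  shows "\<bar>real (k choose j) / real (n choose j) - (real k / real n) ^ j\<bar> \<le> real j * (real j / (real n - real j))"
proof -
  have n: "n > 0" "j \<le> n" using assms by auto
  have prod: "real (k choose j) / real (n choose j) = (\<Prod>i = 0..<j. (real k - real i) / (real n - real i))"
    unfolding binomial_gbinomial gbinomial_prod_rev by (simp add: prod_dividef)
  have pw: "(real k / real n) ^ j = (\<Prod>i = 0..<j. real k / real n)" by simp
  have "norm ((\<Prod>i = 0..<j. (real k - real i) / (real n - real i)) - (\<Prod>i = 0..<j. real k / real n))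
      \<le> (\<Sum>i = 0..<j. norm ((real k - real i) / (real n - real i) - real k / real n))"
  proof (rule norm_prod_diff)
    fix i assume "i \<in> {0..<j}"
    then have "real i < real j" "2 * real j < real n" using assms by auto
    then show "norm ((real k - real i) / (real n - real i)) \<le> 1"
      using assms by (simp add: abs_if divide_simps)
    show "norm (real k / real n) \<le> 1" using assms by (simp add: divide_simps)
  qed
  also have "\<dots> \<le> (\<Sum>i = 0..<j. real j / (real n - real j))"
  proof (rule sum_mono)
    fix i assume "i \<in> {0..<j}"
    then have i: "real i < real j" "2 * real j < real n" using assms by auto
    have "(real k - real i) / (real n - real i) - real k / real n = - (real i / (real n - real i)) * ((real n - real k) / real n)"
      using i by (simp add: field_simps)
    then have "norm ((real k - real i) / (real n - real i) - real k / real n)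
       = real i / (real n - real i) * ((real n - real k) / real n)"
      using i assms by (simp add: abs_mult)
    also have "\<dots> \<le> real j / (real n - real j) * 1"
      using i assms by (intro mult_mono frac_le) auto
    finally show "norm ((real k - real i) / (real n - real i) - real k / real n) \<le> real j / (real n - real j)" by simp
  qed
  finally show ?thesis unfolding prod pw by simp
qed

text \<open>Masses \<open>w n k\<close> at the points \<open>k / n\<close> have total mass 1 and
  nearly the right moments; tightness supplies a weak limit along a subsequence. The nonnegative
  differences are what makes the masses nonnegative.\<close>

theorem Hausdorff_moments:
  fixes m :: "nat \<Rightarrow> real"
  assumes m0: "m 0 = 1" and nonneg: "\<And>l k. mdiff m l k \<ge> 0"
  shows "\<exists>\<mu>. real_distribution \<mu> \<and> (AE x in \<mu>. 0 \<le> x \<and> x \<le> 1) \<and> (\<forall>j. (LINT x|\<mu>. x ^ j) = m j)"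
proof -
  define w where "w n k = real (n choose k) * mdiff m (n - k) k" for n k
  have w0: "w n k \<ge> 0" for n k by (simp add: w_def nonneg)
  have wsum: "(\<Sum>k\<le>n. w n k) = 1" for n
    using mdiff_binomial_moment[of 0 n m] by (simp add: w_def m0)
  define P where "P n = point_measure {..n} (\<lambda>k. ennreal (w n k))" for n
  \<comment> \<open>\<open>Suc n\<close> avoids the denominator 0.\<close>
  define \<nu> where "\<nu> n = distr (P (Suc n)) borel (\<lambda>k. real k / real (Suc n))" for n
  have meas: "(\<lambda>k. real k / real (Suc n)) \<in> measurable (P (Suc n)) borel" for n by (simp add: P_def)
  have int_\<nu>: "(LINT x|\<nu> n. f x) = (\<Sum>k\<le>Suc n. w (Suc n) k * f (real k / real (Suc n)))"
    if "f \<in> borel_measurable borel" for f :: "real \<Rightarrow> real" and n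
    unfolding \<nu>_def
    by (subst integral_distr[OF meas that])
       (simp add: P_def lebesgue_integral_point_measure_finite w0)
  have P_prob: "prob_space (P n)" for n
  proof
    have "emeasure (P n) (space (P n)) = (\<Sum>k\<le>n. ennreal (w n k))"
      unfolding P_def by (subst emeasure_point_measure_finite) (auto simp: space_point_measure)
    also have "\<dots> = 1" by (simp add: sum_ennreal w0 wsum)
    finally show "emeasure (P n) (space (P n)) = 1" .
  qed
  have \<nu>_rd: "real_distribution (\<nu> n)" for n
    unfolding real_distribution_def real_distribution_axioms_def \<nu>_def
    using prob_space.prob_space_distr[OF P_prob meas] by simp
  have "tight \<nu>"
    unfolding tight_def
  proof (intro conjI allI impI \<nu>_rd)
    fix \<epsilon> :: real assume "\<epsilon> > 0"
    \<comment> \<open>The half-open interval has to start below 0 to contain the atom at 0.\<close>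
    have "measure (\<nu> n) {-1<..1} = 1" for n
    proof -
      have "measure (\<nu> n) {-1<..1} = measure (P (Suc n)) ((\<lambda>k. real k / real (Suc n)) -` {-1<..1} \<inter> space (P (Suc n)))"
        unfolding \<nu>_def by (rule measure_distr[OF meas]) simp
      also have "(\<lambda>k. real k / real (Suc n)) -` {-1<..1} \<inter> space (P (Suc n)) = space (P (Suc n))"
        by (auto simp: P_def space_point_measure divide_simps)
      finally show ?thesis using prob_space.prob_space[OF P_prob] by simp
    qed
    then show "\<exists>a b. a < b \<and> (\<forall>n. 1 - \<epsilon> < measure (\<nu> n) {a<..b})"
      using \<open>\<epsilon> > 0\<close> by (intro exI[of _ "-1"] exI[of _ 1]) auto
  qed
  from tight_imp_convergent_subsubsequence[OF this strict_mono_id]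
  obtain r L where r: "strict_mono r" and L: "real_distribution L" and wc: "weak_conv_m (\<nu> \<circ> r) L"
    by (auto simp: o_assoc)
  interpret L: real_distribution L by fact
  \<comment> \<open>Clamping to [0,1] does not move the atoms, turns \<open>x^j\<close> into a
    bounded continuous test function, and finally pushes the limit measure onto [0,1].\<close>
  define cl where "cl x = max 0 (min 1 x)" for x :: real
  have [measurable]: "cl \<in> borel_measurable borel" unfolding cl_def by measurable
  have mom: "(LINT x|L. cl x ^ j) = m j" for j
  proof (rule LIMSEQ_unique)
    show "(\<lambda>n. LINT x|(\<nu> \<circ> r) n. cl x ^ j) \<longlonglongrightarrow> (LINT x|L. cl x ^ j)"
    proof (rule weak_conv_imp_integral_bdd_continuous_conv[where B=1])
      show "isCont (\<lambda>x. cl x ^ j) x" for x unfolding cl_def by (intro continuous_intros)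
      show "norm (cl x ^ j) \<le> 1" for x by (auto simp: cl_def power_abs intro!: power_le_one)
      show "real_distribution ((\<nu> \<circ> r) n)" for n by (simp add: \<nu>_rd)
    qed (fact L wc)+
    have "(\<lambda>n. LINT x|\<nu> n. cl x ^ j) \<longlonglongrightarrow> m j"
    proof (rule LIMSEQ_I)
      fix e :: real assume e: "e > 0"
      have "(\<lambda>n. real j * (real j / (real (Suc n) - real j))) \<longlonglongrightarrow> 0" by real_asymp
      then have "\<forall>\<^sub>F n in sequentially. real j * (real j / (real (Suc n) - real j)) < e"
        using e by (rule order_tendstoD(2))
      moreover have "\<forall>\<^sub>F n in sequentially. 2 * j < Suc n"
        using eventually_ge_at_top[of "2 * j"] by eventually_elim auto
      ultimately have "\<forall>\<^sub>F n in sequentially. real j * (real j / (real (Suc n) - real j)) < e \<and> 2 * j < Suc n"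
        by (rule eventually_conj)
      then obtain n0 where n0: "\<And>n. n \<ge> n0 \<Longrightarrow> real j * (real j / (real (Suc n) - real j)) < e \<and> 2 * j < Suc n"
        by (auto simp: eventually_sequentially)
      have "norm ((LINT x|\<nu> n. cl x ^ j) - m j) < e" if "n \<ge> n0" for n
      proof -
        let ?N = "Suc n"
        have N: "2 * j < ?N" using n0[OF that] by simp
        have "(LINT x|\<nu> n. cl x ^ j) = (\<Sum>k\<le>?N. w ?N k * (real k / real ?N) ^ j)"
          by (subst int_\<nu>) (auto intro!: sum.cong simp: cl_def divide_simps simp del: of_nat_Suc)
        \<comment> \<open>Binomial moments are exact; the error comes only from replacing the
          binomial ratio by the power \<open>(k / N)^j\<close>.\<close>
        moreover have "m j = (\<Sum>k\<le>?N. w ?N k * (real (k choose j) / real (?N choose j)))"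
        proof -
          have "(?N choose j) > 0" using N by (intro zero_less_binomial) auto
          then show ?thesis using mdiff_binomial_moment[of j ?N m] N
            by (simp add: w_def sum_divide_distrib[symmetric] del: binomial_Suc_Suc sum.atMost_Suc)
        qed
        ultimately have "norm ((LINT x|\<nu> n. cl x ^ j) - m j)
            = \<bar>\<Sum>k\<le>?N. w ?N k * ((real k / real ?N) ^ j - real (k choose j) / real (?N choose j))\<bar>"
          by (simp only: sum_subtractf[symmetric] right_diff_distrib[symmetric] real_norm_def)
        also have "\<dots> \<le> (\<Sum>k\<le>?N. w ?N k * (real j * (real j / (real ?N - real j))))"
        proof (rule order_trans[OF sum_abs sum_mono])
          fix k assume "k \<in> {..?N}"
          then have "\<bar>(real k / real ?N) ^ j - real (k choose j) / real (?N choose j)\<bar> \<le> real j * (real j / (real ?N - real j))"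
            using binomial_ratio_approx[of k ?N j] N by (simp only: abs_minus_commute atMost_iff)
          then show "\<bar>w ?N k * ((real k / real ?N) ^ j - real (k choose j) / real (?N choose j))\<bar>
             \<le> w ?N k * (real j * (real j / (real ?N - real j)))"
            unfolding abs_mult using w0[of ?N k] by (simp only: abs_of_nonneg mult_left_mono)
        qed
        also have "\<dots> = real j * (real j / (real ?N - real j))"
          by (simp only: sum_distrib_right[symmetric] wsum mult_1)
        also have "\<dots> < e" using n0[OF that] by simp
        finally show ?thesis .
      qed
      then show "\<exists>n0. \<forall>n\<ge>n0. norm ((LINT x|\<nu> n. cl x ^ j) - m j) < e" by blast
    qed
    from LIMSEQ_subseq_LIMSEQ[OF this r] show "(\<lambda>n. LINT x|(\<nu> \<circ> r) n. cl x ^ j) \<longlonglongrightarrow> m j"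
      by (simp add: o_def)
  qed
  define \<mu> where "\<mu> = distr L borel cl"
  have cl_L: "cl \<in> measurable L borel" by measurable
  have "real_distribution \<mu>"
    unfolding real_distribution_def real_distribution_axioms_def \<mu>_def
    using L.prob_space_distr[OF cl_L] by simp
  moreover have "AE x in \<mu>. 0 \<le> x \<and> x \<le> 1"
    unfolding \<mu>_def by (subst AE_distr_iff[OF cl_L]) (auto simp: cl_def)
  moreover have "(LINT x|\<mu>. x ^ j) = m j" for j
    unfolding \<mu>_def by (subst integral_distr[OF cl_L]) (auto simp: mom)
  ultimately show ?thesis by blast
qed

section \<open>Functions determined by their integrals\<close>

text \<open>Integrating over \<open>A = {Re (c * g) > 0}\<close> shows
  \<open>Re (c * g) <= 0\<close> almost everywhere; the values 1, -1, \<open>\<i>\<close>,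
  \<open>- \<i>\<close> of \<open>c\<close> leave only \<open>g = 0\<close>.\<close>

lemma AE_zero_of_set_integrals:
  fixes g :: "'a \<Rightarrow> complex"
  assumes g: "integrable M g"
    and zero: "\<And>A. A \<in> sets M \<Longrightarrow> (LINT x:A|M. g x) = 0"
  shows "AE x in M. g x = 0"
proof -
  have [measurable]: "g \<in> borel_measurable M" using g by simp
  have half: "AE x in M. Re (c * g x) \<le> 0" for c
  proof -
    define A where "A = {x \<in> space M. Re (c * g x) > 0}"
    have A[measurable]: "A \<in> sets M" unfolding A_def by measurable
    have int: "integrable M (\<lambda>x. indicat_real A x *\<^sub>R (c * g x))"
      using g by (intro integrable_mult_indicator A) auto
    have "(LINT x|M. Re (indicat_real A x *\<^sub>R (c * g x))) = Re (c * (LINT x:A|M. g x))"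
      unfolding set_lebesgue_integral_def using int g
      by (subst integral_Re) (auto simp: mult_scaleR_right[symmetric] simp del: mult_scaleR_right)
    then have 0: "(LINT x|M. Re (indicat_real A x *\<^sub>R (c * g x))) = 0" using zero[OF A] by simp
    have "AE x in M. 0 \<le> Re (indicat_real A x *\<^sub>R (c * g x))"
      by (auto simp: A_def indicator_def)
    from iffD1[OF integral_nonneg_eq_0_iff_AE[OF integrable_Re[OF int] this] 0]
    have "AE x in M. Re (indicat_real A x *\<^sub>R (c * g x)) = 0" .
    moreover have "AE x in M. x \<in> space M" by (rule AE_space)
    ultimately show ?thesis by eventually_elim (auto simp: A_def indicator_def split: if_splits)
  qed
  from half[of 1] half[of "-1"] half[of \<i>] half[of "-\<i>"] show ?thesis
    by eventually_elim (auto simp: complex_eq_iff)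
qed

text \<open>Dynkin's argument: half-lines are closed under intersection and generate the Borel sets;
  the total integral handles complements.\<close>

lemma AE_zero_of_atMost_integrals:
  fixes g :: "real \<Rightarrow> complex"
  assumes g: "integrable M g" and M: "sets M = sets borel"
    and total: "(LINT x|M. g x) = 0"
    and zero: "\<And>t. (LINT x:{..t}|M. g x) = 0"
  shows "AE x in M. g x = 0"
proof (rule AE_zero_of_set_integrals[OF g])
  note [measurable_cong] = M
  have sp: "space M = UNIV" using sets_eq_imp_space_eq[OF M] by simp
  have si: "set_integrable M A g" if "A \<in> sets borel" for A
    unfolding set_integrable_def using that g M by (intro integrable_mult_indicator) auto
  have borel: "sets borel = sigma_sets UNIV (range (\<lambda>a::real. {..a}))"
    by (subst borel_eq_atMost) simp
  fix A assume "A \<in> sets M"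
  then have "A \<in> sigma_sets UNIV (range (\<lambda>a::real. {..a}))" using M borel by simp
  have "Int_stable (range (\<lambda>a::real. {..a}))" "range (\<lambda>a::real. {..a}) \<subseteq> Pow UNIV"
    by (auto simp: Int_stable_def)
  from this \<open>A \<in> sigma_sets UNIV _\<close> show "(LINT x:A|M. g x) = 0"
  proof (induction rule: sigma_sets_induct_disjoint)
    case (basic A) then show ?case using zero by auto
  next
    case empty show ?case by (simp add: set_lebesgue_integral_def)
  next
    case (compl A)
    then have A: "A \<in> sets borel" by (simp add: borel)
    have "(LINT x:A \<union> (UNIV - A)|M. g x) = (LINT x:A|M. g x) + (LINT x:UNIV - A|M. g x)"
      using A by (intro set_integral_Un si) auto
    then show ?case using compl total by (simp add: set_lebesgue_integral_def)
  next
    case (union A)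
    then have A: "\<And>i. A i \<in> sets borel" by (auto simp: borel)
    have "(LINT x:(\<Union>i. A i)|M. g x) = (\<Sum>i. (LINT x:(A i)|M. g x))"
      using union A by (intro lebesgue_integral_countable_add si) (auto simp: M disjoint_family_on_def)
    then show ?case using union by simp
  qed
qed

text \<open>Vanishing power moments pass to \<open>x^k (1 - x)^l\<close>, hence to Bernstein
  polynomials, to continuous functions, and through continuous steps to half-lines.\<close>

lemma AE_zero_of_moments:
  fixes g :: "real \<Rightarrow> complex"
  assumes \<mu>: "finite_measure \<mu>" "sets \<mu> = sets borel" and unit: "AE x in \<mu>. 0 \<le> x \<and> x \<le> 1"
    and g: "integrable \<mu> g" and zero: "\<And>i. (LINT x|\<mu>. g x * of_real (x ^ i)) = 0"
  shows "AE x in \<mu>. g x = 0"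
proof -
  note [measurable_cong] = \<mu>(2)
  have [measurable]: "g \<in> borel_measurable \<mu>" using g by simp
  have bd: "integrable \<mu> (\<lambda>x. g x * of_real (h x))"
    if h[measurable]: "h \<in> borel_measurable borel" and B: "\<And>x. 0 \<le> x \<Longrightarrow> x \<le> 1 \<Longrightarrow> \<bar>h x\<bar> \<le> B" for h B
  proof (rule Bochner_Integration.integrable_bound[OF integrable_mult_right[OF integrable_norm[OF g], of B]])
    show "AE x in \<mu>. norm (g x * complex_of_real (h x)) \<le> norm (B * norm (g x))"
      using unit
    proof eventually_elim
      case (elim x)
      then have "\<bar>h x\<bar> \<le> \<bar>B\<bar>" using B[of x] by linarith
      then show ?case by (simp add: norm_mult abs_mult mult.commute mult_right_mono)
    qed
  qed measurable
  have poly: "(LINT x|\<mu>. g x * of_real (x ^ k * (1 - x) ^ l)) = 0" for k l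
  proof (induction l arbitrary: k)
    case 0 then show ?case using zero by simp
  next
    case (Suc l)
    have I: "integrable \<mu> (\<lambda>x. g x * of_real (x ^ k * (1 - x) ^ l))" for k
      by (rule bd[of _ 1]) (auto intro!: mult_le_one power_le_one simp: abs_mult power_abs)
    have "(\<lambda>x. g x * of_real (x ^ k * (1 - x) ^ Suc l)) =
      (\<lambda>x. g x * of_real (x ^ k * (1 - x) ^ l) - g x * of_real (x ^ Suc k * (1 - x) ^ l))"
      by (auto simp: algebra_simps)
    then show ?case by (simp only: Bochner_Integration.integral_diff[OF I I] Suc diff_self)
  qed
  have cont: "(LINT x|\<mu>. g x * of_real (h x)) = 0" if h: "continuous_on UNIV h" for h
  proof -
    have hm[measurable]: "h \<in> borel_measurable borel" using h by (rule borel_measurable_continuous_onI)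
    have hc: "continuous_on {0..1} h" using h by (rule continuous_on_subset) simp
    then have "bounded (h ` {0..1})"
      by (intro compact_imp_bounded compact_continuous_image) auto
    then obtain B where "\<forall>y\<in>h ` {0..1}. norm y \<le> B" unfolding bounded_iff by blast
    then have B: "\<And>x. 0 \<le> x \<Longrightarrow> x \<le> 1 \<Longrightarrow> \<bar>h x\<bar> \<le> B" by auto
    have "norm (LINT x|\<mu>. g x * of_real (h x)) \<le> 0 + e" if e: "e > 0" for e
    proof -
      define G where "G = (LINT x|\<mu>. norm (g x))"
      have G0: "G \<ge> 0" by (simp add: G_def)
      define \<delta> where "\<delta> = e / (G + 1)"
      have \<delta>: "\<delta> > 0" using e G0 by (simp add: \<delta>_def)
      from Bernstein_Weierstrass[OF hc \<delta>] obtain n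
        where n: "\<And>x. x \<in> {0..1} \<Longrightarrow> \<bar>h x - (\<Sum>k\<le>n. h (k/n) * Bernstein n k x)\<bar> < \<delta>" by blast
      define p where "p x = (\<Sum>k\<le>n. h (k/n) * Bernstein n k x)" for x
      have pm[measurable]: "p \<in> borel_measurable borel" unfolding p_def Bernstein_def by measurable
      have I: "integrable \<mu> (\<lambda>x. g x * of_real (x ^ k * (1 - x) ^ l))" for k l
        by (rule bd[of _ 1]) (auto intro!: mult_le_one power_le_one simp: abs_mult power_abs)
      have "(\<lambda>x. g x * of_real (p x)) = (\<lambda>x. \<Sum>k\<le>n. of_real (h (k/n) * real (n choose k)) * (g x * of_real (x ^ k * (1 - x) ^ (n - k))))"
        by (auto simp: p_def Bernstein_def sum_distrib_left mult_ac)
      then have p0: "(LINT x|\<mu>. g x * of_real (p x)) = 0" and pint: "integrable \<mu> (\<lambda>x. g x * of_real (p x))"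
        using I poly by (simp_all only: Bochner_Integration.integral_sum integrable_mult_right integral_mult_right_zero
           Bochner_Integration.integrable_sum mult_zero_right sum.neutral_const)
      have "(LINT x|\<mu>. g x * of_real (h x)) = (LINT x|\<mu>. g x * of_real (h x) - g x * of_real (p x))"
        using bd[OF hm B] pint p0 by simp
      also have "norm \<dots> \<le> (LINT x|\<mu>. \<delta> * norm (g x))"
      proof (rule order_trans[OF integral_norm_bound integral_mono_AE])
        show "integrable \<mu> (\<lambda>x. cmod (g x * complex_of_real (h x) - g x * complex_of_real (p x)))"
          using bd[OF hm B] pint by auto
        show "integrable \<mu> (\<lambda>x. \<delta> * cmod (g x))" using g by auto
        show "AE x in \<mu>. cmod (g x * complex_of_real (h x) - g x * complex_of_real (p x)) \<le> \<delta> * cmod (g x)"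
          using unit
        proof eventually_elim
          case (elim x)
          have "cmod (g x * complex_of_real (h x) - g x * complex_of_real (p x)) = cmod (g x) * \<bar>h x - p x\<bar>"
            by (simp flip: right_diff_distrib of_real_diff add: norm_mult)
          also have "\<dots> \<le> cmod (g x) * \<delta>"
            using n[of x] elim by (intro mult_left_mono) (auto simp: p_def)
          finally show ?case by (simp add: mult.commute)
        qed
      qed
      also have "\<dots> = \<delta> * G" by (simp add: G_def)
      also have "\<dots> \<le> e" using e G0 by (simp add: \<delta>_def field_simps)
      finally show ?thesis by simp
    qed
    then have "norm (LINT x|\<mu>. g x * of_real (h x)) \<le> 0" by (rule field_le_epsilon)
    then show ?thesis by simp
  qed
  show ?thesis
  proof (rule AE_zero_of_atMost_integrals[OF g \<mu>(2)])
    show "(LINT x|\<mu>. g x) = 0" using zero[of 0] by simp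
    fix t :: real
    show "(LINT x:{..t}|\<mu>. g x) = 0"
    proof (rule LIMSEQ_unique)
      \<comment> \<open>Continuous functions equal to 1 up to \<open>t\<close> and to 0 from
        \<open>t + 1 / Suc n\<close> on; they converge pointwise to the indicator.\<close>
      let ?h = "\<lambda>n. cts_step t (t + 1 / real (Suc n))"
      have hc: "continuous_on UNIV (?h n)" for n
        by (intro uniformly_continuous_imp_continuous cts_step_uniformly_continuous) simp
      then have [measurable]: "\<And>n. ?h n \<in> borel_measurable borel" by (intro borel_measurable_continuous_onI)
      show "(\<lambda>n. LINT x|\<mu>. g x * of_real (?h n x)) \<longlonglongrightarrow> (LINT x:{..t}|\<mu>. g x)"
        unfolding set_lebesgue_integral_def
      proof (rule integral_dominated_convergence[where w="\<lambda>x. norm (g x)"])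
        show "AE x in \<mu>. (\<lambda>n. g x * complex_of_real (?h n x)) \<longlonglongrightarrow> indicat_real {..t} x *\<^sub>R g x"
        proof (rule AE_I2)
          fix x
          have "(\<lambda>n. ?h n x) \<longlonglongrightarrow> indicat_real {..t} x"
          proof (cases "x \<le> t")
            case True then show ?thesis by (simp add: cts_step_def)
          next
            case False
            then have "\<forall>\<^sub>F n in sequentially. inverse (real (Suc n)) < x - t"
              using LIMSEQ_inverse_real_of_nat by (intro order_tendstoD(2)) auto
            then have "\<forall>\<^sub>F n in sequentially. ?h n x = 0"
              by eventually_elim (use False in \<open>auto simp: cts_step_def inverse_eq_divide\<close>)
            then show ?thesis using False by (simp add: tendsto_eventually)
          qed
          then have "(\<lambda>n. g x * complex_of_real (?h n x)) \<longlonglongrightarrow> g x * of_real (indicat_real {..t} x)"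
            by (intro tendsto_intros)
          then show "(\<lambda>n. g x * complex_of_real (?h n x)) \<longlonglongrightarrow> indicat_real {..t} x *\<^sub>R g x"
            by (simp add: scaleR_conv_of_real mult.commute)
        qed
        show "AE x in \<mu>. norm (g x * complex_of_real (?h n x)) \<le> norm (g x)" for n
        proof (rule AE_I2)
          fix x
          have "0 \<le> ?h n x \<and> ?h n x \<le> 1" by (auto simp: cts_step_def divide_simps)
          then show "norm (g x * complex_of_real (?h n x)) \<le> norm (g x)"
            by (simp add: norm_mult mult_left_le)
        qed
        show "(\<lambda>x. g x * complex_of_real (?h n x)) \<in> borel_measurable \<mu>" for n by measurable
        show "(\<lambda>x. indicat_real {..t} x *\<^sub>R g x) \<in> borel_measurable \<mu>" by measurable
      qed (use g in \<open>auto\<close>)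
      show "(\<lambda>n. LINT x|\<mu>. g x * of_real (?h n x)) \<longlonglongrightarrow> 0" using cont[OF hc] by simp
    qed
  qed
qed

section \<open>A spectral theorem of uniform multiplicity\<close>

context
  fixes \<mu> :: "real measure" and \<Omega> :: "(real \<times> nat) measure"
  assumes fin: "finite_measure \<mu>" and sets_\<mu>: "sets \<mu> = sets borel"
    and \<Omega>: "\<Omega> = \<mu> \<Otimes>\<^sub>M count_space UNIV"
begin

interpretation finite_measure \<mu> by (fact fin)
interpretation pair_sigma_finite \<mu> "count_space (UNIV :: nat set)"
  by (intro pair_sigma_finite.intro sigma_finite_measure_axioms sigma_finite_measure_count_space)

lemma space_slices: "space \<mu> = UNIV" "space \<Omega> = UNIV"
  using sets_eq_imp_space_eq[OF sets_\<mu>] by (auto simp: \<Omega> space_pair_measure)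

lemma slice_measurable: "(\<lambda>s. (s, n)) \<in> measurable \<mu> \<Omega>"
  unfolding \<Omega> by measurable

lemma slice_set: "UNIV \<times> {n} \<in> sets \<Omega>"
  unfolding \<Omega> using sets.top[of \<mu>] by (auto simp: space_slices)

text \<open>Identifies the n-th copy of \<open>\<mu>\<close> with a restriction of
  \<open>\<Omega>\<close>, so that integrals over one copy become integrals over
  \<open>\<Omega>\<close> against an indicator.\<close>

lemma distr_slice: "distr \<mu> \<Omega> (\<lambda>s. (s, n)) = density \<Omega> (indicator (UNIV \<times> {n}))"
proof (rule measure_eqI)
  fix A assume "A \<in> sets (distr \<mu> \<Omega> (\<lambda>s. (s, n)))"
  then have A: "A \<in> sets \<Omega>" by simp
  have B: "(\<lambda>s. (s, n)) -` A \<inter> space \<mu> \<in> sets \<mu>"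
    using A slice_measurable by (rule measurable_sets[rotated])
  have "emeasure (density \<Omega> (indicator (UNIV \<times> {n}))) A = emeasure \<Omega> ((UNIV \<times> {n}) \<inter> A)"
    using A slice_set by (intro emeasure_restricted)
  also have "\<dots> = (\<integral>\<^sup>+x. emeasure (count_space UNIV) (Pair x -` ((UNIV \<times> {n}) \<inter> A)) \<partial>\<mu>)"
    unfolding \<Omega> using A slice_set[of n]
    by (intro sigma_finite_measure.emeasure_pair_measure_alt[OF sigma_finite_measure_count_space]) (auto simp: \<Omega>)
  also have "\<dots> = (\<integral>\<^sup>+x. indicator ((\<lambda>s. (s, n)) -` A \<inter> space \<mu>) x \<partial>\<mu>)"
  proof (rule nn_integral_cong)
    fix x
    have "Pair x -` ((UNIV \<times> {n}) \<inter> A) = (if (x, n) \<in> A then {n} else {})" by auto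
    then show "emeasure (count_space UNIV) (Pair x -` ((UNIV \<times> {n}) \<inter> A)) = indicator ((\<lambda>s. (s, n)) -` A \<inter> space \<mu>) x"
      by (simp add: indicator_def space_slices)
  qed
  also have "\<dots> = emeasure \<mu> ((\<lambda>s. (s, n)) -` A \<inter> space \<mu>)"
    using B by simp
  also have "\<dots> = emeasure (distr \<mu> \<Omega> (\<lambda>s. (s, n))) A"
    by (rule emeasure_distr[OF slice_measurable A, symmetric])
  finally show "emeasure (distr \<mu> \<Omega> (\<lambda>s. (s, n))) A = emeasure (density \<Omega> (indicator (UNIV \<times> {n}))) A" by simp
qed simp

lemma slice_integrable_iff:
  fixes f :: "real \<times> nat \<Rightarrow> 'b :: {banach, second_countable_topology}"
  assumes [measurable]: "f \<in> borel_measurable \<Omega>"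
  shows "integrable \<Omega> (\<lambda>x. indicat_real (UNIV \<times> {n}) x *\<^sub>R f x) \<longleftrightarrow> integrable \<mu> (\<lambda>s. f (s, n))"
proof -
  note [measurable] = slice_measurable slice_set
  have "integrable \<mu> (\<lambda>s. f (s, n)) \<longleftrightarrow> integrable (density \<Omega> (\<lambda>x. ennreal (indicat_real (UNIV \<times> {n}) x))) f"
    unfolding ennreal_indicator distr_slice[symmetric] by (subst integrable_distr_eq) auto
  also have "\<dots> \<longleftrightarrow> integrable \<Omega> (\<lambda>x. indicat_real (UNIV \<times> {n}) x *\<^sub>R f x)"
    by (rule integrable_density) auto
  finally show ?thesis by simp
qed

lemma slice_integral:
  fixes f :: "real \<times> nat \<Rightarrow> 'b :: {banach, second_countable_topology}"
  assumes [measurable]: "f \<in> borel_measurable \<Omega>"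
  shows "(LINT x|\<Omega>. indicat_real (UNIV \<times> {n}) x *\<^sub>R f x) = (LINT s|\<mu>. f (s, n))"
proof -
  note [measurable] = slice_measurable slice_set
  have "(LINT s|\<mu>. f (s, n)) = (LINT x|density \<Omega> (\<lambda>x. ennreal (indicat_real (UNIV \<times> {n}) x)). f x)"
    unfolding ennreal_indicator distr_slice[symmetric] by (subst integral_distr) auto
  also have "\<dots> = (LINT x|\<Omega>. indicat_real (UNIV \<times> {n}) x *\<^sub>R f x)"
    by (rule integral_density) auto
  finally show ?thesis by simp
qed

lemma AE_slices:
  assumes [measurable]: "Measurable.pred \<Omega> P" and "\<And>n. AE s in \<mu>. P (s, n)"
  shows "AE x in \<Omega>. P x"
  unfolding \<Omega>
proof (rule AE_pair_measure)
  show "{x \<in> space (\<mu> \<Otimes>\<^sub>M count_space UNIV). P x} \<in> sets (\<mu> \<Otimes>\<^sub>M count_space UNIV)"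
    using assms(1) unfolding \<Omega> by measurable
  show "AE x in \<mu>. AE y in count_space UNIV. P (x, y)"
    using assms(2) by (simp add: AE_count_space AE_all_countable)
qed

end

text \<open>In terms of quadratic forms, \<open>0 <= S <= 1\<close>. \<open>S\<close> acts on
  representatives, and linearity is not among the assumptions; symmetry yields it up to null
  sets.\<close>

locale positive_contraction =
  fixes M :: "'a measure" and S :: "('a \<Rightarrow> complex) \<Rightarrow> 'a \<Rightarrow> complex"
  assumes S_L2: "f \<in> L2 M \<Longrightarrow> S f \<in> L2 M"
    and S_sym: "f \<in> L2 M \<Longrightarrow> g \<in> L2 M \<Longrightarrow> l2_inner M (S f) g = l2_inner M f (S g)"
    and S_pos: "f \<in> L2 M \<Longrightarrow> 0 \<le> Re (l2_inner M (S f) f)"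
    and S_le: "f \<in> L2 M \<Longrightarrow> Re (l2_inner M (S f) f) \<le> (l2_norm M f)^2"
begin

lemma pow_L2: "f \<in> L2 M \<Longrightarrow> (S ^^ i) f \<in> L2 M"
  by (induction i) (auto intro: S_L2)

lemma pow_sym:
  assumes "f \<in> L2 M" "g \<in> L2 M"
  shows "l2_inner M ((S ^^ i) f) g = l2_inner M f ((S ^^ i) g)"
  using assms(2)
proof (induction i arbitrary: g)
  case (Suc i)
  have "l2_inner M ((S ^^ Suc i) f) g = l2_inner M ((S ^^ i) f) (S g)"
    using S_sym[OF pow_L2[OF assms(1)] Suc.prems] by simp
  also have "\<dots> = l2_inner M f ((S ^^ i) (S g))" by (rule Suc.IH[OF S_L2[OF Suc.prems]])
  finally show ?case by (simp add: funpow_swap1)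
qed simp

lemma pow_pow:
  assumes "f \<in> L2 M" "g \<in> L2 M"
  shows "l2_inner M ((S ^^ i) f) ((S ^^ j) g) = l2_inner M ((S ^^ (i + j)) f) g"
proof -
  have "l2_inner M ((S ^^ (j + i)) f) g = l2_inner M ((S ^^ j) ((S ^^ i) f)) g" by (simp add: funpow_add)
  also have "\<dots> = l2_inner M ((S ^^ i) f) ((S ^^ j) g)" by (intro pow_sym pow_L2 assms)
  finally show ?thesis by (simp add: add.commute)
qed

lemma pow_real: "f \<in> L2 M \<Longrightarrow> l2_inner M ((S ^^ i) f) f = of_real (Re (l2_inner M ((S ^^ i) f) f))"
  using pow_sym[of f f i] inner_commute_cnj[of M "(S ^^ i) f" f]
  by (simp add: complex_eq_iff)

text \<open>Operator form of \<open>x^2 <= x\<close> on [0,1]: positivity at \<open>f - S f\<close>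
  is \<open>x (1 - x)^2 >= 0\<close>, and the upper bound at \<open>S f\<close> is
  \<open>x^3 <= x^2\<close>.\<close>

lemma S_norm:
  assumes f: "f \<in> L2 M" shows "(l2_norm M (S f))^2 \<le> Re (l2_inner M (S f) f)"
proof -
  let ?g = "\<lambda>x. f x - S f x"
  note L = f S_L2[OF f] S_L2[OF S_L2[OF f]]
  have g: "?g \<in> L2 M" using L by auto
  have "l2_inner M (S ?g) ?g = l2_inner M (S ?g) f - l2_inner M (S ?g) (S f)"
    using L g by (simp add: inner_diff_right S_L2)
  also have "l2_inner M (S ?g) f = l2_inner M f (S f) - l2_inner M (S f) (S f)"
    using L g by (simp add: S_sym inner_diff_left)
  also have "l2_inner M (S ?g) (S f) = l2_inner M f (S (S f)) - l2_inner M (S f) (S (S f))"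
    using L g by (simp add: S_sym inner_diff_left)
  finally have 1: "Re (l2_inner M (S ?g) ?g) = Re (l2_inner M (S f) f) - 2 * (l2_norm M (S f))^2 + Re (l2_inner M (S (S f)) (S f))"
    using S_sym[OF L(1) L(2)] S_sym[OF L(1) L(1)] S_sym[OF L(2) L(2)] arg_cong[OF inner_self[of M "S f"], of Re]
    by (simp del: of_real_power)
  show ?thesis using S_pos[OF g] S_le[OF L(2)] unfolding 1 by linarith
qed

lemma S_contract:
  assumes f: "f \<in> L2 M" shows "l2_norm M (S f) \<le> l2_norm M f"
  using order_trans[OF S_norm[OF f] S_le[OF f]] by (rule power2_le_imp_le) simp

text \<open>In place of linearity: with \<open>?h\<close> the difference of the images, symmetry
  moves \<open>S\<close> from \<open>f\<close> and \<open>f'\<close> to \<open>?h\<close>, and the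
  contraction bound applies to \<open>S ?h\<close>.\<close>

lemma S_diff:
  assumes f: "f \<in> L2 M" and f': "f' \<in> L2 M"
  shows "l2_norm M (\<lambda>w. S f w - S f' w) \<le> l2_norm M (\<lambda>w. f w - f' w)"
proof -
  let ?h = "\<lambda>w. S f w - S f' w"
  have h: "?h \<in> L2 M" using f f' by (auto intro: S_L2)
  have "l2_inner M ?h ?h = l2_inner M (\<lambda>w. f w - f' w) (S ?h)"
    by (subst (1) inner_diff_left) (use f f' h in \<open>auto simp: S_L2 S_sym inner_diff_left\<close>)
  then have "(l2_norm M ?h)^2 = cmod (l2_inner M (\<lambda>w. f w - f' w) (S ?h))"
    by (metis inner_self norm_of_real abs_of_nonneg zero_le_power2)
  also have "\<dots> \<le> l2_norm M (\<lambda>w. f w - f' w) * l2_norm M (S ?h)"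
    using f f' h by (intro l2_Cauchy_Schwarz S_L2) auto
  also have "\<dots> \<le> l2_norm M (\<lambda>w. f w - f' w) * l2_norm M ?h"
    by (intro mult_left_mono S_contract h) simp
  finally have "l2_norm M ?h * l2_norm M ?h \<le> l2_norm M (\<lambda>w. f w - f' w) * l2_norm M ?h"
    by (simp add: power2_eq_square)
  then show ?thesis
    using l2_norm_nonneg[of M ?h] by (cases "l2_norm M ?h = 0") (auto simp: mult_le_cancel_right)
qed

text \<open>Linearity up to a null function: the defect is orthogonal to itself, since symmetry
  transfers \<open>S\<close> to the defect in both terms.\<close>

lemma S_lin_comb:
  assumes x: "\<And>i. x i \<in> L2 M"
  shows "l2_norm M (\<lambda>w. S (lin_comb x c F) w - lin_comb (\<lambda>i. S (x i)) c F w) = 0"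
proof -
  let ?h = "\<lambda>w. S (lin_comb x c F) w - lin_comb (\<lambda>i. S (x i)) c F w"
  note L = lin_comb_L2[of x, OF x] S_L2[OF lin_comb_L2[of x, OF x]] lin_comb_L2[of "\<lambda>i. S (x i)", OF S_L2[OF x]]
  have h: "?h \<in> L2 M" using L by auto
  have "l2_inner M (lin_comb (\<lambda>i. S (x i)) c F) ?h = l2_inner M (lin_comb x c F) (S ?h)"
  proof -
    have "l2_inner M (lin_comb z c F) k = (\<Sum>i\<in>F. c i * l2_inner M (z i) k)" if "\<And>i. z i \<in> L2 M" "k \<in> L2 M" for z k
      unfolding lin_comb_def by (rule inner_sum_left[OF that])
    then show ?thesis using x h by (simp add: S_L2 S_sym)
  qed
  then have "l2_inner M ?h ?h = 0"
    by (subst (1) inner_diff_left) (use L h in \<open>auto simp: S_sym\<close>)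
  then show ?thesis by (simp add: inner_self)
qed

text \<open>These are the moments of \<open>x^k (1 - x)^l\<close> for a spectral measure that is not
  yet available. Replacing \<open>f\<close> by \<open>f - S f\<close> lowers \<open>l\<close> by 2;
  the cases 0 and 1 split on the parity of \<open>k\<close> and rest on positivity, the upper bound
  and \<open>S_norm\<close>.\<close>

lemma mdiff_pow_nonneg:
  assumes "f \<in> L2 M"
  shows "mdiff (\<lambda>j. Re (l2_inner M ((S ^^ j) f) f)) l k \<ge> 0"
  using assms
proof (induction l arbitrary: f rule: less_induct)
  case (less l)
  have even_odd: "k = i + i \<or> k = i + Suc i" if "i = k div 2" for i using that by presburger
  define i where "i = k div 2"
  consider "l = 0" | "l = 1" | n where "l = Suc (Suc n)" by (metis One_nat_def not0_implies_Suc)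
  then show ?case
  proof cases
    case 1
    have "0 \<le> Re (l2_inner M ((S ^^ (i + i)) f) f)"
      unfolding pow_pow[OF less.prems less.prems, symmetric] by (simp add: inner_self)
    moreover have "0 \<le> Re (l2_inner M ((S ^^ (i + Suc i)) f) f)"
      using S_pos[OF pow_L2[OF less.prems, of i]] pow_pow[OF less.prems less.prems, of "Suc i" i] by simp
    ultimately show ?thesis using 1 even_odd[OF i_def] by auto
  next
    case 2
    note f = less.prems
    have a: "Re (l2_inner M ((S ^^ (i + i)) f) f) = (l2_norm M ((S ^^ i) f))^2"
      unfolding pow_pow[OF f f, symmetric] by (simp add: inner_self)
    have b: "Re (l2_inner M ((S ^^ (i + Suc i)) f) f) = Re (l2_inner M (S ((S ^^ i) f)) ((S ^^ i) f))"
      using pow_pow[OF f f, of "Suc i" i] by simp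
    have c: "Re (l2_inner M ((S ^^ (Suc i + Suc i)) f) f) = (l2_norm M (S ((S ^^ i) f)))^2"
      unfolding pow_pow[OF f f, symmetric] by (simp add: inner_self del: of_real_power)
    have "Re (l2_inner M ((S ^^ Suc k) f) f) \<le> Re (l2_inner M ((S ^^ k) f) f)"
      using even_odd[OF i_def]
    proof
      assume "k = i + i"
      then show ?thesis using S_le[OF pow_L2[OF f, of i]] a b by simp
    next
      assume "k = i + Suc i"
      then show ?thesis using S_norm[OF pow_L2[OF f, of i]] b c by simp
    qed
    then show ?thesis using 2 by simp
  next
    case 3
    note f = less.prems
    let ?g = "\<lambda>x. f x - S f x"
    have g: "?g \<in> L2 M" using f by (auto intro: S_L2)
    have m: "Re (l2_inner M ((S ^^ j) ?g) ?g)
       = Re (l2_inner M ((S ^^ j) f) f) - 2 * Re (l2_inner M ((S ^^ Suc j) f) f) + Re (l2_inner M ((S ^^ Suc (Suc j)) f) f)" for j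
    proof -
      have "l2_inner M ((S ^^ j) ?g) ?g = l2_inner M ((S ^^ j) ?g) f - l2_inner M ((S ^^ j) ?g) (S f)"
        using f g by (simp add: inner_diff_right S_L2 pow_L2)
      also have "l2_inner M ((S ^^ j) ?g) f = l2_inner M f ((S ^^ j) f) - l2_inner M (S f) ((S ^^ j) f)"
        using f g by (simp add: pow_sym inner_diff_left S_L2 pow_L2)
      also have "l2_inner M ((S ^^ j) ?g) (S f) = l2_inner M f ((S ^^ j) (S f)) - l2_inner M (S f) ((S ^^ j) (S f))"
        using f g by (simp add: pow_sym inner_diff_left S_L2 pow_L2)
      also have "l2_inner M f ((S ^^ j) f) = l2_inner M ((S ^^ j) f) f" by (simp add: pow_sym f)
      also have "l2_inner M (S f) ((S ^^ j) f) = l2_inner M ((S ^^ Suc j) f) f"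
        using pow_pow[OF f f, of 1 j] by simp
      also have "l2_inner M f ((S ^^ j) (S f)) = l2_inner M ((S ^^ Suc j) f) f"
        using pow_sym[OF f f, of "Suc j"] by (simp add: funpow_swap1)
      also have "l2_inner M (S f) ((S ^^ j) (S f)) = l2_inner M ((S ^^ Suc (Suc j)) f) f"
        using pow_pow[OF f f, of 1 "Suc j"] by (simp add: funpow_swap1)
      finally show ?thesis by simp
    qed
    \<comment> \<open>In terms of moments, passing to \<open>f - S f\<close> is multiplication by
      \<open>(1 - x)^2\<close>, that is, a second difference.\<close>
    have md: "mdiff (\<lambda>j. a j - 2 * a (Suc j) + a (Suc (Suc j))) n k = mdiff a (Suc (Suc n)) k" for a n k
      by (induction n arbitrary: k) auto
    have "mdiff (\<lambda>j. Re (l2_inner M ((S ^^ j) f) f)) l k = mdiff (\<lambda>j. Re (l2_inner M ((S ^^ j) ?g) ?g)) n k"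
      unfolding m 3 using md[of "\<lambda>j. Re (l2_inner M ((S ^^ j) f) f)" n k] by (simp only:)
    then show ?thesis using less.IH[of n ?g] 3 g by simp
  qed
qed

text \<open>The \<open>v n\<close> generate mutually orthogonal cyclic spaces with the same moments
  \<open>c i\<close>, so one measure serves all copies. \<open>C\<close> undoes the scaling of the
  inverse: \<open>u = C S h\<close> stands for \<open>h = A u\<close> with an unbounded operator
  \<open>A\<close>.\<close>

theorem spectral_model:
  fixes v :: "nat \<Rightarrow> 'a \<Rightarrow> complex"
  assumes v: "\<And>n. v n \<in> L2 M"
    and gram: "\<And>i m n. l2_inner M ((S ^^ i) (v m)) (v n) = (if m = n then c i else 0)"
    and c0: "c 0 \<noteq> 0"
    and total: "\<And>f. f \<in> L2 M \<Longrightarrow> (\<And>i n. l2_inner M f ((S ^^ i) (v n)) = 0) \<Longrightarrow> l2_norm M f = 0"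
    and inj: "\<And>f. f \<in> L2 M \<Longrightarrow> l2_norm M (S f) = 0 \<Longrightarrow> l2_norm M f = 0"
    and C: "C > 0"
  shows "\<exists>\<mu> :: real measure. sets \<mu> = sets borel \<and> finite_measure \<mu> \<and>
     (\<exists>U. l2_unitary M (\<mu> \<Otimes>\<^sub>M count_space (UNIV :: nat set)) U \<and>
       (\<forall>u\<in>L2 M. \<forall>h\<in>L2 M. (AE x in M. u x = of_real C * S h x) \<longleftrightarrow>
         (U u, U h) \<in> multiplication_op (\<mu> \<Otimes>\<^sub>M count_space UNIV) (\<lambda>(s, n). complex_of_real s)))"
proof -
  \<comment> \<open>The moment theorem needs total mass 1; the factor \<open>sqrt r\<close> in
    \<open>y\<close> restores the norm of the \<open>v n\<close>.\<close>
  define r where "r = (l2_norm M (v 0))^2"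
  have c_r: "c 0 = of_real r" using gram[of 0 0 0] by (simp add: inner_self r_def)
  then have r: "r > 0" using c0 by (auto simp: r_def)
  have c_real: "c i = of_real (Re (c i))" for i using pow_real[OF v[of 0], of i] gram[of i 0 0] by simp
  define m where "m i = Re (c i) / r" for i
  have "mdiff (\<lambda>j. a j / r) l k = mdiff a l k / r" for a l k
    by (induction l arbitrary: k) (auto simp: diff_divide_distrib)
  then have "mdiff m l k \<ge> 0" for l k
    using mdiff_pow_nonneg[OF v[of 0], of l k] r by (simp add: m_def[abs_def] gram)
  moreover have "m 0 = 1" using r by (simp add: m_def c_r)
  ultimately obtain \<mu>0 where \<mu>0: "real_distribution \<mu>0" and unit: "AE x in \<mu>0. 0 \<le> x \<and> x \<le> 1"
    and mom: "\<And>j. (LINT x|\<mu>0. x ^ j) = m j"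
    using Hausdorff_moments by blast
  interpret \<mu>0: real_distribution \<mu>0 by fact
  \<comment> \<open>\<open>S\<close> is to become multiplication by \<open>\<phi> s\<close>. Because
    \<open>inverse 0 = 0\<close>, this is an involution of the whole line; the point 0 turns out to
    be null in \<open>null0\<close>.\<close>
  define \<phi> where "\<phi> s = inverse (C * s)" for s
  have \<phi>\<phi>: "\<phi> (\<phi> s) = s" for s using C by (simp add: \<phi>_def)
  have [measurable]: "\<phi> \<in> borel_measurable borel" unfolding \<phi>_def by measurable
  have \<phi>_m: "\<phi> \<in> measurable \<mu>0 borel" by measurable
  define \<mu> where "\<mu> = distr \<mu>0 borel \<phi>"
  have sets_\<mu>: "sets \<mu> = sets borel" by (simp add: \<mu>_def)
  have fin: "finite_measure \<mu>"
    using \<mu>0.prob_space_distr[OF \<phi>_m] unfolding \<mu>_def by (simp add: prob_space_def)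
  interpret \<mu>: finite_measure \<mu> by (fact fin)
  define \<Omega> where "\<Omega> = \<mu> \<Otimes>\<^sub>M count_space (UNIV :: nat set)"
  note sl = fin sets_\<mu> \<Omega>_def
  note [measurable_cong] = sets_\<mu>
  have \<phi>_\<mu>[measurable]: "\<phi> \<in> measurable \<mu> borel" by measurable
  note [measurable] = slice_measurable[OF sl] slice_set[OF sl]
  have fst_m[measurable]: "fst \<in> measurable \<Omega> borel" and snd_m[measurable]: "snd \<in> measurable \<Omega> (count_space UNIV)"
    unfolding \<Omega>_def measurable_cong_sets[OF refl sets_\<mu>, symmetric] by (rule measurable_fst, rule measurable_snd)
  have unit': "AE s in \<mu>. 0 \<le> \<phi> s \<and> \<phi> s \<le> 1"
    unfolding \<mu>_def by (subst AE_distr_iff[OF \<phi>_m]) (use unit in \<open>auto simp: \<phi>\<phi>\<close>)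
  have unit\<Omega>: "AE x in \<Omega>. 0 \<le> \<phi> (fst x) \<and> \<phi> (fst x) \<le> 1"
    by (rule AE_slices[OF sl]) (use unit' in auto)
  have mom': "(LINT s|\<mu>. \<phi> s ^ j) = m j" for j
    unfolding \<mu>_def by (subst integral_distr[OF \<phi>_m]) (auto simp: \<phi>\<phi> mom)
  have int': "integrable \<mu> (\<lambda>s. \<phi> s ^ j)" for j
  proof (rule \<mu>.integrable_const_bound[of _ 1])
    show "AE s in \<mu>. norm (\<phi> s ^ j) \<le> 1"
      using unit' by eventually_elim (auto intro!: power_le_one simp: power_abs)
  qed measurable
  define x where "x = (\<lambda>(i, n). (S ^^ i) (v n))"
  \<comment> \<open>The vector obtained from \<open>v n\<close> by applying \<open>S\<close>
    \<open>i\<close> times corresponds to \<open>sqrt r * \<phi>^i\<close> on the n-th copy.\<close>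
  define y where "y = (\<lambda>(i, n) (z :: real \<times> nat). indicat_real (UNIV \<times> {n}) z *\<^sub>R complex_of_real (sqrt r * \<phi> (fst z) ^ i))"
  have y_m[measurable]: "y p \<in> borel_measurable \<Omega>" for p
    unfolding y_def by (cases p) (simp, measurable)
  have yy: "y (i, m) z * cnj (y (j, n) z) =
     (if m = n then indicat_real (UNIV \<times> {n}) z *\<^sub>R complex_of_real (r * \<phi> (fst z) ^ (i + j)) else 0)" for i j m n z
  proof -
    have "complex_of_real (sqrt r * a) * complex_of_real (sqrt r * b) = complex_of_real (r * (a * b))" for a b
      unfolding of_real_mult[symmetric] using r by (simp add: mult_ac del: of_real_mult)
    then show ?thesis by (auto simp: y_def indicator_def power_add simp del: of_real_mult)
  qed
  have intr: "integrable \<mu> (\<lambda>s. complex_of_real (r * \<phi> s ^ j))" for j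
    using int' by (intro integrable_of_real integrable_mult_right) auto
  have yL: "y p \<in> L2 \<Omega>" for p
  proof (cases p)
    case (Pair i n)
    have "(\<lambda>z. (cmod (y p z))^2) = (\<lambda>z. indicat_real (UNIV \<times> {n}) z *\<^sub>R (r * \<phi> (fst z) ^ (i + i)))"
    proof
      fix z
      have "complex_of_real ((cmod (y p z))^2) = of_real (indicat_real (UNIV \<times> {n}) z *\<^sub>R (r * \<phi> (fst z) ^ (i + i)))"
        unfolding complex_norm_square Pair yy by (simp add: scaleR_conv_of_real)
      then show "(cmod (y p z))^2 = indicat_real (UNIV \<times> {n}) z *\<^sub>R (r * \<phi> (fst z) ^ (i + i))"
        by (simp only: of_real_eq_iff)
    qed
    moreover have "integrable \<Omega> (\<lambda>z. indicat_real (UNIV \<times> {n}) z *\<^sub>R (r * \<phi> (fst z) ^ (i + i)))"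
      by (subst slice_integrable_iff[OF sl]) (use int' in auto)
    ultimately show ?thesis by (intro L2_I y_m) simp
  qed
  have yG: "l2_inner \<Omega> (y (i, m)) (y (j, n)) = (if m = n then c (i + j) else 0)" for i j m n
  proof -
    have "l2_inner \<Omega> (y (i, m)) (y (j, n)) = (if m = n then (LINT s|\<mu>. complex_of_real (r * \<phi> s ^ (i + j))) else 0)"
      unfolding l2_inner_def yy using slice_integral[OF sl, of "\<lambda>z. complex_of_real (r * \<phi> (fst z) ^ (i + j))" n] by simp
    then show ?thesis using r c_real[of "i + j"]
      by (simp add: mom' m_def del: of_real_mult of_real_power)
  qed
  interpret eg: equal_gram M \<Omega> x y
  proof
    show "x p \<in> L2 M" for p by (cases p) (simp add: x_def pow_L2 v)
    show "y p \<in> L2 \<Omega>" for p by (rule yL)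
    show "l2_inner M (x p) (x q) = l2_inner \<Omega> (y p) (y q)" for p q
      by (cases p; cases q) (simp add: yG x_def pow_pow v gram)
  qed
  interpret op: equal_gram \<Omega> M y x by unfold_locales (auto simp: eg.x eg.y eg.gram)
  have totx: "l2_norm M f = 0" if "f \<in> L2 M" "\<And>p. l2_inner M f (x p) = 0" for f
    using total[OF that(1)] that(2) unfolding x_def by (metis case_prod_conv)
  \<comment> \<open>A function orthogonal to all \<open>y p\<close> has vanishing moments on every
    copy.\<close>
  have toty: "l2_norm \<Omega> f = 0" if f: "f \<in> L2 \<Omega>" and 0: "\<And>p. l2_inner \<Omega> f (y p) = 0" for f
  proof -
    have f_m[measurable]: "f \<in> borel_measurable \<Omega>" using f by (simp add: L2_def)
    have slice0: "AE s in \<mu>. f (s, n) = 0" for n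
    proof -
      have sq: "integrable \<mu> (\<lambda>s. (cmod (f (s, n)))^2)"
        using L2_integrable[OF f] by (subst slice_integrable_iff[OF sl, symmetric]) (auto intro!: integrable_mult_indicator simp del: real_scaleR_def)
      have gi: "integrable \<mu> (\<lambda>s. f (s, n))"
      proof (rule Bochner_Integration.integrable_bound)
        show "integrable \<mu> (\<lambda>s. 1 + (cmod (f (s, n)))^2)" using sq by auto
        have "a \<le> 1 + a\<^sup>2" for a :: real using sum_squares_bound[of 1 a] by (simp add: power2_eq_square) (use zero_le_square[of a] in linarith)
        then show "AE s in \<mu>. norm (f (s, n)) \<le> norm (1 + (cmod (f (s, n)))^2)" by auto
      qed measurable
      have "(LINT s|\<mu>. f (s, n) * of_real (\<phi> s ^ i)) = 0" for i
      proof -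
        have "l2_inner \<Omega> f (y (i, n)) = (LINT z|\<Omega>. indicat_real (UNIV \<times> {n}) z *\<^sub>R (f z * of_real (sqrt r * \<phi> (fst z) ^ i)))"
          unfolding l2_inner_def y_def by (intro Bochner_Integration.integral_cong) (auto simp: indicator_def)
        also have "\<dots> = (LINT s|\<mu>. f (s, n) * of_real (sqrt r * \<phi> s ^ i))"
          by (subst slice_integral[OF sl]) auto
        also have "\<dots> = of_real (sqrt r) * (LINT s|\<mu>. f (s, n) * of_real (\<phi> s ^ i))"
          by (subst integral_mult_right_zero[symmetric]) (simp add: mult_ac)
        finally show ?thesis using 0[of "(i, n)"] r by simp
      qed
      \<comment> \<open>The moments of the slice are transported from \<open>\<mu>\<close> to
        \<open>\<mu>0\<close>, because \<open>AE_zero_of_moments\<close> speaks of measures on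
        [0,1].\<close>
      then have mz: "(LINT x|\<mu>0. f (\<phi> x, n) * of_real (x ^ i)) = 0" for i
        unfolding \<mu>_def by (subst (asm) integral_distr[OF \<phi>_m]) (auto simp: \<phi>\<phi> \<mu>_def[symmetric])
      have gi0: "integrable \<mu>0 (\<lambda>x. f (\<phi> x, n))"
        using gi unfolding \<mu>_def by (subst (asm) integrable_distr_eq[OF \<phi>_m]) (auto simp: \<mu>_def[symmetric])
      have "AE x in \<mu>0. f (\<phi> x, n) = 0"
        by (rule AE_zero_of_moments[OF \<mu>0.finite_measure_axioms _ unit gi0 mz]) simp
      then show ?thesis unfolding \<mu>_def
        by (subst AE_distr_iff[OF \<phi>_m]) (auto simp: \<mu>_def[symmetric])
    qed
    have "AE z in \<Omega>. f z = 0" by (rule AE_slices[OF sl]) (use slice0 in auto)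
    then show ?thesis using l2_norm_eq_0_iff[OF f] by simp
  qed
  obtain U where U: "l2_unitary M \<Omega> U" and UG: "\<And>f. f \<in> L2 M \<Longrightarrow> l2_graph M \<Omega> x y f (U f)"
    using eg.unitary_exists[OF totx toty] by blast
  define X where "X g z = complex_of_real (\<phi> (fst z)) * g z" for g :: "real \<times> nat \<Rightarrow> complex" and z
  have X_le: "AE z in \<Omega>. (cmod (X g z))^2 \<le> (cmod (g z))^2" for g
    using unit\<Omega> by eventually_elim (auto simp: X_def norm_mult intro!: power_mono mult_left_le_one_le)
  have XL: "X g \<in> L2 \<Omega>" if g: "g \<in> L2 \<Omega>" for g
  proof (rule L2_I)
    have [measurable]: "g \<in> borel_measurable \<Omega>" using g by (simp add: L2_def)
    show "X g \<in> borel_measurable \<Omega>" unfolding X_def by measurable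
    then have [measurable]: "X g \<in> borel_measurable \<Omega>" .
    show "integrable \<Omega> (\<lambda>z. (cmod (X g z))^2)"
      by (rule Bochner_Integration.integrable_bound[OF L2_integrable[OF g]]) (use X_le[of g] in auto)
  qed
  have Xn: "l2_norm \<Omega> (X g) \<le> l2_norm \<Omega> g" if g: "g \<in> L2 \<Omega>" for g
    unfolding l2_norm_def
    by (intro real_sqrt_le_mono integral_mono_AE L2_integrable X_le g XL)
  have UX: "l2_graph M \<Omega> x y (S f) (X (U f))" if f: "f \<in> L2 M" for f
  proof (rule eg.graph_intertwine[where K=1 and T=S and X=X])
    show "l2_graph M \<Omega> x y f (U f)" by (rule UG[OF f])
    show "l2_norm M (\<lambda>w. S f w - S f' w) \<le> 1 * l2_norm M (\<lambda>w. f w - f' w)" if "f \<in> L2 M" "f' \<in> L2 M" for f f'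
      using S_diff[OF that] by simp
    show "l2_norm \<Omega> (\<lambda>w. X f w - X f' w) \<le> 1 * l2_norm \<Omega> (\<lambda>w. f w - f' w)" if "f \<in> L2 \<Omega>" "f' \<in> L2 \<Omega>" for f f'
      using Xn[OF L2_diff[OF that]] by (simp add: X_def[abs_def] right_diff_distrib)
    fix c :: "nat \<times> nat \<Rightarrow> complex" and F :: "(nat \<times> nat) set" assume F: "finite F"
    \<comment> \<open>Applying \<open>S\<close>, or multiplying by \<open>\<phi>\<close>, raises the
      exponent of every basis vector by one; \<open>c'\<close> transports the coefficients along
      this shift.\<close>
    define sh where "sh = (\<lambda>(i::nat, n::nat). (Suc i, n))"
    define c' where "c' = (\<lambda>(i, n). c (i - 1, n))"
    have inj: "inj_on sh F" by (auto simp: inj_on_def sh_def)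
    have 1: "lin_comb x c' (sh ` F) = lin_comb (\<lambda>i. S (x i)) c F"
      unfolding lin_comb_def sum.reindex[OF inj]
      by (rule ext, rule sum.cong) (auto simp: sh_def c'_def x_def)
    have 2: "X (lin_comb y c F) = lin_comb y c' (sh ` F)"
      unfolding lin_comb_def sum.reindex[OF inj] X_def sum_distrib_left
      by (rule ext, rule sum.cong) (auto simp: sh_def c'_def y_def)
    show "\<exists>c' F'. finite F' \<and> l2_norm M (\<lambda>w. S (lin_comb x c F) w - lin_comb x c' F' w) = 0 \<and>
        l2_norm \<Omega> (\<lambda>w. X (lin_comb y c F) w - lin_comb y c' F' w) = 0"
      by (rule exI[of _ c'], rule exI[of _ "sh ` F"]) (use F S_lin_comb[of x c F, OF eg.x] in \<open>simp add: 1 2\<close>)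
  qed (auto intro: S_L2 XL)
  \<comment> \<open>An atom at 0 would be annihilated by multiplication with \<open>\<phi>\<close>;
    its preimage would be a nonzero function annihilated by \<open>S\<close>, against
    \<open>inj\<close>.\<close>
  have null0: "AE z in \<Omega>. fst z \<noteq> 0"
  proof -
    have "AE s in \<mu>. s \<noteq> 0"
    proof -
      define e where "e z = indicat_real (UNIV \<times> {0::nat}) z *\<^sub>R complex_of_real (indicat_real {0} (fst z))" for z :: "real \<times> nat"
      have e_m[measurable]: "e \<in> borel_measurable \<Omega>" unfolding e_def by measurable
      have e2: "(\<lambda>z. (cmod (e z))^2) = (\<lambda>z. indicat_real (UNIV \<times> {0::nat}) z *\<^sub>R indicat_real {0} (fst z))"
        by (auto simp: e_def indicator_def)
      have eL: "e \<in> L2 \<Omega>"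
      proof (rule L2_I[OF e_m])
        show "integrable \<Omega> (\<lambda>z. (cmod (e z))^2)" unfolding e2
          by (subst slice_integrable_iff[OF sl]) (auto intro!: \<mu>.integrable_const_bound[of _ 1])
      qed
      obtain w where w: "w \<in> L2 M" and Uw: "AE z in \<Omega>. U w z = e z"
        using U eL unfolding l2_unitary_def by blast
      have "AE z in \<Omega>. X (U w) z = 0"
        using Uw by eventually_elim (auto simp: X_def e_def \<phi>_def indicator_def)
      then have "l2_norm \<Omega> (X (U w)) = 0"
        using UX[OF w] by (subst l2_norm_eq_0_iff) (auto simp: l2_graph_def)
      then have "l2_norm M (S w) = 0" using eg.graph_norm[OF UX[OF w]] by simp
      then have "l2_norm M w = 0" by (rule inj[OF w])
      then have "l2_norm \<Omega> (U w) = 0" using eg.graph_norm[OF UG[OF w]] by simp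
      then have "AE z in \<Omega>. U w z = 0" using UG[OF w] by (subst (asm) l2_norm_eq_0_iff) (auto simp: l2_graph_def)
      then have "AE z in \<Omega>. e z = 0" using Uw by eventually_elim simp
      then have "l2_norm \<Omega> e = 0" using l2_norm_eq_0_iff[OF eL] by simp
      then have "(LINT z|\<Omega>. (cmod (e z))^2) = 0" by (simp add: l2_norm_def)
      then have "(LINT s|\<mu>. indicat_real {0} s) = 0"
        unfolding e2 by (subst (asm) slice_integral[OF sl]) auto
      then have "measure \<mu> {0} = 0" by (simp add: space_slices[OF sl])
      then have "{0} \<in> null_sets \<mu>" using \<mu>.emeasure_eq_measure[of "{0}"] by (auto simp: sets_\<mu> null_sets_def)
      then show ?thesis by (rule AE_I') (auto)
    qed
    then show ?thesis by (intro AE_slices[OF sl]) auto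
  qed
  have key: "(AE w in M. u w = of_real C * S h w) \<longleftrightarrow> (U u, U h) \<in> multiplication_op \<Omega> (\<lambda>(s, n). complex_of_real s)"
    if u: "u \<in> L2 M" and h: "h \<in> L2 M" for u h
  proof -
    have G: "l2_graph M \<Omega> x y (\<lambda>w. of_real C * S h w) (\<lambda>z. of_real C * X (U h) z)"
      by (rule eg.graph_scale[OF UX[OF h]])
    have L: "U u \<in> L2 \<Omega>" "U h \<in> L2 \<Omega>" using UG[OF u] UG[OF h] by (auto simp: l2_graph_def)
    have "(AE w in M. u w = of_real C * S h w) \<longleftrightarrow> (AE z in \<Omega>. U u z = of_real C * X (U h) z)"
    proof
      assume "AE w in M. u w = of_real C * S h w"
      then show "AE z in \<Omega>. U u z = of_real C * X (U h) z" by (rule eg.graph_unique[OF UG[OF u] G])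
    next
      assume "AE z in \<Omega>. U u z = of_real C * X (U h) z"
      then show "AE w in M. u w = of_real C * S h w"
        using UG[OF u] G by (intro op.graph_unique[of "U u" u "\<lambda>z. of_real C * X (U h) z"]) (auto simp: l2_graph_sym[of \<Omega>])
    qed
    also have "\<dots> \<longleftrightarrow> (AE z in \<Omega>. U h z = of_real (fst z) * U u z)"
    proof -
      have "AE z in \<Omega>. U u z = of_real C * X (U h) z \<longleftrightarrow> U h z = of_real (fst z) * U u z"
        using null0 by eventually_elim (use C in \<open>auto simp: X_def \<phi>_def field_simps\<close>)
      then show ?thesis by (auto elim: eventually_elim2)
    qed
    finally show ?thesis using L by (simp add: multiplication_op_def case_prod_beta)
  qed
  show ?thesis
    using sets_\<mu> fin U key unfolding \<Omega>_def by blast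
qed

end

section \<open>Absolutely continuous functions on the unit interval\<close>

abbreviation unit_norm :: "(real \<Rightarrow> complex) \<Rightarrow> real" where
  "unit_norm \<equiv> l2_norm unit_lebesgue"

abbreviation square_summable :: "(nat \<Rightarrow> real \<Rightarrow> complex) \<Rightarrow> bool" where
  "square_summable \<phi> \<equiv> summable (\<lambda>k. (unit_norm (\<phi> k))^2)"

lemma unit_prob: "prob_space unit_lebesgue"
  by (rule prob_space_restrict_space) auto

interpretation U: prob_space unit_lebesgue by (rule unit_prob)

lemma space_unit [simp]: "space unit_lebesgue = {0<..<1}"
  by (simp add: space_restrict_space)

lemma unit_measurable [measurable (raw)]:
  "f \<in> borel_measurable borel \<Longrightarrow> f \<in> borel_measurable unit_lebesgue"
  by (rule measurable_restrict_space1) simp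

lemma unit_integral: "(LINT t|unit_lebesgue. f t) = (LINT t:{0<..<1}|lborel. f t)"
  for f :: "real \<Rightarrow> 'b :: {banach, second_countable_topology}"
  unfolding set_lebesgue_integral_def by (rule integral_restrict_space) simp

lemma unit_integrable_iff: "integrable unit_lebesgue f \<longleftrightarrow> set_integrable lborel {0<..<1} f"
  for f :: "real \<Rightarrow> 'b :: {banach, second_countable_topology}"
  unfolding set_integrable_def by (rule integrable_restrict_space) simp

lemma AE_unit_iff: "(AE t in unit_lebesgue. P t) \<longleftrightarrow> (AE t in lborel. t \<in> {0<..<1} \<longrightarrow> P t)"
  by (rule AE_restrict_space_iff) simp

lemma AE_unit_neq: "AE t in unit_lebesgue. t \<noteq> a"
  unfolding AE_unit_iff by (rule AE_mp[OF AE_lborel_singleton[of a]]) auto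

lemma AE_unit_in: "AE t in unit_lebesgue. 0 < t \<and> t < 1"
  using AE_space[of unit_lebesgue] by simp

lemma set_integral_HK:
  fixes f :: "real \<Rightarrow> complex"
  assumes "continuous_on {a..b} f"
  shows "(LINT t:{a..b}|lborel. f t) = integral {a..b} f"
  using borel_integrable_atLeastAtMost'[OF assms] by (rule set_borel_integral_eq_integral(2))

lemma unit_continuous_integrable:
  fixes f :: "real \<Rightarrow> complex"
  assumes "continuous_on {0..1} f" shows "integrable unit_lebesgue f"
  unfolding unit_integrable_iff
  by (rule set_integrable_subset[OF borel_integrable_atLeastAtMost'[OF assms]]) auto

lemma unit_integral_upto:
  fixes f :: "real \<Rightarrow> complex"
  assumes t: "t \<in> {0..1}" and f: "continuous_on {0..1} f"
  shows "(LINT s|unit_lebesgue. indicat_real {..t} s *\<^sub>R f s) = (LINT s:{0..t}|lborel. f s)"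
  unfolding unit_integral set_lebesgue_integral_def
proof (rule integral_cong_AE)
  have m: "set_integrable lborel A f" if "A \<in> sets borel" "A \<subseteq> {0..1}" for A
    using that by (intro set_integrable_subset[OF borel_integrable_atLeastAtMost'[OF f]]) auto
  have eq: "(\<lambda>s. indicat_real {0<..<1} s *\<^sub>R indicat_real {..t} s *\<^sub>R f s) = (\<lambda>s. indicat_real ({0<..<1} \<inter> {..t}) s *\<^sub>R f s)"
    by (auto simp: indicator_def)
  show "(\<lambda>s. indicat_real {0<..<1} s *\<^sub>R indicat_real {..t} s *\<^sub>R f s) \<in> borel_measurable lborel"
    unfolding eq by (rule borel_measurable_integrable, fold set_integrable_def, rule m) auto
  show "(\<lambda>s. indicat_real {0..t} s *\<^sub>R f s) \<in> borel_measurable lborel"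
    by (rule borel_measurable_integrable, fold set_integrable_def, rule m) (use t in auto)
  show "AE s in lborel. indicat_real {0<..<1} s *\<^sub>R indicat_real {..t} s *\<^sub>R f s = indicat_real {0..t} s *\<^sub>R f s"
    using AE_lborel_singleton[of 0] AE_lborel_singleton[of 1]
    by eventually_elim (use t in \<open>auto simp: indicator_def\<close>)
qed

text \<open>\<open>F\<close> is absolutely continuous on [0,1] with derivative \<open>p\<close>. The
  values of \<open>F\<close> at 0 and 1 are honest values, while \<open>p\<close> matters only
  almost everywhere; \<open>unit_lebesgue\<close> cuts \<open>{..t}\<close> down to its part in
  (0,1).\<close>

definition primitive :: "(real \<Rightarrow> complex) \<Rightarrow> (real \<Rightarrow> complex) \<Rightarrow> bool" where
  "primitive F p \<longleftrightarrow> integrable unit_lebesgue p \<and>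
     (\<forall>t\<in>{0..1}. F t = F 0 + (LINT s|unit_lebesgue. indicat_real {..t} s *\<^sub>R p s))"

lemma primitiveI:
  assumes "integrable unit_lebesgue p"
    and "\<And>t. t \<in> {0..1} \<Longrightarrow> F t = F 0 + (LINT s|unit_lebesgue. indicat_real {..t} s *\<^sub>R p s)"
  shows "primitive F p"
  using assms unfolding primitive_def by blast

lemma primitive_integrable: "primitive F p \<Longrightarrow> integrable unit_lebesgue p"
  unfolding primitive_def by blast

lemma primitiveD:
  "primitive F p \<Longrightarrow> t \<in> {0..1} \<Longrightarrow> F t = F 0 + (LINT s|unit_lebesgue. indicat_real {..t} s *\<^sub>R p s)"
  unfolding primitive_def by blast

lemma indicator_integrable:
  fixes p :: "real \<Rightarrow> complex"
  assumes "integrable unit_lebesgue p" "A \<in> sets borel"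
  shows "integrable unit_lebesgue (\<lambda>s. indicat_real A s *\<^sub>R p s)"
proof -
  have "integrable unit_lebesgue (\<lambda>s. indicat_real (A \<inter> {0<..<1}) s *\<^sub>R p s)"
    using assms by (intro integrable_mult_indicator) (auto simp: sets_restrict_space)
  also have "?this \<longleftrightarrow> ?thesis" by (intro Bochner_Integration.integrable_cong) (auto simp: indicator_def)
  finally show ?thesis .
qed

lemma primitive_C1:
  fixes F p :: "real \<Rightarrow> complex"
  assumes der: "\<And>t. t \<in> {0..1} \<Longrightarrow> (F has_vector_derivative p t) (at t within {0..1})"
    and cont: "continuous_on {0..1} p"
  shows "primitive F p"
proof (rule primitiveI[OF unit_continuous_integrable[OF cont]])
  fix t :: real assume t: "t \<in> {0..1}"
  have "(p has_integral F t - F 0) {0..t}"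
    using t by (intro fundamental_theorem_of_calculus) (auto intro: has_vector_derivative_within_subset[OF der])
  then have "integral {0..t} p = F t - F 0" by (rule integral_unique)
  moreover have "continuous_on {0..t} p" using cont by (rule continuous_on_subset) (use t in auto)
  ultimately show "F t = F 0 + (LINT s|unit_lebesgue. indicat_real {..t} s *\<^sub>R p s)"
    unfolding unit_integral_upto[OF t cont] by (simp add: set_integral_HK)
qed

lemma primitive_const: "primitive (\<lambda>_. c) (\<lambda>_. 0)"
  by (rule primitiveI) simp_all

lemma primitive_add:
  assumes "primitive F p" "primitive G q"
  shows "primitive (\<lambda>t. F t + G t) (\<lambda>t. p t + q t)"
proof (rule primitiveI)
  show "integrable unit_lebesgue (\<lambda>t. p t + q t)" using assms by (auto dest: primitive_integrable)
  fix t :: real assume t: "t \<in> {0..1}"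
  have "(LINT s|unit_lebesgue. indicat_real {..t} s *\<^sub>R (p s + q s))
      = (LINT s|unit_lebesgue. indicat_real {..t} s *\<^sub>R p s) + (LINT s|unit_lebesgue. indicat_real {..t} s *\<^sub>R q s)"
    unfolding scaleR_add_right
    by (intro Bochner_Integration.integral_add indicator_integrable) (use assms in \<open>auto dest: primitive_integrable\<close>)
  then show "F t + G t = F 0 + G 0 + (LINT s|unit_lebesgue. indicat_real {..t} s *\<^sub>R (p s + q s))"
    using primitiveD[OF assms(1) t] primitiveD[OF assms(2) t] by (simp only: add_ac)
qed

lemma primitive_scale:
  assumes "primitive F p"
  shows "primitive (\<lambda>t. c * F t) (\<lambda>t. c * p t)"
proof (rule primitiveI)
  show "integrable unit_lebesgue (\<lambda>t. c * p t)" using assms by (auto dest: primitive_integrable)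
  fix t :: real assume t: "t \<in> {0..1}"
  have "(LINT s|unit_lebesgue. indicat_real {..t} s *\<^sub>R (c * p s)) = c * (LINT s|unit_lebesgue. indicat_real {..t} s *\<^sub>R p s)"
    by (simp flip: integral_mult_right_zero)
  then show "c * F t = c * F 0 + (LINT s|unit_lebesgue. indicat_real {..t} s *\<^sub>R (c * p s))"
    by (subst primitiveD[OF assms t]) (simp only: distrib_left)
qed

lemma primitive_diff:
  assumes "primitive F p" "primitive G q"
  shows "primitive (\<lambda>t. F t - G t) (\<lambda>t. p t - q t)"
  using primitive_add[OF assms(1) primitive_scale[OF assms(2), of "-1"]] by simp

lemma primitive_sum:
  assumes "\<And>i. i \<in> I \<Longrightarrow> primitive (F i) (p i)"
  shows "primitive (\<lambda>t. \<Sum>i\<in>I. c i * F i t) (\<lambda>t. \<Sum>i\<in>I. c i * p i t)"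
  using assms
  by (induction I rule: infinite_finite_induct) (auto intro!: primitive_const primitive_add primitive_scale)

lemma primitive_cnj:
  assumes "primitive F p"
  shows "primitive (\<lambda>t. cnj (F t)) (\<lambda>t. cnj (p t))"
proof (rule primitiveI)
  show "integrable unit_lebesgue (\<lambda>t. cnj (p t))" using assms by (auto dest: primitive_integrable)
  fix t :: real assume t: "t \<in> {0..1}"
  have "(LINT s|unit_lebesgue. indicat_real {..t} s *\<^sub>R cnj (p s)) = cnj (LINT s|unit_lebesgue. indicat_real {..t} s *\<^sub>R p s)"
    by (simp flip: Bochner_Integration.integral_cnj)
  then show "cnj (F t) = cnj (F 0) + (LINT s|unit_lebesgue. indicat_real {..t} s *\<^sub>R cnj (p s))"
    by (subst primitiveD[OF assms t]) (simp only: complex_cnj_add)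
qed

text \<open>Dominated convergence: the indicators converge except at the single point
  \<open>a\<close>.\<close>

lemma upto_continuous:
  fixes p :: "real \<Rightarrow> complex"
  assumes p: "integrable unit_lebesgue p"
  shows "continuous_on S (\<lambda>t. LINT s|unit_lebesgue. indicat_real {..t} s *\<^sub>R p s)"
  unfolding continuous_on_sequentially
proof (intro allI ballI impI, elim conjE)
  fix x :: "nat \<Rightarrow> real" and a assume x: "x \<longlonglongrightarrow> a"
  show "((\<lambda>t. LINT s|unit_lebesgue. indicat_real {..t} s *\<^sub>R p s) \<circ> x) \<longlonglongrightarrow> (LINT s|unit_lebesgue. indicat_real {..a} s *\<^sub>R p s)"
    unfolding o_def
  proof (rule integral_dominated_convergence[where w="\<lambda>s. norm (p s)"])
    show "AE s in unit_lebesgue. (\<lambda>n. indicat_real {..x n} s *\<^sub>R p s) \<longlonglongrightarrow> indicat_real {..a} s *\<^sub>R p s"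
      using AE_unit_neq[of a]
    proof eventually_elim
      case (elim s)
      have "\<forall>\<^sub>F n in sequentially. indicat_real {..x n} s = indicat_real {..a} s"
      proof (cases "s < a")
        case True
        then have "\<forall>\<^sub>F n in sequentially. s < x n" using x by (intro order_tendstoD(1))
        then show ?thesis by eventually_elim (use True in auto)
      next
        case False
        then have "\<forall>\<^sub>F n in sequentially. x n < s" using x elim by (intro order_tendstoD(2)) auto
        then show ?thesis by eventually_elim (use False elim in auto)
      qed
      then show ?case by (intro tendsto_eventually) (auto elim: eventually_mono)
    qed
  qed (use p indicator_integrable[OF p] in \<open>auto simp: indicator_def dest!: borel_measurable_integrable\<close>)
qed

lemma primitive_continuous:
  assumes "primitive F p" shows "continuous_on {0..1} F"
proof -
  have "continuous_on {0..1} (\<lambda>t. F 0 + (LINT s|unit_lebesgue. indicat_real {..t} s *\<^sub>R p s))"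
    using assms by (intro continuous_intros upto_continuous) (rule primitive_integrable)
  also have "?this \<longleftrightarrow> ?thesis"
    by (rule continuous_on_cong) (simp_all only: primitiveD[OF assms, symmetric])
  finally show ?thesis .
qed

lemma continuous_unit_measurable:
  fixes F :: "real \<Rightarrow> complex"
  assumes "continuous_on {0..1} F" shows "F \<in> borel_measurable unit_lebesgue"
  using unit_continuous_integrable[OF assms] by simp

lemma continuous_unit_bounded:
  fixes F :: "real \<Rightarrow> complex"
  assumes "continuous_on {0..1} F" shows "\<exists>B\<ge>0. \<forall>t\<in>{0..1}. cmod (F t) \<le> B"
proof -
  have "bounded (F ` {0..1})" by (intro compact_imp_bounded compact_continuous_image assms) simp
  then obtain B where B: "\<forall>y\<in>F ` {0..1}. norm y \<le> B" unfolding bounded_iff by blast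
  then have "norm (F 0) \<le> B" by simp
  then have "B \<ge> 0" using norm_ge_zero order_trans by blast
  then show ?thesis using B by blast
qed

lemma continuous_unit_L2:
  fixes F :: "real \<Rightarrow> complex"
  assumes "continuous_on {0..1} F" shows "F \<in> L2 unit_lebesgue"
proof (rule L2_I[OF continuous_unit_measurable[OF assms]])
  have "integrable unit_lebesgue (\<lambda>t. F t * cnj (F t))"
    by (intro unit_continuous_integrable continuous_intros assms)
  then have "integrable unit_lebesgue (\<lambda>t. Re (F t * cnj (F t)))" by (rule integrable_Re)
  then show "integrable unit_lebesgue (\<lambda>t. (cmod (F t))^2)"
    by (simp only: complex_norm_square[symmetric] Re_complex_of_real)
qed

lemma L2_unit_integrable:
  assumes "f \<in> L2 unit_lebesgue" shows "integrable unit_lebesgue f"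
  using L2_mult_integrable[OF assms, of "\<lambda>_. 1"] by (simp add: L2_def)

lemma mult_continuous_integrable:
  fixes F p :: "real \<Rightarrow> complex"
  assumes F: "continuous_on {0..1} F" and p: "integrable unit_lebesgue p"
  shows "integrable unit_lebesgue (\<lambda>t. F t * p t)"
proof -
  obtain B where B: "B \<ge> 0" "\<forall>t\<in>{0..1}. cmod (F t) \<le> B" using continuous_unit_bounded[OF F] by blast
  note [measurable] = continuous_unit_measurable[OF F] borel_measurable_integrable[OF p]
  show ?thesis
  proof (rule Bochner_Integration.integrable_bound)
    show "integrable unit_lebesgue (\<lambda>t. B * norm (p t))" using p by auto
    show "AE t in unit_lebesgue. norm (F t * p t) \<le> norm (B * norm (p t))"
      using AE_unit_in by eventually_elim (use B in \<open>auto simp: norm_mult intro!: mult_right_mono\<close>)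
  qed measurable
qed

text \<open>Integration by parts: split the square \<open>[0,t]\<^sup>2\<close> along the diagonal and use Fubini.\<close>

lemma upto_mult:
  fixes p q :: "real \<Rightarrow> complex"
  assumes p: "integrable unit_lebesgue p" and q: "integrable unit_lebesgue q"
  defines "P t \<equiv> LINT s|unit_lebesgue. indicat_real {..t} s *\<^sub>R p s"
    and "Q t \<equiv> LINT s|unit_lebesgue. indicat_real {..t} s *\<^sub>R q s"
  shows "P t * Q t = (LINT s|unit_lebesgue. indicat_real {..t} s *\<^sub>R (p s * Q s))
     + (LINT s|unit_lebesgue. indicat_real {..t} s *\<^sub>R (P s * q s))"
proof -
  interpret pair_sigma_finite unit_lebesgue unit_lebesgue
    by (intro pair_sigma_finite.intro U.sigma_finite_measure_axioms)
  note [measurable] = borel_measurable_integrable[OF p] borel_measurable_integrable[OF q]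
  have idm[measurable]: "(\<lambda>s. s) \<in> borel_measurable unit_lebesgue" by (rule unit_measurable) simp
  \<comment> \<open>The kernel lives on the triangle \<open>s < r <= t\<close>; integrating over
    \<open>r\<close> first gives \<open>p (Q t - Q s)\<close>, over \<open>s\<close> first
    \<open>P q\<close>.\<close>
  define K where "K s r = (if s < r \<and> r \<le> t then p s * q r else 0)" for s r
  have [measurable]: "(\<lambda>(s, r). K s r) \<in> borel_measurable (unit_lebesgue \<Otimes>\<^sub>M unit_lebesgue)"
    unfolding K_def by measurable
  have Qc: "continuous_on {0..1} Q" and Pc: "continuous_on {0..1} P"
    unfolding Q_def P_def by (intro upto_continuous p q)+
  have KI: "integrable unit_lebesgue (K s)" for s
  proof -
    have "K s = (\<lambda>r. indicat_real {s<..t} r *\<^sub>R (p s * q r))" by (auto simp: K_def indicator_def)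
    then show ?thesis using q by (auto intro!: indicator_integrable)
  qed
  have "integrable (unit_lebesgue \<Otimes>\<^sub>M unit_lebesgue) (\<lambda>(s, r). K s r)"
  proof (rule Fubini_integrable)
    show "AE s in unit_lebesgue. integrable unit_lebesgue (\<lambda>r. case (s, r) of (s, r) \<Rightarrow> K s r)" using KI by simp
    show "integrable unit_lebesgue (\<lambda>s. LINT r|unit_lebesgue. norm (case (s, r) of (s, r) \<Rightarrow> K s r))"
    proof (rule Bochner_Integration.integrable_bound)
      show "integrable unit_lebesgue (\<lambda>s. norm (p s) * (LINT r|unit_lebesgue. norm (q r)))" using p by auto
      show "AE s in unit_lebesgue. norm (LINT r|unit_lebesgue. norm (case (s, r) of (s, r) \<Rightarrow> K s r))
         \<le> norm (norm (p s) * (LINT r|unit_lebesgue. norm (q r)))"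
      proof (rule AE_I2)
        fix s
        have "(LINT r|unit_lebesgue. norm (K s r)) \<le> (LINT r|unit_lebesgue. norm (p s) * norm (q r))"
          using q by (intro integral_mono integrable_norm[OF KI]) (auto simp: K_def norm_mult)
        then show "norm (LINT r|unit_lebesgue. norm (case (s, r) of (s, r) \<Rightarrow> K s r))
         \<le> norm (norm (p s) * (LINT r|unit_lebesgue. norm (q r)))" by simp
      qed
    qed measurable
  qed measurable
  then have swap: "(LINT s|unit_lebesgue. LINT r|unit_lebesgue. K s r) = (LINT r|unit_lebesgue. LINT s|unit_lebesgue. K s r)"
    by (rule Fubini_integral[symmetric])
  have inner1: "(LINT r|unit_lebesgue. K s r) = indicat_real {..t} s *\<^sub>R (p s * (Q t - Q s))" for s
  proof (cases "s \<le> t")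
    case True
    have "Q t - Q s = (LINT r|unit_lebesgue. indicat_real {..t} r *\<^sub>R q r - indicat_real {..s} r *\<^sub>R q r)"
      unfolding Q_def using indicator_integrable[OF q] by simp
    also have "\<dots> = (LINT r|unit_lebesgue. indicat_real {s<..t} r *\<^sub>R q r)"
      by (intro Bochner_Integration.integral_cong) (use True in \<open>auto simp: indicator_def\<close>)
    finally have "p s * (Q t - Q s) = (LINT r|unit_lebesgue. p s * (indicat_real {s<..t} r *\<^sub>R q r))"
      by (simp only: integral_mult_right_zero)
    also have "\<dots> = (LINT r|unit_lebesgue. K s r)"
      by (intro Bochner_Integration.integral_cong) (auto simp: K_def indicator_def)
    finally show ?thesis using True by simp
  next
    case False
    then have "K s = (\<lambda>r. 0)" by (intro ext) (auto simp: K_def)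
    then show ?thesis using False by simp
  qed
  have inner2: "(LINT s|unit_lebesgue. K s r) = indicat_real {..t} r *\<^sub>R (P r * q r)" for r
  proof -
    have "(LINT s|unit_lebesgue. K s r) = (LINT s|unit_lebesgue. (indicat_real {..r} s *\<^sub>R p s) * (indicat_real {..t} r *\<^sub>R q r))"
    proof (rule integral_cong_AE)
      show "AE s in unit_lebesgue. K s r = (indicat_real {..r} s *\<^sub>R p s) * (indicat_real {..t} r *\<^sub>R q r)"
        using AE_unit_neq[of r] by eventually_elim (auto simp: K_def indicator_def)
    qed (unfold K_def, measurable)
    also have "\<dots> = P r * (indicat_real {..t} r *\<^sub>R q r)"
      unfolding P_def by (rule integral_mult_left_zero)
    finally show ?thesis by simp
  qed
  have int1: "integrable unit_lebesgue (\<lambda>s. indicat_real {..t} s *\<^sub>R (p s * Q t))"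
    using p by (auto intro!: indicator_integrable)
  have int2: "integrable unit_lebesgue (\<lambda>s. indicat_real {..t} s *\<^sub>R (p s * Q s))"
    using mult_continuous_integrable[OF Qc p] by (auto intro!: indicator_integrable simp: mult.commute)
  have "P t * Q t = (LINT s|unit_lebesgue. indicat_real {..t} s *\<^sub>R (p s * Q t))"
    unfolding P_def by (simp flip: integral_mult_left_zero)
  also have "\<dots> = (LINT s|unit_lebesgue. indicat_real {..t} s *\<^sub>R (p s * Q s) + indicat_real {..t} s *\<^sub>R (p s * (Q t - Q s)))"
    by (intro Bochner_Integration.integral_cong) (auto simp: algebra_simps)
  also have "\<dots> = (LINT s|unit_lebesgue. indicat_real {..t} s *\<^sub>R (p s * Q s)) + (LINT s|unit_lebesgue. indicat_real {..t} s *\<^sub>R (p s * (Q t - Q s)))"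
  proof (rule Bochner_Integration.integral_add[OF int2])
    show "integrable unit_lebesgue (\<lambda>s. indicat_real {..t} s *\<^sub>R (p s * (Q t - Q s)))"
      using Bochner_Integration.integrable_diff[OF int1 int2] by (simp add: algebra_simps)
  qed
  also have "(LINT s|unit_lebesgue. indicat_real {..t} s *\<^sub>R (p s * (Q t - Q s))) = (LINT s|unit_lebesgue. indicat_real {..t} s *\<^sub>R (P s * q s))"
    using swap unfolding inner1 inner2 .
  finally show ?thesis .
qed

text \<open>Writing \<open>F = F 0 + P\<close> and \<open>G = G 0 + Q\<close> reduces the product
  rule to \<open>upto_mult\<close>.\<close>

lemma primitive_mult:
  assumes F: "primitive F p" and G: "primitive G q"
  shows "primitive (\<lambda>t. F t * G t) (\<lambda>t. p t * G t + F t * q t)"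
proof (rule primitiveI)
  have p: "integrable unit_lebesgue p" and q: "integrable unit_lebesgue q" using F G by (auto dest: primitive_integrable)
  note Fc = primitive_continuous[OF F] and Gc = primitive_continuous[OF G]
  have pG: "integrable unit_lebesgue (\<lambda>t. p t * G t)" using mult_continuous_integrable[OF Gc p] by (simp add: mult.commute)
  have Fq: "integrable unit_lebesgue (\<lambda>t. F t * q t)" by (rule mult_continuous_integrable[OF Fc q])
  show "integrable unit_lebesgue (\<lambda>t. p t * G t + F t * q t)" using pG Fq by simp
  define P where "P t = (LINT s|unit_lebesgue. indicat_real {..t} s *\<^sub>R p s)" for t
  define Q where "Q t = (LINT s|unit_lebesgue. indicat_real {..t} s *\<^sub>R q s)" for t
  have FP: "F t = F 0 + P t" and GQ: "G t = G 0 + Q t" if "t \<in> {0..1}" for t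
    unfolding P_def Q_def by (rule primitiveD[OF F that], rule primitiveD[OF G that])
  have Pc: "continuous_on {0..1} P" and Qc: "continuous_on {0..1} Q"
    unfolding Q_def P_def by (intro upto_continuous p q)+
  have pQ: "integrable unit_lebesgue (\<lambda>t. p t * Q t)" using mult_continuous_integrable[OF Qc p] by (simp add: mult.commute)
  have Pq: "integrable unit_lebesgue (\<lambda>t. P t * q t)" by (rule mult_continuous_integrable[OF Pc q])
  fix t :: real assume t: "t \<in> {0..1}"
  have "(LINT s|unit_lebesgue. indicat_real {..t} s *\<^sub>R (p s * G s + F s * q s))
     = (LINT s|unit_lebesgue. (G 0 * (indicat_real {..t} s *\<^sub>R p s) + F 0 * (indicat_real {..t} s *\<^sub>R q s))
         + (indicat_real {..t} s *\<^sub>R (p s * Q s) + indicat_real {..t} s *\<^sub>R (P s * q s)))"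
  proof (rule Bochner_Integration.integral_cong[OF refl])
    fix s assume "s \<in> space unit_lebesgue"
    then have s: "s \<in> {0..1}" by simp
    have "p s * G s + F s * q s = G 0 * p s + F 0 * q s + (p s * Q s + P s * q s)"
      by (subst FP[OF s], subst GQ[OF s]) (simp only: algebra_simps)
    then show "indicat_real {..t} s *\<^sub>R (p s * G s + F s * q s)
      = (G 0 * (indicat_real {..t} s *\<^sub>R p s) + F 0 * (indicat_real {..t} s *\<^sub>R q s))
         + (indicat_real {..t} s *\<^sub>R (p s * Q s) + indicat_real {..t} s *\<^sub>R (P s * q s))"
      by (simp add: indicator_def)
  qed
  also have "\<dots> = (G 0 * P t + F 0 * Q t) + P t * Q t"
  proof -
    have I: "integrable unit_lebesgue (\<lambda>s. indicat_real {..t} s *\<^sub>R p s)"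
      "integrable unit_lebesgue (\<lambda>s. indicat_real {..t} s *\<^sub>R q s)"
      "integrable unit_lebesgue (\<lambda>s. indicat_real {..t} s *\<^sub>R (p s * Q s))"
      "integrable unit_lebesgue (\<lambda>s. indicat_real {..t} s *\<^sub>R (P s * q s))"
      by (auto intro: indicator_integrable p q pQ Pq)
    have I': "integrable unit_lebesgue (\<lambda>s. G 0 * (indicat_real {..t} s *\<^sub>R p s))"
      "integrable unit_lebesgue (\<lambda>s. F 0 * (indicat_real {..t} s *\<^sub>R q s))"
      by (intro integrable_mult_right I)+
    note J = Bochner_Integration.integral_add[OF Bochner_Integration.integrable_add[OF I'] Bochner_Integration.integrable_add[OF I(3,4)]]
      Bochner_Integration.integral_add[OF I'] Bochner_Integration.integral_add[OF I(3,4)]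
    have "P t * Q t = (LINT s|unit_lebesgue. indicat_real {..t} s *\<^sub>R (p s * Q s))
        + (LINT s|unit_lebesgue. indicat_real {..t} s *\<^sub>R (P s * q s))"
      unfolding P_def Q_def by (rule upto_mult[OF p q])
    then show ?thesis unfolding J integral_mult_right_zero by (simp only: P_def Q_def)
  qed
  finally show "F t * G t = F 0 * G 0 + (LINT s|unit_lebesgue. indicat_real {..t} s *\<^sub>R (p s * G s + F s * q s))"
    using FP[OF t] GQ[OF t] by (simp add: algebra_simps)
qed

lemma primitive_total:
  assumes "primitive F p" shows "(LINT s|unit_lebesgue. p s) = F 1 - F 0"
proof -
  have "(LINT s|unit_lebesgue. indicat_real {..1} s *\<^sub>R p s) = (LINT s|unit_lebesgue. p s)"
    by (intro Bochner_Integration.integral_cong) auto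
  then show ?thesis using primitiveD[OF assms, of 1] by simp
qed

lemma integration_by_parts_unit:
  assumes F: "primitive F p" and G: "primitive G q"
  shows "(LINT s|unit_lebesgue. p s * G s) = F 1 * G 1 - F 0 * G 0 - (LINT s|unit_lebesgue. F s * q s)"
proof -
  have "integrable unit_lebesgue (\<lambda>t. p t * G t)"
    using mult_continuous_integrable[OF primitive_continuous[OF G] primitive_integrable[OF F]] by (simp add: mult.commute)
  moreover have "integrable unit_lebesgue (\<lambda>t. F t * q t)"
    by (rule mult_continuous_integrable[OF primitive_continuous[OF F] primitive_integrable[OF G]])
  ultimately show ?thesis using primitive_total[OF primitive_mult[OF F G]] by (simp add: eq_diff_eq)
qed

text \<open>The hypothesis concerns interior \<open>t\<close>; the value at 1 follows by continuity
  of the integral, and then all half-lines of the real line are covered.\<close>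

lemma AE_zero_of_upto:
  fixes g :: "real \<Rightarrow> complex"
  assumes g: "integrable unit_lebesgue g"
    and zero: "\<And>t. t \<in> {0<..<1} \<Longrightarrow> (LINT s|unit_lebesgue. indicat_real {..t} s *\<^sub>R g s) = 0"
  shows "AE t in unit_lebesgue. g t = 0"
proof -
  define G where "G t = (LINT s|unit_lebesgue. indicat_real {..t} s *\<^sub>R g s)" for t
  have Gc: "continuous_on UNIV G" unfolding G_def by (rule upto_continuous[OF g])
  have G0: "G t = 0" if "t \<le> 0" for t
  proof -
    have "G t = (LINT s|unit_lebesgue. 0)" unfolding G_def
      by (intro Bochner_Integration.integral_cong) (use that in \<open>auto simp: indicator_def\<close>)
    then show ?thesis by simp
  qed
  have G1: "G t = (LINT s|unit_lebesgue. g s)" if "t \<ge> 1" for t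
    unfolding G_def by (intro Bochner_Integration.integral_cong) (use that in \<open>auto simp: indicator_def\<close>)
  have "G 1 = 0"
  proof (rule LIMSEQ_unique)
    have "(\<lambda>n. 1 - 1 / real (n + 2)) \<longlonglongrightarrow> 1" by real_asymp
    then show "(\<lambda>n. G (1 - 1 / real (n + 2))) \<longlonglongrightarrow> G 1"
      using Gc by (intro continuous_on_tendsto_compose[OF Gc]) auto
    show "(\<lambda>n. G (1 - 1 / real (n + 2))) \<longlonglongrightarrow> 0"
      using zero by (simp add: G_def)
  qed
  then have G: "G t = 0" for t
    using G0[of t] G1[of t] G1[of 1] zero[of t] by (cases "t \<le> 0"; cases "t \<ge> 1") (auto simp: G_def)
  have gi: "integrable lborel (\<lambda>t. indicat_real {0<..<1} t *\<^sub>R g t)"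
    using g unfolding unit_integrable_iff set_integrable_def .
  have "AE t in lborel. indicat_real {0<..<1} t *\<^sub>R g t = 0"
  proof (rule AE_zero_of_atMost_integrals[OF gi])
    show "(LINT t|lborel. indicat_real {0<..<1} t *\<^sub>R g t) = 0"
      using G[of 1] G1[of 1] by (simp add: unit_integral set_lebesgue_integral_def)
    fix t :: real
    have "(LINT s:{..t}|lborel. indicat_real {0<..<1} s *\<^sub>R g s) = G t"
      unfolding G_def unit_integral set_lebesgue_integral_def by (simp add: mult.commute)
    then show "(LINT s:{..t}|lborel. indicat_real {0<..<1} s *\<^sub>R g s) = 0" using G by simp
  qed simp
  then show ?thesis unfolding AE_unit_iff by eventually_elim auto
qed

lemma primitive_unique:
  assumes "primitive F p" "primitive F q" shows "AE t in unit_lebesgue. p t = q t"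
proof -
  have "AE t in unit_lebesgue. p t - q t = 0"
  proof (rule AE_zero_of_upto)
    show "integrable unit_lebesgue (\<lambda>t. p t - q t)" by (rule primitive_integrable[OF primitive_diff[OF assms]])
    fix t :: real assume "t \<in> {0<..<1}"
    then show "(LINT s|unit_lebesgue. indicat_real {..t} s *\<^sub>R (p s - q s)) = 0"
      using primitiveD[OF primitive_diff[OF assms], of t] by simp
  qed
  then show ?thesis by simp
qed

section \<open>Weak derivatives\<close>

lemma test_function_primitive:
  assumes "test_function \<phi> \<psi>"
  shows "primitive (\<lambda>t. of_real (\<phi> t)) (\<lambda>t. of_real (\<psi> t))" "\<phi> 0 = 0" "\<phi> 1 = 0"
proof -
  have der: "\<And>t. (\<phi> has_real_derivative \<psi> t) (at t)" and cont: "continuous_on UNIV \<psi>"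
    using assms by (auto simp: test_function_def)
  show "primitive (\<lambda>t. of_real (\<phi> t)) (\<lambda>t. of_real (\<psi> t))"
  proof (rule primitive_C1)
    show "continuous_on {0..1} (\<lambda>t. complex_of_real (\<psi> t))"
      by (intro continuous_intros continuous_on_subset[OF cont]) auto
    show "((\<lambda>t. complex_of_real (\<phi> t)) has_vector_derivative complex_of_real (\<psi> t)) (at t within {0..1})" for t
      using der[of t] by (intro has_vector_derivative_of_real) (auto intro: has_field_derivative_at_within)
  qed
  from assms obtain c d where "0 < c" "d < 1" "\<And>t. t \<notin> {c..d} \<Longrightarrow> \<phi> t = 0"
    unfolding test_function_def by blast
  then show "\<phi> 0 = 0" "\<phi> 1 = 0" by auto
qed

lemma primitive_weak_derivative:
  assumes "primitive F p" shows "has_weak_derivative F p"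
  unfolding has_weak_derivative_def
proof (intro allI impI)
  fix \<phi> \<psi> assume t: "test_function \<phi> \<psi>"
  show "(LINT t|unit_lebesgue. F t * complex_of_real (\<psi> t)) = - (LINT t|unit_lebesgue. p t * complex_of_real (\<phi> t))"
    using integration_by_parts_unit[OF assms test_function_primitive(1)[OF t]] test_function_primitive(2,3)[OF t] by simp
qed

text \<open>The antiderivative is constant on either side of [c,d], and the mean value zero makes
  the two constants agree.\<close>

lemma test_function_exists:
  fixes \<psi> :: "real \<Rightarrow> real"
  assumes cont: "continuous_on UNIV \<psi>" and cd: "0 < c" "c \<le> d" "d < 1"
    and supp: "\<And>t. t \<notin> {c..d} \<Longrightarrow> \<psi> t = 0" and int: "integral {c..d} \<psi> = 0"
  shows "\<exists>\<phi>. test_function \<phi> \<psi>"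
proof -
  have "\<exists>F. \<forall>x. (-\<infinity>::ereal) < ereal x \<longrightarrow> ereal x < \<infinity> \<longrightarrow> (F has_vector_derivative \<psi> x) (at x)"
    using cont by (intro einterval_antiderivative) (auto simp: continuous_on_eq_continuous_at)
  then obtain F where F: "\<And>x. (F has_real_derivative \<psi> x) (at x)"
    by (auto simp: has_real_derivative_iff_has_vector_derivative)
  define \<phi> where "\<phi> t = F t - F c" for t
  have der: "(\<phi> has_real_derivative \<psi> t) (at t)" for t
    unfolding \<phi>_def using DERIV_diff[OF F[of t] DERIV_const[of "F c"]] by simp
  have "(\<psi> has_integral F d - F c) {c..d}"
    using cd F by (intro fundamental_theorem_of_calculus)
      (auto simp: has_real_derivative_iff_has_vector_derivative[symmetric] intro: has_field_derivative_at_within)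
  then have Fd: "F d = F c" using int by (auto dest: integral_unique)
  have cF: "continuous_on S F" for S
    using F by (intro DERIV_continuous_on[of S F \<psi>]) (auto intro: has_field_derivative_at_within)
  have "\<phi> t = 0" if "t \<notin> {c..d}" for t
  proof (cases "t < c")
    case True
    have "F c = F t"
      by (rule DERIV_isconst_end[OF True cF]) (use supp F in \<open>metis atLeastAtMost_iff linorder_not_le\<close>)
    then show ?thesis by (simp add: \<phi>_def)
  next
    case False
    then have t: "d < t" using that by auto
    have "F t = F d"
      by (rule DERIV_isconst_end[OF t cF]) (use supp F in \<open>metis atLeastAtMost_iff linorder_not_le\<close>)
    then show ?thesis by (simp add: \<phi>_def Fd)
  qed
  then have "test_function \<phi> \<psi>" unfolding test_function_def using der cont cd by blast
  then show ?thesis by blast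
qed

text \<open>The test function \<open>\<psi> = \<eta> (Re w - k)\<close> with a bump \<open>\<eta>\<close> and the \<open>\<eta>\<close>-average \<open>k\<close> of \<open>Re w\<close>
  yields \<open>\<integral> \<eta> (Re w - k)\<^sup>2 = 0\<close>.\<close>

lemma du_Bois_Reymond_Re:
  fixes w :: "real \<Rightarrow> complex"
  assumes w: "continuous_on {0<..<1} w"
    and zero: "\<forall>\<phi> \<psi>. test_function \<phi> \<psi> \<longrightarrow> (LINT t|unit_lebesgue. w t * of_real (\<psi> t)) = 0"
    and cd: "0 < c" "c < d" "d < 1"
  shows "\<exists>k. \<forall>t\<in>{c<..<d}. Re (w t) = k"
proof -
  \<comment> \<open>Freezing \<open>w\<close> outside [c,d] extends it continuously to the real
    line, as is required of the derivative of a test function.\<close>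
  define cl where "cl t = max c (min d t)" for t
  have cl: "cl t \<in> {c..d}" "t \<in> {c..d} \<Longrightarrow> cl t = t" for t using cd by (auto simp: cl_def)
  define u where "u t = Re (w (cl t))" for t
  have wc: "continuous_on UNIV (\<lambda>t. w (cl t))"
    using cl(1) cd by (intro continuous_on_compose2[OF w]) (auto simp: cl_def[abs_def] intro!: continuous_intros)
  have uc: "continuous_on S u" for S unfolding u_def
    by (rule continuous_on_subset[OF _ subset_UNIV]) (intro continuous_intros wc)
  define \<eta> where "\<eta> t = max 0 ((t - c) * (d - t))" for t
  have \<eta>c: "continuous_on S \<eta>" for S unfolding \<eta>_def by (intro continuous_intros)
  have \<eta>0: "\<eta> t \<ge> 0" for t by (simp add: \<eta>_def)
  have \<eta>pos: "\<eta> t > 0" if "t \<in> {c<..<d}" for t using that by (simp add: \<eta>_def)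
  have \<eta>supp: "\<eta> t = 0" if "t \<notin> {c..d}" for t
  proof -
    have "(t - c) * (d - t) \<le> 0"
    proof (cases "t < c")
      case True then show ?thesis using cd by (intro mult_nonpos_nonneg) auto
    next
      case False then show ?thesis using that cd by (intro mult_nonneg_nonpos) auto
    qed
    then show ?thesis by (simp add: \<eta>_def)
  qed
  have int_nz: "integral {c..d} \<eta> \<noteq> 0"
  proof
    assume "integral {c..d} \<eta> = 0"
    then have "\<eta> ((c + d) / 2) = 0"
      using cd \<eta>0 \<eta>c integral_eq_0_iff[of c d \<eta>] by auto
    moreover have "\<eta> ((c + d) / 2) > 0" using cd by (intro \<eta>pos) (auto simp: field_simps)
    ultimately show False by simp
  qed
  define k where "k = integral {c..d} (\<lambda>t. \<eta> t * u t) / integral {c..d} \<eta>"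
  define \<psi> where "\<psi> t = \<eta> t * (u t - k)" for t
  have \<psi>c: "continuous_on S \<psi>" for S unfolding \<psi>_def by (intro continuous_intros \<eta>c uc)
  have I: "f integrable_on {c..d}" if "continuous_on {c..d} f" for f :: "real \<Rightarrow> real"
    using that by (rule integrable_continuous_real)
  have \<psi>int: "integral {c..d} \<psi> = 0"
  proof -
    have "integral {c..d} \<psi> = integral {c..d} (\<lambda>t. \<eta> t * u t - k * \<eta> t)"
      by (simp add: \<psi>_def[abs_def] algebra_simps)
    also have "\<dots> = integral {c..d} (\<lambda>t. \<eta> t * u t) - k * integral {c..d} \<eta>"
      by (subst integral_diff) (auto intro!: I continuous_intros \<eta>c uc)
    finally show ?thesis using int_nz by (simp add: k_def)
  qed
  obtain \<phi> where "test_function \<phi> \<psi>"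
    using test_function_exists[OF \<psi>c, of c d] cd \<eta>supp \<psi>int by (auto simp: \<psi>_def)
  with zero have z: "(LINT t|unit_lebesgue. w t * of_real (\<psi> t)) = 0" by blast
  have "(LINT t|unit_lebesgue. w t * of_real (\<psi> t)) = (LINT t:{c..d}|lborel. w (cl t) * of_real (\<psi> t))"
    unfolding unit_integral set_lebesgue_integral_def
    by (intro Bochner_Integration.integral_cong refl)
       (use cd cl(2) \<eta>supp in \<open>auto simp: indicator_def \<psi>_def\<close>)
  also have "\<dots> = integral {c..d} (\<lambda>t. w (cl t) * of_real (\<psi> t))"
    by (intro set_integral_HK continuous_intros \<psi>c continuous_on_subset[OF wc]) auto
  finally have "integral {c..d} (\<lambda>t. w (cl t) * of_real (\<psi> t)) = 0" using z by simp
  moreover have "(\<lambda>t. w (cl t) * of_real (\<psi> t)) integrable_on {c..d}"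
    by (intro integrable_continuous_real continuous_intros \<psi>c continuous_on_subset[OF wc]) auto
  ultimately have "((\<lambda>t. w (cl t) * of_real (\<psi> t)) has_integral 0) {c..d}" by (metis integrable_integral)
  from has_integral_Re[OF this] have "((\<lambda>t. u t * \<psi> t) has_integral 0) {c..d}" by (simp add: u_def)
  then have "integral {c..d} (\<lambda>t. u t * \<psi> t) = 0" by (rule integral_unique)
  moreover have "integral {c..d} (\<lambda>t. \<eta> t * (u t - k)^2) = integral {c..d} (\<lambda>t. u t * \<psi> t) - k * integral {c..d} \<psi>"
  proof -
    have "integral {c..d} (\<lambda>t. \<eta> t * (u t - k)^2) = integral {c..d} (\<lambda>t. u t * \<psi> t - k * \<psi> t)"
      by (simp add: \<psi>_def[abs_def] power2_eq_square algebra_simps)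
    also have "\<dots> = integral {c..d} (\<lambda>t. u t * \<psi> t) - k * integral {c..d} \<psi>"
      by (subst integral_diff) (auto intro!: I continuous_intros \<psi>c uc)
    finally show ?thesis .
  qed
  ultimately have "integral {c..d} (\<lambda>t. \<eta> t * (u t - k)^2) = 0" using \<psi>int by simp
  moreover have "continuous_on {c..d} (\<lambda>t. \<eta> t * (u t - k)^2)" by (intro continuous_intros \<eta>c uc)
  ultimately have 0: "\<eta> t * (u t - k)^2 = 0" if "t \<in> {c..d}" for t
    using cd that \<eta>0 integral_eq_0_iff[of c d "\<lambda>t. \<eta> t * (u t - k)^2"] by auto
  have "Re (w t) = k" if "t \<in> {c<..<d}" for t
    using 0[of t] \<eta>pos[OF that] cl(2)[of t] that by (simp add: u_def)
  then show ?thesis by blast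
qed

text \<open>Applies the version for real parts to \<open>w\<close> and to \<open>- \<i> * w\<close>,
  whose real part is the imaginary part of \<open>w\<close>, on an interval around both
  points.\<close>

lemma du_Bois_Reymond:
  fixes w :: "real \<Rightarrow> complex"
  assumes w: "continuous_on {0<..<1} w"
    and zero: "\<forall>\<phi> \<psi>. test_function \<phi> \<psi> \<longrightarrow> (LINT t|unit_lebesgue. w t * of_real (\<psi> t)) = 0"
    and st: "s \<in> {0<..<1}" "t \<in> {0<..<1}"
  shows "w s = w t"
proof -
  define c where "c = min s t / 2" define d where "d = (max s t + 1) / 2"
  have cd: "0 < c" "c < d" "d < 1" "s \<in> {c<..<d}" "t \<in> {c<..<d}" using st by (auto simp: c_def d_def)
  have "Re (w s) = Re (w t)" using du_Bois_Reymond_Re[OF w zero cd(1-3)] cd(4,5) by auto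
  moreover have "continuous_on {0<..<1} (\<lambda>t. - \<i> * w t)" by (intro continuous_intros w)
  moreover have "\<forall>\<phi> \<psi>. test_function \<phi> \<psi> \<longrightarrow> (LINT t|unit_lebesgue. (- \<i> * w t) * of_real (\<psi> t)) = 0"
    using zero by (simp add: mult.assoc)
  ultimately show ?thesis
    using du_Bois_Reymond_Re[of "\<lambda>t. - \<i> * w t", OF _ _ cd(1-3)] cd(4,5) by (force simp: complex_eq_iff)
qed

text \<open>The difference of \<open>v\<close> and the integral of \<open>g\<close> has weak
  derivative 0, so it is constant on (0,1), and by continuity on [0,1].\<close>

lemma weak_derivative_primitive:
  assumes v: "continuous_on {0..1} v" and g: "g \<in> L2 unit_lebesgue" and weak: "has_weak_derivative v g"
  shows "primitive v g"
proof (rule primitiveI[OF L2_unit_integrable[OF g]])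
  define G where "G t = (LINT s|unit_lebesgue. indicat_real {..t} s *\<^sub>R g s)" for t
  have G0: "G 0 = 0"
  proof -
    have "G 0 = (LINT s|unit_lebesgue. 0)" unfolding G_def
      by (intro Bochner_Integration.integral_cong) (auto simp: indicator_def)
    then show ?thesis by simp
  qed
  have Gp: "primitive G g" using G0 L2_unit_integrable[OF g] by (intro primitiveI) (auto simp: G_def)
  note Gc = primitive_continuous[OF Gp]
  have eq: "v s - G s = v t - G t" if "s \<in> {0<..<1}" "t \<in> {0<..<1}" for s t
  proof (rule du_Bois_Reymond[OF _ _ that])
    show "continuous_on {0<..<1} (\<lambda>t. v t - G t)"
      by (intro continuous_intros continuous_on_subset[OF v] continuous_on_subset[OF Gc]) auto
    show "\<forall>\<phi> \<psi>. test_function \<phi> \<psi> \<longrightarrow> (LINT t|unit_lebesgue. (v t - G t) * complex_of_real (\<psi> t)) = 0"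
    proof (intro allI impI)
    fix \<phi> \<psi> assume t: "test_function \<phi> \<psi>"
    have \<psi>: "integrable unit_lebesgue (\<lambda>t. complex_of_real (\<psi> t))"
      using test_function_primitive(1)[OF t] by (rule primitive_integrable)
    show "(LINT t|unit_lebesgue. (v t - G t) * complex_of_real (\<psi> t)) = 0"
      using weak primitive_weak_derivative[OF Gp] t mult_continuous_integrable[OF v \<psi>] mult_continuous_integrable[OF Gc \<psi>]
      unfolding has_weak_derivative_def by (simp add: left_diff_distrib)
    qed
  qed
  have const: "v t - G t = v (1/2) - G (1/2)" if "t \<in> {0<..<1}" for t
    by (rule eq) (use that in auto)
  have const': "v t - G t = v (1/2) - G (1/2)" if "t \<in> {0..1}" for t
  proof (rule continuous_constant_on_closure[of "{0<..<1}" "\<lambda>t. v t - G t"])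
    show "continuous_on (closure {0<..<1}) (\<lambda>t. v t - G t)" using v Gc by (auto intro!: continuous_intros)
    show "t \<in> closure {0<..<1}" using that by simp
  qed (rule const)
  fix t :: real assume "t \<in> {0..1}"
  then show "v t = v 0 + (LINT s|unit_lebesgue. indicat_real {..t} s *\<^sub>R g s)"
  proof -
    assume "t \<in> {0..1}"
    then have "v t - G t = v 0 - G 0" by (rule trans[OF const' const'[symmetric]]) simp
    then have "v t = v 0 + G t" by (simp add: G0 algebra_simps)
    then show ?thesis by (simp only: G_def)
  qed
qed

text \<open>\<open>weak_derivative\<close> is an arbitrary choice of representative; uniqueness of
  \<open>p\<close> in \<open>primitive\<close> identifies it almost everywhere.\<close>

lemma primitive_H1:
  assumes "primitive F p" "p \<in> L2 unit_lebesgue"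
  shows "F \<in> H1_unit" "AE t in unit_lebesgue. weak_derivative F t = p t" "weak_derivative F \<in> L2 unit_lebesgue"
proof -
  note w = primitive_weak_derivative[OF assms(1)] and c = primitive_continuous[OF assms(1)]
  show "F \<in> H1_unit" using w assms(2) continuous_unit_L2[OF c] by (auto simp: H1_unit_def)
  have *: "weak_derivative F \<in> L2 unit_lebesgue \<and> has_weak_derivative F (weak_derivative F)"
    unfolding weak_derivative_def by (rule someI[of _ p]) (use w assms in auto)
  then show "weak_derivative F \<in> L2 unit_lebesgue" by blast
  show "AE t in unit_lebesgue. weak_derivative F t = p t"
    using primitive_unique[OF weak_derivative_primitive[OF c] assms(1)] * by blast
qed

lemma H1_unit_weak_derivative:
  assumes "v \<in> H1_unit"
  shows "weak_derivative v \<in> L2 unit_lebesgue" "has_weak_derivative v (weak_derivative v)"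
proof -
  have "weak_derivative v \<in> L2 unit_lebesgue \<and> has_weak_derivative v (weak_derivative v)"
  proof -
    obtain g where "g \<in> L2 unit_lebesgue \<and> has_weak_derivative v g" using assms by (auto simp: H1_unit_def)
    then show ?thesis unfolding weak_derivative_def
      by (rule someI[of "\<lambda>g. g \<in> L2 unit_lebesgue \<and> has_weak_derivative v g"])
  qed
  then show "weak_derivative v \<in> L2 unit_lebesgue" "has_weak_derivative v (weak_derivative v)" by auto
qed

lemma H1_unit_cong_weak:
  assumes "\<And>t. t \<in> {0<..<1} \<Longrightarrow> v t = v' t" "has_weak_derivative v g"
  shows "has_weak_derivative v' g"
proof -
  have "(LINT t|unit_lebesgue. v t * complex_of_real (\<psi> t)) = (LINT t|unit_lebesgue. v' t * complex_of_real (\<psi> t))" for \<psi>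
    by (intro Bochner_Integration.integral_cong) (use assms(1) in auto)
  then show ?thesis using assms(2) by (simp add: has_weak_derivative_def)
qed

lemma integral_norm_sq_le:
  assumes p: "p \<in> L2 unit_lebesgue"
  shows "(LINT s|unit_lebesgue. cmod (p s))^2 \<le> (unit_norm p)^2"
proof -
  let ?q = "\<lambda>s. complex_of_real (cmod (p s))"
  have q: "?q \<in> L2 unit_lebesgue" using p by (auto simp: L2_def)
  have one: "(\<lambda>_. 1) \<in> L2 unit_lebesgue" by (simp add: L2_def)
  have n1: "unit_norm (\<lambda>_. 1) = 1" using U.prob_space by (simp add: l2_norm_def)
  have "\<bar>LINT s|unit_lebesgue. cmod (p s)\<bar> \<le> unit_norm p"
    using l2_Cauchy_Schwarz[OF q one] by (simp add: n1) (simp add: l2_inner_def l2_norm_def)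
  then show ?thesis by (simp add: abs_le_square_iff[symmetric])
qed

text \<open>\<open>F 1 - F t\<close> is at most the L^1 norm of \<open>p\<close>; squaring and
  averaging over \<open>t\<close> removes the dependence on \<open>t\<close>. Later this makes the
  boundary terms at distant vertices small.\<close>

lemma trace_inequality:
  assumes F: "primitive F p" and p: "p \<in> L2 unit_lebesgue"
  shows "(cmod (F 1))^2 \<le> 2 * (unit_norm F)^2 + 2 * (unit_norm p)^2"
proof -
  have pi: "integrable unit_lebesgue p" using F by (rule primitive_integrable)
  have FL: "F \<in> L2 unit_lebesgue" by (rule continuous_unit_L2[OF primitive_continuous[OF F]])
  have le: "(cmod (F 1))^2 \<le> 2 * (cmod (F t))^2 + 2 * (unit_norm p)^2" if t: "t \<in> {0<..<1}" for t
  proof -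
    have F1: "F 1 = F 0 + (LINT s|unit_lebesgue. indicat_real {..1} s *\<^sub>R p s)"
      and Ft: "F t = F 0 + (LINT s|unit_lebesgue. indicat_real {..t} s *\<^sub>R p s)"
      by (rule primitiveD[OF F], use t in auto)+
    have "F 1 - F t = (LINT s|unit_lebesgue. indicat_real {..1} s *\<^sub>R p s - indicat_real {..t} s *\<^sub>R p s)"
      using indicator_integrable[OF pi] by (simp add: F1 Ft)
    also have "cmod \<dots> \<le> (LINT s|unit_lebesgue. cmod (p s))"
    proof (rule order_trans[OF integral_norm_bound integral_mono])
      show "integrable unit_lebesgue (\<lambda>s. cmod (indicat_real {..1} s *\<^sub>R p s - indicat_real {..t} s *\<^sub>R p s))"
        using indicator_integrable[OF pi] by auto
    qed (use pi t in \<open>auto simp: indicator_def\<close>)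
    finally have "(cmod (F 1 - F t))^2 \<le> (LINT s|unit_lebesgue. cmod (p s))^2" by (intro power_mono) auto
    also have "\<dots> \<le> (unit_norm p)^2" by (rule integral_norm_sq_le[OF p])
    finally have "(cmod (F 1 - F t))^2 \<le> (unit_norm p)^2" .
    moreover have "(cmod (F 1))^2 \<le> 2 * (cmod (F t))^2 + 2 * (cmod (F 1 - F t))^2"
      using norm_add_square_le[of "F t" "F 1 - F t"] by simp
    ultimately show ?thesis by linarith
  qed
  have "(LINT t|unit_lebesgue. (cmod (F 1))^2) \<le> (LINT t|unit_lebesgue. 2 * (cmod (F t))^2 + 2 * (unit_norm p)^2)"
    using L2_integrable[OF FL] le by (intro integral_mono) auto
  also have "\<dots> = 2 * (unit_norm F)^2 + 2 * (unit_norm p)^2"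
    using L2_integrable[OF FL] U.prob_space by (simp add: l2_norm_power2)
  finally show ?thesis using U.prob_space by simp
qed

section \<open>A uniqueness lemma of Mikusinski\<close>

text \<open>The series \<open>\<Sum>\<^sub>k (-1)\<^sup>k y\<^sup>k / k!\<close> with \<open>y = exp (n (x - t))\<close> turns the exponential moments into
  \<open>\<integral> (1 - exp (- exp (n (x - t)))) g(t) dt\<close>, whose kernel tends to the indicator of \<open>t < x\<close>.\<close>

lemma exponential_moments_zero:
  fixes g :: "real \<Rightarrow> complex"
  assumes g: "integrable unit_lebesgue g"
    and bd: "\<And>n::nat. n \<ge> 1 \<Longrightarrow> cmod (LINT t|unit_lebesgue. of_real (exp (real n * (1 - t))) * g t) \<le> C"
  shows "AE t in unit_lebesgue. g t = 0"
proof (rule AE_zero_of_upto[OF g])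
  note [measurable] = borel_measurable_integrable[OF g]
  have idm[measurable]: "(\<lambda>s. s) \<in> borel_measurable unit_lebesgue" by (rule unit_measurable) simp
  fix x :: real assume x: "x \<in> {0<..<1}"
  define y where "y n t = exp (real n * (x - t))" for n :: nat and t
  \<comment> \<open>\<open>y n t = q n * exp (n (1 - t))\<close>, so the k-th term of the series is
    a moment of order \<open>n (k + 1)\<close>, bounded by \<open>C\<close>; the factor
    \<open>q n\<close> tends to 0 because \<open>x < 1\<close>.\<close>
  define q where "q n = exp (- real n * (1 - x))" for n :: nat
  have small: "cmod (LINT t|unit_lebesgue. of_real (1 - exp (- y n t)) * g t) \<le> C * (exp (q n) - 1)" if n: "n \<ge> 1" for n
  proof -
    define f where "f k t = complex_of_real ((- y n t) ^ Suc k / fact (Suc k)) * g t" for k t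
    have ym[measurable]: "y n \<in> borel_measurable unit_lebesgue" unfolding y_def by measurable
    have yb: "\<bar>y n t\<bar> \<le> exp (real n)" if "t \<in> {0<..<1}" for t
      using that x by (auto simp: y_def intro!: mult_left_le)
    have fb: "AE t in unit_lebesgue. cmod (f k t) \<le> exp (real n) ^ Suc k / fact (Suc k) * cmod (g t)" for k
      using AE_unit_in
    proof eventually_elim
      case (elim t)
      have "\<bar>y n t\<bar> ^ Suc k \<le> exp (real n) ^ Suc k" using yb[of t] elim by (intro power_mono) auto
      then show ?case unfolding f_def norm_mult norm_of_real
        by (intro mult_right_mono) (auto simp: abs_mult power_abs divide_right_mono simp del: power_Suc fact_Suc)
    qed
    have fi: "integrable unit_lebesgue (f k)" for k
    proof (rule Bochner_Integration.integrable_bound)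
      show "integrable unit_lebesgue (\<lambda>t. exp (real n) ^ Suc k / fact (Suc k) * cmod (g t))" using g by auto
      show "f k \<in> borel_measurable unit_lebesgue" unfolding f_def by measurable
      show "AE t in unit_lebesgue. cmod (f k t) \<le> norm (exp (real n) ^ Suc k / fact (Suc k) * cmod (g t))"
        using fb[of k] by eventually_elim (simp add: abs_mult del: fact_Suc power_Suc)
    qed
    have exps: "(\<lambda>k. z ^ Suc k / fact (Suc k)) sums (exp z - 1)" for z :: real
    proof -
      have "(\<lambda>k. z ^ k / fact k) sums exp z"
        using exp_converges[of z] by (simp add: divide_inverse mult.commute)
      then show ?thesis by (subst sums_Suc_iff) simp
    qed
    have s1: "summable (\<lambda>k. cmod (f k t))" for t
    proof -
      have "summable (\<lambda>k. \<bar>y n t\<bar> ^ Suc k / fact (Suc k) * cmod (g t))"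
        by (intro summable_mult2 sums_summable[OF exps])
      then show ?thesis by (simp add: f_def norm_mult power_abs abs_mult norm_divide norm_power del: power_Suc fact_Suc)
    qed
    have s2: "summable (\<lambda>k. LINT t|unit_lebesgue. cmod (f k t))"
    proof (rule summable_comparison_test'[where N=0])
      show "summable (\<lambda>k. exp (real n) ^ Suc k / fact (Suc k) * (LINT t|unit_lebesgue. cmod (g t)))"
        by (intro summable_mult2 sums_summable[OF exps])
      fix k
      have "(LINT t|unit_lebesgue. cmod (f k t)) \<le> (LINT t|unit_lebesgue. exp (real n) ^ Suc k / fact (Suc k) * cmod (g t))"
        using fb[of k] fi[of k] g by (intro integral_mono_AE) auto
      then show "norm (LINT t|unit_lebesgue. cmod (f k t)) \<le> exp (real n) ^ Suc k / fact (Suc k) * (LINT t|unit_lebesgue. cmod (g t))"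
        by simp
    qed
    have sum_f: "(\<Sum>k. f k t) = - (of_real (1 - exp (- y n t)) * g t)" for t
    proof -
      have "(\<lambda>k. complex_of_real ((- y n t) ^ Suc k / fact (Suc k)) * g t) sums (of_real (exp (- y n t) - 1) * g t)"
        by (intro sums_mult2 sums_of_real exps)
      then show ?thesis unfolding f_def using sums_unique by (force simp: algebra_simps)
    qed
    have "(LINT t|unit_lebesgue. of_real (1 - exp (- y n t)) * g t) = - (LINT t|unit_lebesgue. (\<Sum>k. f k t))"
      unfolding sum_f by simp
    also have "(LINT t|unit_lebesgue. (\<Sum>k. f k t)) = (\<Sum>k. LINT t|unit_lebesgue. f k t)"
      by (rule integral_suminf[OF fi]) (use s1 s2 in auto)
    finally have eq: "cmod (LINT t|unit_lebesgue. of_real (1 - exp (- y n t)) * g t) = cmod (\<Sum>k. LINT t|unit_lebesgue. f k t)"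
      by simp
    have le: "cmod (LINT t|unit_lebesgue. f k t) \<le> C * (q n ^ Suc k / fact (Suc k))" for k
    proof -
      have "(- y n t) ^ Suc k = (- 1) ^ Suc k * q n ^ Suc k * exp (real (n * Suc k) * (1 - t))" for t
      proof -
        have "y n t = q n * exp (real n * (1 - t))" unfolding y_def q_def exp_add[symmetric] by (simp add: algebra_simps)
        moreover have "exp (real n * (1 - t)) ^ Suc k = exp (real (n * Suc k) * (1 - t))"
          unfolding exp_of_nat_mult[symmetric] by (simp add: algebra_simps)
        moreover have "(- y n t) ^ Suc k = (- 1) ^ Suc k * y n t ^ Suc k" by (rule power_minus)
        ultimately show ?thesis by (simp only: power_mult_distrib mult.assoc)
      qed
      then have "f k t = of_real ((- 1) ^ Suc k * q n ^ Suc k / fact (Suc k)) * (of_real (exp (real (n * Suc k) * (1 - t))) * g t)" for t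
        unfolding f_def by (simp only: of_real_mult of_real_divide) (simp only: mult_ac times_divide_eq_left times_divide_eq_right)
      then have "(LINT t|unit_lebesgue. f k t) = of_real ((- 1) ^ Suc k * q n ^ Suc k / fact (Suc k)) * (LINT t|unit_lebesgue. of_real (exp (real (n * Suc k) * (1 - t))) * g t)"
        by (simp only: integral_mult_right_zero)
      then have "cmod (LINT t|unit_lebesgue. f k t) = q n ^ Suc k / fact (Suc k) * cmod (LINT t|unit_lebesgue. of_real (exp (real (n * Suc k) * (1 - t))) * g t)"
        by (simp only: norm_mult norm_of_real abs_mult abs_divide power_abs)
           (simp add: q_def del: fact_Suc power_Suc of_nat_mult of_nat_Suc)
      also have "\<dots> \<le> q n ^ Suc k / fact (Suc k) * C"
        using n by (intro mult_left_mono bd) (auto simp: q_def simp del: fact_Suc power_Suc)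
      finally show ?thesis by (simp only: mult.commute)
    qed
    have sq: "(\<lambda>k. C * (q n ^ Suc k / fact (Suc k))) sums (C * (exp (q n) - 1))"
      by (intro sums_mult exps)
    have "cmod (\<Sum>k. LINT t|unit_lebesgue. f k t) \<le> (\<Sum>k. C * (q n ^ Suc k / fact (Suc k)))"
      by (rule norm_suminf_le[OF le sums_summable[OF sq]])
    also have "\<dots> = C * (exp (q n) - 1)" using sq by (rule sums_unique[symmetric])
    finally show ?thesis using eq by simp
  qed
  have "(\<lambda>n. LINT t|unit_lebesgue. of_real (1 - exp (- y n t)) * g t) \<longlonglongrightarrow> 0"
  proof (rule Lim_null_comparison)
    show "\<forall>\<^sub>F n in sequentially. cmod (LINT t|unit_lebesgue. of_real (1 - exp (- y n t)) * g t) \<le> C * (exp (q n) - 1)"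
      using eventually_ge_at_top[of 1] by eventually_elim (rule small)
    have "q \<longlonglongrightarrow> 0" unfolding q_def using x by real_asymp
    then have "(\<lambda>n. C * (exp (q n) - 1)) \<longlonglongrightarrow> C * (exp 0 - 1)" by (intro tendsto_intros)
    then show "(\<lambda>n. C * (exp (q n) - 1)) \<longlonglongrightarrow> 0" by simp
  qed
  \<comment> \<open>At \<open>t = x\<close> the kernel keeps the value \<open>1 - 1/e\<close>; this
    single point is null.\<close>
  moreover have "(\<lambda>n. LINT t|unit_lebesgue. of_real (1 - exp (- y n t)) * g t) \<longlonglongrightarrow> (LINT t|unit_lebesgue. indicat_real {..x} t *\<^sub>R g t)"
  proof (rule integral_dominated_convergence[where w="\<lambda>t. cmod (g t)"])
    show "AE t in unit_lebesgue. (\<lambda>n. complex_of_real (1 - exp (- y n t)) * g t) \<longlonglongrightarrow> indicat_real {..x} t *\<^sub>R g t"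
      using AE_unit_neq[of x]
    proof eventually_elim
      case (elim t)
      have "(\<lambda>n. 1 - exp (- y n t)) \<longlonglongrightarrow> indicat_real {..x} t"
      proof (cases "t < x")
        case True
        then have "x - t > 0" by simp
        then have "(\<lambda>n. 1 - exp (- exp (real n * (x - t)))) \<longlonglongrightarrow> 1" by real_asymp
        then show ?thesis using True by (simp add: y_def)
      next
        case False
        then have "x - t < 0" using elim by simp
        then have "(\<lambda>n. 1 - exp (- exp (real n * (x - t)))) \<longlonglongrightarrow> 0" by real_asymp
        then show ?thesis using False elim by (simp add: y_def)
      qed
      then have "(\<lambda>n. complex_of_real (1 - exp (- y n t)) * g t) \<longlonglongrightarrow> of_real (indicat_real {..x} t) * g t"
        by (intro tendsto_intros)
      then show ?case by (simp add: scaleR_conv_of_real)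
    qed
    show "AE t in unit_lebesgue. cmod (complex_of_real (1 - exp (- y n t)) * g t) \<le> cmod (g t)" for n
    proof (rule AE_I2)
      fix t
      have "\<bar>1 - exp (- y n t)\<bar> \<le> 1" by (simp add: y_def abs_le_iff)
      then show "cmod (complex_of_real (1 - exp (- y n t)) * g t) \<le> cmod (g t)"
        unfolding norm_mult norm_of_real by (intro mult_left_le_one_le) auto
    qed
    show "(\<lambda>t. complex_of_real (1 - exp (- y n t)) * g t) \<in> borel_measurable unit_lebesgue" for n
      unfolding y_def by measurable
  qed (use g indicator_integrable[OF g, of "{..x}"] in auto)
  ultimately show "(LINT t|unit_lebesgue. indicat_real {..x} t *\<^sub>R g t) = 0" by (rule LIMSEQ_unique[rotated])
qed

section \<open>Integration on the tree\<close>

abbreviation tree_L2 :: "nat \<Rightarrow> (tree_point \<Rightarrow> complex) set" where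
  "tree_L2 b \<equiv> L2 (tree_measure b)"

abbreviation tree_norm :: "nat \<Rightarrow> (tree_point \<Rightarrow> complex) \<Rightarrow> real" where
  "tree_norm b \<equiv> l2_norm (tree_measure b)"

abbreviation tree_inner :: "nat \<Rightarrow> (tree_point \<Rightarrow> complex) \<Rightarrow> (tree_point \<Rightarrow> complex) \<Rightarrow> complex" where
  "tree_inner b \<equiv> l2_inner (tree_measure b)"

definition words :: "nat \<Rightarrow> nat \<Rightarrow> nat list set" where
  "words b L = {w \<in> lists {..<b}. length w = L}"

lemma finite_words [simp]: "finite (words b L)"
  using finite_lists_length_eq[of "{..<b}" L] by (simp add: words_def lists_eq_set)

lemma words_0 [simp]: "words b 0 = {[]}"
  by (auto simp: words_def)

lemma wordsD: "w \<in> words b L \<Longrightarrow> w \<in> lists {..<b}" "w \<in> words b L \<Longrightarrow> length w = L"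
  by (auto simp: words_def)

lemma words_Suc_snoc: "words b (Suc L) = (\<lambda>(w, d). w @ [d]) ` (words b L \<times> {..<b})"
proof -
  have "x \<in> (\<lambda>(w, d). w @ [d]) ` (words b L \<times> {..<b})" if "x \<in> words b (Suc L)" for x
  proof -
    have "x \<noteq> []" using that by (auto simp: words_def)
    then obtain w d where "x = w @ [d]" by (metis append_butlast_last_id)
    then show ?thesis using that by (auto simp: words_def image_iff)
  qed
  then show ?thesis by (auto simp: words_def)
qed

lemma sum_words_Suc_snoc: "(\<Sum>x\<in>words b (Suc L). f x) = (\<Sum>w\<in>words b L. \<Sum>d<b. f (w @ [d]))"
  for f :: "nat list \<Rightarrow> 'c :: comm_monoid_add"
proof -
  have inj: "inj_on (\<lambda>(w, d). w @ [d]) (words b L \<times> {..<b})" by (auto simp: inj_on_def)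
  show ?thesis unfolding words_Suc_snoc sum.reindex[OF inj]
    by (simp add: sum.cartesian_product o_def case_prod_beta)
qed

lemma words_Suc_Cons: "words b (Suc L) = (\<lambda>(d, w). d # w) ` ({..<b} \<times> words b L)"
proof -
  have "x \<in> (\<lambda>(d, w). d # w) ` ({..<b} \<times> words b L)" if "x \<in> words b (Suc L)" for x
    using that by (cases x) (auto simp: words_def image_iff)
  then show ?thesis by (auto simp: words_def)
qed

lemma sum_words_Suc_Cons: "(\<Sum>x\<in>words b (Suc L). f x) = (\<Sum>d<b. \<Sum>w\<in>words b L. f (d # w))"
  for f :: "nat list \<Rightarrow> 'c :: comm_monoid_add"
proof -
  have inj: "inj_on (\<lambda>(d, w). d # w) ({..<b} \<times> words b L)" by (auto simp: inj_on_def)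
  show ?thesis unfolding words_Suc_Cons sum.reindex[OF inj]
    by (simp add: sum.cartesian_product o_def case_prod_beta)
qed

definition edge :: "nat \<Rightarrow> nat list \<Rightarrow> tree_point set" where
  "edge b w = ({w} \<times> UNIV) \<inter> tree b"

lemma tree_iff: "(w, t) \<in> tree b \<longleftrightarrow> w \<in> lists {..<b} \<and> (0 < t \<and> t \<le> 1 \<or> w = [] \<and> t = 0)"
  by (auto simp: tree_def tree_root_def)

lemma tree_cases:
  assumes "x \<in> tree b"
  obtains w t where "x = (w, t)" "w \<in> lists {..<b}" "0 < t \<and> t \<le> 1 \<or> w = [] \<and> t = 0"
  using assms that by (metis tree_iff surj_pair)

lemma tree_sets: "tree b \<in> sets (count_space UNIV \<Otimes>\<^sub>M (lborel :: real measure))"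
proof -
  have "{tree_root} \<in> sets (count_space UNIV \<Otimes>\<^sub>M (lborel :: real measure))"
  proof -
    have "{tree_root} = {[]} \<times> {0}" by (auto simp: tree_root_def)
    also have "\<dots> \<in> sets (count_space UNIV \<Otimes>\<^sub>M (lborel :: real measure))" by (rule pair_measureI) auto
    finally show ?thesis .
  qed
  moreover have "lists {..<b} \<times> {0<..1} \<in> sets (count_space UNIV \<Otimes>\<^sub>M (lborel :: real measure))"
    by (rule pair_measureI) auto
  ultimately have "{tree_root} \<union> lists {..<b} \<times> {0<..1} \<in> sets (count_space UNIV \<Otimes>\<^sub>M (lborel :: real measure))"
    by (rule sets.Un)
  then show ?thesis by (simp add: tree_def)
qed

lemma space_tree [simp]: "space (tree_measure b) = tree b"
  by (simp add: tree_measure_def space_restrict_space space_pair_measure)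

lemma sets_tree: "A \<in> sets (tree_measure b) \<longleftrightarrow> A \<subseteq> tree b \<and> A \<in> sets (count_space UNIV \<Otimes>\<^sub>M lborel)"
  unfolding tree_measure_def by (rule sets_restrict_space_iff) (simp add: tree_sets)

lemma edge_sets [measurable]: "edge b w \<in> sets (tree_measure b)"
proof -
  have "{w} \<times> UNIV \<in> sets (count_space UNIV \<Otimes>\<^sub>M (lborel :: real measure))" by (rule pair_measureI) auto
  then show ?thesis unfolding sets_tree edge_def using tree_sets[of b] by auto
qed

lemma edge_measurable [measurable]:
  assumes "w \<in> lists {..<b}" shows "Pair w \<in> measurable unit_lebesgue (tree_measure b)"
  unfolding tree_measure_def
proof (rule measurable_restrict_space2)
  show "Pair w \<in> space unit_lebesgue \<rightarrow> tree b" using assms by (auto simp: tree_iff)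
  have "Pair w \<in> measurable lborel (count_space UNIV \<Otimes>\<^sub>M lborel)" by measurable
  then show "Pair w \<in> measurable unit_lebesgue (count_space UNIV \<Otimes>\<^sub>M lborel)"
    by (rule measurable_restrict_space1)
qed

text \<open>Each edge carries a copy of \<open>unit_lebesgue\<close>, its end point and, on the
  first edge, the root being null. Integrals over an edge thereby become one-dimensional.\<close>

lemma distr_edge:
  assumes w: "w \<in> lists {..<b}"
  shows "distr unit_lebesgue (tree_measure b) (Pair w) = density (tree_measure b) (indicator (edge b w))"
proof (rule measure_eqI)
  fix A assume "A \<in> sets (distr unit_lebesgue (tree_measure b) (Pair w))"
  then have A: "A \<in> sets (tree_measure b)" by simp
  then have A': "A \<subseteq> tree b" "A \<in> sets (count_space UNIV \<Otimes>\<^sub>M lborel)" by (auto simp: sets_tree)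
  have B: "Pair w -` A \<in> sets lborel" using sets_Pair1[OF A'(2)] by simp
  have "emeasure (density (tree_measure b) (indicator (edge b w))) A = emeasure (tree_measure b) (edge b w \<inter> A)"
    by (intro emeasure_restricted edge_sets A)
  also have "\<dots> = emeasure (count_space UNIV \<Otimes>\<^sub>M lborel) (edge b w \<inter> A)"
    unfolding tree_measure_def by (rule emeasure_restrict_space) (use tree_sets A' in auto)
  also have "edge b w \<inter> A = {w} \<times> (Pair w -` A)" using A' by (auto simp: edge_def)
  also have "emeasure (count_space UNIV \<Otimes>\<^sub>M lborel) \<dots> = emeasure (count_space UNIV) {w} * emeasure lborel (Pair w -` A)"
    by (rule lborel.emeasure_pair_measure_Times) (use B in auto)
  also have "\<dots> = emeasure lborel (Pair w -` A)" by simp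
  also have "\<dots> = emeasure lborel (Pair w -` A \<inter> {0<..<1})"
  proof (rule emeasure_eq_AE)
    show "AE t in lborel. t \<in> Pair w -` A \<longleftrightarrow> t \<in> Pair w -` A \<inter> {0<..<1}"
      using AE_lborel_singleton[of 0] AE_lborel_singleton[of 1]
      by eventually_elim (use A' in \<open>auto simp: tree_iff\<close>)
  qed (use B in auto)
  also have "\<dots> = emeasure unit_lebesgue (Pair w -` A \<inter> space unit_lebesgue)"
    by (subst emeasure_restrict_space) auto
  also have "\<dots> = emeasure (distr unit_lebesgue (tree_measure b) (Pair w)) A"
    by (rule emeasure_distr[OF edge_measurable[OF w] A, symmetric])
  finally show "emeasure (distr unit_lebesgue (tree_measure b) (Pair w)) A = emeasure (density (tree_measure b) (indicator (edge b w))) A"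
    by simp
qed simp

lemma edge_integrable_iff:
  fixes f :: "tree_point \<Rightarrow> 'c :: {banach, second_countable_topology}"
  assumes w[measurable]: "w \<in> lists {..<b}" and [measurable]: "f \<in> borel_measurable (tree_measure b)"
  shows "integrable (tree_measure b) (\<lambda>x. indicat_real (edge b w) x *\<^sub>R f x) \<longleftrightarrow> integrable unit_lebesgue (\<lambda>t. f (w, t))"
proof -
  have "integrable unit_lebesgue (\<lambda>t. f (w, t)) \<longleftrightarrow> integrable (density (tree_measure b) (\<lambda>x. ennreal (indicat_real (edge b w) x))) f"
    unfolding ennreal_indicator distr_edge[OF w, symmetric]
    by (subst integrable_distr_eq[OF edge_measurable[OF w]]) auto
  also have "\<dots> \<longleftrightarrow> integrable (tree_measure b) (\<lambda>x. indicat_real (edge b w) x *\<^sub>R f x)"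
    by (rule integrable_density) auto
  finally show ?thesis by simp
qed

lemma edge_integral:
  fixes f :: "tree_point \<Rightarrow> 'c :: {banach, second_countable_topology}"
  assumes w: "w \<in> lists {..<b}" and [measurable]: "f \<in> borel_measurable (tree_measure b)"
  shows "(LINT x|tree_measure b. indicat_real (edge b w) x *\<^sub>R f x) = (LINT t|unit_lebesgue. f (w, t))"
proof -
  have "(LINT t|unit_lebesgue. f (w, t)) = (LINT x|density (tree_measure b) (\<lambda>x. ennreal (indicat_real (edge b w) x)). f x)"
    unfolding ennreal_indicator distr_edge[OF w, symmetric]
    by (subst integral_distr[OF edge_measurable[OF w]]) auto
  also have "\<dots> = (LINT x|tree_measure b. indicat_real (edge b w) x *\<^sub>R f x)"
    by (rule integral_density) auto
  finally show ?thesis by simp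
qed

lemma edge_nn_integral:
  assumes w: "w \<in> lists {..<b}" and [measurable]: "f \<in> borel_measurable (tree_measure b)"
  shows "(\<integral>\<^sup>+x. indicator (edge b w) x * f x \<partial>tree_measure b) = (\<integral>\<^sup>+t. f (w, t) \<partial>unit_lebesgue)"
proof -
  have "(\<integral>\<^sup>+t. f (w, t) \<partial>unit_lebesgue) = (\<integral>\<^sup>+x. f x \<partial>density (tree_measure b) (indicator (edge b w)))"
    unfolding distr_edge[OF w, symmetric] by (subst nn_integral_distr[OF edge_measurable[OF w]]) auto
  also have "\<dots> = (\<integral>\<^sup>+x. indicator (edge b w) x * f x \<partial>tree_measure b)"
    by (rule nn_integral_density) auto
  finally show ?thesis by simp
qed

text \<open>The tree splits into countably many measurable pieces: the open edges, their end points,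
  the root. On single points every function is measurable, so the open edges alone impose a
  condition.\<close>

lemma tree_borel_measurable_iff:
  fixes f :: "tree_point \<Rightarrow> 'c :: {second_countable_topology, t2_space}"
  shows "f \<in> borel_measurable (tree_measure b) \<longleftrightarrow> (\<forall>w\<in>lists {..<b}. (\<lambda>t. f (w, t)) \<in> borel_measurable unit_lebesgue)"
proof
  assume "f \<in> borel_measurable (tree_measure b)"
  then show "\<forall>w\<in>lists {..<b}. (\<lambda>t. f (w, t)) \<in> borel_measurable unit_lebesgue"
    using measurable_compose[OF edge_measurable] by blast
next
  assume f: "\<forall>w\<in>lists {..<b}. (\<lambda>t. f (w, t)) \<in> borel_measurable unit_lebesgue"
  define C where "C = (\<lambda>w. {w} \<times> {0<..<1::real}) ` lists {..<b} \<union> (\<lambda>w. {(w, 1)}) ` lists {..<b} \<union> {{([], 0)}}"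
  have times: "{w} \<times> A \<in> sets (tree_measure b)" if "A \<in> sets borel" "{w} \<times> A \<subseteq> tree b" for w A
    unfolding sets_tree using that by (auto intro!: pair_measureI)
  have single: "{(w, t)} \<in> sets (tree_measure b)" if "(w, t) \<in> tree b" for w t
    using times[of "{t}" w] that by simp
  show "f \<in> borel_measurable (tree_measure b)"
  proof (rule measurable_piecewise_restrict)
    show "countable C" unfolding C_def by (intro countable_Un countable_image countable_lists) auto
    show "space (tree_measure b) \<subseteq> \<Union>C" by (auto simp: C_def tree_def tree_root_def)
    fix \<Omega> assume "\<Omega> \<in> C"
    have "([], 0) \<in> tree b" "\<And>w. w \<in> lists {..<b} \<Longrightarrow> (w, 1) \<in> tree b" by (auto simp: tree_iff)
    with \<open>\<Omega> \<in> C\<close> consider w where "w \<in> lists {..<b}" "\<Omega> = {w} \<times> {0<..<1}" | x where "x \<in> tree b" "\<Omega> = {x}"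
      unfolding C_def by blast
    then show "\<Omega> \<inter> space (tree_measure b) \<in> sets (tree_measure b)" "f \<in> borel_measurable (restrict_space (tree_measure b) \<Omega>)"
    proof (atomize (full), cases)
      case 1
      then have sub: "\<Omega> \<subseteq> tree b" by (auto simp: tree_iff)
      have S: "\<Omega> \<in> sets (tree_measure b)" using 1 sub by (auto intro!: times)
      have "snd \<in> measurable (restrict_space (tree_measure b) \<Omega>) unit_lebesgue"
      proof (rule measurable_restrict_space2)
        show "snd \<in> space (restrict_space (tree_measure b) \<Omega>) \<rightarrow> {0<..<1}" using 1 by (auto simp: space_restrict_space)
        have "snd \<in> measurable (tree_measure b) lborel" unfolding tree_measure_def
          by (rule measurable_restrict_space1) (rule measurable_snd)
        then show "snd \<in> measurable (restrict_space (tree_measure b) \<Omega>) lborel" by (rule measurable_restrict_space1)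
      qed
      then have "(\<lambda>x. f (w, snd x)) \<in> borel_measurable (restrict_space (tree_measure b) \<Omega>)"
        using measurable_compose[of snd _ unit_lebesgue "\<lambda>t. f (w, t)"] f 1 by auto
      also have "?this \<longleftrightarrow> f \<in> borel_measurable (restrict_space (tree_measure b) \<Omega>)"
        by (rule measurable_cong) (use 1 in \<open>auto simp: space_restrict_space\<close>)
      finally show "\<Omega> \<inter> space (tree_measure b) \<in> sets (tree_measure b) \<and> f \<in> borel_measurable (restrict_space (tree_measure b) \<Omega>)"
        using S sub by (simp add: Int_absorb2)
    next
      case 2
      then have S: "\<Omega> \<in> sets (tree_measure b)" using single by (cases x) auto
      have "(\<lambda>y. f x) \<in> borel_measurable (restrict_space (tree_measure b) \<Omega>)" by simp
      also have "?this \<longleftrightarrow> f \<in> borel_measurable (restrict_space (tree_measure b) \<Omega>)"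
        by (rule measurable_cong) (use 2 in \<open>auto simp: space_restrict_space\<close>)
      finally show "\<Omega> \<inter> space (tree_measure b) \<in> sets (tree_measure b) \<and> f \<in> borel_measurable (restrict_space (tree_measure b) \<Omega>)"
        using S 2 by simp
    qed
  qed
qed

lemma edge_partition:
  assumes "x \<in> tree b"
  shows "(\<Sum>w\<in>words b L. indicat_real (edge b w) x) = (if length (fst x) = L then 1 else 0)"
proof -
  obtain w t where x: "x = (w, t)" by force
  then have w: "w \<in> lists {..<b}" using assms by (auto simp: tree_iff)
  have "(\<Sum>v\<in>words b L. indicat_real (edge b v) x) = (\<Sum>v\<in>words b L. if v = w then 1 else 0)"
    by (rule sum.cong) (use assms in \<open>auto simp: edge_def x indicator_def\<close>)
  also have "\<dots> = (if w \<in> words b L then 1 else 0)" by simp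
  finally show ?thesis using w by (auto simp: words_def x)
qed

text \<open>Summing by generations keeps the inner sums finite, which suits both the orthogonal
  transformations within a generation and the telescoping over generations.\<close>

lemma tree_nn_integral:
  assumes [measurable]: "f \<in> borel_measurable (tree_measure b)"
  shows "(\<integral>\<^sup>+x. f x \<partial>tree_measure b) = (\<Sum>L. \<Sum>w\<in>words b L. \<integral>\<^sup>+t. f (w, t) \<partial>unit_lebesgue)"
proof -
  have "f x = (\<Sum>L. \<Sum>w\<in>words b L. indicator (edge b w) x * f x)" if x: "x \<in> tree b" for x
  proof -
    have "(\<Sum>w\<in>words b L. indicator (edge b w) x * f x) = ennreal (\<Sum>w\<in>words b L. indicat_real (edge b w) x) * f x" for L
      by (simp add: sum_distrib_right sum_nonneg ennreal_indicator flip: sum_ennreal)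
    then have "(\<lambda>L. \<Sum>w\<in>words b L. indicator (edge b w) x * f x) = (\<lambda>L. if L = length (fst x) then f x else 0)"
      unfolding edge_partition[OF x] by auto
    then show ?thesis using sums_single[of "length (fst x)" "\<lambda>_. f x"] by (simp add: sums_iff)
  qed
  then have "(\<integral>\<^sup>+x. f x \<partial>tree_measure b) = (\<integral>\<^sup>+x. (\<Sum>L. \<Sum>w\<in>words b L. indicator (edge b w) x * f x) \<partial>tree_measure b)"
    by (intro nn_integral_cong) simp
  also have "\<dots> = (\<Sum>L. \<integral>\<^sup>+x. (\<Sum>w\<in>words b L. indicator (edge b w) x * f x) \<partial>tree_measure b)"
    by (rule nn_integral_suminf) measurable
  also have "\<dots> = (\<Sum>L. \<Sum>w\<in>words b L. \<integral>\<^sup>+t. f (w, t) \<partial>unit_lebesgue)"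
    by (intro suminf_cong, subst nn_integral_sum) (auto intro!: sum.cong edge_nn_integral dest: wordsD)
  finally show ?thesis .
qed

lemma tree_integral_sums:
  fixes f :: "tree_point \<Rightarrow> 'c :: {banach, second_countable_topology}"
  assumes f: "integrable (tree_measure b) f"
  shows "(\<lambda>L. \<Sum>w\<in>words b L. LINT t|unit_lebesgue. f (w, t)) sums (LINT x|tree_measure b. f x)"
  unfolding sums_def
proof -
  have [measurable]: "f \<in> borel_measurable (tree_measure b)" using f by simp
  define S where "S N x = (\<Sum>L<N. \<Sum>w\<in>words b L. indicat_real (edge b w) x *\<^sub>R f x)" for N x
  have S: "S N x = (if length (fst x) < N then f x else 0)" if "x \<in> tree b" for N x
    unfolding S_def scaleR_left.sum[symmetric] edge_partition[OF that] by (auto simp: if_distrib[of "\<lambda>c. c *\<^sub>R f x"] cong: if_cong)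
  have int: "integrable (tree_measure b) (\<lambda>x. indicat_real (edge b w) x *\<^sub>R f x)" for w
    using f by (intro integrable_mult_indicator edge_sets)
  have "(LINT x|tree_measure b. S N x) = (\<Sum>L<N. \<Sum>w\<in>words b L. LINT t|unit_lebesgue. f (w, t))" for N
  proof -
    have 1: "integrable (tree_measure b) (\<lambda>x. \<Sum>w\<in>words b L. indicat_real (edge b w) x *\<^sub>R f x)" for L
      by (intro Bochner_Integration.integrable_sum int)
    show ?thesis unfolding S_def Bochner_Integration.integral_sum[OF 1] Bochner_Integration.integral_sum[OF int]
      by (intro sum.cong refl edge_integral) (auto dest: wordsD)
  qed
  moreover have "(\<lambda>N. LINT x|tree_measure b. S N x) \<longlonglongrightarrow> (LINT x|tree_measure b. f x)"
  proof (rule integral_dominated_convergence[where w="\<lambda>x. norm (f x)"])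
    show "AE x in tree_measure b. (\<lambda>N. S N x) \<longlonglongrightarrow> f x"
    proof (rule AE_I2)
      fix x assume "x \<in> space (tree_measure b)"
      then have x: "x \<in> tree b" by simp
      have "\<forall>\<^sub>F N in sequentially. S N x = f x"
        using eventually_gt_at_top[of "length (fst x)"] by eventually_elim (simp add: S[OF x])
      then show "(\<lambda>N. S N x) \<longlonglongrightarrow> f x" by (rule tendsto_eventually)
    qed
    show "AE x in tree_measure b. norm (S N x) \<le> norm (f x)" for N by (rule AE_I2) (simp add: S)
    show "S N \<in> borel_measurable (tree_measure b)" for N unfolding S_def by measurable
  qed (use f in auto)
  ultimately show "(\<lambda>N. \<Sum>L<N. \<Sum>w\<in>words b L. LINT t|unit_lebesgue. f (w, t)) \<longlonglongrightarrow> (LINT x|tree_measure b. f x)"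
    by simp
qed

lemma tree_integrable_edge:
  fixes f :: "tree_point \<Rightarrow> 'c :: {banach, second_countable_topology}"
  assumes f: "integrable (tree_measure b) f" and w: "w \<in> lists {..<b}"
  shows "integrable unit_lebesgue (\<lambda>t. f (w, t))"
  using integrable_mult_indicator[OF edge_sets f, of w] edge_integrable_iff[OF w, of f] f by auto

lemma tree_L2_edge:
  assumes f: "f \<in> tree_L2 b" and w: "w \<in> lists {..<b}"
  shows "(\<lambda>t. f (w, t)) \<in> L2 unit_lebesgue"
  using tree_integrable_edge[OF L2_integrable[OF f] w] measurable_compose[OF edge_measurable[OF w] L2_measurable[OF f]]
  by (intro L2_I) auto

section \<open>Continuity on the tree\<close>

text \<open>\<open>edge_ext f w\<close> is \<open>f\<close> on the closed edge \<open>w\<close>: the initial point of \<open>w \<noteq> []\<close> is the end point of the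
  preceding edge.\<close>

definition edge_point :: "nat list \<Rightarrow> real \<Rightarrow> tree_point" where
  "edge_point w t = (if t = 0 \<and> w \<noteq> [] then (butlast w, 1) else (w, t))"

definition edge_ext :: "(tree_point \<Rightarrow> complex) \<Rightarrow> nat list \<Rightarrow> real \<Rightarrow> complex" where
  "edge_ext f w t = f (edge_point w t)"

lemma edge_point_tree: "w \<in> lists {..<b} \<Longrightarrow> t \<in> {0..1} \<Longrightarrow> edge_point w t \<in> tree b"
  by (auto simp: edge_point_def tree_iff dest: in_set_butlastD)

lemma lcp_self: "longest_common_prefix w w = w" for w :: "'c list"
  by (induction w) auto

lemma lcp_snoc: "longest_common_prefix w (w @ [d]) = w" for w :: "'c list"
  by (induction w) auto

lemma tree_dist_same: "s \<in> {0..1} \<Longrightarrow> t \<in> {0..1} \<Longrightarrow> tree_dist (w, s) (w, t) = \<bar>s - t\<bar>"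
  by (auto simp: tree_dist_def tree_meet_height_def tree_height_def lcp_self min_def)

lemma tree_dist_snoc: "s \<in> {0..1} \<Longrightarrow> tree_dist (w, 1) (w @ [d], s) = s"
  by (auto simp: tree_dist_def tree_meet_height_def tree_height_def lcp_snoc min_def)

text \<open>Closed edges are isometric to [0,1], the initial point being a point of the preceding
  edge.\<close>

lemma tree_dist_edge_point:
  assumes "s \<in> {0..1}" "t \<in> {0..1}"
  shows "tree_dist (edge_point w s) (edge_point w t) = \<bar>s - t\<bar>"
proof (cases "w = []")
  case True then show ?thesis using assms by (simp add: edge_point_def tree_dist_same)
next
  case False
  then have w: "w = butlast w @ [last w]" by simp
  have sym: "tree_dist x y = tree_dist y x" for x y
    using Metric_space.commute[OF Metric_space_tree] by blast
  consider "s = 0" "t = 0" | "s = 0" "t \<noteq> 0" | "s \<noteq> 0" "t = 0" | "s \<noteq> 0" "t \<noteq> 0" by blast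
  then show ?thesis
  proof cases
    case 2
    then show ?thesis using False assms tree_dist_snoc[of t "butlast w" "last w"] by (simp add: edge_point_def)
  next
    case 3
    then show ?thesis using False assms tree_dist_snoc[of s "butlast w" "last w"] by (simp add: edge_point_def sym[of "(w, s)"])
  qed (use assms in \<open>auto simp: edge_point_def tree_dist_same\<close>)
qed

text \<open>A small ball around a point meets only its own edge, or at a vertex also the edges
  emanating from it: leaving through the initial point costs \<open>t\<close>, through the end point
  \<open>1 - t\<close>.\<close>

lemma tree_dist_near:
  assumes x: "(w, t) \<in> tree b" "t > 0" and y: "(w', s) \<in> tree b"
    and d: "tree_dist (w, t) (w', s) < t" "t < 1 \<Longrightarrow> tree_dist (w, t) (w', s) < 1 - t"
  shows "w' = w \<or> t = 1 \<and> (\<exists>d<b. w' = w @ [d])"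
proof -
  let ?c = "longest_common_prefix w w'"
  have t: "0 < t" "t \<le> 1" using x by (auto simp: tree_iff)
  have s: "0 < s \<and> s \<le> 1 \<or> w' = [] \<and> s = 0" and w': "w' \<in> lists {..<b}" using y by (auto simp: tree_iff)
  have le: "length ?c \<le> length w" "length ?c \<le> length w'" by (rule length_lcp_le)+
  have dist: "tree_dist (w, t) (w', s) = (real (length w) + t) + (real (length w') + s)
     - 2 * min (min (real (length w) + t) (real (length w') + s)) (real (length ?c) + 1)"
    by (simp add: tree_dist_def tree_meet_height_def tree_height_def)
  \<comment> \<open>If the paths separated before the end of \<open>w\<close>, the distance would be
    at least \<open>t\<close>.\<close>
  have "length ?c = length w"
  proof (rule ccontr)
    assume "length ?c \<noteq> length w"
    then have "real (length ?c) + 1 \<le> real (length w)" using le by linarith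
    then have "tree_dist (w, t) (w', s) \<ge> t" unfolding dist using t s by (auto simp: min_def split: if_splits)
    then show False using d by simp
  qed
  then have "prefix w w'" using longest_common_prefix_prefix1[of w w'] longest_common_prefix_prefix2[of w w']
    by (metis append_Nil2 append_eq_append_conv prefix_def)
  then obtain u where u: "w' = w @ u" by (auto simp: prefix_def)
  show ?thesis
  proof (cases "u = []")
    case False
    then have s0: "s > 0" using s u by auto
    have len: "length w' = length w + length u" using u by simp
    have "length u \<ge> 1" using False by (cases u) auto
    then have l1: "real (length w') \<ge> real (length w) + 1" using len by linarith
    have ge: "tree_dist (w, t) (w', s) \<ge> (real (length w') + s) - (real (length w) + t)"
      unfolding dist by (auto simp: min_def)
    have t1: "t = 1"
    proof (rule ccontr)
      assume "t \<noteq> 1"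
      then show False using d(2) t ge l1 s0 by linarith
    qed
    have "length u = 1"
    proof (rule ccontr)
      assume "length u \<noteq> 1"
      then have "real (length w') \<ge> real (length w) + 2" using len \<open>length u \<ge> 1\<close> by linarith
      then show False using d(1) t1 ge s0 by linarith
    qed
    then obtain d where "u = [d]" by (cases u) auto
    then show ?thesis using t1 u w' by auto
  qed (use u in simp)
qed

text \<open>Turns the metric topology into edgewise continuity, where the value at the start of an
  edge is the one at the preceding vertex.\<close>

lemma tree_continuous_iff:
  "continuous_map (tree_topology b) euclidean f \<longleftrightarrow> (\<forall>w\<in>lists {..<b}. continuous_on {0..1} (edge_ext f w))"
proof -
  interpret T: Metric_space "tree b" tree_dist by (rule Metric_space_tree)
  have ed: "continuous_map (tree_topology b) euclidean f \<longleftrightarrow>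
     (\<forall>a\<in>tree b. \<forall>e>0. \<exists>d>0. \<forall>x. x \<in> tree b \<and> tree_dist a x < d \<longrightarrow> dist (f a) (f x) < e)"
    unfolding tree_topology_def mtopology_is_euclidean[symmetric]
    by (subst T.metric_continuous_map[OF Met_TC.Metric_space_axioms]) auto
  show ?thesis
  proof
    assume c: "continuous_map (tree_topology b) euclidean f"
    show "\<forall>w\<in>lists {..<b}. continuous_on {0..1} (edge_ext f w)"
    proof
      fix w assume w: "w \<in> lists {..<b}"
      show "continuous_on {0..1} (edge_ext f w)"
        unfolding continuous_on_iff
      proof (intro ballI allI impI)
        fix t e :: real assume t: "t \<in> {0..1}" and "e > 0"
        with c obtain d where d: "d > 0" "\<And>x. x \<in> tree b \<Longrightarrow> tree_dist (edge_point w t) x < d \<Longrightarrow> dist (f (edge_point w t)) (f x) < e"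
          unfolding ed using edge_point_tree[OF w t] by meson
        show "\<exists>d>0. \<forall>s\<in>{0..1}. dist s t < d \<longrightarrow> dist (edge_ext f w s) (edge_ext f w t) < e"
        proof (intro exI[of _ d] conjI ballI impI d(1))
          fix s :: real assume s: "s \<in> {0..1}" "dist s t < d"
          then have "tree_dist (edge_point w t) (edge_point w s) < d"
            using tree_dist_edge_point[OF t s(1), of w] by (simp add: dist_real_def abs_minus_commute)
          then show "dist (edge_ext f w s) (edge_ext f w t) < e"
            using d(2)[OF edge_point_tree[OF w s(1)]] by (simp add: edge_ext_def dist_commute)
        qed
      qed
    qed
  next
    assume c: "\<forall>w\<in>lists {..<b}. continuous_on {0..1} (edge_ext f w)"
    have cd: "\<exists>d>0. \<forall>s\<in>{0..1}. \<bar>s - t\<bar> < d \<longrightarrow> dist (edge_ext f w s) (edge_ext f w t) < e"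
      if "w \<in> lists {..<b}" "t \<in> {0..1}" "e > 0" for w t e
      using c that unfolding continuous_on_iff dist_real_def by blast
    show "continuous_map (tree_topology b) euclidean f"
      unfolding ed
    proof (intro ballI allI impI)
      fix a and e :: real assume "a \<in> tree b" and e: "e > 0"
      then obtain w t where a: "a = (w, t)" and w: "w \<in> lists {..<b}" and t: "0 < t \<and> t \<le> 1 \<or> w = [] \<and> t = 0"
        by (elim tree_cases)
      have at: "(w, t) \<in> tree b" using \<open>a \<in> tree b\<close> a by simp
      have t01: "t \<in> {0..1}" using t by auto
      obtain d0 where d0: "d0 > 0" "\<And>s. s \<in> {0..1} \<Longrightarrow> \<bar>s - t\<bar> < d0 \<Longrightarrow> dist (edge_ext f w s) (edge_ext f w t) < e"
        using cd[OF w t01 e] by blast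
      have ea: "edge_ext f w t = f (w, t)" using t by (auto simp: edge_ext_def edge_point_def)
      have es: "edge_ext f w' s = f (w', s)" if "(w', s) \<in> tree b" for w' s
        using that by (auto simp: edge_ext_def edge_point_def tree_iff)
      show "\<exists>d>0. \<forall>x. x \<in> tree b \<and> tree_dist a x < d \<longrightarrow> dist (f a) (f x) < e"
      proof (cases "t = 0")
        case True
        then have w0: "w = []" using t by auto
        show ?thesis
        proof (intro exI[of _ "min 1 d0"] conjI allI impI)
          fix x assume x: "x \<in> tree b \<and> tree_dist a x < min 1 d0"
          obtain w' s where x': "x = (w', s)" by force
          then have s: "0 < s \<and> s \<le> 1 \<or> w' = [] \<and> s = 0" "(w', s) \<in> tree b" using x by (auto simp: tree_iff)
          have "tree_dist a x = real (length w') + s"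
            using s by (auto simp: a x' w0 True tree_dist_def tree_meet_height_def tree_height_def min_def)
          then have "real (length w') + s < 1" "real (length w') + s < d0" using x by auto
          moreover have "0 \<le> s" using s by auto
          ultimately have "real (length w') < 1" by linarith
          then have "w' = []" by simp
          then have "\<bar>s - t\<bar> < d0" "s \<in> {0..1}" using \<open>real (length w') + s < d0\<close> s True by auto
          with \<open>w' = []\<close> show "dist (f a) (f x) < e" using d0(2)[of s] es[OF s(2)] ea by (simp add: a x' w0 dist_commute)
        qed (use d0 in auto)
      next
        case False
        then have t0: "t > 0" using t by auto
        have "\<exists>d>0. \<forall>s\<in>{0..1}. \<bar>s - 0\<bar> < d \<longrightarrow> dist (edge_ext f (w @ [i]) s) (edge_ext f (w @ [i]) 0) < e" if "i < b" for i
          by (rule cd) (use w that e in auto)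
        then obtain D where D: "\<And>i. i < b \<Longrightarrow> D i > 0"
          "\<And>i s. i < b \<Longrightarrow> s \<in> {0..1} \<Longrightarrow> \<bar>s\<bar> < D i \<Longrightarrow> dist (edge_ext f (w @ [i]) s) (edge_ext f (w @ [i]) 0) < e"
          by (simp only: diff_0_right) metis
        \<comment> \<open>Finite branching allows one radius for all emanating edges.\<close>
        define d1 where "d1 = Min (insert 1 (D ` {..<b}))"
        have d1: "d1 > 0" "\<And>i. i < b \<Longrightarrow> d1 \<le> D i" unfolding d1_def using D(1) by (auto intro: Min_le)
        \<comment> \<open>The second minimum meets the hypotheses of \<open>tree_dist_near\<close>;
          the value 1 stands in when \<open>t = 1\<close>.\<close>
        define d where "d = min (min d0 d1) (min t (if t < 1 then 1 - t else 1))"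
        show ?thesis
        proof (intro exI[of _ d] conjI allI impI)
          show "d > 0" using d0 d1 t0 by (auto simp: d_def)
          fix x assume x: "x \<in> tree b \<and> tree_dist a x < d"
          obtain w' s where x': "x = (w', s)" by force
          then have s: "(w', s) \<in> tree b" "s \<in> {0..1}" using x by (auto simp: tree_iff)
          have "w' = w \<or> t = 1 \<and> (\<exists>d<b. w' = w @ [d])"
            by (rule tree_dist_near[OF at t0 s(1)]) (use x in \<open>auto simp: d_def a x' split: if_splits\<close>)
          then show "dist (f a) (f x) < e"
          proof (elim disjE conjE exE)
            assume eq: "w' = w"
            have "\<bar>s - t\<bar> < d0" using x tree_dist_same[OF t01 s(2), of w] by (auto simp: a x' eq d_def)
            then show ?thesis using d0(2)[OF s(2)] es[OF s(1)] ea by (simp add: a x' eq dist_commute)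
          next
            fix i assume t1: "t = 1" and i: "i < b" and eq: "w' = w @ [i]"
            have "s < d1" using x tree_dist_snoc[OF s(2), of w i] by (auto simp: a x' eq t1 d_def)
            then have "dist (edge_ext f (w @ [i]) s) (edge_ext f (w @ [i]) 0) < e"
              using d1(2)[OF i] s(2) by (intro D(2)[OF i]) auto
            moreover have "edge_ext f (w @ [i]) 0 = f (w, 1)" by (simp add: edge_ext_def edge_point_def)
            ultimately show ?thesis using es[OF s(1)] by (simp add: a x' eq t1 dist_commute)
          qed
        qed
      qed
    qed
  qed
qed

section \<open>The Dirichlet Laplacian on piecewise regular functions\<close>

text \<open>After integration by parts on every edge, the terms at the ends of one generation cancel
  those at the start of the next, by continuity of the test function and the Kirchhoff condition;
  what remains is a boundary term tending to 0. For nonempty \<open>w\<close> the pair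
  \<open>(w, 0)\<close> lies outside the tree, and \<open>u (w, 0)\<close> serves as the limit of
  \<open>u\<close> along the edge.\<close>

lemma dirichlet_domainI:
  fixes u u1 u2 :: "tree_point \<Rightarrow> complex"
  assumes P1: "\<And>w. w \<in> lists {..<b} \<Longrightarrow> primitive (\<lambda>t. u (w, t)) (\<lambda>t. u1 (w, t))"
    and P2: "\<And>w. w \<in> lists {..<b} \<Longrightarrow> primitive (\<lambda>t. u1 (w, t)) (\<lambda>t. u2 (w, t))"
    and L: "u \<in> tree_L2 b" "u1 \<in> tree_L2 b" "u2 \<in> tree_L2 b"
    and root: "u ([], 0) = 0"
    and cont: "\<And>w d. w \<in> lists {..<b} \<Longrightarrow> d < b \<Longrightarrow> u (w @ [d], 0) = u (w, 1)"
    and Kirchhoff: "\<And>w. w \<in> lists {..<b} \<Longrightarrow> (\<Sum>d<b. u1 (w @ [d], 0)) = u1 (w, 1)"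
  shows "(u, \<lambda>x. - u2 x) \<in> dirichlet_laplacian b"
proof -
  let ?M = "tree_measure b"
  have u1e: "(\<lambda>t. u1 (w, t)) \<in> L2 unit_lebesgue" if "w \<in> lists {..<b}" for w by (rule tree_L2_edge[OF L(2) that])
  have u2e: "(\<lambda>t. u2 (w, t)) \<in> L2 unit_lebesgue" if "w \<in> lists {..<b}" for w by (rule tree_L2_edge[OF L(3) that])
  note H1u = primitive_H1[OF P1 u1e]
  have Du: "tree_derivative u \<in> L2 ?M"
  proof -
    have m: "tree_derivative u \<in> borel_measurable ?M"
      unfolding tree_borel_measurable_iff using H1u(3) by (auto simp: tree_derivative_def dest: L2_measurable)
    have [measurable]: "tree_derivative u \<in> borel_measurable ?M" "u1 \<in> borel_measurable ?M" using m L by (auto simp: L2_def)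
    have "(\<integral>\<^sup>+x. ennreal ((cmod (tree_derivative u x))^2) \<partial>?M) = (\<integral>\<^sup>+x. ennreal ((cmod (u1 x))^2) \<partial>?M)"
      unfolding tree_nn_integral[of "\<lambda>x. ennreal ((cmod (tree_derivative u x))^2)" b, simplified]
        tree_nn_integral[of "\<lambda>x. ennreal ((cmod (u1 x))^2)" b, simplified]
    proof (intro suminf_cong sum.cong refl nn_integral_cong_AE)
      fix n w assume "w \<in> words b n"
      then have "AE t in unit_lebesgue. weak_derivative (\<lambda>s. u (w, s)) t = u1 (w, t)" by (intro H1u(2)) (auto dest: wordsD)
      then show "AE t in unit_lebesgue. ennreal ((cmod (tree_derivative u (w, t)))^2) = ennreal ((cmod (u1 (w, t)))^2)"
        by eventually_elim (simp add: tree_derivative_def)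
    qed
    also have "\<dots> = ennreal ((l2_norm ?M u1)^2)" by (rule nn_integral_sq_eq[OF L(2)])
    finally show ?thesis using L2_of_nn_integral(1)[OF m, of "l2_norm ?M u1"] by simp
  qed
  have uH: "u \<in> H10 b"
    unfolding H10_def
  proof (intro CollectI conjI ballI)
    show "continuous_map (tree_topology b) euclidean u"
      unfolding tree_continuous_iff
    proof
      fix w assume w: "w \<in> lists {..<b}"
      have "edge_ext u w t = u (w, t)" if "t \<in> {0..1}" for t
      proof (cases "t = 0 \<and> w \<noteq> []")
        case True
        then have "w = butlast w @ [last w]" by simp
        moreover have "butlast w \<in> lists {..<b}" using w by (auto dest: in_set_butlastD)
        moreover have "last w < b" using w True by (auto dest: last_in_set)
        ultimately show ?thesis using True cont[of "butlast w" "last w"] by (simp add: edge_ext_def edge_point_def)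
      qed (auto simp: edge_ext_def edge_point_def)
      then have "continuous_on {0..1} (edge_ext u w) \<longleftrightarrow> continuous_on {0..1} (\<lambda>t. u (w, t))"
        by (intro continuous_on_cong) auto
      then show "continuous_on {0..1} (edge_ext u w)" using primitive_continuous[OF P1[OF w]] by simp
    qed
    show "(\<lambda>t. u (w, t)) \<in> H1_unit" if "w \<in> lists {..<b}" for w by (rule H1u(1)[OF that that])
    show "integrable ?M (\<lambda>x. (cmod (tree_derivative u x))^2 + (cmod (u x))^2)"
      by (intro Bochner_Integration.integrable_add L2_integrable Du L)
    show "u tree_root = 0" using root by (simp add: tree_root_def)
  qed
  have form: "dirichlet_form b u v = l2_inner ?M (\<lambda>x. - u2 x) v" if v: "v \<in> H10 b" for v
  proof -
    have vc: "\<And>w. w \<in> lists {..<b} \<Longrightarrow> continuous_on {0..1} (edge_ext v w)"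
      and vH: "\<And>w. w \<in> lists {..<b} \<Longrightarrow> (\<lambda>t. v (w, t)) \<in> H1_unit"
      and vi: "integrable ?M (\<lambda>x. (cmod (tree_derivative v x))^2 + (cmod (v x))^2)"
      and v0: "v ([], 0) = 0"
      using v unfolding H10_def tree_continuous_iff by (auto simp: tree_root_def)
    define v1 where "v1 w = weak_derivative (\<lambda>t. v (w, t))" for w
    have v1L: "v1 w \<in> L2 unit_lebesgue" if "w \<in> lists {..<b}" for w
      unfolding v1_def by (rule H1_unit_weak_derivative(1)[OF vH[OF that]])
    have ev: "edge_ext v w t = v (w, t)" if "t > 0" for w t using that by (simp add: edge_ext_def edge_point_def)
    have vP: "primitive (edge_ext v w) (v1 w)" if w: "w \<in> lists {..<b}" for w
    proof (rule weak_derivative_primitive[OF vc[OF w] v1L[OF w]])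
      show "has_weak_derivative (edge_ext v w) (v1 w)"
        by (rule H1_unit_cong_weak[OF _ H1_unit_weak_derivative(2)[OF vH[OF w], folded v1_def]]) (simp add: ev)
    qed
    have vm: "v \<in> borel_measurable ?M" unfolding tree_borel_measurable_iff using vH by (auto simp: H1_unit_def L2_def)
    have Dvm: "tree_derivative v \<in> borel_measurable ?M"
      unfolding tree_borel_measurable_iff using v1L by (auto simp: tree_derivative_def v1_def L2_def)
    note [measurable] = vm Dvm
    have vL: "v \<in> L2 ?M" by (rule L2_I[OF vm], rule Bochner_Integration.integrable_bound[OF vi]) auto
    have DvL: "tree_derivative v \<in> L2 ?M" by (rule L2_I[OF Dvm], rule Bochner_Integration.integrable_bound[OF vi]) auto
    define B where "B n = (\<Sum>w\<in>words b n. u1 (w, 1) * cnj (v (w, 1)))" for n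
    \<comment> \<open>\<open>v\<close> carries no information at \<open>(w, 0)\<close> for nonempty
      \<open>w\<close>, so the initial value is read off from \<open>edge_ext\<close>.\<close>
    define B' where "B' n = (\<Sum>w\<in>words b n. u1 (w, 0) * cnj (edge_ext v w 0))" for n
    define S where "S n = (\<Sum>w\<in>words b n. LINT t|unit_lebesgue. tree_derivative u (w, t) * cnj (tree_derivative v (w, t)))" for n
    define H where "H n = (\<Sum>w\<in>words b n. LINT t|unit_lebesgue. - u2 (w, t) * cnj (v (w, t)))" for n
    have S_sums: "S sums dirichlet_form b u v"
      unfolding S_def dirichlet_form_def by (rule tree_integral_sums) (rule L2_mult_integrable[OF Du DvL])
    have mu2: "(\<lambda>x. - u2 x) \<in> L2 ?M" using L2_scale[OF L(3), of "-1"] by simp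
    have H_sums: "H sums l2_inner ?M (\<lambda>x. - u2 x) v"
      unfolding H_def l2_inner_def by (rule tree_integral_sums) (rule L2_mult_integrable[OF mu2 vL])
    have edge: "(LINT t|unit_lebesgue. tree_derivative u (w, t) * cnj (tree_derivative v (w, t)))
        = u1 (w, 1) * cnj (v (w, 1)) - u1 (w, 0) * cnj (edge_ext v w 0) + (LINT t|unit_lebesgue. - u2 (w, t) * cnj (v (w, t)))"
      if w: "w \<in> lists {..<b}" for w
    proof -
      have [measurable]: "weak_derivative (\<lambda>s. u (w, s)) \<in> borel_measurable unit_lebesgue" "v1 w \<in> borel_measurable unit_lebesgue"
        "(\<lambda>t. u1 (w, t)) \<in> borel_measurable unit_lebesgue"
        using H1u(3)[OF w w] v1L[OF w] u1e[OF w] by (auto simp: L2_def)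
      have "(LINT t|unit_lebesgue. tree_derivative u (w, t) * cnj (tree_derivative v (w, t)))
          = (LINT t|unit_lebesgue. cnj (v1 w t) * u1 (w, t))"
      proof (rule integral_cong_AE)
        show "AE t in unit_lebesgue. tree_derivative u (w, t) * cnj (tree_derivative v (w, t)) = cnj (v1 w t) * u1 (w, t)"
          using H1u(2)[OF w w] by eventually_elim (simp add: tree_derivative_def v1_def)
      qed (simp_all add: tree_derivative_def v1_def[symmetric])
      also have "\<dots> = cnj (edge_ext v w 1) * u1 (w, 1) - cnj (edge_ext v w 0) * u1 (w, 0)
          - (LINT t|unit_lebesgue. cnj (edge_ext v w t) * u2 (w, t))"
        by (rule integration_by_parts_unit[OF primitive_cnj[OF vP[OF w]] P2[OF w]])
      also have "(LINT t|unit_lebesgue. cnj (edge_ext v w t) * u2 (w, t)) = - (LINT t|unit_lebesgue. - u2 (w, t) * cnj (v (w, t)))"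
        by (subst Bochner_Integration.integral_minus[symmetric], intro Bochner_Integration.integral_cong) (auto simp: ev)
      finally show ?thesis by (simp add: ev mult.commute)
    qed
    have SBH: "S n = B n - B' n + H n" for n
      unfolding S_def B_def B'_def H_def sum_subtractf[symmetric] sum.distrib[symmetric]
      by (intro sum.cong refl edge) (auto dest: wordsD)
    have B'0: "B' 0 = 0" using v0 by (simp add: B'_def edge_ext_def edge_point_def)
    have B'S: "B' (Suc n) = B n" for n
    proof -
      have "B' (Suc n) = (\<Sum>w\<in>words b n. (\<Sum>d<b. u1 (w @ [d], 0)) * cnj (v (w, 1)))"
        unfolding B'_def sum_words_Suc_snoc by (simp add: edge_ext_def edge_point_def sum_distrib_right)
      also have "\<dots> = B n" unfolding B_def
        by (intro sum.cong refl) (simp only: Kirchhoff[OF wordsD(1)])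
      finally show ?thesis .
    qed
    \<comment> \<open>The start of generation \<open>k + 1\<close> cancels the end of generation
      \<open>k\<close>; only the last ends survive.\<close>
    have tele: "(\<Sum>k<Suc n. S k) = B n + (\<Sum>k<Suc n. H k)" for n
      by (induction n) (auto simp: SBH B'0 B'S)
    \<comment> \<open>A summable majorant: \<open>trace_inequality\<close> for \<open>u1\<close> and
      for \<open>v\<close> bounds the boundary term by edge norms, and the terms of a convergent
      series tend to 0.\<close>
    define Z where "Z n = (\<Sum>w\<in>words b n. (LINT t|unit_lebesgue. (cmod (u1 (w, t)))^2) + (LINT t|unit_lebesgue. (cmod (u2 (w, t)))^2)
        + (LINT t|unit_lebesgue. (cmod (v (w, t)))^2) + (LINT t|unit_lebesgue. (cmod (tree_derivative v (w, t)))^2))" for n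
    have "summable Z"
      unfolding Z_def sum.distrib
      by (intro summable_add sums_summable[OF tree_integral_sums] L2_integrable L vL DvL)
    then have "(\<lambda>n. 2 * Z n) \<longlonglongrightarrow> 2 * 0" by (intro tendsto_intros summable_LIMSEQ_zero)
    then have Z0: "(\<lambda>n. 2 * Z n) \<longlonglongrightarrow> 0" by simp
    have BZ: "cmod (B n) \<le> 2 * Z n" for n
    proof -
      have "cmod (B n) \<le> (\<Sum>w\<in>words b n. cmod (u1 (w, 1) * cnj (v (w, 1))))" unfolding B_def by (rule norm_sum)
      also have "\<dots> \<le> (\<Sum>w\<in>words b n. 2 * ((LINT t|unit_lebesgue. (cmod (u1 (w, t)))^2) + (LINT t|unit_lebesgue. (cmod (u2 (w, t)))^2)
        + (LINT t|unit_lebesgue. (cmod (v (w, t)))^2) + (LINT t|unit_lebesgue. (cmod (tree_derivative v (w, t)))^2)))"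
      proof (rule sum_mono)
        fix w assume "w \<in> words b n"
        then have w: "w \<in> lists {..<b}" by (rule wordsD)
        have 1: "(cmod (u1 (w, 1)))^2 \<le> 2 * (LINT t|unit_lebesgue. (cmod (u1 (w, t)))^2) + 2 * (LINT t|unit_lebesgue. (cmod (u2 (w, t)))^2)"
          using trace_inequality[OF P2[OF w] u2e[OF w]] by (simp add: l2_norm_power2)
        have "(LINT t|unit_lebesgue. (cmod (edge_ext v w t))^2) = (LINT t|unit_lebesgue. (cmod (v (w, t)))^2)"
          by (intro Bochner_Integration.integral_cong) (auto simp: ev)
        then have 2: "(cmod (v (w, 1)))^2 \<le> 2 * (LINT t|unit_lebesgue. (cmod (v (w, t)))^2) + 2 * (LINT t|unit_lebesgue. (cmod (tree_derivative v (w, t)))^2)"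
          using trace_inequality[OF vP[OF w] v1L[OF w]] by (simp add: l2_norm_power2 ev v1_def tree_derivative_def)
        have "2 * (cmod (u1 (w, 1)) * cmod (v (w, 1))) \<le> (cmod (u1 (w, 1)))^2 + (cmod (v (w, 1)))^2"
          using sum_squares_bound[of "cmod (u1 (w, 1))" "cmod (v (w, 1))"] by simp
        moreover have "0 \<le> cmod (u1 (w, 1)) * cmod (v (w, 1))" by simp
        ultimately have "cmod (u1 (w, 1)) * cmod (v (w, 1)) \<le> (cmod (u1 (w, 1)))^2 + (cmod (v (w, 1)))^2" by linarith
        from order_trans[OF this add_mono[OF 1 2]] show "cmod (u1 (w, 1) * cnj (v (w, 1))) \<le> 2 * ((LINT t|unit_lebesgue. (cmod (u1 (w, t)))^2) + (LINT t|unit_lebesgue. (cmod (u2 (w, t)))^2)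
        + (LINT t|unit_lebesgue. (cmod (v (w, t)))^2) + (LINT t|unit_lebesgue. (cmod (tree_derivative v (w, t)))^2))"
          by (simp only: norm_mult complex_mod_cnj distrib_left add.assoc)
      qed
      also have "\<dots> = 2 * Z n" unfolding Z_def sum_distrib_left ..
      finally show ?thesis .
    qed
    have B0: "B \<longlonglongrightarrow> 0"
      by (rule Lim_null_comparison[OF always_eventually Z0]) (use BZ in blast)
    have lim: "(\<lambda>n. \<Sum>k<Suc n. S k) \<longlonglongrightarrow> dirichlet_form b u v" "(\<lambda>n. \<Sum>k<Suc n. H k) \<longlonglongrightarrow> l2_inner ?M (\<lambda>x. - u2 x) v"
      using S_sums H_sums unfolding sums_def by (auto intro: LIMSEQ_Suc simp del: sum.lessThan_Suc)
    have "(\<lambda>n. B n + (\<Sum>k<Suc n. H k)) \<longlonglongrightarrow> 0 + l2_inner ?M (\<lambda>x. - u2 x) v"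
      by (intro tendsto_add B0 lim)
    then have "(\<lambda>n. \<Sum>k<Suc n. S k) \<longlonglongrightarrow> l2_inner ?M (\<lambda>x. - u2 x) v" unfolding tele by simp
    then show ?thesis using lim(1) LIMSEQ_unique by blast
  qed
  show ?thesis
    unfolding dirichlet_laplacian_def form_operator_def
    using L uH form L2_scale[OF L(3), of "-1"] by (auto intro!: bexI[of _ u])
qed

section \<open>Orthogonal decomposition over the words\<close>

text \<open>The Householder reflection of \<open>\<real>\<^sup>b\<close> exchanging the first unit vector and the constant unit vector.\<close>

definition chi :: "nat \<Rightarrow> nat \<Rightarrow> nat \<Rightarrow> real" where
  "chi b c d = of_bool (c = d) - (of_bool (c = 0) - 1 / sqrt b) * (of_bool (d = 0) - 1 / sqrt b) / (1 - 1 / sqrt b)"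

lemma chi_sym: "chi b c d = chi b d c"
  by (auto simp: chi_def)

lemma sqrt_b: assumes "b \<ge> 2" shows "sqrt (real b) > 1" "1 - 1 / sqrt (real b) > 0" "1 / sqrt (real b) * (1 / sqrt (real b)) = 1 / real b"
proof -
  show "sqrt (real b) > 1" using assms by simp
  then show "1 - 1 / sqrt (real b) > 0" by (simp add: field_simps)
  show "1 / sqrt (real b) * (1 / sqrt (real b)) = 1 / real b" using assms by simp
qed

lemma chi_0: assumes "b \<ge> 2" shows "chi b 0 d = 1 / sqrt b"
  using sqrt_b[OF assms] by (simp add: chi_def)

lemma chi_orth:
  assumes b: "b \<ge> 2" and "c < b" "d < b"
  shows "(\<Sum>e<b. chi b c e * chi b d e) = of_bool (c = d)"
proof -
  define r where "r = 1 / sqrt (real b)"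
  have r: "1 - r > 0" "r * r = 1 / real b" using sqrt_b[OF b] by (auto simp: r_def)
  define v where "v e = of_bool (e = 0) - r" for e :: nat
  define \<beta> where "\<beta> = 1 / (1 - r)"
  have delta: "(\<Sum>e<b. of_bool (c = e) * f e) = f c" if "c < b" for f :: "nat \<Rightarrow> real" and c
  proof -
    have "(\<Sum>e<b. of_bool (c = e) * f e) = (\<Sum>e<b. if e = c then f e else 0)" by (intro sum.cong) auto
    then show ?thesis using that by simp
  qed
  \<comment> \<open>\<open>chi\<close> is \<open>1 - \<beta> v v^T\<close>; it is an orthogonal
    reflection because \<open>\<beta> = 2 / |v|^2\<close>.\<close>
  have "(\<Sum>e<b. v e * v e) = (\<Sum>e<b. of_bool (0 = e) * (1 - 2 * r) + r * r)"
    by (intro sum.cong) (auto simp: v_def algebra_simps)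
  also have "\<dots> = (1 - 2 * r) + real b * (r * r)" using b by (simp add: sum.distrib delta)
  also have "\<dots> = 2 * (1 - r)" using r b by simp
  finally have vv: "(\<Sum>e<b. v e * v e) = 2 * (1 - r)" .
  have "(\<Sum>e<b. chi b c e * chi b d e) = (\<Sum>e<b. of_bool (c = e) * of_bool (d = e) - of_bool (c = e) * (\<beta> * v d * v e)
      - of_bool (d = e) * (\<beta> * v c * v e) + \<beta> * \<beta> * v c * v d * (v e * v e))"
    by (intro sum.cong refl) (simp add: chi_def v_def[symmetric] r_def[symmetric] \<beta>_def algebra_simps)
  also have "\<dots> = of_bool (d = c) - \<beta> * v d * v c - \<beta> * v c * v d + \<beta> * \<beta> * v c * v d * (2 * (1 - r))"
    using assms by (simp only: sum.distrib sum_subtractf delta sum_distrib_left[symmetric] vv)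
  also have "\<beta> * \<beta> * v c * v d * (2 * (1 - r)) = 2 * (\<beta> * (1 - r)) * (\<beta> * v c * v d)"
    by (simp only: mult_ac)
  also have "\<beta> * (1 - r) = 1" using r by (simp add: \<beta>_def)
  finally show ?thesis by (auto simp: mult_ac)
qed

text \<open>Row 0 is constant, so this is orthogonality to row 0.\<close>

lemma chi_sum: assumes b: "b \<ge> 2" and c: "c < b" "c \<noteq> 0" shows "(\<Sum>d<b. chi b c d) = 0"
proof -
  have "(\<Sum>d<b. chi b c d) * (1 / sqrt b) = (\<Sum>d<b. chi b c d * chi b 0 d)"
    unfolding chi_0[OF b] sum_distrib_right ..
  also have "\<dots> = 0" using chi_orth[OF b c(1), of 0] b c by simp
  finally show ?thesis using b by simp
qed

text \<open>Row \<open>q = p @ 0\<^sup>k\<close>, with \<open>p\<close> not ending in \<open>0\<close>, is supported on the words below the parent of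
  \<open>p\<close>; along \<open>k\<close> it is spread evenly over the generations.\<close>

fun eps :: "nat \<Rightarrow> nat list \<Rightarrow> nat list \<Rightarrow> real" where
  "eps b [] [] = 1"
| "eps b (c # q) (d # w) = (if set q \<subseteq> {0} then chi b c d else of_bool (c = d)) * eps b q w"
| "eps b _ _ = 0"

lemma sum_of_bool_eq: "c < b \<Longrightarrow> (\<Sum>d<b. of_bool (c = d) * of_bool (c' = d)) = (of_bool (c = c') :: real)"
  for b c c' :: nat
proof -
  assume "c < b"
  have "(\<Sum>d<b. of_bool (c = d) * of_bool (c' = d)) = (\<Sum>d<b. if d = c then of_bool (c = c') else 0 :: real)"
    by (intro sum.cong) auto
  then show ?thesis using \<open>c < b\<close> by simp
qed

text \<open>Induction on the first letter: rows with different tails are orthogonal already, and for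
  equal tails the first letters are transformed by one orthogonal matrix.\<close>

lemma eps_rows:
  assumes b: "b \<ge> 2" and "q \<in> words b L" "q' \<in> words b L"
  shows "(\<Sum>w\<in>words b L. eps b q w * eps b q' w) = of_bool (q = q')"
  using assms(2,3)
proof (induction L arbitrary: q q')
  case (Suc L)
  obtain c r where q: "q = c # r" "c < b" "r \<in> words b L" using Suc.prems(1) by (auto simp: words_Suc_Cons)
  obtain c' r' where q': "q' = c' # r'" "c' < b" "r' \<in> words b L" using Suc.prems(2) by (auto simp: words_Suc_Cons)
  define A where "A r c d = (if set r \<subseteq> {0} then chi b c d else of_bool (c = d))" for r :: "nat list" and c d
  have A: "(\<Sum>d<b. A r c d * A r c' d) = of_bool (c = c')"
    using chi_orth[OF b q(2) q'(2)] sum_of_bool_eq[OF q(2), of c'] by (cases "set r \<subseteq> {0}") (simp_all add: A_def)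
  have "(\<Sum>w\<in>words b (Suc L). eps b q w * eps b q' w) = (\<Sum>d<b. \<Sum>w\<in>words b L. (A r c d * A r' c' d) * (eps b r w * eps b r' w))"
    unfolding sum_words_Suc_Cons by (intro sum.cong refl) (simp add: q q' A_def mult_ac)
  also have "\<dots> = (\<Sum>d<b. A r c d * A r' c' d) * of_bool (r = r')"
    by (simp only: sum_distrib_left[symmetric] sum_distrib_right[symmetric] Suc.IH[OF q(3) q'(3)])
  also have "\<dots> = of_bool (q = q')" using A by (auto simp: q q')
  finally show ?case .
qed simp

text \<open>The matrix acting on the first letter depends on the remaining word, so the sum over the
  first letter is carried out first, for each fixed tail.\<close>

lemma eps_cols:
  assumes b: "b \<ge> 2" and "w \<in> words b L" "w' \<in> words b L"
  shows "(\<Sum>q\<in>words b L. eps b q w * eps b q w') = of_bool (w = w')"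
  using assms(2,3)
proof (induction L arbitrary: w w')
  case (Suc L)
  obtain d r where w: "w = d # r" "d < b" "r \<in> words b L" using Suc.prems(1) by (auto simp: words_Suc_Cons)
  obtain d' r' where w': "w' = d' # r'" "d' < b" "r' \<in> words b L" using Suc.prems(2) by (auto simp: words_Suc_Cons)
  define A where "A q c d = (if set q \<subseteq> {0} then chi b c d else of_bool (c = d))" for q :: "nat list" and c d
  have A: "(\<Sum>c<b. A q c d * A q c d') = of_bool (d = d')" for q
  proof (cases "set q \<subseteq> {0}")
    case True
    have "(\<Sum>c<b. chi b c d * chi b c d') = (\<Sum>c<b. chi b d c * chi b d' c)"
      by (intro sum.cong refl arg_cong2[where f="(*)"] chi_sym)
    then show ?thesis using True chi_orth[OF b w(2) w'(2)] by (simp add: A_def)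
  next
    case False
    have "(\<Sum>c<b. of_bool (c = d) * of_bool (c = d')) = (\<Sum>c<b. of_bool (d = c) * of_bool (d' = c) :: real)"
      by (intro sum.cong refl) auto
    then show ?thesis using False sum_of_bool_eq[OF w(2), of d'] by (simp add: A_def del: of_bool_eq_iff)
  qed
  have "(\<Sum>q\<in>words b (Suc L). eps b q w * eps b q w') = (\<Sum>c<b. \<Sum>q\<in>words b L. (A q c d * A q c d') * (eps b q r * eps b q r'))"
    unfolding sum_words_Suc_Cons by (intro sum.cong refl) (simp add: w w' A_def mult_ac)
  also have "\<dots> = (\<Sum>q\<in>words b L. (\<Sum>c<b. A q c d * A q c d') * (eps b q r * eps b q r'))"
    by (subst sum.swap) (simp only: sum_distrib_right)
  also have "\<dots> = of_bool (d = d') * of_bool (r = r')"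
    by (simp only: A sum_distrib_left[symmetric] Suc.IH[OF w(3) w'(3)])
  also have "\<dots> = of_bool (w = w')" by (auto simp: w w')
  finally show ?case .
qed simp

text \<open>Appending 0 alters none of the tests \<open>set q \<subseteq> {0}\<close> at earlier
  letters; the new last factor is the constant row of \<open>chi\<close>.\<close>

lemma eps_snoc_0: "b \<ge> 2 \<Longrightarrow> length q = length w \<Longrightarrow> eps b (q @ [0]) (w @ [d]) = eps b q w / sqrt b"
  by (induction b q w rule: eps.induct) (auto simp: chi_0)

text \<open>A nonzero last letter switches every earlier factor to a Kronecker delta, which
  localises the row below one vertex.\<close>

lemma eps_snoc: "c \<noteq> 0 \<Longrightarrow> length q = length w \<Longrightarrow> eps b (q @ [c]) (w @ [d]) = of_bool (q = w) * chi b c d"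
  by (induction b q w rule: eps.induct) auto

text \<open>At fixed \<open>t\<close> an orthogonal change of basis within each generation;
  \<open>coef\<close> is its inverse. Both therefore commute with differentiation along the
  edges.\<close>

definition syn :: "nat \<Rightarrow> (nat list \<Rightarrow> real \<Rightarrow> complex) \<Rightarrow> tree_point \<Rightarrow> complex" where
  "syn b \<psi> = (\<lambda>(w, t). \<Sum>q\<in>words b (length w). of_real (eps b q w) * \<psi> q t)"

definition coef :: "nat \<Rightarrow> (tree_point \<Rightarrow> complex) \<Rightarrow> nat list \<Rightarrow> real \<Rightarrow> complex" where
  "coef b f q t = (\<Sum>w\<in>words b (length q). of_real (eps b q w) * f (w, t))"

lemma syn_coef:
  assumes b: "b \<ge> 2" and w: "w \<in> lists {..<b}"
  shows "syn b (coef b f) (w, t) = f (w, t)"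
proof -
  let ?L = "length w"
  have W: "w \<in> words b ?L" using w by (simp add: words_def)
  have "syn b (coef b f) (w, t) = (\<Sum>q\<in>words b ?L. \<Sum>v\<in>words b ?L. of_real (eps b q w * eps b q v) * f (v, t))"
    unfolding syn_def coef_def by (auto simp: sum_distrib_left mult.assoc wordsD(2) intro!: sum.cong)
  also have "\<dots> = (\<Sum>v\<in>words b ?L. of_real (\<Sum>q\<in>words b ?L. eps b q w * eps b q v) * f (v, t))"
    by (subst sum.swap) (simp only: sum_distrib_right of_real_sum)
  also have "\<dots> = (\<Sum>v\<in>words b ?L. if v = w then f (v, t) else 0)"
    by (intro sum.cong refl) (simp add: eps_cols[OF b W])
  also have "\<dots> = f (w, t)" using W by simp
  finally show ?thesis .
qed

lemma coef_syn:
  assumes b: "b \<ge> 2" and q: "q \<in> lists {..<b}"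
  shows "coef b (syn b \<psi>) q t = \<psi> q t"
proof -
  let ?L = "length q"
  have W: "q \<in> words b ?L" using q by (simp add: words_def)
  have "coef b (syn b \<psi>) q t = (\<Sum>w\<in>words b ?L. \<Sum>q'\<in>words b ?L. of_real (eps b q w * eps b q' w) * \<psi> q' t)"
    unfolding syn_def coef_def by (auto simp: sum_distrib_left mult.assoc wordsD(2) intro!: sum.cong)
  also have "\<dots> = (\<Sum>q'\<in>words b ?L. of_real (\<Sum>w\<in>words b ?L. eps b q w * eps b q' w) * \<psi> q' t)"
    by (subst sum.swap) (simp only: sum_distrib_right of_real_sum)
  also have "\<dots> = (\<Sum>q'\<in>words b ?L. if q' = q then \<psi> q' t else 0)"
    by (intro sum.cong refl) (simp add: eps_rows[OF b W])
  also have "\<dots> = \<psi> q t" using W by simp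
  finally show ?thesis .
qed

text \<open>The matrix \<open>eps\<close> is real, so the transformation moves from one factor to
  the other.\<close>

lemma syn_pairing:
  "(\<Sum>w\<in>words b L. f (w, t) * cnj (syn b \<psi> (w, t))) = (\<Sum>q\<in>words b L. coef b f q t * cnj (\<psi> q t))"
proof -
  have "(\<Sum>w\<in>words b L. f (w, t) * cnj (syn b \<psi> (w, t)))
      = (\<Sum>w\<in>words b L. \<Sum>q\<in>words b L. of_real (eps b q w) * f (w, t) * cnj (\<psi> q t))"
    unfolding syn_def by (auto simp: sum_distrib_left mult_ac wordsD(2) intro!: sum.cong)
  also have "\<dots> = (\<Sum>q\<in>words b L. coef b f q t * cnj (\<psi> q t))"
    unfolding coef_def by (subst sum.swap) (auto simp: sum_distrib_right wordsD(2) intro!: sum.cong)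
  finally show ?thesis .
qed

lemma syn_Parseval:
  assumes b: "b \<ge> 2"
  shows "(\<Sum>w\<in>words b L. (cmod (syn b \<psi> (w, t)))^2) = (\<Sum>q\<in>words b L. (cmod (\<psi> q t))^2)"
proof -
  have "complex_of_real (\<Sum>w\<in>words b L. (cmod (syn b \<psi> (w, t)))^2) = of_real (\<Sum>q\<in>words b L. (cmod (\<psi> q t))^2)"
    unfolding of_real_sum complex_norm_square syn_pairing
    by (intro sum.cong refl) (simp add: coef_syn[OF b] wordsD)
  then show ?thesis by (simp only: of_real_eq_iff)
qed

lemma syn_measurable:
  assumes "\<And>q. q \<in> lists {..<b} \<Longrightarrow> \<psi> q \<in> borel_measurable unit_lebesgue"
  shows "syn b \<psi> \<in> borel_measurable (tree_measure b)"
  unfolding tree_borel_measurable_iff syn_def using assms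
  by (auto intro!: borel_measurable_sum borel_measurable_times dest: wordsD)

lemma coef_L2:
  assumes f: "f \<in> tree_L2 b" shows "coef b f q \<in> L2 unit_lebesgue"
  unfolding coef_def[abs_def] by (intro L2_sum L2_scale tree_L2_edge[OF f]) (rule wordsD)

lemma syn_nn_integral:
  assumes b: "b \<ge> 2" and m: "\<And>q. q \<in> lists {..<b} \<Longrightarrow> \<psi> q \<in> borel_measurable unit_lebesgue"
  shows "(\<integral>\<^sup>+x. ennreal ((cmod (syn b \<psi> x))^2) \<partial>tree_measure b)
     = (\<Sum>L. \<Sum>q\<in>words b L. \<integral>\<^sup>+t. ennreal ((cmod (\<psi> q t))^2) \<partial>unit_lebesgue)"
proof -
  have sm[measurable]: "syn b \<psi> \<in> borel_measurable (tree_measure b)" by (rule syn_measurable) (rule m)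
  have sw: "(\<lambda>t. syn b \<psi> (w, t)) \<in> borel_measurable unit_lebesgue" if "w \<in> words b L" for w L
    by (rule measurable_compose[OF edge_measurable[OF wordsD(1)[OF that]] sm])
  have "(\<Sum>w\<in>words b L. \<integral>\<^sup>+t. ennreal ((cmod (syn b \<psi> (w, t)))^2) \<partial>unit_lebesgue)
      = (\<Sum>q\<in>words b L. \<integral>\<^sup>+t. ennreal ((cmod (\<psi> q t))^2) \<partial>unit_lebesgue)" for L
  proof -
    have "(\<Sum>w\<in>words b L. \<integral>\<^sup>+t. ennreal ((cmod (syn b \<psi> (w, t)))^2) \<partial>unit_lebesgue)
       = (\<integral>\<^sup>+t. ennreal (\<Sum>w\<in>words b L. (cmod (syn b \<psi> (w, t)))^2) \<partial>unit_lebesgue)"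
      using sw by (subst nn_integral_sum[symmetric]) (auto simp: sum_ennreal)
    also have "\<dots> = (\<integral>\<^sup>+t. ennreal (\<Sum>q\<in>words b L. (cmod (\<psi> q t))^2) \<partial>unit_lebesgue)"
      by (simp only: syn_Parseval[OF b])
    also have "\<dots> = (\<Sum>q\<in>words b L. \<integral>\<^sup>+t. ennreal ((cmod (\<psi> q t))^2) \<partial>unit_lebesgue)"
    proof -
      have "\<psi> q \<in> borel_measurable unit_lebesgue" if "q \<in> words b L" for q using m wordsD(1)[OF that] by blast
      then show ?thesis by (subst nn_integral_sum[symmetric]) (auto simp: sum_ennreal)
    qed
    finally show ?thesis .
  qed
  then show ?thesis by (subst tree_nn_integral) auto
qed

lemma coef_nn_integral:
  assumes b: "b \<ge> 2" and f: "f \<in> tree_L2 b"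
  shows "(\<Sum>L. \<Sum>q\<in>words b L. \<integral>\<^sup>+t. ennreal ((cmod (coef b f q t))^2) \<partial>unit_lebesgue) = ennreal ((tree_norm b f)^2)"
proof -
  have "(\<integral>\<^sup>+x. ennreal ((cmod (syn b (coef b f) x))^2) \<partial>tree_measure b) = (\<integral>\<^sup>+x. ennreal ((cmod (f x))^2) \<partial>tree_measure b)"
    by (intro nn_integral_cong) (metis space_tree tree_cases syn_coef[OF b])
  then show ?thesis using syn_nn_integral[OF b, of "coef b f"] nn_integral_sq_eq[OF f] coef_L2[OF f]
    by (simp add: L2_measurable)
qed

lemma syn_inner_sums:
  assumes f: "f \<in> tree_L2 b" and s: "syn b \<psi> \<in> tree_L2 b"
    and \<psi>: "\<And>q. q \<in> lists {..<b} \<Longrightarrow> \<psi> q \<in> L2 unit_lebesgue"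
  shows "(\<lambda>L. \<Sum>q\<in>words b L. LINT t|unit_lebesgue. coef b f q t * cnj (\<psi> q t)) sums tree_inner b f (syn b \<psi>)"
proof -
  have "(\<Sum>w\<in>words b L. LINT t|unit_lebesgue. f (w, t) * cnj (syn b \<psi> (w, t)))
     = (\<Sum>q\<in>words b L. LINT t|unit_lebesgue. coef b f q t * cnj (\<psi> q t))" for L
  proof -
    have 1: "integrable unit_lebesgue (\<lambda>t. f (w, t) * cnj (syn b \<psi> (w, t)))" if "w \<in> words b L" for w
      by (intro L2_mult_integrable tree_L2_edge[OF f] tree_L2_edge[OF s] wordsD(1)[OF that])
    have 2: "integrable unit_lebesgue (\<lambda>t. coef b f q t * cnj (\<psi> q t))" if "q \<in> words b L" for q
      by (intro L2_mult_integrable coef_L2[OF f] \<psi> wordsD(1)[OF that])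
    have "(\<Sum>w\<in>words b L. LINT t|unit_lebesgue. f (w, t) * cnj (syn b \<psi> (w, t)))
        = (LINT t|unit_lebesgue. (\<Sum>w\<in>words b L. f (w, t) * cnj (syn b \<psi> (w, t))))"
      by (rule Bochner_Integration.integral_sum[OF 1, symmetric])
    also have "\<dots> = (LINT t|unit_lebesgue. (\<Sum>q\<in>words b L. coef b f q t * cnj (\<psi> q t)))"
      by (simp only: syn_pairing)
    also have "\<dots> = (\<Sum>q\<in>words b L. LINT t|unit_lebesgue. coef b f q t * cnj (\<psi> q t))"
      by (rule Bochner_Integration.integral_sum[OF 2])
    finally show ?thesis .
  qed
  then show ?thesis unfolding l2_inner_def
    using tree_integral_sums[OF L2_mult_integrable[OF f s]] by simp
qed

lemma words_snoc_split:
  "(\<Sum>q\<in>words b (Suc L). g q) = (\<Sum>q\<in>words b L. g (q @ [0]) + (\<Sum>c\<in>{1..<b}. g (q @ [c])))"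
  if "b \<ge> 2" for g :: "nat list \<Rightarrow> complex"
proof -
  have "{..<b} = insert 0 {1..<b}" using that by auto
  then show ?thesis unfolding sum_words_Suc_snoc by simp
qed

lemma syn_snoc:
  assumes b: "b \<ge> 2" and w: "w \<in> lists {..<b}" and d: "d < b"
  shows "syn b \<psi> (w @ [d], t) = (\<Sum>q\<in>words b (length w). of_real (eps b q w / sqrt b) * \<psi> (q @ [0]) t)
     + (\<Sum>c\<in>{1..<b}. of_real (chi b c d) * \<psi> (w @ [c]) t)"
proof -
  have W: "w \<in> words b (length w)" using w by (simp add: words_def)
  have "syn b \<psi> (w @ [d], t) = (\<Sum>q\<in>words b (length w). of_real (eps b (q @ [0]) (w @ [d])) * \<psi> (q @ [0]) t
      + (\<Sum>c\<in>{1..<b}. of_real (eps b (q @ [c]) (w @ [d])) * \<psi> (q @ [c]) t))"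
    unfolding syn_def by (simp add: words_snoc_split[OF b])
  also have "\<dots> = (\<Sum>q\<in>words b (length w). of_real (eps b q w / sqrt b) * \<psi> (q @ [0]) t
      + (if q = w then (\<Sum>c\<in>{1..<b}. of_real (chi b c d) * \<psi> (w @ [c]) t) else 0))"
  proof (intro sum.cong refl)
    fix q assume "q \<in> words b (length w)"
    then have len: "length q = length w" by (rule wordsD)
    have "(\<Sum>c\<in>{1..<b}. of_real (eps b (q @ [c]) (w @ [d])) * \<psi> (q @ [c]) t)
      = (if q = w then (\<Sum>c\<in>{1..<b}. of_real (chi b c d) * \<psi> (w @ [c]) t) else 0)"
      by (auto simp: eps_snoc[OF _ len] intro!: sum.neutral)
    then show "of_real (eps b (q @ [0]) (w @ [d])) * \<psi> (q @ [0]) t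
      + (\<Sum>c\<in>{1..<b}. of_real (eps b (q @ [c]) (w @ [d])) * \<psi> (q @ [c]) t)
      = of_real (eps b q w / sqrt b) * \<psi> (q @ [0]) t
      + (if q = w then (\<Sum>c\<in>{1..<b}. of_real (chi b c d) * \<psi> (w @ [c]) t) else 0)"
      by (simp only: eps_snoc_0[OF b len])
  qed
  also have "\<dots> = (\<Sum>q\<in>words b (length w). of_real (eps b q w / sqrt b) * \<psi> (q @ [0]) t)
     + (\<Sum>c\<in>{1..<b}. of_real (chi b c d) * \<psi> (w @ [c]) t)"
    using W by (simp add: sum.distrib)
  finally show ?thesis .
qed

text \<open>The vertex conditions decouple: continuity demands values independent of the child, so
  rows ending in \<open>c \<noteq> 0\<close> vanish there; in the Kirchhoff sum these rows drop out
  by \<open>chi_sum\<close>, and the constant row contributes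
  \<open>b / sqrt b = sqrt b\<close>.\<close>

lemma syn_domainI:
  assumes b: "b \<ge> 2"
    and P1: "\<And>q. q \<in> lists {..<b} \<Longrightarrow> primitive (\<psi> q) (\<psi>1 q)"
    and P2: "\<And>q. q \<in> lists {..<b} \<Longrightarrow> primitive (\<psi>1 q) (\<psi>2 q)"
    and L: "syn b \<psi> \<in> tree_L2 b" "syn b \<psi>1 \<in> tree_L2 b" "syn b \<psi>2 \<in> tree_L2 b"
    and root: "\<psi> [] 0 = 0"
    and V0: "\<And>q. q \<in> lists {..<b} \<Longrightarrow> \<psi> (q @ [0]) 0 = of_real (sqrt b) * \<psi> q 1"
    and V1: "\<And>q c. q \<in> lists {..<b} \<Longrightarrow> c \<in> {1..<b} \<Longrightarrow> \<psi> (q @ [c]) 0 = 0"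
    and K: "\<And>q. q \<in> lists {..<b} \<Longrightarrow> of_real (sqrt b) * \<psi>1 (q @ [0]) 0 = \<psi>1 q 1"
  shows "(syn b \<psi>, \<lambda>x. - syn b \<psi>2 x) \<in> dirichlet_laplacian b"
proof (rule dirichlet_domainI[where u="syn b \<psi>" and ?u1.0="syn b \<psi>1" and ?u2.0="syn b \<psi>2"])
  have sb: "sqrt (real b) \<noteq> 0" "sqrt (real b) * sqrt (real b) = real b" using b by auto
  fix w assume w: "w \<in> lists {..<b}"
  show "primitive (\<lambda>t. syn b \<psi> (w, t)) (\<lambda>t. syn b \<psi>1 (w, t))"
    unfolding syn_def prod.case by (intro primitive_sum P1) (rule wordsD)
  show "primitive (\<lambda>t. syn b \<psi>1 (w, t)) (\<lambda>t. syn b \<psi>2 (w, t))"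
    unfolding syn_def prod.case by (intro primitive_sum P2) (rule wordsD)
  have first: "(\<Sum>q\<in>words b (length w). of_real (eps b q w / sqrt b) * \<psi> (q @ [0]) 0) = syn b \<psi> (w, 1)"
    unfolding syn_def prod.case
    by (intro sum.cong refl) (use sb in \<open>simp add: V0 wordsD(1)\<close>)
  show "syn b \<psi> (w @ [d], 0) = syn b \<psi> (w, 1)" if "d < b" for d
    unfolding syn_snoc[OF b w that] first using V1[OF w] by simp
  have "(\<Sum>d<b. syn b \<psi>1 (w @ [d], 0)) = (\<Sum>d<b. (\<Sum>q\<in>words b (length w). of_real (eps b q w / sqrt b) * \<psi>1 (q @ [0]) 0)
     + (\<Sum>c\<in>{1..<b}. of_real (chi b c d) * \<psi>1 (w @ [c]) 0))"
    by (intro sum.cong refl) (simp add: syn_snoc[OF b w])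
  also have "\<dots> = of_nat b * (\<Sum>q\<in>words b (length w). of_real (eps b q w / sqrt b) * \<psi>1 (q @ [0]) 0)
     + (\<Sum>c\<in>{1..<b}. \<Sum>d<b. of_real (chi b c d) * \<psi>1 (w @ [c]) 0)"
    by (simp only: sum.distrib sum_constant card_lessThan sum.swap[of _ "{..<b}" "{1..<b}"])
  also have "(\<Sum>c\<in>{1..<b}. \<Sum>d<b. of_real (chi b c d) * \<psi>1 (w @ [c]) 0) = (\<Sum>c\<in>{1..<b}. of_real (\<Sum>d<b. chi b c d) * \<psi>1 (w @ [c]) 0)"
    by (simp only: of_real_sum sum_distrib_right)
  also have "\<dots> = 0" using chi_sum[OF b] by (intro sum.neutral) auto
  also have "of_nat b * (\<Sum>q\<in>words b (length w). of_real (eps b q w / sqrt b) * \<psi>1 (q @ [0]) 0) = syn b \<psi>1 (w, 1)"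
    unfolding syn_def prod.case sum_distrib_left
  proof (intro sum.cong refl)
    fix q assume "q \<in> words b (length w)"
    then have "\<psi>1 q 1 = of_real (sqrt b) * \<psi>1 (q @ [0]) 0" using K wordsD(1) by simp
    moreover have "of_nat b * complex_of_real (eps b q w / sqrt b) = of_real (eps b q w) * of_real (sqrt b)"
    proof -
      have "of_nat b * complex_of_real (eps b q w / sqrt b) = complex_of_real (sqrt b * sqrt b * (eps b q w / sqrt b))"
        unfolding sb by simp
      also have "sqrt b * sqrt b * (eps b q w / sqrt b) = eps b q w * sqrt b"
      proof -
        have "s * s * (e / s) = e * s" if "s \<noteq> 0" for s e :: real using that by simp
        then show ?thesis using sb(1) by blast
      qed
      finally show ?thesis by simp
    qed
    ultimately show "of_nat b * (complex_of_real (eps b q w / sqrt b) * \<psi>1 (q @ [0]) 0) = complex_of_real (eps b q w) * \<psi>1 q 1"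
      by (simp only: mult.assoc[symmetric])
  qed
  finally show "(\<Sum>d<b. syn b \<psi>1 (w @ [d], 0)) = syn b \<psi>1 (w, 1)" by simp
next
  show "syn b \<psi> ([], 0) = 0" using root by (simp add: syn_def)
qed (fact L)+

section \<open>The half-line problems\<close>

text \<open>\<open>cs z\<close> and \<open>sn z\<close> solve \<open>- f'' = z f\<close> with
  initial data (1,0) and (0,1). Both are even in the square root, hence independent of its branch;
  \<open>sn\<close> is continued to \<open>z = 0\<close> by its limit.\<close>

definition cs :: "complex \<Rightarrow> real \<Rightarrow> complex" where
  "cs z t = cos (csqrt z * of_real t)"

definition sn :: "complex \<Rightarrow> real \<Rightarrow> complex" where
  "sn z t = (if z = 0 then of_real t else sin (csqrt z * of_real t) / csqrt z)"

lemma cs_0 [simp]: "cs z 0 = 1" and sn_0 [simp]: "sn z 0 = 0"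
  by (auto simp: cs_def sn_def)

lemma cs_deriv: "(cs z has_vector_derivative - z * sn z t) (at t within A)"
proof -
  have 1: "((\<lambda>w. cos (csqrt z * w)) has_field_derivative - sin (csqrt z * of_real t) * csqrt z) (at (of_real t))"
    by (auto intro!: derivative_eq_intros)
  have "- sin (csqrt z * of_real t) * csqrt z = - z * sn z t"
    by (cases "z = 0") (auto simp: sn_def field_simps, metis power2_csqrt power2_eq_square mult.assoc)
  then show ?thesis using has_vector_derivative_real_field[OF 1, of A] by (simp add: cs_def[abs_def] o_def)
qed

lemma sn_deriv: "(sn z has_vector_derivative cs z t) (at t within A)"
proof (cases "z = 0")
  case True
  have "((\<lambda>w. w) has_field_derivative 1) (at (complex_of_real t))" by (auto intro!: derivative_eq_intros)
  from has_vector_derivative_real_field[OF this, of A] show ?thesis using True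
    by (simp add: sn_def[abs_def] cs_def o_def)
next
  case False
  have 1: "((\<lambda>w. sin (csqrt z * w) / csqrt z) has_field_derivative cos (csqrt z * of_real t)) (at (of_real t))"
    using False by (auto intro!: derivative_eq_intros)
  show ?thesis using has_vector_derivative_real_field[OF 1, of A] False by (simp add: cs_def sn_def[abs_def] o_def)
qed

text \<open>The Wronskian of \<open>cs\<close> and \<open>sn\<close>; in the variation of constants
  it turns the terms containing \<open>g\<close> into exactly \<open>- g\<close>.\<close>

lemma cs_sn: "(cs z t)^2 + z * (sn z t)^2 = 1"
proof (cases "z = 0")
  case False
  have "z * (sn z t)^2 = (sin (csqrt z * of_real t))^2"
    using False by (simp add: sn_def power_divide)
  then show ?thesis by (simp add: cs_def)
qed (simp add: cs_def)

lemma cs_cont: "continuous_on A (cs z)" and sn_cont: "continuous_on A (sn z)"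
  by (rule continuous_on_vector_derivative[OF cs_deriv], rule continuous_on_vector_derivative[OF sn_deriv])

lemma primitive_cs: "primitive (cs z) (\<lambda>t. - z * sn z t)"
  by (rule primitive_C1[OF cs_deriv]) (intro continuous_intros sn_cont)

lemma primitive_sn: "primitive (sn z) (cs z)"
  by (rule primitive_C1[OF sn_deriv cs_cont])

lemma primitive_upto:
  assumes "integrable unit_lebesgue p"
  shows "primitive (\<lambda>t. a + (LINT s|unit_lebesgue. indicat_real {..t} s *\<^sub>R p s)) p"
proof (rule primitiveI[OF assms])
  have "(LINT s|unit_lebesgue. indicat_real {..0} s *\<^sub>R p s) = (LINT s|unit_lebesgue. 0)"
    by (intro Bochner_Integration.integral_cong) (auto simp: indicator_def)
  then show "a + (LINT s|unit_lebesgue. indicat_real {..t} s *\<^sub>R p s)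
     = a + (LINT s|unit_lebesgue. indicat_real {..0} s *\<^sub>R p s) + (LINT s|unit_lebesgue. indicat_real {..t} s *\<^sub>R p s)" for t
    by simp
qed

lemma upto_0: "(LINT s|unit_lebesgue. indicat_real {..0} s *\<^sub>R p s) = (0 :: complex)"
proof -
  have "(LINT s|unit_lebesgue. indicat_real {..0} s *\<^sub>R p s) = (LINT s|unit_lebesgue. 0)"
    by (intro Bochner_Integration.integral_cong) (auto simp: indicator_def)
  then show ?thesis by simp
qed

lemma upto_1: "(LINT s|unit_lebesgue. indicat_real {..1} s *\<^sub>R p s) = (LINT s|unit_lebesgue. p s :: complex)"
  by (intro Bochner_Integration.integral_cong) auto

text \<open>Variation of constants on one edge.\<close>

lemma edge_initial_value:
  "\<exists>K\<ge>0. \<forall>g\<in>L2 unit_lebesgue. \<forall>a d. \<exists>\<phi> \<phi>1.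
     primitive \<phi> \<phi>1 \<and> primitive \<phi>1 (\<lambda>t. - z * \<phi> t - g t) \<and> \<phi> 0 = a \<and> \<phi>1 0 = d \<and>
     \<phi> 1 = cs z 1 * a + sn z 1 * d + (cs z 1 * (LINT t|unit_lebesgue. sn z t * g t) - sn z 1 * (LINT t|unit_lebesgue. cs z t * g t)) \<and>
     \<phi>1 1 = - z * sn z 1 * a + cs z 1 * d - (z * sn z 1 * (LINT t|unit_lebesgue. sn z t * g t) + cs z 1 * (LINT t|unit_lebesgue. cs z t * g t)) \<and>
     cmod (LINT t|unit_lebesgue. sn z t * g t) \<le> K * unit_norm g \<and>
     cmod (LINT t|unit_lebesgue. cs z t * g t) \<le> K * unit_norm g \<and>
     (\<forall>t\<in>{0..1}. cmod (\<phi> t) \<le> K * (cmod a + cmod d + unit_norm g)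
        \<and> cmod (\<phi>1 t) \<le> K * (cmod a + cmod d + unit_norm g))"
proof -
  obtain B1 B2 where B1: "B1 \<ge> 0" "\<forall>t\<in>{0..1}. cmod (cs z t) \<le> B1" and B2: "B2 \<ge> 0" "\<forall>t\<in>{0..1}. cmod (sn z t) \<le> B2"
    using continuous_unit_bounded[OF cs_cont[of _ z]] continuous_unit_bounded[OF sn_cont[of _ z]] by blast
  define k where "k = B1 + B2 + cmod z * B2"
  have k0: "k \<ge> 0" using B1 B2 by (simp add: k_def)
  have zB: "0 \<le> cmod z * B2" using B2 by simp
  have kb: "cmod (cs z t) \<le> k" "cmod (sn z t) \<le> k" "cmod (z * sn z t) \<le> k" if "t \<in> {0..1}" for t
  proof -
    have "cmod (z * sn z t) \<le> cmod z * B2" unfolding norm_mult using B2 that by (intro mult_left_mono) auto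
    then show "cmod (cs z t) \<le> k" "cmod (sn z t) \<le> k" "cmod (z * sn z t) \<le> k"
      using B1(2)[rule_format, OF that] B2(2)[rule_format, OF that] B1(1) B2(1) zB unfolding k_def by linarith+
  qed
  define K where "K = k + 2 * k * (1 + k)"
  have K0: "K \<ge> 0" "k \<le> K" using k0 by (auto simp: K_def)
  show ?thesis
  proof (intro exI[of _ K] conjI ballI allI K0(1))
    fix g :: "real \<Rightarrow> complex" and a d :: complex assume g: "g \<in> L2 unit_lebesgue"
    have gi: "integrable unit_lebesgue g" by (rule L2_unit_integrable[OF g])
    have sg: "integrable unit_lebesgue (\<lambda>t. sn z t * g t)" and cg: "integrable unit_lebesgue (\<lambda>t. cs z t * g t)"
      by (intro mult_continuous_integrable sn_cont cs_cont gi)+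
    define n where "n = unit_norm g"
    have "(LINT s|unit_lebesgue. cmod (g s))^2 \<le> n\<^sup>2" unfolding n_def by (rule integral_norm_sq_le[OF g])
    then have gn: "(LINT s|unit_lebesgue. cmod (g s)) \<le> n" by (rule power2_le_imp_le) (simp add: n_def)
    have int_le: "cmod (LINT s|unit_lebesgue. indicat_real {..t} s *\<^sub>R (f s * g s)) \<le> k * n"
      if f: "\<And>s. s \<in> {0..1} \<Longrightarrow> cmod (f s) \<le> k" and fg: "integrable unit_lebesgue (\<lambda>s. f s * g s)" for f t
    proof -
      have "cmod (LINT s|unit_lebesgue. indicat_real {..t} s *\<^sub>R (f s * g s)) \<le> (LINT s|unit_lebesgue. k * cmod (g s))"
      proof (rule order_trans[OF integral_norm_bound integral_mono])
        show "integrable unit_lebesgue (\<lambda>s. cmod (indicat_real {..t} s *\<^sub>R (f s * g s)))"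
          by (intro integrable_norm indicator_integrable fg) auto
        show "integrable unit_lebesgue (\<lambda>s. k * cmod (g s))" using gi by auto
        fix s assume "s \<in> space unit_lebesgue"
        then have "cmod (f s) \<le> k" by (intro f) auto
        then have "cmod (f s) * cmod (g s) \<le> k * cmod (g s)" by (intro mult_right_mono) auto
        then show "cmod (indicat_real {..t} s *\<^sub>R (f s * g s)) \<le> k * cmod (g s)"
          using k0 by (auto simp: indicator_def norm_mult)
      qed
      also have "\<dots> = k * (LINT s|unit_lebesgue. cmod (g s))" by simp
      also have "\<dots> \<le> k * n" by (intro mult_left_mono gn k0)
      finally show ?thesis .
    qed
    \<comment> \<open>Variable coefficients in \<open>\<phi> = cs P + sn Q\<close>, chosen such that
      the derivative of \<open>\<phi>\<close> has no term in \<open>g\<close>.\<close>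
    define P where "P t = a + (LINT s|unit_lebesgue. indicat_real {..t} s *\<^sub>R (sn z s * g s))" for t
    define Q where "Q t = d + (LINT s|unit_lebesgue. indicat_real {..t} s *\<^sub>R (- (cs z s * g s)))" for t
    have mcg: "integrable unit_lebesgue (\<lambda>t. - (cs z t * g t))" using cg by simp
    have P: "primitive P (\<lambda>t. sn z t * g t)" and Q: "primitive Q (\<lambda>t. - (cs z t * g t))"
      unfolding P_def Q_def by (intro primitive_upto sg mcg)+
    define \<phi> where "\<phi> t = cs z t * P t + sn z t * Q t" for t
    define \<phi>1 where "\<phi>1 t = - z * sn z t * P t + cs z t * Q t" for t
    have "primitive \<phi> (\<lambda>t. ((- z * sn z t) * P t + cs z t * (sn z t * g t)) + (cs z t * Q t + sn z t * (- (cs z t * g t))))"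
      unfolding \<phi>_def by (intro primitive_add primitive_mult primitive_cs primitive_sn P Q)
    also have "(\<lambda>t. ((- z * sn z t) * P t + cs z t * (sn z t * g t)) + (cs z t * Q t + sn z t * (- (cs z t * g t)))) = \<phi>1"
      by (auto simp: \<phi>1_def algebra_simps)
    finally have p1: "primitive \<phi> \<phi>1" .
    have ps: "primitive (\<lambda>t. - z * sn z t) (\<lambda>t. - z * cs z t)" by (rule primitive_scale[OF primitive_sn])
    have "primitive \<phi>1 (\<lambda>t. ((- z * cs z t) * P t + (- z * sn z t) * (sn z t * g t)) + ((- z * sn z t) * Q t + cs z t * (- (cs z t * g t))))"
      unfolding \<phi>1_def by (intro primitive_add primitive_mult ps primitive_cs P Q)
    also have "(\<lambda>t. ((- z * cs z t) * P t + (- z * sn z t) * (sn z t * g t)) + ((- z * sn z t) * Q t + cs z t * (- (cs z t * g t))))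
       = (\<lambda>t. - z * \<phi> t - ((cs z t)^2 + z * (sn z t)^2) * g t)"
      by (auto simp: \<phi>_def algebra_simps power2_eq_square)
    finally have p2: "primitive \<phi>1 (\<lambda>t. - z * \<phi> t - g t)" by (simp add: cs_sn)
    have P0: "P 0 = a" and Q0: "Q 0 = d" unfolding P_def Q_def upto_0 by auto
    have P1: "P 1 = a + (LINT t|unit_lebesgue. sn z t * g t)" and Q1: "Q 1 = d - (LINT t|unit_lebesgue. cs z t * g t)"
      unfolding P_def Q_def upto_1 by auto
    have Pb: "cmod (P t) \<le> cmod a + k * n" for t
      unfolding P_def by (rule order_trans[OF norm_triangle_ineq add_left_mono[OF int_le[OF kb(2) sg]]])
    have Qb: "cmod (Q t) \<le> cmod d + k * n" for t
    proof -
      have "cmod (LINT s|unit_lebesgue. indicat_real {..t} s *\<^sub>R (- (cs z s * g s))) \<le> k * n"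
        using int_le[OF kb(1) cg, of t] by simp
      then show ?thesis unfolding Q_def by (rule order_trans[OF norm_triangle_ineq add_left_mono])
    qed
    have n0: "n \<ge> 0" by (simp add: n_def)
    have fin: "k * (cmod a + k * n) + k * (cmod d + k * n) \<le> K * (cmod a + cmod d + n)"
    proof -
      have "k * (cmod a + k * n) + k * (cmod d + k * n) = k * cmod a + k * cmod d + 2 * k * k * n" by (simp add: algebra_simps)
      also have "\<dots> \<le> K * cmod a + K * cmod d + K * n"
        using k0 n0 K0 by (intro add_mono mult_right_mono) (auto simp: K_def algebra_simps)
      finally show ?thesis by (simp add: algebra_simps)
    qed
    have bound: "cmod (\<phi> t) \<le> K * (cmod a + cmod d + n)" "cmod (\<phi>1 t) \<le> K * (cmod a + cmod d + n)" if t: "t \<in> {0..1}" for t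
    proof -
      have "cmod (\<phi> t) \<le> cmod (cs z t) * cmod (P t) + cmod (sn z t) * cmod (Q t)"
        unfolding \<phi>_def using norm_triangle_ineq[of "cs z t * P t" "sn z t * Q t"] by (simp add: norm_mult)
      also have "\<dots> \<le> k * (cmod a + k * n) + k * (cmod d + k * n)"
        using kb[OF t] Pb Qb k0 by (intro add_mono mult_mono) auto
      finally show "cmod (\<phi> t) \<le> K * (cmod a + cmod d + n)" using fin by linarith
      have "cmod (\<phi>1 t) \<le> cmod (z * sn z t) * cmod (P t) + cmod (cs z t) * cmod (Q t)"
        unfolding \<phi>1_def using norm_triangle_ineq[of "- z * sn z t * P t" "cs z t * Q t"] by (simp add: norm_mult)
      also have "\<dots> \<le> k * (cmod a + k * n) + k * (cmod d + k * n)"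
        using kb[OF t] Pb Qb k0 by (intro add_mono mult_mono) auto
      finally show "cmod (\<phi>1 t) \<le> K * (cmod a + cmod d + n)" using fin by linarith
    qed
    have I: "cmod (LINT t|unit_lebesgue. sn z t * g t) \<le> K * n" "cmod (LINT t|unit_lebesgue. cs z t * g t) \<le> K * n"
      using int_le[OF kb(2) sg, of 1] int_le[OF kb(1) cg, of 1] mult_right_mono[OF K0(2) n0] unfolding upto_1 by linarith+
    show "\<exists>\<phi> \<phi>1. primitive \<phi> \<phi>1 \<and> primitive \<phi>1 (\<lambda>t. - z * \<phi> t - g t) \<and> \<phi> 0 = a \<and> \<phi>1 0 = d \<and>
     \<phi> 1 = cs z 1 * a + sn z 1 * d + (cs z 1 * (LINT t|unit_lebesgue. sn z t * g t) - sn z 1 * (LINT t|unit_lebesgue. cs z t * g t)) \<and>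
     \<phi>1 1 = - z * sn z 1 * a + cs z 1 * d - (z * sn z 1 * (LINT t|unit_lebesgue. sn z t * g t) + cs z 1 * (LINT t|unit_lebesgue. cs z t * g t)) \<and>
     cmod (LINT t|unit_lebesgue. sn z t * g t) \<le> K * unit_norm g \<and>
     cmod (LINT t|unit_lebesgue. cs z t * g t) \<le> K * unit_norm g \<and>
     (\<forall>t\<in>{0..1}. cmod (\<phi> t) \<le> K * (cmod a + cmod d + unit_norm g)
        \<and> cmod (\<phi>1 t) \<le> K * (cmod a + cmod d + unit_norm g))"
      by (intro exI[of _ \<phi>] exI[of _ \<phi>1] conjI p1 p2 I[unfolded n_def] ballI bound[unfolded n_def])
         (simp_all add: \<phi>_def \<phi>1_def P0 Q0 P1 Q1 algebra_simps)
  qed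
qed

text \<open>Cauchy-Schwarz with weights: the factor of \<open>x^2\<close> stays
  \<open>a < 1\<close>, so the estimate can be summed along a recurrence and absorbed.\<close>

lemma convex_square:
  fixes a x y :: real
  assumes "0 \<le> a" "a < 1"
  shows "(a * x + y)^2 \<le> a * x\<^sup>2 + y\<^sup>2 / (1 - a)"
proof -
  have "a * x\<^sup>2 + y\<^sup>2 / (1 - a) - (a * x + y)\<^sup>2 = a * ((1 - a) * x - y)^2 / (1 - a)"
    using assms by (simp add: field_simps power2_eq_square)
  moreover have "a * ((1 - a) * x - y)^2 / (1 - a) \<ge> 0" using assms by simp
  ultimately show ?thesis by linarith
qed

text \<open>The recurrence factors as \<open>y\<^sub>k = m (\<eta>\<^sub>k + y\<^bsub>k+1\<^esub>)\<close>, solved backwards, and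
  \<open>\<xi>\<^bsub>k+1\<^esub> = m \<xi>\<^sub>k + y\<^bsub>k+1\<^esub>\<close>, solved forwards.\<close>

lemma l2_recurrence:
  fixes m :: complex
  assumes m: "0 < cmod m" "cmod m < 1"
  shows "\<exists>K\<ge>0. \<forall>\<eta> :: nat \<Rightarrow> complex. summable (\<lambda>k. (cmod (\<eta> k))^2) \<longrightarrow>
     (\<exists>\<xi>. \<xi> 0 = 0 \<and> (\<forall>k. \<xi> (Suc (Suc k)) - (m + 1 / m) * \<xi> (Suc k) + \<xi> k = - \<eta> (Suc k)) \<and>
        summable (\<lambda>k. (cmod (\<xi> k))^2) \<and> (\<Sum>k. (cmod (\<xi> k))^2) \<le> K * (\<Sum>k. (cmod (\<eta> k))^2))"
proof -
  define a where "a = cmod m"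
  have a: "0 < a" "a < 1" using m by (auto simp: a_def)
  \<comment> \<open>The product of the bounds for the forward and for the backward
    recurrence.\<close>
  define K where "K = (1 / (1 - a) / (1 - a)) * (a\<^sup>2 / (1 - a) / (1 - a))"
  have K0: "K \<ge> 0" using a by (simp add: K_def)
  show ?thesis
  proof (intro exI[of _ K] conjI K0 allI impI)
    fix \<eta> :: "nat \<Rightarrow> complex" assume sum: "summable (\<lambda>k. (cmod (\<eta> k))^2)"
    define E where "E = (\<Sum>k. (cmod (\<eta> k))^2)"
    have "Bseq \<eta>"
    proof -
      have "(\<lambda>k. sqrt ((cmod (\<eta> k))^2)) \<longlonglongrightarrow> sqrt 0" by (intro tendsto_real_sqrt summable_LIMSEQ_zero[OF sum])
      then have "(\<lambda>k. cmod (\<eta> k)) \<longlonglongrightarrow> 0" by simp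
      then have "\<eta> \<longlonglongrightarrow> 0" by (rule tendsto_norm_zero_cancel)
      then show ?thesis by (rule convergent_imp_Bseq[OF convergentI])
    qed
    then obtain B where B: "B > 0" "\<And>k. cmod (\<eta> k) \<le> B" by (auto simp: Bseq_def)
    have geo: "summable (\<lambda>j. a ^ Suc j * B)" using a by (intro summable_mult2 summable_mult summable_geometric | simp)+
    have trm: "cmod (m ^ Suc j * \<eta> (k + j)) \<le> a ^ Suc j * B" for j k
      using B(2)[of "k + j"] a by (simp add: norm_mult norm_power a_def[symmetric] mult_mono del: power_Suc)
    have sy: "summable (\<lambda>j. m ^ Suc j * \<eta> (k + j))" for k
      by (rule summable_comparison_test'[OF geo, of 0]) (use trm in simp)
    define y where "y k = (\<Sum>j. m ^ Suc j * \<eta> (k + j))" for k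
    have yrec: "y k = m * (\<eta> k + y (Suc k))" for k
    proof -
      have "y k = m * \<eta> k + (\<Sum>j. m ^ Suc (Suc j) * \<eta> (k + Suc j))"
        unfolding y_def using suminf_split_head[OF sy[of k]] by simp
      also have "(\<Sum>j. m ^ Suc (Suc j) * \<eta> (k + Suc j)) = (\<Sum>j. m * (m ^ Suc j * \<eta> (Suc k + j)))"
        by (simp add: mult.assoc)
      also have "\<dots> = m * y (Suc k)" unfolding y_def by (rule suminf_mult[OF sy])
      finally show ?thesis by (simp add: distrib_left)
    qed
    have yb: "cmod (y k) \<le> (\<Sum>j. a ^ Suc j * B)" for k
      unfolding y_def by (rule norm_suminf_le[OF trm geo])
    define Bs where "Bs = (\<Sum>j. a ^ Suc j * B)"
    have Bs0: "Bs \<ge> 0" using order_trans[OF norm_ge_zero yb[of 0]] by (simp add: Bs_def)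
    have Yrec: "(cmod (y k))^2 \<le> a * (cmod (y (Suc k)))^2 + a\<^sup>2 / (1 - a) * (cmod (\<eta> k))^2" for k
    proof -
      have "cmod (y k) \<le> a * cmod (y (Suc k)) + a * cmod (\<eta> k)"
        unfolding yrec[of k] norm_mult a_def[symmetric] using a norm_triangle_ineq[of "\<eta> k" "y (Suc k)"]
        by (simp add: distrib_left[symmetric] add.commute)
      then have "(cmod (y k))^2 \<le> (a * cmod (y (Suc k)) + a * cmod (\<eta> k))^2" by (intro power_mono) auto
      also have "\<dots> \<le> a * (cmod (y (Suc k)))^2 + (a * cmod (\<eta> k))^2 / (1 - a)" using a by (intro convex_square) auto
      finally show ?thesis by (simp add: power_mult_distrib)
    qed
    \<comment> \<open>The sum on the right is shifted by one index. The surplus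
      \<open>a |y N|^2\<close> is first only bounded, which gives summability, and then tends to
      0.\<close>
    have fin: "(1 - a) * (\<Sum>k<N. (cmod (y k))^2) \<le> a * (cmod (y N))^2 + a\<^sup>2 / (1 - a) * E" for N
    proof -
      have "(\<Sum>k<N. (cmod (y k))^2) \<le> (\<Sum>k<N. a * (cmod (y (Suc k)))^2 + a\<^sup>2 / (1 - a) * (cmod (\<eta> k))^2)"
        by (intro sum_mono Yrec)
      also have "\<dots> = a * (\<Sum>k<N. (cmod (y (Suc k)))^2) + a\<^sup>2 / (1 - a) * (\<Sum>k<N. (cmod (\<eta> k))^2)"
        by (simp add: sum.distrib sum_distrib_left)
      also have "\<dots> \<le> a * ((\<Sum>k<N. (cmod (y k))^2) + (cmod (y N))^2) + a\<^sup>2 / (1 - a) * E"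
      proof (intro add_mono mult_left_mono)
        have "(\<Sum>k<Suc N. (cmod (y k))^2) = (cmod (y 0))^2 + (\<Sum>k<N. (cmod (y (Suc k)))^2)"
          by (rule sum.lessThan_Suc_shift)
        moreover have "0 \<le> (cmod (y 0))^2" by simp
        ultimately show "(\<Sum>k<N. (cmod (y (Suc k)))^2) \<le> (\<Sum>k<N. (cmod (y k))^2) + (cmod (y N))^2"
          unfolding sum.lessThan_Suc by linarith
        show "(\<Sum>k<N. (cmod (\<eta> k))^2) \<le> E" unfolding E_def by (rule sum_le_suminf[OF sum]) auto
      qed (use a in auto)
      finally show ?thesis by (simp add: algebra_simps)
    qed
    have sumY: "summable (\<lambda>k. (cmod (y k))^2)"
    proof (rule summableI_nonneg_bounded)
      fix N
      have "(cmod (y N))^2 \<le> Bs\<^sup>2" using yb[of N] by (intro power_mono) (auto simp: Bs_def)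
      then have "(1 - a) * (\<Sum>k<N. (cmod (y k))^2) \<le> a * Bs\<^sup>2 + a\<^sup>2 / (1 - a) * E"
        using fin[of N] a mult_left_mono[of "(cmod (y N))^2" "Bs\<^sup>2" a] by linarith
      then show "(\<Sum>k<N. (cmod (y k))^2) \<le> (a * Bs\<^sup>2 + a\<^sup>2 / (1 - a) * E) / (1 - a)"
        using a by (simp add: pos_le_divide_eq mult.commute)
    qed simp
    have Ysum: "(\<Sum>k. (cmod (y k))^2) \<le> a\<^sup>2 / (1 - a) / (1 - a) * E"
    proof -
      have "(1 - a) * (\<Sum>k. (cmod (y k))^2) \<le> a * 0 + a\<^sup>2 / (1 - a) * E"
      proof (rule LIMSEQ_le)
        show "(\<lambda>N. (1 - a) * (\<Sum>k<N. (cmod (y k))^2)) \<longlonglongrightarrow> (1 - a) * (\<Sum>k. (cmod (y k))^2)"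
          by (intro tendsto_intros summable_LIMSEQ sumY)
        show "(\<lambda>N. a * (cmod (y N))^2 + a\<^sup>2 / (1 - a) * E) \<longlonglongrightarrow> a * 0 + a\<^sup>2 / (1 - a) * E"
          by (intro tendsto_add tendsto_mult tendsto_const summable_LIMSEQ_zero[OF sumY])
      qed (use fin in blast)
      then show ?thesis using a by (simp add: pos_le_divide_eq mult.commute)
    qed
    \<comment> \<open>The forward half of the factorised recurrence, started at 0 as the Dirichlet
      condition demands.\<close>
    define \<xi> where "\<xi> = rec_nat 0 (\<lambda>k x. m * x + y (Suc k))"
    have \<xi>0: "\<xi> 0 = 0" and \<xi>S: "\<xi> (Suc k) = m * \<xi> k + y (Suc k)" for k by (auto simp: \<xi>_def)
    have rec: "\<xi> (Suc (Suc k)) - (m + 1 / m) * \<xi> (Suc k) + \<xi> k = - \<eta> (Suc k)" for k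
    proof -
      have m0: "m \<noteq> 0" using m by auto
      have "y (Suc (Suc k)) = y (Suc k) / m - \<eta> (Suc k)" using yrec[of "Suc k"] m0 by (simp add: field_simps)
      then show ?thesis unfolding \<xi>S using m0 by (simp add: field_simps)
    qed
    have Xrec: "(cmod (\<xi> (Suc k)))^2 \<le> a * (cmod (\<xi> k))^2 + 1 / (1 - a) * (cmod (y (Suc k)))^2" for k
    proof -
      have "cmod (\<xi> (Suc k)) \<le> a * cmod (\<xi> k) + cmod (y (Suc k))"
        unfolding \<xi>S a_def using norm_triangle_ineq[of "m * \<xi> k"] by (simp add: norm_mult)
      then have "(cmod (\<xi> (Suc k)))^2 \<le> (a * cmod (\<xi> k) + cmod (y (Suc k)))^2" by (intro power_mono) auto
      also have "\<dots> \<le> a * (cmod (\<xi> k))^2 + (cmod (y (Suc k)))^2 / (1 - a)" using a by (intro convex_square) auto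
      finally show ?thesis by simp
    qed
    have finX: "(\<Sum>k<N. (cmod (\<xi> k))^2) \<le> 1 / (1 - a) / (1 - a) * (\<Sum>k. (cmod (y k))^2)" for N
    proof -
      have "(\<Sum>k<N. (cmod (\<xi> k))^2) \<le> (\<Sum>k<Suc N. (cmod (\<xi> k))^2)" by simp
      also have "\<dots> = (\<Sum>k<N. (cmod (\<xi> (Suc k)))^2)" by (subst sum.lessThan_Suc_shift) (simp add: \<xi>0)
      also have "\<dots> \<le> (\<Sum>k<N. a * (cmod (\<xi> k))^2 + 1 / (1 - a) * (cmod (y (Suc k)))^2)" by (intro sum_mono Xrec)
      also have "\<dots> = a * (\<Sum>k<N. (cmod (\<xi> k))^2) + 1 / (1 - a) * (\<Sum>k<N. (cmod (y (Suc k)))^2)"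
        by (simp only: sum.distrib sum_distrib_left)
      also have "\<dots> \<le> a * (\<Sum>k<N. (cmod (\<xi> k))^2) + 1 / (1 - a) * (\<Sum>k. (cmod (y k))^2)"
      proof (intro add_left_mono mult_left_mono)
        have "(\<Sum>k<N. (cmod (y (Suc k)))^2) \<le> (\<Sum>k<Suc N. (cmod (y k))^2)"
          by (subst sum.lessThan_Suc_shift) simp
        also have "\<dots> \<le> (\<Sum>k. (cmod (y k))^2)" by (rule sum_le_suminf[OF sumY]) auto
        finally show "(\<Sum>k<N. (cmod (y (Suc k)))^2) \<le> (\<Sum>k. (cmod (y k))^2)" .
      qed (use a in auto)
      finally have "(\<Sum>k<N. (cmod (\<xi> k))^2) * (1 - a) \<le> 1 / (1 - a) * (\<Sum>k. (cmod (y k))^2)" by (simp add: algebra_simps)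
      then have "(\<Sum>k<N. (cmod (\<xi> k))^2) \<le> 1 / (1 - a) * (\<Sum>k. (cmod (y k))^2) / (1 - a)"
        using a by (simp add: pos_le_divide_eq)
      then show ?thesis by simp
    qed
    have sumX: "summable (\<lambda>k. (cmod (\<xi> k))^2)" by (rule summableI_nonneg_bounded[OF _ finX]) simp
    have "(\<Sum>k. (cmod (\<xi> k))^2) \<le> 1 / (1 - a) / (1 - a) * (\<Sum>k. (cmod (y k))^2)"
      by (rule suminf_le_const[OF sumX finX])
    also have "\<dots> \<le> 1 / (1 - a) / (1 - a) * (a\<^sup>2 / (1 - a) / (1 - a) * E)"
      using a by (intro mult_left_mono Ysum) auto
    finally have "(\<Sum>k. (cmod (\<xi> k))^2) \<le> K * E" by (simp add: K_def)
    then show "\<exists>\<xi>. \<xi> 0 = 0 \<and> (\<forall>k. \<xi> (Suc (Suc k)) - (m + 1 / m) * \<xi> (Suc k) + \<xi> k = - \<eta> (Suc k)) \<and>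
        summable (\<lambda>k. (cmod (\<xi> k))^2) \<and> (\<Sum>k. (cmod (\<xi> k))^2) \<le> K * (\<Sum>k. (cmod (\<eta> k))^2)"
      using \<xi>0 rec sumX unfolding E_def by blast
  qed
qed

lemma three_squares: "((x::real) + y + w)^2 \<le> 3 * (x\<^sup>2 + y\<^sup>2 + w\<^sup>2)"
proof -
  have "3 * (x\<^sup>2 + y\<^sup>2 + w\<^sup>2) - (x + y + w)\<^sup>2 = (x - y)^2 + (y - w)^2 + (x - w)^2"
    by (simp add: power2_eq_square algebra_simps)
  moreover have "(x - y)^2 + (y - w)^2 + (x - w)^2 \<ge> 0" by simp
  ultimately show ?thesis by linarith
qed

lemma norm_diff_add_le: "norm (x - y + w) \<le> norm x + norm y + norm (w :: 'a :: real_normed_vector)"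
  using norm_triangle_ineq[of "x - y" w] norm_triangle_ineq4[of x y] by linarith

lemma unit_l2_norm_le:
  assumes f: "continuous_on {0..1} f" and le: "\<And>t. t \<in> {0..1} \<Longrightarrow> cmod (f t) \<le> B"
  shows "(unit_norm f)^2 \<le> B\<^sup>2"
proof -
  interpret U: prob_space unit_lebesgue by (rule unit_prob)
  have "(LINT t|unit_lebesgue. (cmod (f t))^2) \<le> (LINT t|unit_lebesgue. B\<^sup>2)"
    by (intro integral_mono L2_integrable continuous_unit_L2 f) (auto intro!: power_mono le)
  then show ?thesis using U.prob_space by (simp add: l2_norm_power2)
qed

text \<open>\<open>\<phi>\<^sub>k\<close>, with derivative \<open>\<phi>1\<^sub>k\<close>, is a solution of \<open>- \<phi>'' = z \<phi> + \<gamma>\<close> on the \<open>k\<close>-th edge of the half-line.\<close>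

abbreviation half_line_solution :: "real \<Rightarrow> complex \<Rightarrow> real \<Rightarrow> (nat \<Rightarrow> real \<Rightarrow> complex) \<Rightarrow> (nat \<Rightarrow> real \<Rightarrow> complex) \<Rightarrow> (nat \<Rightarrow> real \<Rightarrow> complex) \<Rightarrow> bool" where
  "half_line_solution b z K \<phi> \<phi>1 \<gamma> \<equiv> (\<forall>k. primitive (\<phi> k) (\<phi>1 k) \<and> primitive (\<phi>1 k) (\<lambda>t. - z * \<phi> k t - \<gamma> k t)) \<and> \<phi> 0 0 = 0 \<and>
      (\<forall>k. \<phi> (Suc k) 0 = of_real (sqrt b) * \<phi> k 1 \<and> of_real (sqrt b) * \<phi>1 (Suc k) 0 = \<phi>1 k 1) \<and>
      square_summable \<phi> \<and> square_summable \<phi>1 \<and>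
      (\<Sum>k. (unit_norm (\<phi> k))^2) \<le> K * (\<Sum>k. (unit_norm (\<gamma> k))^2) \<and>
      (\<Sum>k. (unit_norm (\<phi>1 k))^2) \<le> K * (\<Sum>k. (unit_norm (\<gamma> k))^2)"

text \<open>The unknowns are the vertex values \<open>\<xi> k = \<phi> k 0\<close>. As
  \<open>sn z 1 \<noteq> 0\<close>, they determine the initial slopes \<open>d k\<close>, and the
  slope condition becomes the recurrence with characteristic roots \<open>m\<close> and
  \<open>1 / m\<close>. \<open>K\<close> is chosen before \<open>\<gamma>\<close>, so that it serves
  all chains at once.\<close>

theorem radial_solution:
  assumes b: "b \<ge> 2" and S: "sn z 1 \<noteq> 0" and m: "0 < cmod m" "cmod m < 1"
    and mz: "m + 1 / m = of_real (sqrt b + 1 / sqrt b) * cs z 1"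
  shows "\<exists>K\<ge>0. \<forall>\<gamma> :: nat \<Rightarrow> real \<Rightarrow> complex. (\<forall>k. \<gamma> k \<in> L2 unit_lebesgue) \<longrightarrow> square_summable \<gamma> \<longrightarrow>
    (\<exists>\<phi> \<phi>1. half_line_solution b z K \<phi> \<phi>1 \<gamma>)"
proof -
  define C where "C = cs z 1" define S' where "S' = sn z 1" define sb where "sb = complex_of_real (sqrt b)"
  have sb0: "sb \<noteq> 0" using b by (simp add: sb_def)
  have S0: "S' \<noteq> 0" using S by (simp add: S'_def)
  have mz': "m + 1 / m = (sb + 1 / sb) * C" using mz by (simp add: sb_def C_def)
  have CS: "C * C + z * S' * S' = 1" using cs_sn[of z 1] by (simp add: C_def S'_def power2_eq_square mult.assoc)
  from edge_initial_value[of z] obtain K1 where K1: "K1 \<ge> 0" and iv: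
    "\<And>g a d. g \<in> L2 unit_lebesgue \<Longrightarrow> \<exists>\<phi> \<phi>1.
     primitive \<phi> \<phi>1 \<and> primitive \<phi>1 (\<lambda>t. - z * \<phi> t - g t) \<and> \<phi> 0 = a \<and> \<phi>1 0 = d \<and>
     \<phi> 1 = C * a + S' * d + (C * (LINT t|unit_lebesgue. sn z t * g t) - S' * (LINT t|unit_lebesgue. cs z t * g t)) \<and>
     \<phi>1 1 = - z * S' * a + C * d - (z * S' * (LINT t|unit_lebesgue. sn z t * g t) + C * (LINT t|unit_lebesgue. cs z t * g t)) \<and>
     cmod (LINT t|unit_lebesgue. sn z t * g t) \<le> K1 * unit_norm g \<and>
     cmod (LINT t|unit_lebesgue. cs z t * g t) \<le> K1 * unit_norm g \<and>
     (\<forall>t\<in>{0..1}. cmod (\<phi> t) \<le> K1 * (cmod a + cmod d + unit_norm g)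
        \<and> cmod (\<phi>1 t) \<le> K1 * (cmod a + cmod d + unit_norm g))"
    unfolding C_def[symmetric] S'_def[symmetric] by blast
  from l2_recurrence[OF m] obtain K2 where K2: "K2 \<ge> 0" and rec:
    "\<And>\<eta> :: nat \<Rightarrow> complex. summable (\<lambda>k. (cmod (\<eta> k))^2) \<Longrightarrow>
     \<exists>\<xi>. \<xi> 0 = 0 \<and> (\<forall>k. \<xi> (Suc (Suc k)) - (m + 1 / m) * \<xi> (Suc k) + \<xi> k = - \<eta> (Suc k)) \<and>
        summable (\<lambda>k. (cmod (\<xi> k))^2) \<and> (\<Sum>k. (cmod (\<xi> k))^2) \<le> K2 * (\<Sum>k. (cmod (\<eta> k))^2)"
    by blast
  define k1 where "k1 = cmod S' * K1 + cmod C * K1"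
  define k2 where "k2 = cmod (z * S') * K1 + cmod C * K1"
  define k3 where "k3 = cmod sb * k1 + (cmod C * k1 + cmod S' * k2)"
  have k0: "k1 \<ge> 0" "k2 \<ge> 0" using K1 by (auto simp: k1_def k2_def)
  then have k30: "k3 \<ge> 0" by (simp add: k3_def)
  define k4 where "k4 = (1 + 1 / cmod sb + cmod C + k1) / cmod S'"
  have sbp: "cmod sb > 0" "cmod S' > 0" using sb0 S0 by auto
  have k40: "k4 \<ge> 0" using k0 sbp by (simp add: k4_def)
  \<comment> \<open>The 3 comes from \<open>three_squares\<close>, and \<open>2 * k4 + 1\<close>
    bounds the slope together with the vertex values. In \<open>K\<close>, the factor 2 counts the
    values and their shift, and \<open>4 * k3^2\<close> bounds the sequence
    \<open>\<eta>\<close>.\<close>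
  define K5 where "K5 = (K1 * (2 * k4 + 1))^2 * 3"
  have K50: "K5 \<ge> 0" by (simp add: K5_def)
  define K where "K = K5 * (2 * K2 * (4 * k3\<^sup>2) + 1)"
  have K0: "K \<ge> 0" using K50 K2 by (simp add: K_def)
  show ?thesis
  proof (intro exI[of _ K] conjI K0 allI impI)
    fix \<gamma> :: "nat \<Rightarrow> real \<Rightarrow> complex"
    assume "\<forall>k. \<gamma> k \<in> L2 unit_lebesgue" and sum: "square_summable \<gamma>"
    then have \<gamma>: "\<And>k. \<gamma> k \<in> L2 unit_lebesgue" by blast
    define n where "n k = unit_norm (\<gamma> k)" for k
    have n0: "n k \<ge> 0" for k by (simp add: n_def)
    have sumn: "summable (\<lambda>k. (n k)^2)" using sum by (simp add: n_def)
    define G where "G = (\<Sum>k. (n k)^2)"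
    define I1 where "I1 k = (LINT t|unit_lebesgue. sn z t * \<gamma> k t)" for k
    define I2 where "I2 k = (LINT t|unit_lebesgue. cs z t * \<gamma> k t)" for k
    have Ib: "cmod (I1 k) \<le> K1 * n k" "cmod (I2 k) \<le> K1 * n k" for k
      using iv[OF \<gamma>[of k]] unfolding I1_def I2_def n_def by blast+
    define \<alpha> where "\<alpha> k = S' * I2 k - C * I1 k" for k
    define \<beta> where "\<beta> k = z * S' * I1 k + C * I2 k" for k
    have \<alpha>b: "cmod (\<alpha> k) \<le> k1 * n k" for k
    proof -
      have "cmod (\<alpha> k) \<le> cmod S' * cmod (I2 k) + cmod C * cmod (I1 k)"
        unfolding \<alpha>_def by (metis norm_mult norm_triangle_ineq4)
      also have "\<dots> \<le> cmod S' * (K1 * n k) + cmod C * (K1 * n k)" by (intro add_mono mult_left_mono Ib) auto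
      finally show ?thesis by (simp add: k1_def algebra_simps)
    qed
    have \<beta>b: "cmod (\<beta> k) \<le> k2 * n k" for k
    proof -
      have "cmod (\<beta> k) \<le> cmod (z * S') * cmod (I1 k) + cmod C * cmod (I2 k)"
        unfolding \<beta>_def by (metis norm_mult norm_triangle_ineq)
      also have "\<dots> \<le> cmod (z * S') * (K1 * n k) + cmod C * (K1 * n k)" by (intro add_mono mult_left_mono Ib) auto
      finally show ?thesis by (simp add: k2_def algebra_simps)
    qed
    \<comment> \<open>Only the indices \<open>Suc k\<close> enter the recurrence;
      \<open>\<eta> 0\<close> is set to 0.\<close>
    define \<eta> where "\<eta> k = (case k of 0 \<Rightarrow> 0 | Suc k \<Rightarrow> sb * \<alpha> (Suc k) - C * \<alpha> k + S' * \<beta> k)" for k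
    have \<eta>b: "(cmod (\<eta> (Suc k)))^2 \<le> 2 * k3\<^sup>2 * ((n (Suc k))^2 + (n k)^2)" for k
    proof -
      have "cmod (\<eta> (Suc k)) \<le> cmod (sb * \<alpha> (Suc k)) + cmod (C * \<alpha> k) + cmod (S' * \<beta> k)"
        unfolding \<eta>_def nat.case by (rule norm_diff_add_le)
      also have "\<dots> \<le> cmod sb * (k1 * n (Suc k)) + cmod C * (k1 * n k) + cmod S' * (k2 * n k)"
        unfolding norm_mult by (intro add_mono mult_left_mono \<alpha>b \<beta>b) auto
      also have "\<dots> = (cmod sb * k1) * n (Suc k) + (cmod C * k1 + cmod S' * k2) * n k" by (simp add: algebra_simps)
      also have "\<dots> \<le> k3 * n (Suc k) + k3 * n k"
        using k0 n0 by (intro add_mono mult_right_mono) (auto simp: k3_def)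
      finally have "(cmod (\<eta> (Suc k)))^2 \<le> (k3 * n (Suc k) + k3 * n k)^2" by (intro power_mono) auto
      also have "\<dots> \<le> 2 * (k3 * n (Suc k))^2 + 2 * (k3 * n k)^2" by (rule sum_square_le)
      finally show ?thesis by (simp add: power_mult_distrib algebra_simps)
    qed
    have sumnS: "summable (\<lambda>k. (n (Suc k))^2)" using sumn by (subst summable_Suc_iff)
    have GS: "(\<Sum>k. (n (Suc k))^2) \<le> G"
      unfolding G_def using suminf_split_head[OF sumn] by simp
    have sum\<eta>S: "summable (\<lambda>k. (cmod (\<eta> (Suc k)))^2)"
      by (rule summable_comparison_test'[where N=0, OF summable_mult[OF summable_add[OF sumnS sumn], of "2 * k3\<^sup>2"]]) (use \<eta>b in simp)
    then have sum\<eta>: "summable (\<lambda>k. (cmod (\<eta> k))^2)" by (subst (asm) summable_Suc_iff)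
    have E: "(\<Sum>k. (cmod (\<eta> k))^2) \<le> 4 * k3\<^sup>2 * G"
    proof -
      have "(\<Sum>k. (cmod (\<eta> k))^2) = (\<Sum>k. (cmod (\<eta> (Suc k)))^2)"
        using suminf_split_head[OF sum\<eta>] by (simp add: \<eta>_def)
      also have "\<dots> \<le> (\<Sum>k. 2 * k3\<^sup>2 * ((n (Suc k))^2 + (n k)^2))"
        by (rule suminf_le[OF \<eta>b sum\<eta>S summable_mult[OF summable_add[OF sumnS sumn]]])
      also have "\<dots> = 2 * k3\<^sup>2 * ((\<Sum>k. (n (Suc k))^2) + G)"
        unfolding G_def using suminf_mult[OF summable_add[OF sumnS sumn], of "2 * k3\<^sup>2"] suminf_add[OF sumnS sumn] by simp
      also have "\<dots> \<le> 2 * k3\<^sup>2 * (G + G)" using GS by (intro mult_left_mono) auto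
      finally show ?thesis by simp
    qed
    from rec[OF sum\<eta>] obtain \<xi> where \<xi>0: "\<xi> 0 = 0"
      and \<xi>rec: "\<And>k. \<xi> (Suc (Suc k)) - (m + 1 / m) * \<xi> (Suc k) + \<xi> k = - \<eta> (Suc k)"
      and sum\<xi>: "summable (\<lambda>k. (cmod (\<xi> k))^2)" and \<xi>le: "(\<Sum>k. (cmod (\<xi> k))^2) \<le> K2 * (\<Sum>k. (cmod (\<eta> k))^2)"
      by blast
    \<comment> \<open>The slope for which the solution reaches \<open>\<xi> (Suc k) / sb\<close> at
      the end of the edge.\<close>
    define d where "d k = (\<xi> (Suc k) / sb - C * \<xi> k + \<alpha> k) / S'" for k
    have db: "cmod (d k) \<le> k4 * (cmod (\<xi> k) + cmod (\<xi> (Suc k)) + n k)" for k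
    proof -
      have "cmod (\<xi> (Suc k) / sb - C * \<xi> k + \<alpha> k) \<le> cmod (\<xi> (Suc k) / sb) + cmod (C * \<xi> k) + cmod (\<alpha> k)"
        by (rule norm_diff_add_le)
      also have "\<dots> \<le> (1 / cmod sb) * cmod (\<xi> (Suc k)) + cmod C * cmod (\<xi> k) + k1 * n k"
        using \<alpha>b[of k] by (simp add: norm_mult norm_divide)
      also have "\<dots> \<le> (1 + 1 / cmod sb + cmod C + k1) * cmod (\<xi> (Suc k)) + (1 + 1 / cmod sb + cmod C + k1) * cmod (\<xi> k) + (1 + 1 / cmod sb + cmod C + k1) * n k"
        using k0 n0 sbp by (intro add_mono mult_right_mono) auto
      also have "\<dots> = (1 + 1 / cmod sb + cmod C + k1) * (cmod (\<xi> k) + cmod (\<xi> (Suc k)) + n k)" by (simp add: algebra_simps)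
      finally show ?thesis using sbp unfolding d_def k4_def norm_divide by (simp add: divide_right_mono)
    qed
    define good where "good k \<phi> \<phi>1 \<longleftrightarrow> primitive \<phi> \<phi>1 \<and> primitive \<phi>1 (\<lambda>t. - z * \<phi> t - \<gamma> k t) \<and> \<phi> 0 = \<xi> k \<and> \<phi>1 0 = d k \<and>
     \<phi> 1 = C * \<xi> k + S' * d k + (C * I1 k - S' * I2 k) \<and>
     \<phi>1 1 = - z * S' * \<xi> k + C * d k - (z * S' * I1 k + C * I2 k) \<and>
     (\<forall>t\<in>{0..1}. cmod (\<phi> t) \<le> K1 * (cmod (\<xi> k) + cmod (d k) + n k) \<and> cmod (\<phi>1 t) \<le> K1 * (cmod (\<xi> k) + cmod (d k) + n k))" for k \<phi> \<phi>1
    have "\<exists>\<phi> \<phi>1. good k \<phi> \<phi>1" for k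
      using iv[OF \<gamma>[of k], of "\<xi> k" "d k"] unfolding good_def I1_def I2_def n_def by blast
    then obtain \<phi> \<phi>1 where good: "\<And>k. good k (\<phi> k) (\<phi>1 k)" by metis
    have p1: "primitive (\<phi> k) (\<phi>1 k)" and p2: "primitive (\<phi>1 k) (\<lambda>t. - z * \<phi> k t - \<gamma> k t)"
      and at0: "\<phi> k 0 = \<xi> k" "\<phi>1 k 0 = d k"
      and at1: "\<phi> k 1 = C * \<xi> k + S' * d k + (C * I1 k - S' * I2 k)"
        "\<phi>1 k 1 = - z * S' * \<xi> k + C * d k - (z * S' * I1 k + C * I2 k)"
      and bd: "\<And>t. t \<in> {0..1} \<Longrightarrow> cmod (\<phi> k t) \<le> K1 * (cmod (\<xi> k) + cmod (d k) + n k)"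
        "\<And>t. t \<in> {0..1} \<Longrightarrow> cmod (\<phi>1 k t) \<le> K1 * (cmod (\<xi> k) + cmod (d k) + n k)" for k
      using good[of k] unfolding good_def by blast+
    have \<phi>1': "\<phi> k 1 = \<xi> (Suc k) / sb" for k
      unfolding at1 d_def \<alpha>_def using S0 by (simp add: field_simps)
    have v1: "\<phi> (Suc k) 0 = sb * \<phi> k 1" for k using sb0 by (simp add: \<phi>1' at0)
    \<comment> \<open>Multiplied by \<open>S'\<close>, the slope condition is the recurrence for
      \<open>\<xi>\<close>; \<open>CS\<close> supplies the term
      \<open>z S' S' \<xi> k\<close>.\<close>
    have v2: "sb * \<phi>1 (Suc k) 0 = \<phi>1 k 1" for k
    proof -
      have r: "\<xi> (Suc (Suc k)) = (sb + 1 / sb) * C * \<xi> (Suc k) - \<xi> k - (sb * \<alpha> (Suc k) - C * \<alpha> k + S' * \<beta> k)"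
        using \<xi>rec[of k] unfolding mz' by (simp add: \<eta>_def algebra_simps)
      have "S' * (sb * d (Suc k)) = \<xi> (Suc (Suc k)) - sb * C * \<xi> (Suc k) + sb * \<alpha> (Suc k)"
        using S0 sb0 by (simp add: d_def field_simps)
      also have "\<dots> = C * (\<xi> (Suc k) / sb) - \<xi> k + C * \<alpha> k - S' * \<beta> k"
        unfolding r by (simp add: algebra_simps)
      also have "\<dots> = C * (\<xi> (Suc k) / sb) - (C * C + z * S' * S') * \<xi> k + C * \<alpha> k - S' * \<beta> k" unfolding CS by simp
      also have "\<dots> = S' * (- z * S' * \<xi> k) + C * (\<xi> (Suc k) / sb - C * \<xi> k + \<alpha> k) - S' * \<beta> k" by (simp add: algebra_simps)
      also have "\<xi> (Suc k) / sb - C * \<xi> k + \<alpha> k = S' * d k" using S0 by (simp add: d_def)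
      finally have "S' * (sb * d (Suc k)) = S' * (- z * S' * \<xi> k + C * d k - \<beta> k)" by (simp add: algebra_simps)
      then have "sb * d (Suc k) = - z * S' * \<xi> k + C * d k - \<beta> k" using S0 by simp
      then show ?thesis by (simp add: at0 at1 \<beta>_def)
    qed
    have nb: "(unit_norm f)^2 \<le> K5 * ((cmod (\<xi> k))^2 + (cmod (\<xi> (Suc k)))^2 + (n k)^2)"
      if f: "continuous_on {0..1} f" and fb: "\<And>t. t \<in> {0..1} \<Longrightarrow> cmod (f t) \<le> K1 * (cmod (\<xi> k) + cmod (d k) + n k)" for f k
    proof -
      let ?s = "cmod (\<xi> k) + cmod (\<xi> (Suc k)) + n k"
      have s0: "?s \<ge> 0" using n0 by (intro add_nonneg_nonneg) auto
      have "cmod (\<xi> k) + cmod (d k) + n k \<le> ?s + k4 * ?s"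
        using db[of k] norm_ge_zero[of "\<xi> (Suc k)"] by linarith
      also have "\<dots> \<le> (2 * k4 + 1) * ?s"
      proof -
        have "0 \<le> k4 * ?s" by (intro mult_nonneg_nonneg k40 s0)
        moreover have "(2 * k4 + 1) * ?s = 2 * (k4 * ?s) + ?s" by (simp add: algebra_simps)
        ultimately show ?thesis by linarith
      qed
      finally have "K1 * (cmod (\<xi> k) + cmod (d k) + n k) \<le> K1 * ((2 * k4 + 1) * ?s)" by (intro mult_left_mono K1)
      then have "(unit_norm f)^2 \<le> (K1 * (2 * k4 + 1) * ?s)^2"
        by (intro unit_l2_norm_le[OF f] order_trans[OF fb]) (simp_all add: mult.assoc)
      also have "\<dots> \<le> (K1 * (2 * k4 + 1))^2 * (3 * ((cmod (\<xi> k))^2 + (cmod (\<xi> (Suc k)))^2 + (n k)^2))"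
        unfolding power_mult_distrib[of _ ?s] by (intro mult_left_mono three_squares) auto
      finally show ?thesis by (simp only: K5_def mult.assoc)
    qed
    have sum\<xi>S: "summable (\<lambda>k. (cmod (\<xi> (Suc k)))^2)" using sum\<xi> by (subst summable_Suc_iff)
    note sT = summable_mult[OF summable_add[OF summable_add[OF sum\<xi> sum\<xi>S] sumn], of K5]
    have tot: "(\<Sum>k. K5 * ((cmod (\<xi> k))^2 + (cmod (\<xi> (Suc k)))^2 + (n k)^2)) \<le> K * G"
    proof -
      have X: "(\<Sum>k. (cmod (\<xi> k))^2) \<le> K2 * (4 * k3\<^sup>2 * G)"
        using \<xi>le mult_left_mono[OF E K2] by linarith
      have XS: "(\<Sum>k. (cmod (\<xi> (Suc k)))^2) \<le> (\<Sum>k. (cmod (\<xi> k))^2)"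
        using suminf_split_head[OF sum\<xi>] by (simp add: \<xi>0)
      have "(\<Sum>k. K5 * ((cmod (\<xi> k))^2 + (cmod (\<xi> (Suc k)))^2 + (n k)^2))
         = K5 * ((\<Sum>k. (cmod (\<xi> k))^2) + (\<Sum>k. (cmod (\<xi> (Suc k)))^2) + G)"
        unfolding G_def suminf_mult[OF summable_add[OF summable_add[OF sum\<xi> sum\<xi>S] sumn]]
          suminf_add[OF summable_add[OF sum\<xi> sum\<xi>S] sumn, symmetric] suminf_add[OF sum\<xi> sum\<xi>S, symmetric] ..
      also have "\<dots> \<le> K5 * (2 * (K2 * (4 * k3\<^sup>2 * G)) + G)"
        using X XS by (intro mult_left_mono K50) linarith
      finally show ?thesis by (simp add: K_def algebra_simps)
    qed
    have main: "square_summable f \<and> (\<Sum>k. (unit_norm (f k))^2) \<le> K * G"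
      if f: "\<And>k. continuous_on {0..1} (f k)" and fb: "\<And>k t. t \<in> {0..1} \<Longrightarrow> cmod (f k t) \<le> K1 * (cmod (\<xi> k) + cmod (d k) + n k)" for f
    proof
      have le: "(unit_norm (f k))^2 \<le> K5 * ((cmod (\<xi> k))^2 + (cmod (\<xi> (Suc k)))^2 + (n k)^2)" for k
        by (rule nb[OF f fb])
      show s: "square_summable f"
        by (rule summable_comparison_test'[where N=0, OF sT]) (use le in simp)
      show "(\<Sum>k. (unit_norm (f k))^2) \<le> K * G"
        using suminf_le[OF le s sT] tot by linarith
    qed
    note m1 = main[OF primitive_continuous[OF p1] bd(1)] and m2 = main[OF primitive_continuous[OF p2] bd(2)]
    show "\<exists>\<phi> \<phi>1. half_line_solution b z K \<phi> \<phi>1 \<gamma>"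
      using p1 p2 at0(1)[of 0] \<xi>0 v1 v2 m1 m2 unfolding sb_def G_def n_def
      by (intro exI[of _ \<phi>] exI[of _ \<phi>1]) auto
  qed
qed

section \<open>Chains of words\<close>

text \<open>Every word is uniquely \<open>p @ 0\<^sup>k\<close> with \<open>p\<close> not ending in \<open>0\<close>; under \<open>syn\<close> the words \<open>p @ 0\<^sup>k\<close>,
  \<open>k \<ge> 0\<close>, carry one half-line problem.\<close>

definition strip :: "nat list \<Rightarrow> nat list" where
  "strip q = rev (dropWhile (\<lambda>x. x = 0) (rev q))"

definition tz :: "nat list \<Rightarrow> nat" where
  "tz q = length (takeWhile (\<lambda>x. x = 0) (rev q))"

definition heads :: "nat \<Rightarrow> nat list set" where
  "heads b = {p \<in> lists {..<b}. p = [] \<or> last p \<noteq> 0}"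

lemma strip_tz: "strip q @ replicate (tz q) 0 = q"
proof -
  have "takeWhile (\<lambda>x. x = 0) (rev q) = replicate (tz q) 0"
    unfolding tz_def by (rule replicate_length_same[symmetric]) (auto dest: set_takeWhileD)
  then have "rev q = replicate (tz q) 0 @ dropWhile (\<lambda>x. x = 0) (rev q)"
    by (metis takeWhile_dropWhile_id)
  then have "rev (rev q) = rev (replicate (tz q) 0 @ dropWhile (\<lambda>x. x = 0) (rev q))" by simp
  then show ?thesis by (simp add: strip_def)
qed

lemma strip_Nil [simp]: "strip [] = []" "tz [] = 0"
  by (auto simp: strip_def tz_def)

lemma strip_snoc_0 [simp]: "strip (q @ [0]) = strip q" "tz (q @ [0]) = Suc (tz q)"
  by (auto simp: strip_def tz_def)

lemma strip_snoc: "c \<noteq> 0 \<Longrightarrow> strip (q @ [c]) = q @ [c]" "c \<noteq> 0 \<Longrightarrow> tz (q @ [c]) = 0"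
  by (auto simp: strip_def tz_def)

lemma strip_append: "strip (q @ replicate k 0) = strip q" "tz (q @ replicate k 0) = tz q + k"
  by (induction k) (simp_all add: replicate_append_same[symmetric] flip: append_assoc)

lemma strip_head: "p \<in> heads b \<Longrightarrow> strip p = p \<and> tz p = 0"
proof -
  assume "p \<in> heads b"
  then have "p = [] \<or> p = butlast p @ [last p] \<and> last p \<noteq> 0" by (auto simp: heads_def)
  then show ?thesis by (metis strip_Nil strip_snoc)
qed

lemma strip_in_heads: "q \<in> lists {..<b} \<Longrightarrow> strip q \<in> heads b"
proof -
  assume q: "q \<in> lists {..<b}"
  have "set (strip q) \<subseteq> set q" by (auto simp: strip_def dest: set_dropWhileD)
  then have 1: "strip q \<in> lists {..<b}" using q by auto
  have "last (strip q) \<noteq> 0" if "strip q \<noteq> []"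
  proof -
    have ne: "dropWhile (\<lambda>x. x = 0) (rev q) \<noteq> []" using that by (simp add: strip_def)
    show ?thesis using hd_dropWhile[OF ne] ne by (simp add: strip_def last_rev)
  qed
  then show ?thesis using 1 unfolding heads_def by blast
qed

lemma chain_word: "b \<ge> 2 \<Longrightarrow> p \<in> heads b \<Longrightarrow> p @ replicate k 0 \<in> lists {..<b}"
  by (auto simp: heads_def)

lemma chain_bij:
  assumes "b \<ge> 2"
  shows "bij_betw (\<lambda>(p, k). p @ replicate k 0) (heads b \<times> UNIV) (lists {..<b})"
proof (rule bij_betw_byWitness[where f'="\<lambda>q. (strip q, tz q)"])
  show "\<forall>a\<in>heads b \<times> UNIV. (\<lambda>q. (strip q, tz q)) (case a of (p, k) \<Rightarrow> p @ replicate k 0) = a"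
    by (auto simp: strip_append dest: strip_head)
  show "\<forall>q\<in>lists {..<b}. (\<lambda>(p, k). p @ replicate k 0) (strip q, tz q) = q" by (simp add: strip_tz)
  show "(\<lambda>(p, k). p @ replicate k 0) ` (heads b \<times> UNIV) \<subseteq> lists {..<b}"
  proof (rule image_subsetI)
    fix x assume "x \<in> heads b \<times> (UNIV :: nat set)"
    then obtain p k where "x = (p, k)" "p \<in> heads b" by blast
    then show "(case x of (p, k) \<Rightarrow> p @ replicate k 0) \<in> lists {..<b}"
      by (simp only: prod.case chain_word[OF assms])
  qed
  show "(\<lambda>q. (strip q, tz q)) ` lists {..<b} \<subseteq> heads b \<times> UNIV" by (auto intro!: strip_in_heads)
qed

text \<open>As an integral for counting measure the sum is free of any order and can be regrouped by
  chains.\<close>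

lemma words_count_space:
  fixes F :: "nat list \<Rightarrow> ennreal"
  shows "(\<Sum>L. \<Sum>q\<in>words b L. F q) = (\<integral>\<^sup>+q. F q \<partial>count_space (lists {..<b}))"
proof -
  have "(\<integral>\<^sup>+q. F q \<partial>count_space (lists {..<b})) = (\<integral>\<^sup>+q. (\<Sum>L. \<Sum>w\<in>words b L. F w * indicator {w} q) \<partial>count_space (lists {..<b}))"
  proof (rule nn_integral_cong)
    fix q assume "q \<in> space (count_space (lists {..<b}))"
    then have q: "q \<in> words b (length q)" by (simp add: words_def)
    have "(\<Sum>w\<in>words b L. F w * indicator {w} q) = (if L = length q then F q else 0)" for L
    proof -
      have "(\<Sum>w\<in>words b L. F w * indicator {w} q) = (\<Sum>w\<in>words b L. if w = q then F q else 0)"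
        by (intro sum.cong refl) (auto simp: indicator_def)
      also have "\<dots> = (if q \<in> words b L then F q else 0)" by simp
      finally show ?thesis using q by (auto simp: words_def)
    qed
    then show "F q = (\<Sum>L. \<Sum>w\<in>words b L. F w * indicator {w} q)"
      using sums_single[of "length q" "\<lambda>_. F q"] by (simp add: sums_iff)
  qed
  also have "\<dots> = (\<Sum>L. \<integral>\<^sup>+q. (\<Sum>w\<in>words b L. F w * indicator {w} q) \<partial>count_space (lists {..<b}))"
    by (rule nn_integral_suminf) simp
  also have "\<dots> = (\<Sum>L. \<Sum>w\<in>words b L. \<integral>\<^sup>+q. F w * indicator {w} q \<partial>count_space (lists {..<b}))"
    by (intro suminf_cong nn_integral_sum) simp
  also have "\<dots> = (\<Sum>L. \<Sum>w\<in>words b L. F w)"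
  proof (intro suminf_cong sum.cong refl)
    fix n w assume "w \<in> words b n"
    then have "{w} \<subseteq> lists {..<b}" using wordsD(1) by blast
    then show "(\<integral>\<^sup>+q. F w * indicator {w} q \<partial>count_space (lists {..<b})) = F w"
      by (subst nn_integral_cmult_indicator) (simp_all add: emeasure_count_space_finite)
  qed
  finally show ?thesis by simp
qed

lemma words_chain_sum:
  fixes F :: "nat list \<Rightarrow> ennreal"
  assumes b: "b \<ge> 2"
  shows "(\<Sum>L. \<Sum>q\<in>words b L. F q) = (\<integral>\<^sup>+p. (\<Sum>k. F (p @ replicate k 0)) \<partial>count_space (heads b))"
proof -
  have "(\<Sum>L. \<Sum>q\<in>words b L. F q) = (\<integral>\<^sup>+x. F (case x of (p, k) \<Rightarrow> p @ replicate k 0) \<partial>count_space (heads b \<times> UNIV))"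
    unfolding words_count_space by (rule nn_integral_bij_count_space[OF chain_bij[OF b], symmetric])
  also have "\<dots> = (\<integral>\<^sup>+x. F (case x of (p, k) \<Rightarrow> p @ replicate k 0) * indicator (heads b \<times> UNIV) x \<partial>count_space UNIV)"
    by (simp add: nn_integral_count_space_indicator)
  also have "\<dots> = (\<integral>\<^sup>+p. \<integral>\<^sup>+k. F (p @ replicate k 0) * indicator (heads b \<times> UNIV) (p, k) \<partial>count_space UNIV \<partial>count_space UNIV)"
    by (subst nn_integral_fst_count_space[symmetric]) simp
  also have "\<dots> = (\<integral>\<^sup>+p. (\<Sum>k. F (p @ replicate k 0)) * indicator (heads b) p \<partial>count_space UNIV)"
    by (intro nn_integral_cong) (auto simp: nn_integral_count_space_nat indicator_def)
  also have "\<dots> = (\<integral>\<^sup>+p. (\<Sum>k. F (p @ replicate k 0)) \<partial>count_space (heads b))"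
    by (simp add: nn_integral_count_space_indicator)
  finally show ?thesis .
qed

definition lift :: "(nat list \<Rightarrow> nat \<Rightarrow> real \<Rightarrow> complex) \<Rightarrow> nat list \<Rightarrow> real \<Rightarrow> complex" where
  "lift \<Phi> q = \<Phi> (strip q) (tz q)"

lemma lift_chain: "p \<in> heads b \<Longrightarrow> lift \<Phi> (p @ replicate k 0) = \<Phi> p k"
  by (simp add: lift_def strip_append strip_head)

lemma syn_lift_nn_integral:
  assumes b: "b \<ge> 2" and m: "\<And>p k. p \<in> heads b \<Longrightarrow> \<Phi> p k \<in> L2 unit_lebesgue"
  shows "(\<integral>\<^sup>+x. ennreal ((cmod (syn b (lift \<Phi>) x))^2) \<partial>tree_measure b)
     = (\<integral>\<^sup>+p. (\<Sum>k. ennreal ((unit_norm (\<Phi> p k))^2)) \<partial>count_space (heads b))"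
proof -
  have "lift \<Phi> q \<in> borel_measurable unit_lebesgue" if "q \<in> lists {..<b}" for q
    unfolding lift_def using m[OF strip_in_heads[OF that]] by (rule L2_measurable)
  then have "(\<integral>\<^sup>+x. ennreal ((cmod (syn b (lift \<Phi>) x))^2) \<partial>tree_measure b)
     = (\<Sum>L. \<Sum>q\<in>words b L. \<integral>\<^sup>+t. ennreal ((cmod (lift \<Phi> q t))^2) \<partial>unit_lebesgue)"
    by (rule syn_nn_integral[OF b])
  also have "\<dots> = (\<integral>\<^sup>+p. (\<Sum>k. \<integral>\<^sup>+t. ennreal ((cmod (lift \<Phi> (p @ replicate k 0) t))^2) \<partial>unit_lebesgue) \<partial>count_space (heads b))"
    by (rule words_chain_sum[OF b])
  also have "\<dots> = (\<integral>\<^sup>+p. (\<Sum>k. ennreal ((unit_norm (\<Phi> p k))^2)) \<partial>count_space (heads b))"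
    by (intro nn_integral_cong suminf_cong) (simp add: lift_chain nn_integral_sq_eq m)
  finally show ?thesis .
qed

lemma syn_lift_L2:
  assumes b: "b \<ge> 2" and m: "\<And>p k. p \<in> heads b \<Longrightarrow> \<Phi> p k \<in> L2 unit_lebesgue"
    and le: "(\<integral>\<^sup>+p. (\<Sum>k. ennreal ((unit_norm (\<Phi> p k))^2)) \<partial>count_space (heads b)) \<le> ennreal (B\<^sup>2)" and B: "B \<ge> 0"
  shows "syn b (lift \<Phi>) \<in> tree_L2 b" "tree_norm b (syn b (lift \<Phi>)) \<le> B"
proof -
  have "syn b (lift \<Phi>) \<in> borel_measurable (tree_measure b)"
    by (rule syn_measurable) (simp add: lift_def L2_measurable m strip_in_heads)
  moreover have "(\<integral>\<^sup>+x. ennreal ((cmod (syn b (lift \<Phi>) x))^2) \<partial>tree_measure b) \<le> ennreal (B\<^sup>2)"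
    using le by (subst syn_lift_nn_integral[OF b m])
  ultimately show "syn b (lift \<Phi>) \<in> tree_L2 b" "tree_norm b (syn b (lift \<Phi>)) \<le> B"
    by (rule L2_of_nn_integral[OF _ _ B])+
qed

text \<open>\<open>syn\<close> inverts \<open>coef\<close> on the tree only, so the second component
  must be adjustable outside it.\<close>

lemma laplacian_cong:
  assumes "(u, h) \<in> dirichlet_laplacian b" and eq: "\<And>x. x \<in> tree b \<Longrightarrow> h x = h' x"
  shows "(u, h') \<in> dirichlet_laplacian b"
proof -
  have "h' \<in> tree_L2 b \<longleftrightarrow> h \<in> tree_L2 b"
    unfolding L2_def mem_Collect_eq using eq
    by (intro conj_cong measurable_cong Bochner_Integration.integrable_cong) auto
  moreover have "tree_inner b h' v = tree_inner b h v" for v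
    unfolding l2_inner_def using eq by (intro Bochner_Integration.integral_cong) auto
  ultimately show ?thesis using assms(1) unfolding dirichlet_laplacian_def form_operator_def by auto
qed

text \<open>The Dirichlet condition at the start of every chain plays two parts: at the root it is
  the boundary condition, and at a head ending in \<open>c \<noteq> 0\<close> it is what continuity
  demands of the rows with nonzero last letter.\<close>

lemma chain_domain:
  assumes b: "b \<ge> 2"
    and P: "\<And>p k. p \<in> heads b \<Longrightarrow> primitive (\<Phi> p k) (\<Phi>1 p k)"
      "\<And>p k. p \<in> heads b \<Longrightarrow> primitive (\<Phi>1 p k) (\<lambda>t. - z * \<Phi> p k t - \<Gamma> p k t)"
    and root: "\<And>p. p \<in> heads b \<Longrightarrow> \<Phi> p 0 0 = 0"
    and V: "\<And>p k. p \<in> heads b \<Longrightarrow> \<Phi> p (Suc k) 0 = of_real (sqrt b) * \<Phi> p k 1"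
      "\<And>p k. p \<in> heads b \<Longrightarrow> of_real (sqrt b) * \<Phi>1 p (Suc k) 0 = \<Phi>1 p k 1"
    and L: "syn b (lift \<Phi>) \<in> tree_L2 b" "syn b (lift \<Phi>1) \<in> tree_L2 b" "syn b (lift \<Gamma>) \<in> tree_L2 b"
  shows "(syn b (lift \<Phi>), \<lambda>x. z * syn b (lift \<Phi>) x + syn b (lift \<Gamma>) x) \<in> dirichlet_laplacian b"
proof -
  define \<psi>2 where "\<psi>2 q t = - z * lift \<Phi> q t - lift \<Gamma> q t" for q t
  have syn2: "syn b \<psi>2 x = - (z * syn b (lift \<Phi>) x + syn b (lift \<Gamma>) x)" for x
  proof (cases x)
    case (Pair w t)
    have "syn b \<psi>2 x = (\<Sum>q\<in>words b (length w). - (z * (of_real (eps b q w) * lift \<Phi> q t) + of_real (eps b q w) * lift \<Gamma> q t))"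
      unfolding Pair syn_def prod.case \<psi>2_def by (intro sum.cong refl) (simp add: algebra_simps)
    then show ?thesis by (simp add: Pair syn_def sum_negf sum.distrib sum_subtractf sum_distrib_left)
  qed
  have "(syn b (lift \<Phi>), \<lambda>x. - syn b \<psi>2 x) \<in> dirichlet_laplacian b"
  proof (rule syn_domainI[OF b, where ?\<psi>1.0="lift \<Phi>1"])
    fix q assume q: "q \<in> lists {..<b}"
    note h = strip_in_heads[OF q]
    show "primitive (lift \<Phi> q) (lift \<Phi>1 q)" unfolding lift_def by (rule P(1)[OF h])
    show "primitive (lift \<Phi>1 q) (\<psi>2 q)" unfolding lift_def \<psi>2_def[abs_def] by (rule P(2)[OF h])
    show "lift \<Phi> (q @ [0]) 0 = of_real (sqrt b) * lift \<Phi> q 1" by (simp add: lift_def V(1)[OF h])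
    show "of_real (sqrt b) * lift \<Phi>1 (q @ [0]) 0 = lift \<Phi>1 q 1" by (simp add: lift_def V(2)[OF h])
    show "lift \<Phi> (q @ [c]) 0 = 0" if "c \<in> {1..<b}" for c
    proof -
      have "q @ [c] \<in> heads b" using q that by (auto simp: heads_def)
      then show ?thesis using root[of "q @ [c]"] that by (simp add: lift_def strip_snoc)
    qed
  next
    show "lift \<Phi> [] 0 = 0" using root[of "[]"] by (simp add: lift_def heads_def)
    have "syn b \<psi>2 = (\<lambda>x. (-1) * (z * syn b (lift \<Phi>) x + syn b (lift \<Gamma>) x))" using syn2 by auto
    then show "syn b \<psi>2 \<in> tree_L2 b" by (simp only:) (intro L2_scale L2_add L)
  qed (use L in auto)
  then show ?thesis unfolding syn2 minus_minus .
qed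

lemma sqrt_sq_le: "0 \<le> K \<Longrightarrow> (sqrt K * x)\<^sup>2 = K * x\<^sup>2"
  by (simp add: power_mult_distrib)

text \<open>\<open>m\<close> and \<open>1 / m\<close> are the Floquet multipliers: the first
  condition excludes the eigenvalues, the second one the bands.\<close>

definition good :: "nat \<Rightarrow> complex \<Rightarrow> bool" where
  "good b z \<longleftrightarrow> sn z 1 \<noteq> 0 \<and>
     (\<exists>m. 0 < cmod m \<and> cmod m < 1 \<and> m + 1 / m = of_real (sqrt b + 1 / sqrt b) * cs z 1)"

text \<open>The problem is solved chain by chain with one constant; orthogonality of the chains adds
  up the squared bounds.\<close>

theorem tree_solution:
  assumes b: "b \<ge> 2" and z: "good b z"
  shows "\<exists>K\<ge>0. \<forall>g\<in>tree_L2 b. \<exists>u\<in>tree_L2 b.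
     (u, \<lambda>x. z * u x + g x) \<in> dirichlet_laplacian b \<and> tree_norm b u \<le> K * tree_norm b g"
proof -
  from z obtain m where S: "sn z 1 \<noteq> 0" and m: "0 < cmod m" "cmod m < 1" and mz: "m + 1 / m = of_real (sqrt b + 1 / sqrt b) * cs z 1"
    by (auto simp: good_def)
  have rb: "real b \<ge> 2" using b by simp
  from radial_solution[OF rb S m mz] obtain K where K: "K \<ge> 0" and sol:
    "\<And>\<gamma> :: nat \<Rightarrow> real \<Rightarrow> complex. (\<And>k. \<gamma> k \<in> L2 unit_lebesgue) \<Longrightarrow> square_summable \<gamma> \<Longrightarrow>
    (\<exists>\<phi> \<phi>1. half_line_solution (real b) z K \<phi> \<phi>1 \<gamma>)"
    by blast
  show ?thesis
  proof (intro exI[of _ "sqrt K"] conjI ballI)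
    show "0 \<le> sqrt K" using K by simp
    fix g assume g: "g \<in> tree_L2 b"
    define \<Gamma> where "\<Gamma> p k = coef b g (p @ replicate k 0)" for p k
    define N where "N = tree_norm b g"
    have \<Gamma>L: "\<Gamma> p k \<in> L2 unit_lebesgue" for p k unfolding \<Gamma>_def by (rule coef_L2[OF g])
    have lift\<Gamma>: "lift \<Gamma> = coef b g" by (auto simp: lift_def \<Gamma>_def strip_tz)
    have tot: "(\<integral>\<^sup>+p. (\<Sum>k. ennreal ((unit_norm (\<Gamma> p k))^2)) \<partial>count_space (heads b)) = ennreal (N\<^sup>2)"
      unfolding syn_lift_nn_integral[OF b \<Gamma>L, symmetric] lift\<Gamma> N_def nn_integral_sq_eq[OF g, symmetric]
      by (intro nn_integral_cong) (metis space_tree tree_cases syn_coef[OF b])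
    have sum\<Gamma>: "square_summable (\<Gamma> p)" if p: "p \<in> heads b" for p
    proof (rule summable_suminf_not_top)
      have "(\<Sum>k. ennreal ((unit_norm (\<Gamma> p k))^2)) \<le> ennreal (N\<^sup>2)"
        unfolding tot[symmetric] using p by (intro nn_integral_ge_point)
      then show "(\<Sum>k. ennreal ((unit_norm (\<Gamma> p k))^2)) \<noteq> \<top>" by (auto simp: top_unique)
    qed simp
    define ok where "ok p \<phi> \<phi>1 \<longleftrightarrow> half_line_solution (real b) z K \<phi> \<phi>1 (\<Gamma> p)" for p and \<phi> \<phi>1 :: "nat \<Rightarrow> real \<Rightarrow> complex"
    have "\<forall>p. \<exists>\<phi> \<phi>1. p \<in> heads b \<longrightarrow> ok p \<phi> \<phi>1"
    proof
      fix p show "\<exists>\<phi> \<phi>1. p \<in> heads b \<longrightarrow> ok p \<phi> \<phi>1"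
        using sol[of "\<Gamma> p", OF \<Gamma>L sum\<Gamma>] unfolding ok_def by blast
    qed
    then obtain \<Phi> \<Phi>1 where ok: "\<And>p. p \<in> heads b \<Longrightarrow> ok p (\<Phi> p) (\<Phi>1 p)" by metis
    have P: "\<And>p k. p \<in> heads b \<Longrightarrow> primitive (\<Phi> p k) (\<Phi>1 p k)"
      "\<And>p k. p \<in> heads b \<Longrightarrow> primitive (\<Phi>1 p k) (\<lambda>t. - z * \<Phi> p k t - \<Gamma> p k t)"
      and root: "\<And>p. p \<in> heads b \<Longrightarrow> \<Phi> p 0 0 = 0"
      and V: "\<And>p k. p \<in> heads b \<Longrightarrow> \<Phi> p (Suc k) 0 = of_real (sqrt b) * \<Phi> p k 1"
      "\<And>p k. p \<in> heads b \<Longrightarrow> of_real (sqrt b) * \<Phi>1 p (Suc k) 0 = \<Phi>1 p k 1"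
      using ok unfolding ok_def by blast+
    have s: "square_summable (\<Phi> p)" "square_summable (\<Phi>1 p)"
      "(\<Sum>k. (unit_norm (\<Phi> p k))^2) \<le> K * (\<Sum>k. (unit_norm (\<Gamma> p k))^2)"
      "(\<Sum>k. (unit_norm (\<Phi>1 p k))^2) \<le> K * (\<Sum>k. (unit_norm (\<Gamma> p k))^2)" if "p \<in> heads b" for p
      using ok[OF that] unfolding ok_def by blast+
    have \<Phi>L: "\<Phi> p k \<in> L2 unit_lebesgue" "\<Phi>1 p k \<in> L2 unit_lebesgue" if "p \<in> heads b" for p k
      using P[OF that] by (auto intro!: continuous_unit_L2 primitive_continuous)
    have bound: "(\<integral>\<^sup>+p. (\<Sum>k. ennreal ((unit_norm (F p k))^2)) \<partial>count_space (heads b)) \<le> ennreal ((sqrt K * N)^2)"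
      if F: "\<And>p. p \<in> heads b \<Longrightarrow> square_summable (F p)"
        "\<And>p. p \<in> heads b \<Longrightarrow> (\<Sum>k. (unit_norm (F p k))^2) \<le> K * (\<Sum>k. (unit_norm (\<Gamma> p k))^2)" for F
    proof -
      have "(\<integral>\<^sup>+p. (\<Sum>k. ennreal ((unit_norm (F p k))^2)) \<partial>count_space (heads b))
         \<le> (\<integral>\<^sup>+p. ennreal K * (\<Sum>k. ennreal ((unit_norm (\<Gamma> p k))^2)) \<partial>count_space (heads b))"
      proof (rule nn_integral_mono)
        fix p assume "p \<in> space (count_space (heads b))"
        then have p: "p \<in> heads b" by simp
        have "(\<Sum>k. ennreal ((unit_norm (F p k))^2)) = ennreal (\<Sum>k. (unit_norm (F p k))^2)"
          by (rule suminf_ennreal2[OF _ F(1)[OF p]]) simp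
        also have "\<dots> \<le> ennreal (K * (\<Sum>k. (unit_norm (\<Gamma> p k))^2))" by (rule ennreal_leI[OF F(2)[OF p]])
        also have "\<dots> = ennreal K * ennreal (\<Sum>k. (unit_norm (\<Gamma> p k))^2)"
          using K by (intro ennreal_mult suminf_nonneg sum\<Gamma> p) auto
        also have "ennreal (\<Sum>k. (unit_norm (\<Gamma> p k))^2) = (\<Sum>k. ennreal ((unit_norm (\<Gamma> p k))^2))"
          by (rule suminf_ennreal2[OF _ sum\<Gamma>[OF p], symmetric]) simp
        finally show "(\<Sum>k. ennreal ((unit_norm (F p k))^2)) \<le> ennreal K * (\<Sum>k. ennreal ((unit_norm (\<Gamma> p k))^2))" .
      qed
      also have "\<dots> = ennreal K * ennreal (N\<^sup>2)" unfolding tot[symmetric] by (rule nn_integral_cmult) simp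
      also have "\<dots> = ennreal ((sqrt K * N)^2)" unfolding sqrt_sq_le[OF K] using K by (simp add: ennreal_mult)
      finally show ?thesis .
    qed
    have NK: "sqrt K * N \<ge> 0" using K by (simp add: N_def)
    note L = syn_lift_L2[OF b \<Phi>L(1) bound[OF s(1,3)] NK]
    note L1 = syn_lift_L2(1)[OF b \<Phi>L(2) bound[OF s(2,4)] NK]
    have L\<Gamma>: "syn b (lift \<Gamma>) \<in> tree_L2 b"
      by (rule syn_lift_L2(1)[OF b \<Gamma>L, where B=N]) (simp_all add: tot N_def)
    have "(syn b (lift \<Phi>), \<lambda>x. z * syn b (lift \<Phi>) x + syn b (lift \<Gamma>) x) \<in> dirichlet_laplacian b"
      by (rule chain_domain[OF b P root V L(1) L1 L\<Gamma>])
    then have "(syn b (lift \<Phi>), \<lambda>x. z * syn b (lift \<Phi>) x + g x) \<in> dirichlet_laplacian b"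
      by (rule laplacian_cong) (auto simp: lift\<Gamma> elim!: tree_cases intro!: syn_coef[OF b])
    then show "\<exists>u\<in>tree_L2 b. (u, \<lambda>x. z * u x + g x) \<in> dirichlet_laplacian b \<and>
        tree_norm b u \<le> sqrt K * tree_norm b g"
      using L by (auto simp: N_def)
  qed
qed

section \<open>Symmetry and the resolvent\<close>

lemma H10_L2:
  assumes v: "v \<in> H10 b"
  shows "v \<in> tree_L2 b" "tree_derivative v \<in> tree_L2 b"
proof -
  have vH: "\<And>w. w \<in> lists {..<b} \<Longrightarrow> (\<lambda>t. v (w, t)) \<in> H1_unit"
    and vi: "integrable (tree_measure b) (\<lambda>x. (cmod (tree_derivative v x))^2 + (cmod (v x))^2)"
    using v unfolding H10_def by auto
  have vm: "v \<in> borel_measurable (tree_measure b)" unfolding tree_borel_measurable_iff using vH by (auto simp: H1_unit_def L2_def)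
  have Dvm: "tree_derivative v \<in> borel_measurable (tree_measure b)"
    unfolding tree_borel_measurable_iff using H1_unit_weak_derivative(1)[OF vH] by (auto simp: tree_derivative_def L2_def)
  note [measurable] = vm Dvm
  show "v \<in> tree_L2 b" by (rule L2_I[OF vm], rule Bochner_Integration.integrable_bound[OF vi]) auto
  show "tree_derivative v \<in> tree_L2 b" by (rule L2_I[OF Dvm], rule Bochner_Integration.integrable_bound[OF vi]) auto
qed

lemma laplacian_L2: "(u, h) \<in> dirichlet_laplacian b \<Longrightarrow> u \<in> tree_L2 b \<and> h \<in> tree_L2 b"
  by (simp add: dirichlet_laplacian_def form_operator_def)

lemma laplacian_form:
  assumes "(u, h) \<in> dirichlet_laplacian b"
  obtains u0 where "u0 \<in> H10 b" "AE x in tree_measure b. u x = u0 x"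
    "\<And>v. v \<in> H10 b \<Longrightarrow> dirichlet_form b u0 v = tree_inner b h v"
  using assms by (auto simp: dirichlet_laplacian_def form_operator_def)

lemma dirichlet_form_hermitian: "dirichlet_form b v u = cnj (dirichlet_form b u v)"
  unfolding dirichlet_form_def Bochner_Integration.integral_cnj[symmetric] by (simp add: mult.commute)

lemma inner_cong_AE_right:
  assumes "AE x in M. f x = f' x" "f \<in> L2 M" "f' \<in> L2 M" "g \<in> L2 M"
  shows "l2_inner M g f = l2_inner M g f'"
  by (subst (1 2) inner_commute_cnj) (simp add: inner_cong_AE[OF assms])

text \<open>Both sides equal the hermitian form at the representatives in \<open>H10 b\<close>;
  \<open>u\<close> and \<open>u'\<close> themselves agree with these only almost everywhere.\<close>

lemma laplacian_symmetric:
  assumes 1: "(u, h) \<in> dirichlet_laplacian b" and 2: "(u', h') \<in> dirichlet_laplacian b"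
  shows "tree_inner b h u' = tree_inner b u h'"
proof -
  obtain u0 where u0: "u0 \<in> H10 b" "AE x in tree_measure b. u x = u0 x"
    "\<And>v. v \<in> H10 b \<Longrightarrow> dirichlet_form b u0 v = tree_inner b h v" using laplacian_form[OF 1] by blast
  obtain u0' where u0': "u0' \<in> H10 b" "AE x in tree_measure b. u' x = u0' x"
    "\<And>v. v \<in> H10 b \<Longrightarrow> dirichlet_form b u0' v = tree_inner b h' v" using laplacian_form[OF 2] by blast
  note L = laplacian_L2[OF 1] laplacian_L2[OF 2] H10_L2(1)[OF u0(1)] H10_L2(1)[OF u0'(1)]
  have "tree_inner b h u' = tree_inner b h u0'"
    by (rule inner_cong_AE_right[OF u0'(2)]) (use L in auto)
  also have "\<dots> = dirichlet_form b u0 u0'" using u0(3)[OF u0'(1)] by simp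
  also have "\<dots> = cnj (dirichlet_form b u0' u0)" by (rule dirichlet_form_hermitian)
  also have "\<dots> = cnj (tree_inner b h' u0)" using u0'(3)[OF u0(1)] by simp
  also have "\<dots> = tree_inner b u0 h'" by (rule inner_commute_cnj[symmetric])
  also have "\<dots> = tree_inner b u h'"
    by (rule inner_cong_AE[symmetric, OF u0(2)]) (use L in auto)
  finally show ?thesis .
qed

lemma laplacian_nonneg:
  assumes "(u, h) \<in> dirichlet_laplacian b" shows "0 \<le> Re (tree_inner b h u)"
proof -
  obtain u0 where u0: "u0 \<in> H10 b" "AE x in tree_measure b. u x = u0 x"
    "\<And>v. v \<in> H10 b \<Longrightarrow> dirichlet_form b u0 v = tree_inner b h v" using laplacian_form[OF assms] by blast
  have "tree_inner b h u = tree_inner b h u0"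
    by (rule inner_cong_AE_right[OF u0(2)]) (use laplacian_L2[OF assms] H10_L2(1)[OF u0(1)] in auto)
  also have "\<dots> = dirichlet_form b u0 u0" using u0(3)[OF u0(1)] by simp
  also have "\<dots> = of_real ((tree_norm b (tree_derivative u0))^2)"
    unfolding dirichlet_form_def inner_self[symmetric] l2_inner_def ..
  finally show ?thesis by simp
qed

text \<open>Duality: with \<open>w\<close> solving the equation at \<open>cnj z\<close> for the
  right-hand side \<open>u\<close>, symmetry gives \<open>(u, u) = (h - z u, w)\<close>.\<close>

lemma laplacian_lower_bound:
  assumes b: "b \<ge> 2" and z: "good b (cnj z)"
  shows "\<exists>K\<ge>0. \<forall>(u, h)\<in>dirichlet_laplacian b. tree_norm b u \<le> K * tree_norm b (\<lambda>x. h x - z * u x)"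
proof -
  let ?M = "tree_measure b"
  from tree_solution[OF b z] obtain K where K: "K \<ge> 0" and sol: "\<And>g. g \<in> L2 ?M \<Longrightarrow> \<exists>w\<in>L2 ?M.
     (w, \<lambda>x. cnj z * w x + g x) \<in> dirichlet_laplacian b \<and> l2_norm ?M w \<le> K * l2_norm ?M g" by blast
  have "l2_norm ?M u \<le> K * l2_norm ?M (\<lambda>x. h x - z * u x)" if uh: "(u, h) \<in> dirichlet_laplacian b" for u h
  proof -
    have L: "u \<in> L2 ?M" "h \<in> L2 ?M" using laplacian_L2[OF uh] by auto
    from sol[OF L(1)] obtain w where w: "w \<in> L2 ?M" "(w, \<lambda>x. cnj z * w x + u x) \<in> dirichlet_laplacian b"
      "l2_norm ?M w \<le> K * l2_norm ?M u" by blast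
    have Lz: "(\<lambda>x. h x - z * u x) \<in> L2 ?M" using L by auto
    have "l2_inner ?M h w = l2_inner ?M u (\<lambda>x. cnj z * w x) + l2_inner ?M u u"
      unfolding laplacian_symmetric[OF uh w(2)] using L w by (intro inner_add_right) auto
    then have "l2_inner ?M u u = l2_inner ?M h w - l2_inner ?M (\<lambda>x. z * u x) w"
      by (simp add: inner_scale_left inner_scale_right)
    also have "\<dots> = l2_inner ?M (\<lambda>x. h x - z * u x) w"
      using L w by (intro inner_diff_left[symmetric]) auto
    finally have "(l2_norm ?M u)^2 = cmod (l2_inner ?M (\<lambda>x. h x - z * u x) w)"
      by (metis inner_self norm_of_real abs_of_nonneg zero_le_power2)
    also have "\<dots> \<le> l2_norm ?M (\<lambda>x. h x - z * u x) * l2_norm ?M w" by (rule l2_Cauchy_Schwarz[OF Lz w(1)])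
    also have "\<dots> \<le> l2_norm ?M (\<lambda>x. h x - z * u x) * (K * l2_norm ?M u)" by (intro mult_left_mono w) simp
    finally have "l2_norm ?M u * l2_norm ?M u \<le> (K * l2_norm ?M (\<lambda>x. h x - z * u x)) * l2_norm ?M u"
      by (simp add: power2_eq_square mult_ac)
    then show ?thesis using l2_norm_nonneg[of ?M u] K
      by (cases "l2_norm ?M u = 0") (auto simp: mult_le_cancel_right)
  qed
  then show ?thesis using K by blast
qed

lemma good_resolvent:
  assumes b: "b \<ge> 2" and z: "good b z" "good b (cnj z)"
  shows "z \<in> resolvent_set (tree_measure b) (dirichlet_laplacian b)"
  unfolding resolvent_set_def
proof (intro CollectI conjI ballI)
  show "\<exists>C. \<forall>(u, h)\<in>dirichlet_laplacian b. tree_norm b u \<le> C * tree_norm b (\<lambda>x. h x - z * u x)"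
    using laplacian_lower_bound[OF b z(2)] by blast
  fix g assume "g \<in> tree_L2 b"
  then obtain u where "(u, \<lambda>x. z * u x + g x) \<in> dirichlet_laplacian b" using tree_solution[OF b z(1)] by blast
  then show "\<exists>(u, h)\<in>dirichlet_laplacian b. AE x in tree_measure b. h x - z * u x = g x"
    by (intro bexI[of _ "(u, \<lambda>x. z * u x + g x)"]) auto
qed

section \<open>Functions carried by one chain\<close>

text \<open>For a head \<open>p\<close>, an isometric embedding of half-line families as functions
  carried by the chain of \<open>p\<close>.\<close>

definition ext :: "nat \<Rightarrow> nat list \<Rightarrow> (nat \<Rightarrow> real \<Rightarrow> complex) \<Rightarrow> tree_point \<Rightarrow> complex" where
  "ext b p \<phi> = syn b (lift (\<lambda>q. if q = p then \<phi> else (\<lambda>_ _. 0)))"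

context
  fixes b :: nat and p :: "nat list"
  assumes b: "b \<ge> 2" and p: "p \<in> heads b"
begin

lemma ext_nn_integral:
  assumes \<phi>: "\<And>k. \<phi> k \<in> L2 unit_lebesgue"
  shows "(\<integral>\<^sup>+x. ennreal ((cmod (ext b p \<phi> x))^2) \<partial>tree_measure b) = (\<Sum>k. ennreal ((unit_norm (\<phi> k))^2))"
proof -
  have "(\<integral>\<^sup>+x. ennreal ((cmod (ext b p \<phi> x))^2) \<partial>tree_measure b)
     = (\<integral>\<^sup>+q. (\<Sum>k. ennreal ((unit_norm ((if q = p then \<phi> else (\<lambda>_ _. 0)) k))^2)) \<partial>count_space (heads b))"
    unfolding ext_def by (rule syn_lift_nn_integral[OF b]) (auto simp: \<phi>)
  also have "\<dots> = (\<integral>\<^sup>+q. (\<Sum>k. ennreal ((unit_norm (\<phi> k))^2)) * indicator {p} q \<partial>count_space (heads b))"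
    by (intro nn_integral_cong) (auto simp: indicator_def)
  also have "\<dots> = (\<Sum>k. ennreal ((unit_norm (\<phi> k))^2))"
    using p by (subst nn_integral_cmult_indicator) (auto simp: emeasure_count_space_finite)
  finally show ?thesis .
qed

lemma ext_L2:
  assumes \<phi>: "\<And>k. \<phi> k \<in> L2 unit_lebesgue" and s: "square_summable \<phi>"
  shows "ext b p \<phi> \<in> tree_L2 b"
    "(tree_norm b (ext b p \<phi>))^2 = (\<Sum>k. (unit_norm (\<phi> k))^2)"
proof -
  define N where "N = (\<Sum>k. (unit_norm (\<phi> k))^2)"
  have N0: "N \<ge> 0" unfolding N_def by (intro suminf_nonneg s) simp
  have nn: "(\<integral>\<^sup>+x. ennreal ((cmod (ext b p \<phi> x))^2) \<partial>tree_measure b) = ennreal N"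
    unfolding ext_nn_integral[OF \<phi>] N_def by (rule suminf_ennreal2[OF _ s]) simp
  have "ext b p \<phi> \<in> borel_measurable (tree_measure b)"
    unfolding ext_def by (rule syn_measurable) (auto simp: lift_def L2_measurable \<phi>)
  from L2_of_nn_integral(1)[OF this, of "sqrt N"] show L: "ext b p \<phi> \<in> tree_L2 b" using N0 nn by simp
  show "(tree_norm b (ext b p \<phi>))^2 = (\<Sum>k. (unit_norm (\<phi> k))^2)"
    using nn nn_integral_sq_eq[OF L] N0 by (simp add: N_def)
qed

text \<open>Generation \<open>length p + k\<close> contains exactly one word of the chain, and
  earlier generations contain none, so the series by generations is a shift of the series along the
  chain.\<close>

lemma ext_inner_sums:
  assumes \<phi>: "\<And>k. \<phi> k \<in> L2 unit_lebesgue" and s: "square_summable \<phi>"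
    and f: "f \<in> tree_L2 b"
  shows "(\<lambda>k. LINT t|unit_lebesgue. coef b f (p @ replicate k 0) t * cnj (\<phi> k t)) sums tree_inner b f (ext b p \<phi>)"
proof -
  let ?\<Phi> = "lift (\<lambda>q. if q = p then \<phi> else (\<lambda>_ _. 0))"
  define A where "A L = (\<Sum>q\<in>words b L. LINT t|unit_lebesgue. coef b f q t * cnj (?\<Phi> q t))" for L
  define B where "B k = (LINT t|unit_lebesgue. coef b f (p @ replicate k 0) t * cnj (\<phi> k t))" for k
  have A: "A sums tree_inner b f (ext b p \<phi>)"
    unfolding A_def ext_def
    by (rule syn_inner_sums[OF f ext_L2(1)[OF \<phi> s, unfolded ext_def]]) (auto simp: lift_def \<phi>)
  have term0: "(LINT t|unit_lebesgue. coef b f q t * cnj (?\<Phi> q t)) = 0" if "strip q \<noteq> p" for q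
    using that by (simp add: lift_def)
  have AB: "A (length p + k) = B k" for k
  proof -
    have w: "p @ replicate k 0 \<in> words b (length p + k)" using chain_word[OF b p, of k] by (simp add: words_def)
    have "A (length p + k) = (\<Sum>q\<in>{p @ replicate k 0}. LINT t|unit_lebesgue. coef b f q t * cnj (?\<Phi> q t))"
      unfolding A_def
    proof (rule sum.mono_neutral_right)
      show "\<forall>q\<in>words b (length p + k) - {p @ replicate k 0}. (LINT t|unit_lebesgue. coef b f q t * cnj (?\<Phi> q t)) = 0"
      proof
        fix q assume q: "q \<in> words b (length p + k) - {p @ replicate k 0}"
        have "strip q \<noteq> p"
        proof
          assume "strip q = p"
          then have "q = p @ replicate (tz q) 0" using strip_tz[of q] by simp
          moreover from this have "length q = length p + tz q" by (metis length_append length_replicate)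
          ultimately show False using q by (auto dest: wordsD)
        qed
        then show "(LINT t|unit_lebesgue. coef b f q t * cnj (?\<Phi> q t)) = 0" by (rule term0)
      qed
    qed (use w in auto)
    then show ?thesis by (simp add: B_def lift_chain[OF p])
  qed
  have A0: "A L = 0" if "L < length p" for L
    unfolding A_def
  proof (intro sum.neutral ballI term0)
    fix q assume "q \<in> words b L"
    then have "length q < length p" using that by (auto dest: wordsD)
    moreover have "length (strip q) \<le> length q" using arg_cong[OF strip_tz[of q], of length] by simp
    ultimately show "strip q \<noteq> p" by auto
  qed
  have "(\<lambda>k. A (k + length p)) sums (tree_inner b f (ext b p \<phi>) - (\<Sum>L<length p. A L))"
    using A by (rule sums_split_initial_segment)
  then show ?thesis using AB A0 by (simp add: B_def[symmetric] add.commute)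
qed

lemma ext_domain:
  assumes P: "\<And>k. primitive (\<phi> k) (\<phi>1 k)" "\<And>k. primitive (\<phi>1 k) (\<lambda>t. - z * \<phi> k t - \<gamma> k t)"
    and root: "\<phi> 0 0 = 0"
    and V: "\<And>k. \<phi> (Suc k) 0 = of_real (sqrt b) * \<phi> k 1" "\<And>k. of_real (sqrt b) * \<phi>1 (Suc k) 0 = \<phi>1 k 1"
    and \<gamma>: "\<And>k. \<gamma> k \<in> L2 unit_lebesgue"
    and s: "square_summable \<phi>" "square_summable \<phi>1"
      "square_summable \<gamma>"
  shows "(ext b p \<phi>, \<lambda>x. z * ext b p \<phi> x + ext b p \<gamma> x) \<in> dirichlet_laplacian b"
proof -
  have L: "\<phi> k \<in> L2 unit_lebesgue" "\<phi>1 k \<in> L2 unit_lebesgue" for k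
    using P by (auto intro!: continuous_unit_L2 primitive_continuous)
  have p0: "primitive (\<lambda>_. 0) (\<lambda>_. 0)" by (rule primitive_const)
  show ?thesis unfolding ext_def
  proof (rule chain_domain[OF b, where ?\<Phi>1.0="\<lambda>q. if q = p then \<phi>1 else (\<lambda>_ _. 0)"])
    show "syn b (lift (\<lambda>q. if q = p then \<phi> else (\<lambda>_ _. 0))) \<in> tree_L2 b"
      "syn b (lift (\<lambda>q. if q = p then \<phi>1 else (\<lambda>_ _. 0))) \<in> tree_L2 b"
      "syn b (lift (\<lambda>q. if q = p then \<gamma> else (\<lambda>_ _. 0))) \<in> tree_L2 b"
      using ext_L2(1)[OF L(1) s(1)] ext_L2(1)[OF L(2) s(2)] ext_L2(1)[OF \<gamma> s(3)] unfolding ext_def by blast+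
  qed (use P root V p0 in auto)
qed

lemma coef_ext:
  "q \<in> lists {..<b} \<Longrightarrow> coef b (ext b p \<phi>) q t = (if strip q = p then \<phi> (tz q) t else 0)"
  unfolding ext_def by (subst coef_syn[OF b]) (auto simp: lift_def)

end

section \<open>The spectrum\<close>

definition spec :: "real \<Rightarrow> real set" where
  "spec \<theta> = (\<Union>l\<in>{1::nat..}. {(pi * (real l - 1) + \<theta>)^2 .. (pi * real l - \<theta>)^2}) \<union> {(pi * real l)^2 | l. l \<ge> (1::nat)}"

text \<open>The two roots have product 1. If neither lies in the open disc, both are unimodular,
  hence conjugate, and \<open>2 * x\<close> is twice a real part.\<close>

lemma quadratic_root:
  fixes x :: complex
  assumes "\<not> (\<exists>m. 0 < cmod m \<and> cmod m < 1 \<and> m + 1 / m = 2 * x)"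
  shows "Im x = 0 \<and> \<bar>Re x\<bar> \<le> 1"
proof -
  define s where "s = csqrt (x\<^sup>2 - 1)"
  define m1 where "m1 = x + s"
  define m2 where "m2 = x - s"
  have prod: "m1 * m2 = 1" by (simp add: m1_def m2_def algebra_simps s_def power2_eq_square[symmetric])
  then have nz: "m1 \<noteq> 0" "m2 \<noteq> 0" by auto
  have inv: "1 / m1 = m2" "1 / m2 = m1" using prod nz by (simp_all add: field_simps)
  have sum: "m1 + m2 = 2 * x" by (simp add: m1_def m2_def)
  have "\<not> cmod m1 < 1" using assms nz inv sum by (metis zero_less_norm_iff)
  moreover have "\<not> cmod m2 < 1" using assms nz inv sum by (metis zero_less_norm_iff add.commute)
  moreover have "cmod m1 * cmod m2 = 1" using prod by (metis norm_mult norm_one)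
  ultimately have c1: "cmod m1 = 1"
  proof -
    assume a: "\<not> cmod m1 < 1" "\<not> cmod m2 < 1" "cmod m1 * cmod m2 = 1"
    then have "cmod m1 * 1 \<le> cmod m1 * cmod m2" by (intro mult_left_mono) auto
    then show ?thesis using a by linarith
  qed
  have "m1 * cnj m1 = 1" using c1 complex_norm_square[of m1] by simp
  then have "m2 = cnj m1" using prod nz by (metis mult_left_cancel)
  then have "2 * x = of_real (2 * Re m1)" using sum complex_add_cnj[of m1] by simp
  then have "x = of_real (Re m1)" by simp
  then show ?thesis using abs_Re_le_cmod[of m1] c1 by (metis Im_complex_of_real Re_complex_of_real)
qed

locale tree_parameters =
  fixes b :: nat and R \<theta> :: real
  assumes b: "b \<ge> 2" and R_eq: "R = (sqrt b + 1 / sqrt b) / 2" and \<theta>_eq: "\<theta> = arccos (1 / R)"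
begin

lemma R_gt: "R > 1"
proof -
  have s: "sqrt (real b) > 1" using b by simp
  have "(sqrt b - 1)^2 / sqrt b > 0" using s by simp
  also have "(sqrt b - 1)^2 / sqrt b = (sqrt b + 1 / sqrt b) - 2" using s by (simp add: field_simps power2_eq_square)
  finally have "(sqrt b + 1 / sqrt b) > 2" by linarith
  then show ?thesis unfolding R_eq by (simp only: less_divide_eq) simp
qed

lemma cos_\<theta>: "cos \<theta> = 1 / R"
  unfolding \<theta>_eq using R_gt by (intro cos_arccos) (auto simp: field_simps)

lemma \<theta>_bounds: "0 < \<theta>" "\<theta> < pi / 2"
proof -
  have r: "0 < 1 / R" "1 / R < 1" using R_gt by auto
  show "0 < \<theta>" unfolding \<theta>_eq using arccos_lt_bounded[of "1 / R"] r by simp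
  show "\<theta> < pi / 2"
  proof (rule ccontr)
    assume "\<not> \<theta> < pi / 2"
    then have "cos \<theta> \<le> cos (pi / 2)"
      using arccos_lbound[of "1/R"] arccos_ubound[of "1/R"] r unfolding \<theta>_eq[symmetric] by (subst cos_mono_le_eq) auto
    then show False using cos_\<theta> r by simp
  qed
qed

text \<open>Reduction modulo \<open>pi\<close> changes \<open>cos\<close> by a sign only; on [0,pi]
  monotonicity turns the bound into \<open>\<theta> <= r <= pi - \<theta>\<close>. The witness is
  \<open>Suc k\<close> because bands are counted from 1.\<close>

lemma cos_le_imp_band:
  assumes "a \<ge> 0" and c: "\<bar>cos a\<bar> \<le> 1 / R"
  shows "\<exists>l\<ge>1::nat. pi * (real l - 1) + \<theta> \<le> a \<and> a \<le> pi * real l - \<theta>"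
proof -
  define k where "k = nat \<lfloor>a / pi\<rfloor>"
  have k: "real k \<le> a / pi" "a / pi < real k + 1"
    using assms(1) by (auto simp: k_def)
  define r where "r = a - pi * real k"
  have "pi * real k \<le> a" "a < pi * (real k + 1)" using k pi_gt_zero by (simp_all add: pos_le_divide_eq pos_divide_less_eq mult.commute)
  then have r: "0 \<le> r" "r < pi" by (auto simp: r_def algebra_simps)
  have "cos a = cos (r + real k * pi)" by (simp add: r_def mult.commute)
  also have "\<dots> = cos r * cos (real k * pi)" by (simp add: cos_add)
  also have "cos (real k * pi) = (- 1) ^ k" using cos_npi[of k] by (simp add: mult.commute)
  finally have cr: "\<bar>cos r\<bar> \<le> cos \<theta>" using c by (simp add: cos_\<theta> abs_mult power_abs)
  have "\<theta> \<le> r"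
  proof (rule ccontr)
    assume "\<not> \<theta> \<le> r"
    then have "cos \<theta> < cos r" using r \<theta>_bounds by (intro cos_monotone_0_pi) auto
    then show False using cr by simp
  qed
  moreover have "r \<le> pi - \<theta>"
  proof (rule ccontr)
    assume "\<not> r \<le> pi - \<theta>"
    then have "cos r < cos (pi - \<theta>)" using r \<theta>_bounds by (intro cos_monotone_0_pi) auto
    then show False using cr by simp
  qed
  ultimately show ?thesis by (intro exI[of _ "Suc k"]) (auto simp: r_def algebra_simps)
qed

text \<open>By contraposition: either \<open>sin \<kappa> = 0\<close> with
  \<open>\<kappa> \<noteq> 0\<close>, which gives an eigenvalue, or no multiplier lies in the open
  disc, and then \<open>R cos \<kappa>\<close> is real and at most 1 in modulus.\<close>

lemma not_spec_good:
  assumes "z \<notin> complex_of_real ` spec \<theta>"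
  shows "good b z"
proof (rule ccontr)
  assume ng: "\<not> good b z"
  define \<kappa> where "\<kappa> = csqrt z"
  have \<kappa>2: "\<kappa>\<^sup>2 = z" by (simp add: \<kappa>_def)
  have "\<exists>lam\<in>spec \<theta>. z = of_real lam"
  proof (cases "sn z 1 = 0")
    case True
    then have z0: "z \<noteq> 0" and "sin \<kappa> = 0" by (auto simp: sn_def \<kappa>_def split: if_splits)
    then obtain n :: int where n: "\<kappa> = of_real (real_of_int n * pi)" by (auto simp: sin_eq_0)
    have "n \<noteq> 0" using n z0 \<kappa>2 by auto
    then have l: "nat \<bar>n\<bar> \<ge> 1" by auto
    have "z = of_real ((real_of_int n * pi)^2)" using \<kappa>2 n by simp
    also have "(real_of_int n * pi)^2 = (pi * real (nat \<bar>n\<bar>))^2" by (simp add: power_mult_distrib mult.commute)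
    finally show ?thesis using l unfolding spec_def by blast
  next
    case False
    have "\<not> (\<exists>m. 0 < cmod m \<and> cmod m < 1 \<and> m + 1 / m = 2 * (of_real R * cos \<kappa>))"
    proof -
      have "2 * (of_real R * cos \<kappa>) = complex_of_real (sqrt b + 1 / sqrt b) * cs z 1"
        unfolding R_eq cs_def \<kappa>_def by simp
      then show ?thesis using ng False unfolding good_def by simp
    qed
    from quadratic_root[OF this] have x: "Im (of_real R * cos \<kappa>) = 0" "\<bar>Re (of_real R * cos \<kappa>)\<bar> \<le> 1" by auto
    then have im: "Im (cos \<kappa>) = 0" and re: "\<bar>Re (cos \<kappa>)\<bar> \<le> 1 / R"
      using R_gt by (auto simp: abs_mult field_simps)
    define a where "a = Re \<kappa>" define c where "c = Im \<kappa>"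
    have a0: "a \<ge> 0" unfolding a_def \<kappa>_def using csqrt_principal[of z] by auto
    have c0: "c = 0"
    proof (rule ccontr)
      assume "c \<noteq> 0"
      then have "exp (- c) - exp c \<noteq> 0" by simp
      then have s: "sin a = 0" using im by (simp add: Im_cos a_def c_def)
      then have "\<bar>cos a\<bar> = 1" using sin_cos_squared_add[of a] by (simp add: power2_eq_1_iff abs_if) auto
      then have "\<bar>Re (cos \<kappa>)\<bar> = (exp c + exp (- c)) / 2"
        by (simp add: Re_cos a_def c_def abs_mult)
      moreover have "(exp c + exp (- c)) / 2 \<ge> 1" using cosh_real_ge_1[of c] by (simp add: cosh_def)
      ultimately have "1 \<le> 1 / R" using re by linarith
      then show False using R_gt by simp
    qed
    have \<kappa>a: "\<kappa> = of_real a" using c0 by (simp add: complex_eq_iff a_def c_def)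
    have "\<bar>cos a\<bar> \<le> 1 / R" using re unfolding \<kappa>a by (simp add: cos_of_real)
    from cos_le_imp_band[OF a0 this] obtain l :: nat where l: "l \<ge> 1" "pi * (real l - 1) + \<theta> \<le> a" "a \<le> pi * real l - \<theta>" by blast
    have "0 \<le> pi * (real l - 1) + \<theta>" using l \<theta>_bounds by simp
    then have "a\<^sup>2 \<in> {(pi * (real l - 1) + \<theta>)^2 .. (pi * real l - \<theta>)^2}" using l a0 by (auto intro!: power_mono)
    moreover have "z = of_real (a\<^sup>2)" using \<kappa>2 \<kappa>a by simp
    ultimately show ?thesis using l(1) unfolding spec_def by blast
  qed
  then show False using assms by auto
qed

lemma resolvent_supset:
  assumes "z \<notin> complex_of_real ` spec \<theta>"
  shows "z \<in> resolvent_set (tree_measure b) (dirichlet_laplacian b)"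
proof (rule good_resolvent[OF b not_spec_good[OF assms] not_spec_good])
  show "cnj z \<notin> complex_of_real ` spec \<theta>"
  proof
    assume "cnj z \<in> complex_of_real ` spec \<theta>"
    then obtain r where r: "r \<in> spec \<theta>" "cnj z = of_real r" by auto
    then have "z = of_real r" by (metis complex_cnj_cnj complex_cnj_complex_of_real)
    then show False using assms r by auto
  qed
qed

end

lemma continuous_l2_norm_0:
  assumes f: "continuous_on {0..1} f" and 0: "unit_norm f = 0" and t: "t \<in> {0..1}"
  shows "f t = 0"
proof -
  have c: "continuous_on {0..1} (\<lambda>t. f t * cnj (f t))" by (intro continuous_intros f)
  have "(LINT t|unit_lebesgue. f t * cnj (f t)) = 0"
    using inner_self[of unit_lebesgue f] 0 by (simp add: l2_inner_def)
  then have "integral {0..1} (\<lambda>t. f t * cnj (f t)) = 0"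
    using unit_integral_upto[of 1, OF _ c] set_integral_HK[OF c] unfolding upto_1 by simp
  then have "((\<lambda>t. f t * cnj (f t)) has_integral 0) {0..1}"
    using integrable_integral[OF integrable_continuous_real[OF c]] by simp
  from has_integral_Re[OF this] have "((\<lambda>t. (cmod (f t))^2) has_integral 0) {0..1}"
    by (simp only: complex_norm_square[symmetric] Re_complex_of_real zero_complex.simps)
  then have "integral {0..1} (\<lambda>t. (cmod (f t))^2) = 0" by (rule integral_unique)
  moreover have "continuous_on {0..1} (\<lambda>t. (cmod (f t))^2)" by (intro continuous_intros f)
  ultimately have "\<forall>t\<in>{0..1}. (cmod (f t))^2 = 0"
    using integral_eq_0_iff[of 0 1 "\<lambda>t. (cmod (f t))^2"] by simp
  then show ?thesis using t by simp
qed

section \<open>Eigenfunctions\<close>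

lemma Nil_heads: "[] \<in> heads b"
  by (simp add: heads_def)

lemma geometric_l2:
  assumes a: "cmod q < 1"
  shows "summable (\<lambda>k. (unit_norm (\<lambda>t. q ^ k * h t))^2)"
    "(\<Sum>k. (unit_norm (\<lambda>t. q ^ k * h t))^2) = (unit_norm h)^2 / (1 - (cmod q)\<^sup>2)"
proof -
  have q2: "(cmod q)^2 < 1" using a by (simp add: power_less_one_iff abs_square_less_1)
  have eq: "(unit_norm (\<lambda>t. q ^ k * h t))^2 = (unit_norm h)^2 * ((cmod q)^2) ^ k" for k
    by (simp only: l2_norm_scale norm_power power_mult_distrib) (simp add: power_mult[symmetric] mult.commute)
  show "summable (\<lambda>k. (unit_norm (\<lambda>t. q ^ k * h t))^2)"
    unfolding eq using q2 by (intro summable_mult summable_geometric) simp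
  show "(\<Sum>k. (unit_norm (\<lambda>t. q ^ k * h t))^2) = (unit_norm h)^2 / (1 - (cmod q)\<^sup>2)"
    unfolding eq using q2 by (subst suminf_mult) (auto simp: suminf_geometric)
qed

text \<open>\<open>sin (pi l t)\<close> vanishes at both ends of an edge, so continuity is
  automatic; the slope condition alone fixes the ratio \<open>q\<close> of consecutive edges, whose
  modulus \<open>b^(-1/2)\<close> makes the function square-integrable.\<close>

lemma eigenfunction:
  assumes b: "b \<ge> 2" and l: "l \<ge> (1::nat)"
  shows "\<exists>u. (u, \<lambda>x. of_real ((pi * real l)^2) * u x) \<in> dirichlet_laplacian b \<and> tree_norm b u > 0"
proof -
  define \<kappa> where "\<kappa> = pi * real l"
  define z where "z = complex_of_real (\<kappa>\<^sup>2)"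
  define q where "q = complex_of_real ((- 1) ^ l / sqrt b)"
  define h where "h t = complex_of_real (sin (\<kappa> * t))" for t
  define h1 where "h1 t = complex_of_real (\<kappa> * cos (\<kappa> * t))" for t
  have sb: "sqrt (real b) > 1" using b by simp
  have q1: "cmod q < 1"
  proof -
    have "cmod q = 1 / sqrt b" unfolding q_def norm_of_real by (simp add: power_abs)
    then show ?thesis using sb by simp
  qed
  have p1: "primitive h h1"
    unfolding h_def h1_def
  proof (rule primitive_C1)
    show "((\<lambda>t. complex_of_real (sin (\<kappa> * t))) has_vector_derivative complex_of_real (\<kappa> * cos (\<kappa> * t))) (at t within {0..1})" for t
      by (intro has_vector_derivative_of_real) (auto intro!: derivative_eq_intros)
  qed (intro continuous_intros)
  have p2: "primitive h1 (\<lambda>t. - z * h t)"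
    unfolding h_def h1_def
  proof (rule primitive_C1)
    show "((\<lambda>t. complex_of_real (\<kappa> * cos (\<kappa> * t))) has_vector_derivative - z * complex_of_real (sin (\<kappa> * t))) (at t within {0..1})" for t
    proof -
      have "((\<lambda>t. complex_of_real (\<kappa> * cos (\<kappa> * t))) has_vector_derivative of_real (- (\<kappa>\<^sup>2) * sin (\<kappa> * t))) (at t within {0..1})"
        by (intro has_vector_derivative_of_real) (auto intro!: derivative_eq_intros simp: power2_eq_square)
      then show ?thesis by (simp add: z_def)
    qed
  qed (intro continuous_intros)
  have at: "h 0 = 0" "h 1 = 0" "h1 0 = of_real \<kappa>" "h1 1 = of_real (\<kappa> * (- 1) ^ l)"
    by (simp_all add: h_def h1_def \<kappa>_def sin_npi2 cos_npi2)
  have hL: "h \<in> L2 unit_lebesgue" by (rule continuous_unit_L2[OF primitive_continuous[OF p1]])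
  define \<phi> where "\<phi> k t = q ^ k * h t" for k t
  have \<phi>L: "\<phi> k \<in> L2 unit_lebesgue" for k unfolding \<phi>_def by (rule L2_scale[OF hL])
  have s: "square_summable \<phi>" unfolding \<phi>_def by (rule geometric_l2(1)[OF q1])
  have dom: "(ext b [] \<phi>, \<lambda>x. z * ext b [] \<phi> x + ext b [] (\<lambda>_ _. 0) x) \<in> dirichlet_laplacian b"
  proof (rule ext_domain[OF b Nil_heads, where ?\<phi>1.0="\<lambda>k t. q ^ k * h1 t"])
    fix k
    show "primitive (\<phi> k) (\<lambda>t. q ^ k * h1 t)" unfolding \<phi>_def by (rule primitive_scale[OF p1])
    show "primitive (\<lambda>t. q ^ k * h1 t) (\<lambda>t. - z * \<phi> k t - 0)"
      using primitive_scale[OF p2, of "q ^ k"] by (simp add: \<phi>_def mult.left_commute)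
    show "\<phi> (Suc k) 0 = complex_of_real (sqrt (real b)) * \<phi> k 1" by (simp add: \<phi>_def at)
    show "complex_of_real (sqrt (real b)) * (q ^ Suc k * h1 0) = q ^ k * h1 1"
      using sb by (simp add: at q_def)
  qed (use s geometric_l2(1)[OF q1] in \<open>auto simp: \<phi>_def at\<close>)
  have "ext b [] (\<lambda>_ _. 0) x = 0" for x
    by (cases x) (simp add: ext_def syn_def lift_def if_distribR if_distrib cong: if_cong)
  then have dom': "(ext b [] \<phi>, \<lambda>x. of_real ((pi * real l)^2) * ext b [] \<phi> x) \<in> dirichlet_laplacian b"
    using dom by (simp add: z_def \<kappa>_def)
  have "tree_norm b (ext b [] \<phi>) \<noteq> 0"
  proof
    assume 0: "tree_norm b (ext b [] \<phi>) = 0"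
    then have "(\<Sum>k. (unit_norm (\<phi> k))^2) = 0"
      using ext_L2(2)[OF b Nil_heads \<phi>L s] by simp
    then have "(unit_norm h)^2 / (1 - (cmod q)\<^sup>2) = 0"
      using geometric_l2(2)[OF q1, of h] by (simp add: \<phi>_def[abs_def])
    moreover have "(cmod q)^2 < 1" using q1 by (simp add: power_less_one_iff abs_square_less_1)
    ultimately have "unit_norm h = 0" by simp
    \<comment> \<open>At this point the sine equals 1.\<close>
    then have "h (1 / (2 * real l)) = 0"
      using l by (intro continuous_l2_norm_0[OF primitive_continuous[OF p1]]) (auto simp: field_simps)
    then show False using l by (simp add: h_def \<kappa>_def)
  qed
  then have "tree_norm b (ext b [] \<phi>) > 0" using l2_norm_nonneg[of "tree_measure b" "ext b [] \<phi>"] by linarith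
  then show ?thesis using dom' by blast
qed

lemma eigenvalue_point:
  assumes "b \<ge> 2" "l \<ge> (1::nat)"
  shows "eigenvalue (tree_measure b) (dirichlet_laplacian b) (of_real ((pi * real l)^2))"
proof -
  obtain u where u: "(u, \<lambda>x. of_real ((pi * real l)^2) * u x) \<in> dirichlet_laplacian b" "tree_norm b u > 0"
    using eigenfunction[OF assms] by blast
  have "\<not> (AE x in tree_measure b. u x = 0)"
    using u(2) l2_norm_eq_0_iff[of u "tree_measure b"] laplacian_L2[OF u(1)] by auto
  then show ?thesis unfolding eigenvalue_def using u(1)
    by (intro bexI[of _ "(u, \<lambda>x. of_real ((pi * real l)^2) * u x)"]) auto
qed

lemma eigenvalue_in_spectrum:
  assumes "eigenvalue M T z" and L: "\<And>u h. (u, h) \<in> T \<Longrightarrow> u \<in> L2 M \<and> h \<in> L2 M"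
  shows "z \<notin> resolvent_set M T"
proof
  assume "z \<in> resolvent_set M T"
  then obtain C where "\<forall>(u, h)\<in>T. l2_norm M u \<le> C * l2_norm M (\<lambda>x. h x - z * u x)"
    unfolding resolvent_set_def by blast
  then have C: "l2_norm M u \<le> C * l2_norm M (\<lambda>x. h x - z * u x)" if "(u, h) \<in> T" for u h using that by auto
  from assms(1) obtain u h where uh: "(u, h) \<in> T" "AE x in M. h x = z * u x" "\<not> (AE x in M. u x = 0)"
    unfolding eigenvalue_def by auto
  have uL: "u \<in> L2 M" "h \<in> L2 M" using L[OF uh(1)] by auto
  have "l2_norm M (\<lambda>x. h x - z * u x) = 0"
    using uh(2) uL by (subst l2_norm_eq_0_iff) auto
  then have "l2_norm M u = 0" using C[OF uh(1)] l2_norm_nonneg[of M u] by simp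
  then show False using uh(3) l2_norm_eq_0_iff[OF uL(1)] by simp
qed

text \<open>Floquet solutions: for \<open>m + 1/m = 2 R cos \<kappa>\<close> the functions \<open>m\<^sup>k h\<close> satisfy the vertex conditions.\<close>

lemma Floquet_solution:
  assumes b: "b > 0" and S: "sn z 1 \<noteq> 0" and m: "m \<noteq> 0" and mz: "m + 1 / m = of_real (sqrt b + 1 / sqrt b) * cs z 1"
  shows "\<exists>h h1. primitive h h1 \<and> primitive h1 (\<lambda>t. - z * h t) \<and> h 0 = 1 \<and> of_real (sqrt b) * h 1 = m \<and>
    of_real (sqrt b) * m * h1 0 = h1 1"
proof -
  define s where "s = complex_of_real (sqrt b)"
  have s0: "s \<noteq> 0" using b by (simp add: s_def)
  define C where "C = cs z 1" define S' where "S' = sn z 1"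
  have S0: "S' \<noteq> 0" using S by (simp add: S'_def)
  have mz': "m + 1 / m = (s + 1 / s) * C" using mz by (simp add: s_def C_def)
  have CS: "C * C + z * S' * S' = 1" using cs_sn[of z 1] by (simp add: C_def S'_def power2_eq_square mult.assoc)
  \<comment> \<open>The initial slope for which \<open>h 1 = m / s\<close>; the remaining slope
    condition is then the quadratic equation of \<open>m\<close>.\<close>
  define d where "d = (m / s - C) / S'"
  have dS: "d * S' = m / s - C" using S0 by (simp add: d_def)
  define h where "h t = cs z t + d * sn z t" for t
  define h1 where "h1 t = - z * sn z t + d * cs z t" for t
  have "primitive h h1" unfolding h_def h1_def by (intro primitive_add primitive_scale primitive_cs primitive_sn)
  moreover have "primitive h1 (\<lambda>t. - z * h t)"
  proof -
    have "primitive h1 (\<lambda>t. - z * cs z t + d * (- z * sn z t))"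
      unfolding h1_def by (intro primitive_add primitive_scale primitive_cs primitive_sn)
    then show ?thesis by (simp add: h_def algebra_simps)
  qed
  moreover have "h 0 = 1" by (simp add: h_def)
  moreover have "s * h 1 = m" using s0 dS by (simp add: h_def C_def[symmetric] S'_def[symmetric])
  moreover have "s * m * h1 0 = h1 1"
  proof -
    have mm: "m * m = m * ((s + 1 / s) * C) - 1"
    proof -
      have "m * (m + 1 / m) = m * m + 1" using m by (simp add: distrib_left)
      then show ?thesis unfolding mz' by (simp add: algebra_simps)
    qed
    have "S' * (s * m * d - d * C) = (s * m - C) * (d * S')" by (simp add: algebra_simps)
    also have "\<dots> = m * m - C * (m * (s + 1 / s)) + C * C" unfolding dS using s0 by (simp add: field_simps)
    also have "\<dots> = C * C - 1" unfolding mm by (simp add: algebra_simps)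
    also have "\<dots> = S' * (- z * S')" using CS by (simp add: algebra_simps)
    finally have "s * m * d - d * C = - z * S'" unfolding mult_left_cancel[OF S0] .
    then show ?thesis by (simp add: h1_def C_def[symmetric] S'_def[symmetric] algebra_simps)
  qed
  ultimately show ?thesis unfolding s_def by blast
qed

section \<open>Weyl sequences in the bands\<close>

lemma weighted_solution:
  assumes w: "primitive w w1" "primitive w1 w2" and h: "primitive h h1" "primitive h1 (\<lambda>t. - z * h t)"
  shows "primitive (\<lambda>t. w t * h t) (\<lambda>t. w1 t * h t + w t * h1 t)"
    "primitive (\<lambda>t. w1 t * h t + w t * h1 t) (\<lambda>t. - z * (w t * h t) - (- (w2 t * h t + 2 * w1 t * h1 t)))"
proof -
  show "primitive (\<lambda>t. w t * h t) (\<lambda>t. w1 t * h t + w t * h1 t)" by (rule primitive_mult[OF w(1) h(1)])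
  have "primitive (\<lambda>t. w1 t * h t + w t * h1 t) (\<lambda>t. (w2 t * h t + w1 t * h1 t) + (w1 t * h1 t + w t * (- z * h t)))"
    by (intro primitive_add primitive_mult w h)
  then show "primitive (\<lambda>t. w1 t * h t + w t * h1 t) (\<lambda>t. - z * (w t * h t) - (- (w2 t * h t + 2 * w1 t * h1 t)))"
    by (simp add: algebra_simps)
qed

text \<open>The cubic that rises from 0 to 1 with vanishing slopes at both ends; as an exponent it
  interpolates between the weights \<open>r^k\<close> and \<open>r^(k+1)\<close> across an
  edge.\<close>

definition ramp :: "real \<Rightarrow> real" where "ramp t = 3 * t\<^sup>2 - 2 * t ^ 3"
definition ramp1 :: "real \<Rightarrow> real" where "ramp1 t = 6 * t - 6 * t\<^sup>2"
definition ramp2 :: "real \<Rightarrow> real" where "ramp2 t = 6 - 12 * t"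

lemma ramp_deriv: "(ramp has_real_derivative ramp1 t) (at t within A)" "(ramp1 has_real_derivative ramp2 t) (at t within A)"
  unfolding ramp_def[abs_def] ramp1_def[abs_def] ramp2_def by (auto intro!: derivative_eq_intros simp: power2_eq_square)

lemma ramp_cont: "continuous_on A ramp" "continuous_on A ramp1" "continuous_on A ramp2"
  unfolding ramp_def[abs_def] ramp1_def[abs_def] ramp2_def[abs_def] by (intro continuous_intros)+

lemma ramp_ends [simp]: "ramp 0 = 0" "ramp 1 = 1" "ramp1 0 = 0" "ramp1 1 = 0"
  by (auto simp: ramp_def ramp1_def)

lemma ramp_bounds:
  assumes "t \<in> {0..1}"
  shows "0 \<le> ramp t" "ramp t \<le> 1" "\<bar>ramp1 t\<bar> \<le> 2" "\<bar>ramp2 t\<bar> \<le> 6"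
proof -
  have t: "0 \<le> t" "t \<le> 1" using assms by auto
  have "ramp t = t\<^sup>2 * (3 - 2 * t)" by (simp add: ramp_def power2_eq_square power3_eq_cube algebra_simps)
  then show "0 \<le> ramp t" using t by simp
  have "1 - ramp t = (1 - t)^2 * (1 + 2 * t)" by (simp add: ramp_def power2_eq_square power3_eq_cube algebra_simps)
  then have "1 - ramp t \<ge> 0" using t by simp
  then show "ramp t \<le> 1" by simp
  have 1: "ramp1 t = 6 * (t * (1 - t))" by (simp add: ramp1_def power2_eq_square algebra_simps)
  have "t * (1 - t) \<le> 1 / 4" using zero_le_square[of "t - 1/2"] by (simp add: algebra_simps power2_eq_square)
  moreover have "0 \<le> t * (1 - t)" using t by simp
  ultimately show "\<bar>ramp1 t\<bar> \<le> 2" unfolding 1 by simp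
  show "\<bar>ramp2 t\<bar> \<le> 6" using t by (simp add: ramp2_def abs_le_iff)
qed

text \<open>The damped Floquet solution \<open>r\<^bsup>k+\<rho>(t)\<^esup> m\<^sup>k h(t)\<close>, \<open>r = exp (-\<epsilon>)\<close>: since \<open>\<rho>'\<close> vanishes at the ends, the
  vertex conditions survive the damping; the factor \<open>\<rho>\<close> on the first edge enforces the Dirichlet condition.\<close>

lemma Weyl_function:
  assumes b: "b \<ge> 2" and m: "cmod m = 1"
    and h: "primitive h h1" "primitive h1 (\<lambda>t. - z * h t)" and at: "h 0 = 1" "of_real (sqrt b) * h 1 = m" "of_real (sqrt b) * m * h1 0 = h1 1"
    and B: "\<And>t. t \<in> {0..1} \<Longrightarrow> cmod (h t) \<le> B" "\<And>t. t \<in> {0..1} \<Longrightarrow> cmod (h1 t) \<le> B"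
    and e: "0 < e" "e \<le> 1"
  shows "\<exists>u g. (u, \<lambda>x. z * u x + g x) \<in> dirichlet_laplacian b \<and> g \<in> tree_L2 b \<and>
     (tree_norm b u)\<^sup>2 * (1 - exp (- 2 * e)) \<ge> exp (- 4 * e) * (unit_norm h)^2 \<and>
     (tree_norm b g)\<^sup>2 * (1 - exp (- 2 * e)) \<le> (36 * B)^2 * (1 - exp (- 2 * e)) + (14 * e * B)^2"
proof -
  define r where "r = exp (- e)"
  have r: "0 < r" "r < 1" using e by (auto simp: r_def)
  have r2: "exp (- 2 * e) = r\<^sup>2" "exp (- 4 * e) = r ^ 4" by (simp_all add: r_def exp_of_nat_mult[symmetric])
  have B0: "B \<ge> 0" using order_trans[OF norm_ge_zero B(1)[of 0]] by simp
  define \<xi> where "\<xi> t = exp (- e * ramp t)" for t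
  define \<xi>1 where "\<xi>1 t = - e * ramp1 t * \<xi> t" for t
  define \<xi>2 where "\<xi>2 t = (- e * ramp2 t + (e * ramp1 t)^2) * \<xi> t" for t
  have d\<xi>: "(\<xi> has_real_derivative \<xi>1 t) (at t within A)" for t A
    unfolding \<xi>_def[abs_def] \<xi>1_def \<xi>_def by (auto intro!: derivative_eq_intros ramp_deriv)
  have d\<xi>1: "(\<xi>1 has_real_derivative \<xi>2 t) (at t within A)" for t A
    unfolding \<xi>1_def[abs_def] \<xi>2_def
    by (rule derivative_eq_intros ramp_deriv d\<xi> refl)+ (simp add: \<xi>1_def algebra_simps power2_eq_square)
  have c\<xi>: "continuous_on A \<xi>" "continuous_on A \<xi>1" "continuous_on A \<xi>2" for A
    unfolding \<xi>_def[abs_def] \<xi>1_def[abs_def] \<xi>2_def[abs_def] by (intro continuous_intros ramp_cont)+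
  have p\<xi>: "primitive (\<lambda>t. of_real (\<xi> t)) (\<lambda>t. of_real (\<xi>1 t))" "primitive (\<lambda>t. of_real (\<xi>1 t)) (\<lambda>t. of_real (\<xi>2 t))"
    by (rule primitive_C1; intro has_vector_derivative_of_real d\<xi> d\<xi>1 continuous_intros c\<xi>)+
  \<comment> \<open>On the first edge the weight starts at 0, and at \<open>t = 1\<close> it has the
    value and the slope of \<open>\<xi>\<close>.\<close>
  define \<omega> where "\<omega> t = ramp t * \<xi> t" for t
  define \<omega>1 where "\<omega>1 t = ramp1 t * \<xi> t + ramp t * \<xi>1 t" for t
  define \<omega>2 where "\<omega>2 t = ramp2 t * \<xi> t + 2 * ramp1 t * \<xi>1 t + ramp t * \<xi>2 t" for t
  have d\<omega>: "(\<omega> has_real_derivative \<omega>1 t) (at t within A)" for t A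
    unfolding \<omega>_def[abs_def] \<omega>1_def by (rule derivative_eq_intros ramp_deriv d\<xi> refl)+ simp
  have d\<omega>1: "(\<omega>1 has_real_derivative \<omega>2 t) (at t within A)" for t A
    unfolding \<omega>1_def[abs_def] \<omega>2_def by (rule derivative_eq_intros ramp_deriv d\<xi> d\<xi>1 refl)+ simp
  have c\<omega>: "continuous_on A \<omega>" "continuous_on A \<omega>1" "continuous_on A \<omega>2" for A
    unfolding \<omega>_def[abs_def] \<omega>1_def[abs_def] \<omega>2_def[abs_def] by (intro continuous_intros ramp_cont c\<xi>)+
  have p\<omega>: "primitive (\<lambda>t. of_real (\<omega> t)) (\<lambda>t. of_real (\<omega>1 t))" "primitive (\<lambda>t. of_real (\<omega>1 t)) (\<lambda>t. of_real (\<omega>2 t))"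
    by (rule primitive_C1; intro has_vector_derivative_of_real d\<omega> d\<omega>1 continuous_intros c\<omega>)+
  have \<xi>b: "r \<le> \<xi> t" "0 \<le> \<xi> t" "\<xi> t \<le> 1" "\<bar>\<xi>1 t\<bar> \<le> 2 * e" "\<bar>\<xi>2 t\<bar> \<le> 10 * e" if t: "t \<in> {0..1}" for t
  proof -
    have "e * ramp t \<le> e * 1" using ramp_bounds[OF t] e by (intro mult_left_mono) auto
    moreover have "0 \<le> e * ramp t" using ramp_bounds[OF t] e by simp
    ultimately show 1: "r \<le> \<xi> t" "0 \<le> \<xi> t" "\<xi> t \<le> 1" by (auto simp: r_def \<xi>_def)
    have 2: "\<bar>e * ramp1 t\<bar> \<le> 2 * e" using ramp_bounds(3)[OF t] e by (simp add: abs_mult mult.commute)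
    have "\<bar>\<xi>1 t\<bar> = \<bar>e * ramp1 t\<bar> * \<xi> t" using 1 by (simp add: \<xi>1_def abs_mult)
    also have "\<dots> \<le> (2 * e) * 1" using 1 2 e by (intro mult_mono) auto
    finally show "\<bar>\<xi>1 t\<bar> \<le> 2 * e" by simp
    have "(e * ramp1 t)^2 \<le> (2 * e)^2" using 2 by (subst abs_le_square_iff[symmetric]) (use e in auto)
    also have "\<dots> \<le> 4 * e" using e by (simp add: power2_eq_square)
    finally have 3: "(e * ramp1 t)^2 \<le> 4 * e" .
    have "\<bar>e * ramp2 t\<bar> \<le> 6 * e" using ramp_bounds(4)[OF t] e by (simp add: abs_mult mult.commute)
    then have "\<bar>- e * ramp2 t + (e * ramp1 t)^2\<bar> \<le> 10 * e"
      using 3 zero_le_power2[of "e * ramp1 t"] unfolding abs_le_iff by linarith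
    then have "\<bar>- e * ramp2 t + (e * ramp1 t)^2\<bar> * \<xi> t \<le> (10 * e) * 1" using 1 e by (intro mult_mono) auto
    then show "\<bar>\<xi>2 t\<bar> \<le> 10 * e" using 1 by (simp add: \<xi>2_def abs_mult)
  qed
  have \<omega>b: "\<bar>\<omega>1 t\<bar> \<le> 4" "\<bar>\<omega>2 t\<bar> \<le> 24" if t: "t \<in> {0..1}" for t
  proof -
    note R = ramp_bounds[OF t] and X = \<xi>b[OF t]
    have a: "\<bar>ramp1 t * \<xi> t\<bar> \<le> 2 * 1" "\<bar>ramp t * \<xi>1 t\<bar> \<le> 1 * 2" "\<bar>ramp2 t * \<xi> t\<bar> \<le> 6 * 1"
      "\<bar>ramp1 t * \<xi>1 t\<bar> \<le> 2 * 2" "\<bar>ramp t * \<xi>2 t\<bar> \<le> 1 * 10"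
      unfolding abs_mult using R X e by (intro mult_mono; force)+
    show "\<bar>\<omega>1 t\<bar> \<le> 4" "\<bar>\<omega>2 t\<bar> \<le> 24" unfolding \<omega>1_def \<omega>2_def using a by linarith+
  qed
  define W where "W k t = complex_of_real (if k = 0 then \<omega> t else \<xi> t)" for k :: nat and t
  define W1 where "W1 k t = complex_of_real (if k = 0 then \<omega>1 t else \<xi>1 t)" for k :: nat and t
  define W2 where "W2 k t = complex_of_real (if k = 0 then \<omega>2 t else \<xi>2 t)" for k :: nat and t
  have pW: "primitive (W k) (W1 k)" "primitive (W1 k) (W2 k)" for k
    using p\<xi> p\<omega> by (cases "k = 0"; simp add: W_def[abs_def] W1_def[abs_def] W2_def[abs_def])+
  define q where "q = of_real r * m"
  have cq: "cmod q = r" using m r by (simp add: q_def norm_mult)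
  have q1: "cmod q < 1" using cq r by simp
  define \<phi> where "\<phi> k t = q ^ k * (W k t * h t)" for k t
  define \<phi>1 where "\<phi>1 k t = q ^ k * (W1 k t * h t + W k t * h1 t)" for k t
  define \<gamma> where "\<gamma> k t = q ^ k * (- (W2 k t * h t + 2 * W1 k t * h1 t))" for k t
  have p1: "primitive (\<phi> k) (\<phi>1 k)" for k
    unfolding \<phi>_def \<phi>1_def by (intro primitive_scale weighted_solution(1)[OF pW h])
  have p2: "primitive (\<phi>1 k) (\<lambda>t. - z * \<phi> k t - \<gamma> k t)" for k
    using primitive_scale[OF weighted_solution(2)[OF pW h], of "q ^ k" k]
    unfolding \<phi>_def \<phi>1_def \<gamma>_def by (simp add: algebra_simps)
  have hc: "continuous_on {0..1} h" "continuous_on {0..1} h1" using h by (auto intro: primitive_continuous)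
  have W2c: "continuous_on {0..1} (W2 k)" for k
    unfolding W2_def using c\<omega>(3) c\<xi>(3) by (cases "k = 0") (auto intro!: continuous_intros)
  have \<gamma>c: "continuous_on {0..1} (\<gamma> k)" for k
    unfolding \<gamma>_def by (intro continuous_intros W2c hc primitive_continuous[OF pW(2)])
  have \<gamma>L: "\<gamma> k \<in> L2 unit_lebesgue" for k by (rule continuous_unit_L2[OF \<gamma>c])
  have r2': "r\<^sup>2 < 1" using r by (simp add: power_less_one_iff abs_square_less_1)
  have le1: "(unit_norm f)^2 \<le> (r ^ k * D)^2"
    if "continuous_on {0..1} f" "\<And>t. t \<in> {0..1} \<Longrightarrow> cmod (f t) \<le> r ^ k * D" for f k D
    by (rule unit_l2_norm_le[OF that])
  have geo: "summable (\<lambda>k. (r ^ k * D)^2)" "(\<Sum>k. (r ^ k * D)^2) = D\<^sup>2 / (1 - r\<^sup>2)" for D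
  proof -
    have eq: "(r ^ k * D)^2 = D\<^sup>2 * (r\<^sup>2) ^ k" for k by (simp add: power_mult_distrib power_mult[symmetric] mult.commute)
    show "summable (\<lambda>k. (r ^ k * D)^2)" unfolding eq using r2' by (intro summable_mult summable_geometric) simp
    show "(\<Sum>k. (r ^ k * D)^2) = D\<^sup>2 / (1 - r\<^sup>2)" unfolding eq using r2' by (subst suminf_mult) (auto simp: suminf_geometric)
  qed
  have Wb: "cmod (W k t) \<le> 1" "cmod (W1 k t) \<le> 4" if t: "t \<in> {0..1}" for k t
  proof -
    have "\<bar>\<omega> t\<bar> \<le> 1 * 1" unfolding \<omega>_def abs_mult using ramp_bounds[OF t] \<xi>b[OF t] by (intro mult_mono) auto
    then show "cmod (W k t) \<le> 1" using \<xi>b[OF t] by (simp add: W_def)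
    show "cmod (W1 k t) \<le> 4" using \<xi>b(4)[OF t] \<omega>b(1)[OF t] e by (simp add: W1_def)
  qed
  have \<phi>b: "cmod (\<phi> k t) \<le> r ^ k * B" if t: "t \<in> {0..1}" for k t
  proof -
    have "cmod (W k t) * cmod (h t) \<le> 1 * B" using Wb[OF t] B(1)[OF t] by (intro mult_mono) auto
    then show ?thesis unfolding \<phi>_def norm_mult norm_power cq using r by (intro mult_left_mono) auto
  qed
  have \<phi>1b: "cmod (\<phi>1 k t) \<le> r ^ k * (5 * B)" if t: "t \<in> {0..1}" for k t
  proof -
    have "cmod (W1 k t * h t + W k t * h1 t) \<le> cmod (W1 k t) * cmod (h t) + cmod (W k t) * cmod (h1 t)"
      by (metis norm_mult norm_triangle_ineq)
    also have "\<dots> \<le> 4 * B + 1 * B" using Wb[OF t] B(1)[OF t] B(2)[OF t] by (intro add_mono mult_mono) auto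
    finally have "cmod (W1 k t * h t + W k t * h1 t) \<le> 5 * B" by simp
    then show ?thesis unfolding \<phi>1_def norm_mult[of "q ^ k"] norm_power cq using r by (intro mult_left_mono) auto
  qed
  have s: "square_summable \<phi>"
    by (rule summable_comparison_test'[where N=0, OF geo(1)[of B]])
       (use le1[OF primitive_continuous[OF p1] \<phi>b] in simp)
  have s1: "square_summable \<phi>1"
    by (rule summable_comparison_test'[where N=0, OF geo(1)[of "5 * B"]])
       (use le1[OF primitive_continuous[OF p2] \<phi>1b] in simp)
  \<comment> \<open>The residual contains only derivatives of the weight. On the first edge these
    are of order 1, giving \<open>24 + 2 * 4 <= 36\<close>; on all others they are of order
    \<open>e\<close>, giving \<open>10 + 2 * 2 = 14\<close>.\<close>
  have gb: "cmod (\<gamma> k t) \<le> r ^ k * (x * B + 2 * (y * B))"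
    if t: "t \<in> {0..1}" and xy: "cmod (W2 k t) \<le> x" "cmod (W1 k t) \<le> y" for k t x y
  proof -
    have "cmod (- (W2 k t * h t + 2 * W1 k t * h1 t)) \<le> cmod (W2 k t) * cmod (h t) + 2 * (cmod (W1 k t) * cmod (h1 t))"
      unfolding norm_minus_cancel using norm_triangle_ineq[of "W2 k t * h t" "2 * W1 k t * h1 t"] by (simp add: norm_mult)
    also have "\<dots> \<le> x * B + 2 * (y * B)"
      using xy B(1)[OF t] B(2)[OF t] order_trans[OF norm_ge_zero xy(1)] order_trans[OF norm_ge_zero xy(2)]
      by (intro add_mono mult_mono mult_left_mono) auto
    finally show ?thesis unfolding \<gamma>_def norm_mult[of "q ^ k"] norm_power cq using r by (intro mult_left_mono) auto
  qed
  have \<gamma>0: "(unit_norm (\<gamma> 0))^2 \<le> (36 * B)^2"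
  proof -
    have "(unit_norm (\<gamma> 0))^2 \<le> (r ^ 0 * (32 * B))^2"
    proof (rule le1[OF \<gamma>c])
      fix t :: real assume t: "t \<in> {0..1}"
      have "cmod (\<gamma> 0 t) \<le> r ^ 0 * (24 * B + 2 * (4 * B))"
        by (rule gb[OF t]) (use \<omega>b[OF t] in \<open>simp_all add: W1_def W2_def\<close>)
      then show "cmod (\<gamma> 0 t) \<le> r ^ 0 * (32 * B)" by simp
    qed
    also have "\<dots> \<le> (36 * B)^2" using B0 by (intro power_mono) auto
    finally show ?thesis .
  qed
  have \<gamma>S: "(unit_norm (\<gamma> (Suc k)))^2 \<le> (r ^ k * (14 * e * B))^2" for k
  proof -
    have "(unit_norm (\<gamma> (Suc k)))^2 \<le> (r ^ Suc k * (14 * e * B))^2"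
    proof (rule le1[OF \<gamma>c])
      fix t :: real assume t: "t \<in> {0..1}"
      have "cmod (\<gamma> (Suc k) t) \<le> r ^ Suc k * ((10 * e) * B + 2 * ((2 * e) * B))"
        by (rule gb[OF t]) (use \<xi>b[OF t] in \<open>simp_all add: W1_def W2_def\<close>)
      then show "cmod (\<gamma> (Suc k) t) \<le> r ^ Suc k * (14 * e * B)" by (simp add: algebra_simps)
    qed
    also have "\<dots> \<le> (r ^ k * (14 * e * B))^2"
      using r e B0 by (intro power_mono mult_right_mono power_decreasing) auto
    finally show ?thesis .
  qed
  have s\<gamma>S: "summable (\<lambda>k. (unit_norm (\<gamma> (Suc k)))^2)"
    by (rule summable_comparison_test'[where N=0, OF geo(1)[of "14 * e * B"]]) (use \<gamma>S in simp)
  then have s\<gamma>: "square_summable \<gamma>" by (subst (asm) summable_Suc_iff)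
  have dom: "(ext b [] \<phi>, \<lambda>x. z * ext b [] \<phi> x + ext b [] \<gamma> x) \<in> dirichlet_laplacian b"
  proof (rule ext_domain[OF b Nil_heads p1 p2 _ _ _ \<gamma>L s s1 s\<gamma>])
    show "\<phi> 0 0 = 0" by (simp add: \<phi>_def W_def \<omega>_def)
    have \<xi>e: "\<xi> 0 = 1" "\<xi> 1 = r" "\<xi>1 0 = 0" "\<xi>1 1 = 0" "\<omega> 1 = r" "\<omega>1 1 = 0"
      by (simp_all add: \<xi>_def \<xi>1_def \<omega>_def \<omega>1_def r_def)
    show "\<phi> (Suc k) 0 = complex_of_real (sqrt (real b)) * \<phi> k 1" for k
      using at(1) by (simp add: \<phi>_def W_def \<xi>e q_def at(2)[symmetric])
    show "complex_of_real (sqrt (real b)) * \<phi>1 (Suc k) 0 = \<phi>1 k 1" for k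
      by (simp add: \<phi>1_def W_def W1_def \<xi>e q_def at(3)[symmetric])
  qed
  have \<phi>L: "\<phi> k \<in> L2 unit_lebesgue" for k by (rule continuous_unit_L2[OF primitive_continuous[OF p1]])
  have lower: "r ^ 4 * (unit_norm h)^2 \<le> (tree_norm b (ext b [] \<phi>))^2 * (1 - r\<^sup>2)"
  proof -
    \<comment> \<open>From the second edge on \<open>\<xi>\<close> is at least \<open>r\<close>; the
      first edge is discarded.\<close>
    have trm: "(r ^ k * (r * r * unit_norm h))^2 \<le> (unit_norm (\<phi> (Suc k)))^2" for k
    proof -
      have "(r ^ Suc k * r)^2 * (unit_norm h)^2 = (LINT t|unit_lebesgue. (r ^ Suc k * r)^2 * (cmod (h t))^2)"
        by (simp add: l2_norm_power2)
      also have "\<dots> \<le> (LINT t|unit_lebesgue. (cmod (\<phi> (Suc k) t))^2)"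
      proof (rule integral_mono)
        show "integrable unit_lebesgue (\<lambda>t. (r ^ Suc k * r)^2 * (cmod (h t))^2)"
          using L2_integrable[OF continuous_unit_L2[OF hc(1)]] by simp
        show "integrable unit_lebesgue (\<lambda>t. (cmod (\<phi> (Suc k) t))^2)" by (rule L2_integrable[OF \<phi>L])
        fix t assume "t \<in> space unit_lebesgue"
        then have t: "t \<in> {0..1}" by simp
        have "cmod (\<phi> (Suc k) t) = r ^ Suc k * \<xi> t * cmod (h t)"
          unfolding \<phi>_def norm_mult norm_power cq using \<xi>b(2)[OF t] by (simp add: W_def)
        moreover have "r ^ Suc k * r * cmod (h t) \<le> r ^ Suc k * \<xi> t * cmod (h t)"
          using r \<xi>b(1)[OF t] by (intro mult_right_mono mult_left_mono) auto
        ultimately have "(r ^ Suc k * r * cmod (h t))^2 \<le> (cmod (\<phi> (Suc k) t))^2" using r by (intro power_mono) auto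
        then show "(r ^ Suc k * r)^2 * (cmod (h t))^2 \<le> (cmod (\<phi> (Suc k) t))^2" by (simp only: power_mult_distrib)
      qed
      finally show ?thesis by (simp add: l2_norm_power2 power_mult_distrib mult_ac)
    qed
    have "(r * r * unit_norm h)^2 / (1 - r\<^sup>2) \<le> (\<Sum>k. (unit_norm (\<phi> (Suc k)))^2)"
      unfolding geo(2)[symmetric] by (rule suminf_le[OF trm geo(1)]) (use s in \<open>subst summable_Suc_iff\<close>)
    also have "\<dots> \<le> (\<Sum>k. (unit_norm (\<phi> k))^2)"
      using suminf_split_head[OF s] by simp
    also have "\<dots> = (tree_norm b (ext b [] \<phi>))^2" by (rule ext_L2(2)[OF b Nil_heads \<phi>L s, symmetric])
    finally have "(r * r * unit_norm h)^2 \<le> (tree_norm b (ext b [] \<phi>))^2 * (1 - r\<^sup>2)"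
      using r2' by (simp add: pos_divide_le_eq)
    moreover have "(r * r * unit_norm h)^2 = r ^ 4 * (unit_norm h)^2"
      by (simp add: power_mult_distrib power2_eq_square power4_eq_xxxx)
    ultimately show ?thesis by simp
  qed
  have upper: "(tree_norm b (ext b [] \<gamma>))^2 * (1 - r\<^sup>2) \<le> (36 * B)^2 * (1 - r\<^sup>2) + (14 * e * B)^2"
  proof -
    have "(tree_norm b (ext b [] \<gamma>))^2 = (\<Sum>k. (unit_norm (\<gamma> k))^2)"
      by (rule ext_L2(2)[OF b Nil_heads \<gamma>L s\<gamma>])
    also have "\<dots> = (\<Sum>k. (unit_norm (\<gamma> (Suc k)))^2) + (unit_norm (\<gamma> 0))^2"
      using suminf_split_head[OF s\<gamma>] by simp
    also have "\<dots> \<le> (14 * e * B)^2 / (1 - r\<^sup>2) + (36 * B)^2"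
      unfolding geo(2)[symmetric] by (intro add_mono \<gamma>0 suminf_le[OF \<gamma>S s\<gamma>S geo(1)])
    finally have "(tree_norm b (ext b [] \<gamma>))^2 * (1 - r\<^sup>2) \<le> ((14 * e * B)^2 / (1 - r\<^sup>2) + (36 * B)^2) * (1 - r\<^sup>2)"
      using r2' by (intro mult_right_mono) auto
    then show ?thesis using r2' by (simp add: distrib_right)
  qed
  show ?thesis unfolding r2
    by (intro exI[of _ "ext b [] \<phi>"] exI[of _ "ext b [] \<gamma>"] conjI dom lower upper ext_L2(1)[OF b Nil_heads \<gamma>L s\<gamma>])
qed

context tree_parameters
begin

text \<open>In a band \<open>|R cos a| <= 1\<close>, so a multiplier of modulus 1 exists, band edges
  included. As the damping \<open>e\<close> tends to 0, the squared residual multiplied by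
  \<open>1 - exp (-2 e)\<close> tends to 0, while the squared norm of the damped solution,
  multiplied by the same factor, stays away from 0.\<close>

lemma band_not_resolvent:
  assumes l: "l \<ge> (1::nat)" and lam: "lam \<in> {(pi * (real l - 1) + \<theta>)^2 .. (pi * real l - \<theta>)^2}"
  shows "complex_of_real lam \<notin> resolvent_set (tree_measure b) (dirichlet_laplacian b)"
proof
  assume "complex_of_real lam \<in> resolvent_set (tree_measure b) (dirichlet_laplacian b)"
  then obtain C where "\<forall>(u, h)\<in>dirichlet_laplacian b.
     tree_norm b u \<le> C * tree_norm b (\<lambda>x. h x - of_real lam * u x)"
    unfolding resolvent_set_def by blast
  then have C: "tree_norm b u \<le> C * tree_norm b (\<lambda>x. h x - of_real lam * u x)"
    if "(u, h) \<in> dirichlet_laplacian b" for u h using that by auto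
  define a where "a = sqrt lam"
  have pos: "0 < pi * (real l - 1) + \<theta>" using l \<theta>_bounds by (simp add: add_nonneg_pos)
  have lam0: "lam > 0" using lam pos by (auto intro: less_le_trans[OF zero_less_power])
  have pos': "0 \<le> pi * real l - \<theta>"
  proof -
    have "pi * 1 \<le> pi * real l" using l by (intro mult_left_mono) auto
    then show ?thesis using \<theta>_bounds by linarith
  qed
  have a: "pi * (real l - 1) + \<theta> \<le> a" "a \<le> pi * real l - \<theta>"
    unfolding a_def using lam pos pos' by (auto intro!: real_le_rsqrt real_le_lsqrt lam0[THEN less_imp_le])
  have a0: "a > 0" and a2: "a\<^sup>2 = lam" using lam0 by (auto simp: a_def)
  define s where "s = a - pi * (real l - 1)"
  have s: "\<theta> \<le> s" "s \<le> pi - \<theta>" using a by (auto simp: s_def algebra_simps)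
  have as: "a = s + real (l - 1) * pi" using l by (simp add: s_def of_nat_diff algebra_simps)
  have "cos a = cos s * (- 1) ^ (l - 1)" unfolding as cos_add by simp
  then have cosa: "\<bar>cos a\<bar> = \<bar>cos s\<bar>" by (simp add: abs_mult power_abs)
  have "cos s \<le> cos \<theta>" by (rule cos_monotone_0_pi_le) (use s \<theta>_bounds in auto)
  moreover have "cos (pi - \<theta>) \<le> cos s" by (rule cos_monotone_0_pi_le) (use s \<theta>_bounds in auto)
  ultimately have ca: "\<bar>cos a\<bar> \<le> 1 / R" unfolding cosa using cos_\<theta> by auto
  define z where "z = complex_of_real lam"
  have \<kappa>: "csqrt z = of_real a" unfolding z_def a_def using lam0 by (simp add: csqrt_of_real_nonneg)
  have z0: "z \<noteq> 0" using lam0 by (simp add: z_def)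
  have cz: "cs z 1 = of_real (cos a)" by (simp add: cs_def \<kappa> cos_of_real)
  have sz: "sn z 1 \<noteq> 0"
  proof
    assume "sn z 1 = 0"
    then have "sin a = 0" using z0 a0 by (simp add: sn_def \<kappa> sin_of_real)
    then have "\<bar>cos a\<bar> = 1" using sin_cos_squared_add[of a] by (simp add: power2_eq_1_iff abs_if) auto
    then show False using ca R_gt by (simp add: field_simps)
  qed
  define m where "m = cis (arccos (R * cos a))"
  have Rc: "\<bar>R * cos a\<bar> \<le> 1" using ca R_gt by (simp add: abs_mult field_simps)
  have m1: "cmod m = 1" by (simp add: m_def)
  have m0: "m \<noteq> 0" using m1 by auto
  have mz: "m + 1 / m = of_real (sqrt b + 1 / sqrt b) * cs z 1"
  proof -
    have "1 / m = cnj m" using m1 m0 complex_norm_square[of m] by (simp add: field_simps)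
    then have "m + 1 / m = of_real (2 * Re m)" by (simp add: complex_add_cnj)
    also have "Re m = R * cos a" using Rc by (simp add: m_def cos_arccos_abs)
    finally show ?thesis unfolding cz R_eq by simp
  qed
  have bpos: "real b > 0" using b by simp
  from Floquet_solution[OF bpos sz m0 mz] obtain h h1 where h: "primitive h h1" "primitive h1 (\<lambda>t. - z * h t)"
    and at: "h 0 = 1" "of_real (sqrt b) * h 1 = m" "of_real (sqrt b) * m * h1 0 = h1 1" by blast
  obtain B1 B2 where "\<forall>t\<in>{0..1}. cmod (h t) \<le> B1" "\<forall>t\<in>{0..1}. cmod (h1 t) \<le> B2"
    using continuous_unit_bounded[OF primitive_continuous[OF h(1)]] continuous_unit_bounded[OF primitive_continuous[OF h(2)]] by blast
  then have B: "\<And>t. t \<in> {0..1} \<Longrightarrow> cmod (h t) \<le> max B1 B2" "\<And>t. t \<in> {0..1} \<Longrightarrow> cmod (h1 t) \<le> max B1 B2"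
    by (auto intro: max.coboundedI1 max.coboundedI2)
  define B where "B = max B1 B2"
  define N where "N = (unit_norm h)^2"
  \<comment> \<open>The resolvent bound for the damped Floquet solution, cleared of the divergent
    factor \<open>1 / (1 - exp (-2 e))\<close>.\<close>
  have ineq: "exp (- 4 * e) * N \<le> C\<^sup>2 * ((36 * B)^2 * (1 - exp (- 2 * e)) + (14 * e * B)^2)" if e: "0 < e" "e \<le> 1" for e
  proof -
    from Weyl_function[OF b m1 h at B e] obtain u g where ug: "(u, \<lambda>x. z * u x + g x) \<in> dirichlet_laplacian b"
      and lo: "exp (- 4 * e) * N \<le> (tree_norm b u)^2 * (1 - exp (- 2 * e))"
      and up: "(tree_norm b g)^2 * (1 - exp (- 2 * e)) \<le> (36 * B)^2 * (1 - exp (- 2 * e)) + (14 * e * B)^2"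
      unfolding N_def B_def by blast
    have "tree_norm b u \<le> C * tree_norm b g" using C[OF ug] by (simp add: z_def)
    then have "(tree_norm b u)^2 \<le> (C * tree_norm b g)^2" by (intro power_mono) auto
    moreover have E: "1 - exp (- 2 * e) \<ge> 0" using e by simp
    ultimately have "(tree_norm b u)^2 * (1 - exp (- 2 * e)) \<le> C\<^sup>2 * ((tree_norm b g)^2 * (1 - exp (- 2 * e)))"
      unfolding power_mult_distrib mult.assoc[symmetric] by (intro mult_right_mono)
    also have "\<dots> \<le> C\<^sup>2 * ((36 * B)^2 * (1 - exp (- 2 * e)) + (14 * e * B)^2)" by (intro mult_left_mono up) simp
    finally show ?thesis using lo by linarith
  qed
  have "exp (- 4 * 0) * N \<le> C\<^sup>2 * ((36 * B)^2 * (1 - exp (- 2 * 0)) + (14 * 0 * B)^2)"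
  proof (rule tendsto_le[of "at_right (0::real)"])
    show "((\<lambda>e. C\<^sup>2 * ((36 * B)^2 * (1 - exp (- 2 * e)) + (14 * e * B)^2)) \<longlongrightarrow> C\<^sup>2 * ((36 * B)^2 * (1 - exp (- 2 * 0)) + (14 * 0 * B)^2)) (at_right 0)"
      by (intro tendsto_intros)
    show "((\<lambda>e. exp (- 4 * e) * N) \<longlongrightarrow> exp (- 4 * 0) * N) (at_right 0)" by (intro tendsto_intros)
    show "\<forall>\<^sub>F e in at_right 0. exp (- 4 * e) * N \<le> C\<^sup>2 * ((36 * B)^2 * (1 - exp (- 2 * e)) + (14 * e * B)^2)"
      unfolding eventually_at_right_field by (intro exI[of _ 1]) (use ineq in auto)
  qed simp
  then have "N \<le> 0" by simp
  then have "unit_norm h = 0" by (simp add: N_def)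
  then have "h 0 = 0" by (rule continuous_l2_norm_0[OF primitive_continuous[OF h(1)]]) simp
  then show False using at(1) by simp
qed

theorem spectrum_eq: "spectrum (tree_measure b) (dirichlet_laplacian b) = complex_of_real ` spec \<theta>"
proof -
  have "complex_of_real lam \<notin> resolvent_set (tree_measure b) (dirichlet_laplacian b)" if "lam \<in> spec \<theta>" for lam
    using that unfolding spec_def
  proof (elim UnE UN_E)
    fix l assume "l \<in> {1::nat..}" "lam \<in> {(pi * (real l - 1) + \<theta>)^2 .. (pi * real l - \<theta>)^2}"
    then show ?thesis by (intro band_not_resolvent) auto
  next
    assume "lam \<in> {(pi * real l)^2 | l. l \<ge> (1::nat)}"
    then obtain l where "l \<ge> (1::nat)" "lam = (pi * real l)^2" by blast
    then show ?thesis using eigenvalue_in_spectrum[OF eigenvalue_point[OF b] laplacian_L2] by blast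
  qed
  then show ?thesis unfolding spectrum_def using resolvent_supset by auto
qed

end

section \<open>The spectral representation\<close>

text \<open>The bound \<open>|1 - S| <= 1\<close> follows from \<open>S^2 <= S\<close> and
  positivity.\<close>

lemma (in positive_contraction) residual_le:
  assumes f: "f \<in> L2 M" shows "l2_norm M (\<lambda>x. f x - S f x) \<le> l2_norm M f"
proof (rule power2_le_imp_le)
  have "(l2_norm M (\<lambda>x. f x - S f x))^2 = (l2_norm M f)^2 - 2 * Re (l2_inner M (S f) f) + (l2_norm M (S f))^2"
    using l2_norm_diff_sq[OF f S_L2[OF f]] S_sym[OF f f] by simp
  then show "(l2_norm M (\<lambda>x. f x - S f x))^2 \<le> (l2_norm M f)^2"
    using S_norm[OF f] S_pos[OF f] by linarith
qed simp

text \<open>The closed span of the \<open>S\<^sup>i u\<close> contains \<open>(1 + \<sigma> S)\<^sup>-\<^sup>1 u\<close>: expand in powers of \<open>\<sigma> (1 - S) / (1 + \<sigma>)\<close>.\<close>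

lemma (in positive_contraction) orthogonal_resolvent:
  assumes u: "u \<in> L2 M" and h: "h \<in> L2 M" and eq: "AE x in M. u x = h x + of_real \<sigma> * S h x" and \<sigma>: "\<sigma> > 0"
    and f: "f \<in> L2 M" and orth: "\<And>i. l2_inner M f ((S ^^ i) u) = 0"
  shows "l2_inner M f h = 0"
proof -
  define q where "q = \<sigma> / (1 + \<sigma>)"
  have q: "0 \<le> q" "q < 1" using \<sigma> by (auto simp: q_def)
  have bound: "cmod (l2_inner M g h) \<le> q ^ j * (l2_norm M f * l2_norm M h)"
    if "g \<in> L2 M" "l2_norm M g \<le> l2_norm M f" "\<And>i. l2_inner M g ((S ^^ i) u) = 0" for g j
    using that
  proof (induction j arbitrary: g)
    case 0
    have "cmod (l2_inner M g h) \<le> l2_norm M g * l2_norm M h" by (rule l2_Cauchy_Schwarz[OF 0(1) h])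
    also have "\<dots> \<le> l2_norm M f * l2_norm M h" using 0 by (intro mult_right_mono) auto
    finally show ?case by simp
  next
    case (Suc j)
    note g = Suc.prems(1)
    let ?g = "\<lambda>x. g x - S g x"
    have gL: "?g \<in> L2 M" using g S_L2[OF g] by auto
    have "l2_inner M ?g ((S ^^ i) u) = 0" for i
      using inner_diff_left[OF g S_L2[OF g] pow_L2[OF u], of i] S_sym[OF g pow_L2[OF u], of i]
        Suc.prems(3)[of i] Suc.prems(3)[of "Suc i"] by simp
    then have "cmod (l2_inner M ?g h) \<le> q ^ j * (l2_norm M f * l2_norm M h)"
      using Suc.prems residual_le[OF g] by (intro Suc.IH gL) auto
    \<comment> \<open>Orthogonality of \<open>g\<close> to \<open>u\<close> reads
      \<open>(g, h) + \<sigma> (S g, h) = 0\<close>; writing \<open>S g\<close> as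
      \<open>g - ?g\<close> isolates the factor \<open>q < 1\<close>, and the step can be repeated
      with \<open>?g\<close>.\<close>
    moreover have "l2_inner M g h = of_real q * l2_inner M ?g h"
    proof -
      have "0 = l2_inner M g u" using Suc.prems(3)[of 0] by simp
      also have "\<dots> = l2_inner M g (\<lambda>x. h x + of_real \<sigma> * S h x)"
        by (rule inner_cong_AE_right[OF eq u _ g]) (use h S_L2[OF h] in auto)
      also have "\<dots> = l2_inner M g h + of_real \<sigma> * l2_inner M (S g) h"
        using inner_add_right[OF h L2_scale[OF S_L2[OF h]] g, of "of_real \<sigma>"] S_sym[OF g h] by (simp add: inner_scale_right)
      finally have "0 = l2_inner M g h + of_real \<sigma> * l2_inner M (S g) h" .
      moreover have "l2_inner M (S g) h = l2_inner M g h - l2_inner M ?g h"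
        using inner_diff_left[OF g S_L2[OF g] h] by simp
      ultimately have "0 = l2_inner M g h + of_real \<sigma> * (l2_inner M g h - l2_inner M ?g h)" by simp
      then have "of_real (1 + \<sigma>) * l2_inner M g h = of_real \<sigma> * l2_inner M ?g h" by (simp add: algebra_simps)
      moreover have "complex_of_real (1 + \<sigma>) \<noteq> 0" using \<sigma> by (simp only: of_real_eq_0_iff)
      ultimately show ?thesis unfolding q_def of_real_divide by (simp add: field_simps)
    qed
    ultimately show ?case using q by (simp add: norm_mult mult.assoc mult_left_mono)
  qed
  have "(\<lambda>j. q ^ j * (l2_norm M f * l2_norm M h)) \<longlonglongrightarrow> 0 * (l2_norm M f * l2_norm M h)"
    using q by (intro tendsto_intros LIMSEQ_power_zero) auto
  then have "cmod (l2_inner M f h) \<le> 0 * (l2_norm M f * l2_norm M h)"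
    by (rule LIMSEQ_le_const) (use bound[OF f order_refl orth] in blast)
  then show ?thesis by simp
qed

lemma unit_inner_bound:
  assumes f: "f \<in> L2 unit_lebesgue" and g: "continuous_on {0..1} g" and B: "\<And>t. t \<in> {0..1} \<Longrightarrow> \<bar>g t\<bar> \<le> B" "0 \<le> B"
  shows "cmod (LINT t|unit_lebesgue. f t * complex_of_real (g t)) \<le> B * unit_norm f"
    "integrable unit_lebesgue (\<lambda>t. f t * complex_of_real (g t))"
proof -
  have gc: "continuous_on {0..1} (\<lambda>t. complex_of_real (g t))" by (intro continuous_intros g)
  note gL = continuous_unit_L2[OF gc]
  show "integrable unit_lebesgue (\<lambda>t. f t * complex_of_real (g t))" using L2_mult_integrable[OF f gL] by simp
  have "(unit_norm (\<lambda>t. complex_of_real (g t)))^2 \<le> B\<^sup>2" by (rule unit_l2_norm_le[OF gc]) (simp add: B)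
  then have "unit_norm (\<lambda>t. complex_of_real (g t)) \<le> B" by (rule power2_le_imp_le) (rule B)
  then have "unit_norm f * unit_norm (\<lambda>t. complex_of_real (g t)) \<le> B * unit_norm f"
    by (subst mult.commute) (intro mult_right_mono; simp)
  then show "cmod (LINT t|unit_lebesgue. f t * complex_of_real (g t)) \<le> B * unit_norm f"
    using l2_Cauchy_Schwarz[OF f gL] by (simp add: l2_inner_def)
qed

text \<open>As \<open>m sinh \<tau> \<le> 1\<close>, the edges beyond the first one on which \<open>f\<close> does not vanish contribute only a bounded
  amount to the exponential moments of \<open>f\<close> on that edge.\<close>

lemma chain_zero:
  assumes f: "\<And>k. f k \<in> L2 unit_lebesgue" and N: "\<And>k. unit_norm (f k) \<le> N"
    and R: "R > 1" and \<beta>: "0 \<le> \<beta>" "\<beta> \<le> 1"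
    and sums: "\<And>n::nat. n \<ge> 1 \<Longrightarrow> \<exists>m::real. 0 < m \<and> m * (R * cosh (real n)) \<le> 1 \<and>
      (\<lambda>k. LINT t|unit_lebesgue. f k t * of_real (m ^ k * (sinh (real n * (1 - t)) + m * \<beta> * sinh (real n * t)))) sums 0"
  shows "AE t in unit_lebesgue. f k t = 0"
proof (induction k rule: less_induct)
  case (less k)
  \<comment> \<open>A bound for \<open>1 / (1 - m)\<close> uniform in \<open>n\<close>, since
    \<open>m <= 1 / R\<close>.\<close>
  define Q where "Q = 1 / (1 - 1 / R)"
  have Q: "Q > 0" using R by (simp add: Q_def)
  have N0: "N \<ge> 0" using order_trans[OF l2_norm_nonneg N[of 0]] .
  show ?case
  \<comment> \<open>Twice the sum of the bounds for \<open>a k\<close> and for the second wave, plus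
    the bound for the remaining decaying exponential.\<close>
  proof (rule exponential_moments_zero[where C="2 * (2 * N * Q + N) + N"])
    show "integrable unit_lebesgue (f k)" by (rule L2_unit_integrable[OF f])
    fix n :: nat assume n: "n \<ge> 1"
    then obtain m where m: "0 < m" "m * (R * cosh (real n)) \<le> 1"
      and S: "(\<lambda>k. LINT t|unit_lebesgue. f k t * of_real (m ^ k * (sinh (real n * (1 - t)) + m * \<beta> * sinh (real n * t)))) sums 0"
      using sums by blast
    define s where "s = sinh (real n)"
    define g where "g t = sinh (real n * (1 - t)) + m * \<beta> * sinh (real n * t)" for t
    have s: "s > 0" using n by (simp add: s_def)
    have sc: "s \<le> cosh (real n)" unfolding s_def by (simp add: sinh_def cosh_def)
    have c1: "1 \<le> cosh (real n)" by (rule cosh_real_ge_1)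
    have "m * (R * 1) \<le> m * (R * cosh (real n))" using m R c1 by (intro mult_left_mono) auto
    from order_trans[OF this m(2)] have mR: "m \<le> 1 / R" using R by (simp add: pos_le_divide_eq)
    have m1: "m < 1" using mR R by (smt (verit) divide_less_eq_1)
    have "m * (1 * s) \<le> m * (R * cosh (real n))" using m R sc s by (intro mult_left_mono mult_mono) auto
    from order_trans[OF this m(2)] have ms: "m * s \<le> 1" by simp
    have sh: "0 \<le> sinh (real n * t)" "sinh (real n * t) \<le> s" if "t \<in> {0..1}" for t
    proof -
      show "0 \<le> sinh (real n * t)" using that by simp
      have "real n * t \<le> real n * 1" using that by (intro mult_left_mono) auto
      then show "sinh (real n * t) \<le> s" by (simp add: s_def)
    qed
    have sh': "0 \<le> sinh (real n * (1 - t))" "sinh (real n * (1 - t)) \<le> s" if "t \<in> {0..1}" for t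
      using sh[of "1 - t"] that by auto
    have gb: "\<bar>g t\<bar> \<le> 2 * s" if t: "t \<in> {0..1}" for t
    proof -
      have "(m * \<beta>) * sinh (real n * t) \<le> 1 * s" using sh[OF t] m m1 \<beta> s by (intro mult_mono mult_le_one) auto
      moreover have "0 \<le> (m * \<beta>) * sinh (real n * t)" using sh[OF t] m \<beta> by simp
      ultimately show ?thesis using sh'[OF t] unfolding g_def by linarith
    qed
    have gc: "continuous_on {0..1} g" unfolding g_def by (intro continuous_intros)
    define a where "a j = (LINT t|unit_lebesgue. f j t * of_real (g t))" for j
    have ab: "cmod (a j) \<le> 2 * s * N" for j
    proof -
      have "cmod (a j) \<le> 2 * s * unit_norm (f j)" unfolding a_def by (rule unit_inner_bound(1)[OF f gc gb]) (use s in auto)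
      also have "\<dots> \<le> 2 * s * N" using N[of j] s by (intro mult_left_mono) auto
      finally show ?thesis .
    qed
    have am: "(LINT t|unit_lebesgue. f j t * of_real (m ^ j * (sinh (real n * (1 - t)) + m * \<beta> * sinh (real n * t)))) = of_real (m ^ j) * a j" for j
    proof -
      have "(LINT t|unit_lebesgue. f j t * of_real (m ^ j * (sinh (real n * (1 - t)) + m * \<beta> * sinh (real n * t)))) =
          (LINT t|unit_lebesgue. of_real (m ^ j) * (f j t * of_real (g t)))"
        unfolding g_def by (intro Bochner_Integration.integral_cong refl) (simp only: of_real_mult mult_ac)
      then show ?thesis unfolding a_def by simp
    qed
    have a0: "a j = 0" if "j < k" for j
    proof -
      have "(LINT t|unit_lebesgue. f j t * of_real (g t)) = (LINT t|unit_lebesgue. 0)"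
        using less.IH[OF that] unit_inner_bound(2)[OF f gc gb] s
        by (intro integral_cong_AE) (auto elim: eventually_mono)
      then show ?thesis by (simp add: a_def)
    qed
    \<comment> \<open>The edges before \<open>k\<close> vanish by induction; the later ones carry an
      extra factor \<open>m\<close>, and \<open>m * s <= 1\<close> compensates the size of
      \<open>g\<close>.\<close>
    have "(\<lambda>i. of_real (m ^ (i + Suc k)) * a (i + Suc k)) sums (0 - (\<Sum>j<Suc k. of_real (m ^ j) * a j))"
      using S unfolding am by (rule sums_split_initial_segment)
    then have tail: "(\<lambda>i. of_real (m ^ (i + Suc k)) * a (i + Suc k)) sums (- (of_real (m ^ k) * a k))"
      using a0 by simp
    have "(\<lambda>i. m ^ (Suc k) * (2 * s * N) * m ^ i) sums (m ^ (Suc k) * (2 * s * N) * (1 / (1 - m)))"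
      using m m1 by (intro sums_mult geometric_sums) simp
    from norm_sums_le[OF tail this] have "cmod (- (of_real (m ^ k) * a k)) \<le> m ^ Suc k * (2 * s * N) * (1 / (1 - m))"
    proof -
      have "cmod (of_real (m ^ (i + Suc k)) * a (i + Suc k)) \<le> m ^ (Suc k) * (2 * s * N) * m ^ i" for i
        using mult_left_mono[OF ab[of "i + Suc k"], of "m ^ (i + Suc k)"] m by (simp add: norm_mult power_add mult_ac norm_power)
      then show ?thesis using norm_sums_le[OF tail \<open>(\<lambda>i. m ^ (Suc k) * (2 * s * N) * m ^ i) sums _\<close>] by blast
    qed
    then have "m ^ k * cmod (a k) \<le> m ^ k * (m * (2 * s * N) * (1 / (1 - m)))"
      using m by (simp add: norm_mult norm_power mult_ac)
    then have "cmod (a k) \<le> m * (2 * s * N) * (1 / (1 - m))"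
      by (rule mult_left_le_imp_le) (use m in simp)
    also have "\<dots> = (m * s) * (2 * N) * (1 / (1 - m))" by simp
    also have "\<dots> \<le> 1 * (2 * N) * Q"
      unfolding Q_def using ms mR N0 R m1 m s by (intro mult_mono divide_left_mono) auto
    finally have ak: "cmod (a k) \<le> 2 * N * Q" by simp
    have fk: "unit_norm (f k) \<le> N" by (rule N)
    define a' where "a' = (LINT t|unit_lebesgue. f k t * of_real (m * \<beta> * sinh (real n * t)))"
    define a'' where "a'' = (LINT t|unit_lebesgue. f k t * of_real (exp (- (real n * (1 - t)))))"
    have c': "continuous_on {0..1} (\<lambda>t. m * \<beta> * sinh (real n * t))" "continuous_on {0..1} (\<lambda>t. exp (- (real n * (1 - t))))"
      by (intro continuous_intros)+
    have b': "\<bar>m * \<beta> * sinh (real n * t)\<bar> \<le> 1" if t: "t \<in> {0..1}" for t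
    proof -
      have "\<beta> * (m * sinh (real n * t)) \<le> 1 * (m * s)" using sh[OF t] m \<beta> s by (intro mult_mono) auto
      moreover have "0 \<le> m * \<beta> * sinh (real n * t)" using sh[OF t] m \<beta> by simp
      ultimately show ?thesis using ms by (simp add: mult_ac)
    qed
    have b'': "\<bar>exp (- (real n * (1 - t)))\<bar> \<le> 1" if "t \<in> {0..1}" for t using that by simp
    have "(LINT t|unit_lebesgue. of_real (exp (real n * (1 - t))) * f k t) =
       (LINT t|unit_lebesgue. 2 * (f k t * of_real (g t) - f k t * of_real (m * \<beta> * sinh (real n * t))) + f k t * of_real (exp (- (real n * (1 - t)))))"
    proof (intro Bochner_Integration.integral_cong refl)
      fix t
      \<comment> \<open>Solves \<open>2 sinh y = exp y - exp (- y)\<close> for \<open>exp y\<close>,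
        with the sinh expressed through \<open>g\<close>.\<close>
      have "exp (real n * (1 - t)) = 2 * (g t - m * \<beta> * sinh (real n * t)) + exp (- (real n * (1 - t)))"
        by (simp add: g_def sinh_def diff_divide_distrib)
      then have "complex_of_real (exp (real n * (1 - t))) = 2 * (of_real (g t) - of_real (m * \<beta> * sinh (real n * t))) + of_real (exp (- (real n * (1 - t))))"
        by (metis of_real_add of_real_diff of_real_mult of_real_numeral)
      then show "of_real (exp (real n * (1 - t))) * f k t =
        2 * (f k t * of_real (g t) - f k t * of_real (m * \<beta> * sinh (real n * t))) + f k t * of_real (exp (- (real n * (1 - t))))"
        by (simp only: ring_distribs mult_ac)
    qed
    also have "\<dots> = 2 * (a k - a') + a''"
      unfolding a_def a'_def a''_def
      using unit_inner_bound(2)[OF f gc gb] unit_inner_bound(2)[OF f c'(1) b'] unit_inner_bound(2)[OF f c'(2) b''] s by simp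
    finally have "cmod (LINT t|unit_lebesgue. of_real (exp (real n * (1 - t))) * f k t) = cmod (2 * (a k - a') + a'')" by simp
    also have "\<dots> \<le> 2 * (cmod (a k) + cmod a') + cmod a''"
      by (rule order_trans[OF norm_triangle_ineq])
        (simp only: norm_mult norm_numeral, intro add_right_mono mult_left_mono norm_triangle_ineq4, simp)
    also have "\<dots> \<le> 2 * (2 * N * Q + N) + N"
      using ak unit_inner_bound(1)[OF f c'(1) b', of k] unit_inner_bound(1)[OF f c'(2) b'', of k] fk
      unfolding a'_def a''_def by (intro add_mono mult_left_mono) auto
    finally show "cmod (LINT t|unit_lebesgue. of_real (exp (real n * (1 - t))) * f k t) \<le> 2 * (2 * N * Q + N) + N" .
  qed
qed

lemma coef_norm_le:
  assumes b: "b \<ge> 2" and f: "f \<in> tree_L2 b" and q: "q \<in> lists {..<b}"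
  shows "unit_norm (coef b f q) \<le> tree_norm b f"
proof (rule power2_le_imp_le)
  define F where "F q = (\<integral>\<^sup>+t. ennreal ((cmod (coef b f q t))^2) \<partial>unit_lebesgue)" for q
  have w: "q \<in> words b (length q)" using q by (simp add: words_def)
  have "F q \<le> (\<Sum>q\<in>words b (length q). F q)" by (rule member_le_sum[OF w]) auto
  also have "\<dots> = sum (\<lambda>L. \<Sum>q\<in>words b L. F q) {length q}" by simp
  also have "\<dots> \<le> (\<Sum>L. \<Sum>q\<in>words b L. F q)" by (rule sum_le_suminf) auto
  also have "\<dots> = ennreal ((tree_norm b f)^2)" unfolding F_def by (rule coef_nn_integral[OF b f])
  finally show "(unit_norm (coef b f q))^2 \<le> (tree_norm b f)^2"
    unfolding F_def nn_integral_sq_eq[OF coef_L2[OF f]] by (simp add: ennreal_le_iff)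
qed simp

text \<open>Chains exhaust all words, and by Parseval the coefficients determine the norm.\<close>

lemma coef_zero:
  assumes b: "b \<ge> 2" and f: "f \<in> tree_L2 b"
    and 0: "\<And>p k. p \<in> heads b \<Longrightarrow> AE t in unit_lebesgue. coef b f (p @ replicate k 0) t = 0"
  shows "tree_norm b f = 0"
proof -
  have "(\<integral>\<^sup>+t. ennreal ((cmod (coef b f (p @ replicate k 0) t))^2) \<partial>unit_lebesgue) = (\<integral>\<^sup>+t. 0 \<partial>unit_lebesgue)"
    if "p \<in> heads b" for p k using 0[OF that, of k] by (intro nn_integral_cong_AE) auto
  then have "(\<Sum>L. \<Sum>q\<in>words b L. \<integral>\<^sup>+t. ennreal ((cmod (coef b f q t))^2) \<partial>unit_lebesgue) = (\<integral>\<^sup>+p. 0 \<partial>count_space (heads b))"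
    unfolding words_chain_sum[OF b] by (intro nn_integral_cong) simp
  then show ?thesis unfolding coef_nn_integral[OF b f] by simp
qed

lemma ext_add: "ext b p (\<lambda>k t. c * \<phi> k t + d * \<psi> k t) x = c * ext b p \<phi> x + d * ext b p \<psi> x"
  by (cases x) (simp add: ext_def syn_def lift_def sum_distrib_left flip: sum.distrib,
    intro sum.cong refl, simp add: algebra_simps)

text \<open>\<open>\<phi>\<close> solves \<open>- \<phi>'' = \<gamma>\<close> along the chain, in the coordinates for which \<open>ext\<close> is an isometry.\<close>

definition radial_pair :: "nat \<Rightarrow> (nat \<Rightarrow> real \<Rightarrow> complex) \<Rightarrow> (nat \<Rightarrow> real \<Rightarrow> complex) \<Rightarrow> bool" where
  "radial_pair b \<phi> \<gamma> \<longleftrightarrow> (\<forall>k. \<gamma> k \<in> L2 unit_lebesgue) \<and> square_summable \<gamma> \<and>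
     square_summable \<phi> \<and>
     (\<exists>\<phi>1. (\<forall>k. primitive (\<phi> k) (\<phi>1 k) \<and> primitive (\<phi>1 k) (\<lambda>t. - \<gamma> k t)) \<and> \<phi> 0 0 = 0 \<and>
       (\<forall>k. \<phi> (Suc k) 0 = of_real (sqrt b) * \<phi> k 1 \<and> of_real (sqrt b) * \<phi>1 (Suc k) 0 = \<phi>1 k 1) \<and>
       square_summable \<phi>1)"

lemma radial_pair_L2: "radial_pair b \<phi> \<gamma> \<Longrightarrow> \<phi> k \<in> L2 unit_lebesgue"
  unfolding radial_pair_def by (auto intro: continuous_unit_L2 primitive_continuous)

lemma radial_pair_laplacian:
  assumes b: "b \<ge> 2" and p: "p \<in> heads b" and r: "radial_pair b \<phi> \<gamma>"
  shows "(ext b p \<phi>, ext b p \<gamma>) \<in> dirichlet_laplacian b"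
proof -
  obtain \<phi>1 where *: "\<And>k. primitive (\<phi> k) (\<phi>1 k)" "\<And>k. primitive (\<phi>1 k) (\<lambda>t. - \<gamma> k t)" "\<phi> 0 0 = 0"
     "\<And>k. \<phi> (Suc k) 0 = of_real (sqrt b) * \<phi> k 1" "\<And>k. of_real (sqrt b) * \<phi>1 (Suc k) 0 = \<phi>1 k 1"
     "square_summable \<phi>1"
    using r unfolding radial_pair_def by blast
  have "(ext b p \<phi>, \<lambda>x. 0 * ext b p \<phi> x + ext b p \<gamma> x) \<in> dirichlet_laplacian b"
    by (rule ext_domain[OF b p *(1) _ *(3,4,5) _ _ *(6)]) (use *(2) r in \<open>auto simp: radial_pair_def\<close>)
  then show ?thesis by simp
qed

text \<open>At \<open>z = 0\<close> the multipliers are \<open>b^(-1/2)\<close> and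
  \<open>b^(1/2)\<close>; this is what makes the Laplacian boundedly invertible.\<close>

lemma good_0: "b \<ge> 2 \<Longrightarrow> good b 0"
  unfolding good_def
proof (intro conjI exI[of _ "complex_of_real (1 / sqrt b)"])
  assume b: "b \<ge> 2"
  show "sn 0 1 \<noteq> 0" by (simp add: sn_def)
  show "0 < cmod (complex_of_real (1 / sqrt b))" "cmod (complex_of_real (1 / sqrt b)) < 1"
    unfolding norm_of_real using b by auto
  show "complex_of_real (1 / sqrt b) + 1 / complex_of_real (1 / sqrt b) = complex_of_real (sqrt b + 1 / sqrt b) * cs 0 1"
    by (simp add: cs_def)
qed

lemma radial_pair_exists:
  assumes b: "b \<ge> 2" and \<gamma>: "\<And>k. \<gamma> k \<in> L2 unit_lebesgue" "square_summable \<gamma>"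
  shows "\<exists>\<phi>. radial_pair b \<phi> \<gamma>"
proof -
  obtain m where m: "sn 0 1 \<noteq> 0" "0 < cmod m" "cmod m < 1" "m + 1 / m = of_real (sqrt b + 1 / sqrt b) * cs 0 1"
    using good_0[OF b] unfolding good_def by blast
  have rb: "real b \<ge> 2" using b by simp
  obtain K :: real where "\<forall>\<gamma> :: nat \<Rightarrow> real \<Rightarrow> complex. (\<forall>k. \<gamma> k \<in> L2 unit_lebesgue) \<longrightarrow> square_summable \<gamma> \<longrightarrow>
    (\<exists>\<phi> \<phi>1. half_line_solution (real b) 0 K \<phi> \<phi>1 \<gamma>)"
    using radial_solution[OF rb m] by (elim exE conjE) assumption
  from this[rule_format, OF \<gamma>] obtain \<phi> \<phi>1 where "\<forall>k. primitive (\<phi> k) (\<phi>1 k) \<and> primitive (\<phi>1 k) (\<lambda>t. - 0 * \<phi> k t - \<gamma> k t)" "\<phi> 0 0 = 0"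
    "\<forall>k. \<phi> (Suc k) 0 = of_real (sqrt b) * \<phi> k 1 \<and> of_real (sqrt b) * \<phi>1 (Suc k) 0 = \<phi>1 k 1"
    "square_summable \<phi>" "square_summable \<phi>1"
    by (elim exE conjE)
  then show ?thesis unfolding radial_pair_def using \<gamma> by (intro exI[of _ \<phi>] exI[of _ \<phi>1] conjI) auto
qed

text \<open>\<open>x\<close> is the mean of \<open>m\<close> and \<open>1 / m\<close>, hence at most
  the larger one, \<open>1 / m\<close>.\<close>

lemma multiplier:
  fixes x :: real assumes "x > 1"
  shows "\<exists>m. 0 < m \<and> m < 1 \<and> m + 1 / m = 2 * x \<and> m * x \<le> 1"
proof (intro exI[of _ "exp (- arcosh x)"] conjI)
  have c: "cosh (arcosh x) = x" using assms by (intro cosh_arcosh_real) simp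
  have a: "arcosh x > 0" using assms by simp
  show "0 < exp (- arcosh x)" by simp
  show 1: "exp (- arcosh x) < 1" using a by simp
  show 2: "exp (- arcosh x) + 1 / exp (- arcosh x) = 2 * x" using c by (simp add: cosh_def exp_minus field_simps)
  then have "x \<le> 1 / exp (- arcosh x)" using 1 assms by linarith
  then show "exp (- arcosh x) * x \<le> 1" by (simp add: pos_le_divide_eq mult.commute)
qed

section \<open>Geometric waves along one chain\<close>

definition wave :: "real \<Rightarrow> real \<Rightarrow> (real \<Rightarrow> real) \<Rightarrow> nat \<Rightarrow> real \<Rightarrow> complex" where
  "wave m d h k t = of_real (m ^ k * (d * h t))"

lemma wave_L2:
  assumes "\<bar>m\<bar> < 1" "continuous_on {0..1} h"
  shows "wave m d h k \<in> L2 unit_lebesgue" "summable (\<lambda>k. (unit_norm (wave m d h k))^2)"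
    "(\<Sum>k. (unit_norm (wave m d h k))^2) = (unit_norm (\<lambda>t. complex_of_real (d * h t)))^2 / (1 - m\<^sup>2)"
proof -
  have eq: "wave m d h = (\<lambda>k t. of_real m ^ k * of_real (d * h t))" by (simp add: wave_def fun_eq_iff)
  have "(\<lambda>t. complex_of_real (d * h t)) \<in> L2 unit_lebesgue" by (intro continuous_unit_L2 continuous_intros assms)
  then show "wave m d h k \<in> L2 unit_lebesgue" unfolding eq by (rule L2_scale)
  show "summable (\<lambda>k. (unit_norm (wave m d h k))^2)"
    unfolding eq using assms by (intro geometric_l2) simp
  show "(\<Sum>k. (unit_norm (wave m d h k))^2) = (unit_norm (\<lambda>t. complex_of_real (d * h t)))^2 / (1 - m\<^sup>2)"
    unfolding eq using geometric_l2(2)[of "of_real m" "\<lambda>t. of_real (d * h t)"] assms by simp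
qed

lemma wave_primitive:
  assumes "\<And>t. (h has_real_derivative h1 t) (at t)" "continuous_on {0..1} h1"
  shows "primitive (wave m d h k) (wave m d h1 k)"
  unfolding wave_def[abs_def]
  by (intro primitive_C1 has_vector_derivative_of_real DERIV_cmult continuous_intros assms
      has_field_derivative_at_within[OF assms(1)])

lemma wave_vertex:
  assumes "c * h 1 = m * h 0"
  shows "wave m d h (Suc k) 0 = of_real c * wave m d h k 1"
proof -
  have "m ^ Suc k * (d * h 0) = m ^ k * d * (m * h 0)" by simp
  also have "\<dots> = c * (m ^ k * (d * h 1))" unfolding assms[symmetric] by simp
  finally show ?thesis by (simp only: wave_def of_real_mult[symmetric])
qed

lemma wave_vertex':
  assumes "c * (m * h 0) = h 1"
  shows "of_real c * wave m d h (Suc k) 0 = wave m d h k 1"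
proof -
  have "c * (m ^ Suc k * (d * h 0)) = m ^ k * (d * (c * (m * h 0)))" by simp
  then show ?thesis unfolding assms by (simp only: wave_def of_real_mult[symmetric])
qed

lemma summable_l2_comb:
  assumes L: "\<And>k. f k \<in> L2 M" "\<And>k. g k \<in> L2 M"
    and s: "summable (\<lambda>k. (l2_norm M (f k))^2)" "summable (\<lambda>k. (l2_norm M (g k))^2)"
  shows "summable (\<lambda>k. (l2_norm M (\<lambda>t. c * f k t + d * g k t))^2)"
proof (rule summable_comparison_test'[where N=0])
  show "summable (\<lambda>k. 2 * ((cmod c)^2 * (l2_norm M (f k))^2) + 2 * ((cmod d)^2 * (l2_norm M (g k))^2))"
    by (intro summable_add summable_mult s)
  show "norm ((l2_norm M (\<lambda>t. c * f k t + d * g k t))^2) \<le> 2 * ((cmod c)^2 * (l2_norm M (f k))^2) + 2 * ((cmod d)^2 * (l2_norm M (g k))^2)" for k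
    using l2_parallelogram[OF L2_scale[OF L(1)[of k], of c] L2_scale[OF L(2)[of k], of d]]
      zero_le_power2[of "l2_norm M (\<lambda>x. c * f k x - d * g k x)"]
    unfolding l2_norm_scale power_mult_distrib real_norm_def abs_power2 by linarith
qed

text \<open>Up to the factor \<open>sinh \<tau>\<close>, the solution of
  \<open>f'' = \<tau>^2 f\<close> with values 1 and \<open>m b^(-1/2)\<close> at the ends; the
  vertex condition multiplies the latter by \<open>b^(1/2)\<close> and so reproduces the factor
  \<open>m\<close> of the next edge.\<close>

definition decaying :: "nat \<Rightarrow> real \<Rightarrow> real \<Rightarrow> real \<Rightarrow> real" where
  "decaying b m \<tau> t = sinh (\<tau> * (1 - t)) + m * (1 / sqrt b) * sinh (\<tau> * t)"

text \<open>The analogous solution for \<open>z = 0\<close>, where the multiplier is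
  \<open>b^(-1/2)\<close> and the end value is therefore \<open>1 / b\<close>.\<close>

definition affine :: "nat \<Rightarrow> real \<Rightarrow> real" where
  "affine b t = 1 - t + t / b"

text \<open>Both waves start with the value 1, so their difference satisfies the Dirichlet
  condition. The affine one has no second derivative; hence the difference divided by
  \<open>\<tau>^2\<close> solves \<open>- \<phi>'' = \<gamma>\<close> with the decaying wave as
  \<open>\<gamma>\<close>.\<close>

lemma decaying_pair:
  assumes b: "b \<ge> 2" and \<tau>: "\<tau> > 0" and m: "0 < m" "m < 1" "m + 1 / m = (sqrt b + 1 / sqrt b) * cosh \<tau>"
  shows "radial_pair b (\<lambda>k t. of_real (1 / \<tau>\<^sup>2) * wave (1 / sqrt b) 1 (affine b) k t +
      of_real (- 1 / \<tau>\<^sup>2) * wave m (1 / sinh \<tau>) (decaying b m \<tau>) k t) (wave m (1 / sinh \<tau>) (decaying b m \<tau>))"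
proof -
  define e where "e = m * (1 / sqrt b)"
  have h: "decaying b m \<tau> = (\<lambda>t. sinh (\<tau> * (1 - t)) + e * sinh (\<tau> * t))" by (simp add: decaying_def e_def fun_eq_iff)
  define g where "g t = \<tau> * (- cosh (\<tau> * (1 - t)) + e * cosh (\<tau> * t))" for t
  define a where "a = (\<lambda>t::real. - 1 + 1 / real b)"
  have sb: "sqrt (real b) > 1" and sb2: "sqrt (real b) * sqrt (real b) = b" using b by auto
  have s0: "sinh \<tau> > 0" using \<tau> by simp
  have d1: "(decaying b m \<tau> has_real_derivative g t) (at t)" for t
    unfolding h g_def by (auto intro!: derivative_eq_intros simp: algebra_simps)
  have d2: "(g has_real_derivative \<tau>\<^sup>2 * decaying b m \<tau> t) (at t)" for t
    unfolding h g_def[abs_def] by (auto intro!: derivative_eq_intros simp: algebra_simps power2_eq_square)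
  have d3: "(affine b has_real_derivative a t) (at t)" for t
    unfolding affine_def[abs_def] a_def using b by (auto intro!: derivative_eq_intros)
  have d4: "(a has_real_derivative 0) (at t)" for t unfolding a_def by simp
  have c: "continuous_on {0..1} (decaying b m \<tau>)" "continuous_on {0..1} g" "continuous_on {0..1} (affine b)" "continuous_on {0..1} a"
    by (rule DERIV_continuous_on, rule has_field_derivative_at_within, rule d1 d2 d3 d4)+
  have p1: "primitive (wave m (1 / sinh \<tau>) (decaying b m \<tau>) k) (wave m (1 / sinh \<tau>) g k)" for k by (rule wave_primitive[OF d1 c(2)])
  have p2: "primitive (wave m (1 / sinh \<tau>) g k) (wave m (1 / sinh \<tau>) (\<lambda>t. \<tau>\<^sup>2 * decaying b m \<tau> t) k)" for k
    by (rule wave_primitive[OF d2]) (intro continuous_intros c)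
  have p3: "primitive (wave (1 / sqrt b) 1 (affine b) k) (wave (1 / sqrt b) 1 a k)" for k by (rule wave_primitive[OF d3 c(4)])
  have p4: "primitive (wave (1 / sqrt b) 1 a k) (wave (1 / sqrt b) 1 (\<lambda>t. 0) k)" for k by (rule wave_primitive[OF d4]) simp
  have m': "\<bar>m\<bar> < 1" "\<bar>1 / sqrt b\<bar> < 1" using m sb by auto
  have v1: "sqrt b * decaying b m \<tau> 1 = m * decaying b m \<tau> 0" using sb by (simp add: decaying_def)
  \<comment> \<open>The slope condition for the decaying wave; it reduces to the quadratic equation
    of \<open>m\<close>.\<close>
  have v2: "sqrt b * (m * g 0) = g 1"
  proof -
    have "m * (m + 1 / m) = m * m + 1" using m(1) by (simp add: distrib_left)
    then have "m * m + 1 = m * ((sqrt b + 1 / sqrt b) * cosh \<tau>)" by (metis m(3))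
    then have mm: "m * m = m * ((sqrt b + 1 / sqrt b) * cosh \<tau>) - 1" by simp
    have "sqrt b * (m * g 0) = \<tau> * (m * m - m * (sqrt b * cosh \<tau>))" using sb by (simp add: g_def e_def algebra_simps)
    then show ?thesis unfolding mm by (simp add: g_def e_def algebra_simps)
  qed
  have v3: "sqrt b * affine b 1 = 1 / sqrt b * affine b 0" using sb sb2 by (simp add: affine_def field_simps)
  have v4: "sqrt b * (1 / sqrt b * a 0) = a 1" using sb by (simp add: a_def)
  show ?thesis unfolding radial_pair_def
  proof (intro conjI allI exI[of _ "\<lambda>k t. of_real (1 / \<tau>\<^sup>2) * wave (1 / sqrt b) 1 a k t + of_real (- 1 / \<tau>\<^sup>2) * wave m (1 / sinh \<tau>) g k t"])
    fix k
    show "primitive (\<lambda>t. of_real (1 / \<tau>\<^sup>2) * wave (1 / sqrt b) 1 (affine b) k t + of_real (- 1 / \<tau>\<^sup>2) * wave m (1 / sinh \<tau>) (decaying b m \<tau>) k t)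
      (\<lambda>t. of_real (1 / \<tau>\<^sup>2) * wave (1 / sqrt b) 1 a k t + of_real (- 1 / \<tau>\<^sup>2) * wave m (1 / sinh \<tau>) g k t)"
      by (intro primitive_add primitive_scale p1 p3)
    have "primitive (\<lambda>t. of_real (1 / \<tau>\<^sup>2) * wave (1 / sqrt b) 1 a k t + of_real (- 1 / \<tau>\<^sup>2) * wave m (1 / sinh \<tau>) g k t)
      (\<lambda>t. of_real (1 / \<tau>\<^sup>2) * wave (1 / sqrt b) 1 (\<lambda>t. 0) k t + of_real (- 1 / \<tau>\<^sup>2) * wave m (1 / sinh \<tau>) (\<lambda>t. \<tau>\<^sup>2 * decaying b m \<tau> t) k t)"
      by (intro primitive_add primitive_scale p2 p4)
    then show "primitive (\<lambda>t. of_real (1 / \<tau>\<^sup>2) * wave (1 / sqrt b) 1 a k t + of_real (- 1 / \<tau>\<^sup>2) * wave m (1 / sinh \<tau>) g k t)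
      (\<lambda>t. - wave m (1 / sinh \<tau>) (decaying b m \<tau>) k t)" using \<tau> by (simp add: wave_def)
    show "of_real (1 / \<tau>\<^sup>2) * wave (1 / sqrt b) 1 (affine b) (Suc k) 0 + of_real (- 1 / \<tau>\<^sup>2) * wave m (1 / sinh \<tau>) (decaying b m \<tau>) (Suc k) 0 =
      of_real (sqrt b) * (of_real (1 / \<tau>\<^sup>2) * wave (1 / sqrt b) 1 (affine b) k 1 + of_real (- 1 / \<tau>\<^sup>2) * wave m (1 / sinh \<tau>) (decaying b m \<tau>) k 1)"
      unfolding wave_vertex[OF v1] wave_vertex[OF v3] by (simp only: distrib_left mult.left_commute)
    show "of_real (sqrt b) * (of_real (1 / \<tau>\<^sup>2) * wave (1 / sqrt b) 1 a (Suc k) 0 + of_real (- 1 / \<tau>\<^sup>2) * wave m (1 / sinh \<tau>) g (Suc k) 0) =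
      of_real (1 / \<tau>\<^sup>2) * wave (1 / sqrt b) 1 a k 1 + of_real (- 1 / \<tau>\<^sup>2) * wave m (1 / sinh \<tau>) g k 1"
      unfolding wave_vertex'[OF v2, symmetric] wave_vertex'[OF v4, symmetric] by (simp only: distrib_left mult.left_commute)
  qed (rule summable_l2_comb wave_L2(1,2) m' c | (use s0 in \<open>simp add: wave_def decaying_def affine_def\<close>))+
qed

text \<open>The double zeros at both ends make the function, extended by 0, satisfy all vertex
  conditions on any single edge, while the exponential factor prepares the use of
  \<open>exponential_moments_zero\<close>.\<close>

lemma bump:
  fixes n :: real
  shows "\<exists>B B1 B2 :: real \<Rightarrow> real. (\<forall>t. (B has_real_derivative B1 t) (at t)) \<and> (\<forall>t. (B1 has_real_derivative B2 t) (at t)) \<and>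
    continuous_on UNIV B2 \<and> B 0 = 0 \<and> B 1 = 0 \<and> B1 0 = 0 \<and> B1 1 = 0 \<and> (\<forall>t. B t = (t * (1 - t))^2 * exp (n * (1 - t)))"
proof -
  let ?B = "\<lambda>t. (t * (1 - t))^2 * exp (n * (1 - t))"
  let ?B1 = "\<lambda>t. (2 * (t * (1 - t)) * (1 - 2 * t) - n * (t * (1 - t))^2) * exp (n * (1 - t))"
  let ?B2 = "\<lambda>t. ((2 * (1 - 2 * t)^2 - 4 * (t * (1 - t))) - 2 * n * (2 * (t * (1 - t)) * (1 - 2 * t)) + n\<^sup>2 * (t * (1 - t))^2) * exp (n * (1 - t))"
  have "(?B has_real_derivative ?B1 t) (at t)" for t
    by (rule derivative_eq_intros refl)+ (simp add: algebra_simps)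
  moreover have "(?B1 has_real_derivative ?B2 t) (at t)" for t
    by (rule derivative_eq_intros refl)+ (simp add: algebra_simps power2_eq_square)
  moreover have "continuous_on UNIV ?B2" by (intro continuous_intros)
  ultimately show ?thesis by (intro exI[of _ ?B] exI[of _ ?B1] exI[of _ ?B2]) simp
qed

lemma heads_infinite:
  assumes "b \<ge> 2" shows "infinite (heads b)"
proof -
  have "range (\<lambda>n::nat. replicate n (1::nat)) \<subseteq> heads b" using assms by (auto simp: heads_def) (metis last_replicate One_nat_def zero_neq_one)
  moreover have "infinite (range (\<lambda>n::nat. replicate n (1::nat)))"
    by (rule range_inj_infinite) (auto simp: inj_def dest: arg_cong[of _ _ length])
  ultimately show ?thesis using finite_subset by blast
qed

text \<open>\<open>T\<close> chooses a representative of the solution for each right-hand side; it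
  is a map on representatives with a norm bound. Linearity and uniqueness hold up to null
  sets.\<close>

locale tree_Green =
  fixes b :: nat and T :: "(tree_point \<Rightarrow> complex) \<Rightarrow> tree_point \<Rightarrow> complex" and K :: real
  assumes b: "b \<ge> 2" and K: "K \<ge> 0"
    and T: "g \<in> tree_L2 b \<Longrightarrow> (T g, g) \<in> dirichlet_laplacian b"
    and T_le: "g \<in> tree_L2 b \<Longrightarrow> tree_norm b (T g) \<le> K * tree_norm b g"
begin

lemma T_L2: "g \<in> tree_L2 b \<Longrightarrow> T g \<in> tree_L2 b"
  using laplacian_L2[OF T] by blast

text \<open>For the difference \<open>w\<close>, symmetry against the solution \<open>T w\<close>
  gives \<open>(w, w) = (h, T w) - (h, T w) = 0\<close>.\<close>

lemma T_unique:
  assumes "(u, h) \<in> dirichlet_laplacian b" shows "AE x in tree_measure b. u x = T h x"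
proof -
  define w where "w = (\<lambda>x. u x - T h x)"
  note L = laplacian_L2[OF assms, THEN conjunct1] laplacian_L2[OF assms, THEN conjunct2]
  have wL: "w \<in> tree_L2 b" using L T_L2 unfolding w_def by auto
  have "tree_inner b w w = tree_inner b u w - tree_inner b (T h) w"
    by (subst (1) w_def) (rule inner_diff_left[OF L(1) T_L2[OF L(2)] wL])
  also have "\<dots> = 0"
    using laplacian_symmetric[OF assms T[OF wL]] laplacian_symmetric[OF T[OF L(2)] T[OF wL]] by simp
  finally have "tree_norm b w = 0" unfolding inner_self by simp
  then show ?thesis unfolding l2_norm_eq_0_iff[OF wL] by (simp add: w_def)
qed

text \<open>One direction is uniqueness; the other uses that the graph is closed under changing
  \<open>u\<close> on null sets.\<close>

lemma graph_T:
  assumes "u \<in> tree_L2 b" "h \<in> tree_L2 b"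
  shows "(u, h) \<in> dirichlet_laplacian b \<longleftrightarrow> (AE x in tree_measure b. u x = T h x)"
proof
  assume eq: "AE x in tree_measure b. u x = T h x"
  obtain u0 where u0: "u0 \<in> H10 b" "AE x in tree_measure b. T h x = u0 x"
    "\<And>v. v \<in> H10 b \<Longrightarrow> dirichlet_form b u0 v = tree_inner b h v" using laplacian_form[OF T[OF assms(2)]] by blast
  have "AE x in tree_measure b. u x = u0 x" using eq u0(2) by eventually_elim simp
  then show "(u, h) \<in> dirichlet_laplacian b"
    unfolding dirichlet_laplacian_def form_operator_def using assms u0 by blast
qed (rule T_unique)

text \<open>Division by \<open>K + 1\<close> makes \<open>S\<close> a contraction and stays
  meaningful for \<open>K = 0\<close>.\<close>

definition S :: "(tree_point \<Rightarrow> complex) \<Rightarrow> tree_point \<Rightarrow> complex" where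
  "S f x = of_real (1 / (K + 1)) * T f x"

lemma S_T: "of_real (K + 1) * S f x = T f x"
proof -
  have "(K + 1) * (1 / (K + 1)) = 1" using K by simp
  then have "complex_of_real (K + 1) * of_real (1 / (K + 1)) = 1" by (metis of_real_mult of_real_1)
  then show ?thesis unfolding S_def by (simp only: mult.assoc[symmetric] mult_1_left)
qed

lemma S_norm_le:
  assumes f: "f \<in> tree_L2 b"
  shows "tree_norm b (S f) \<le> tree_norm b f"
proof -
  have "tree_norm b (S f) = tree_norm b (T f) / (K + 1)"
    unfolding S_def[abs_def] l2_norm_scale norm_of_real using K by simp
  also have "\<dots> \<le> K * tree_norm b f / (K + 1)" using T_le[OF f] K by (intro divide_right_mono) auto
  also have "\<dots> \<le> tree_norm b f" using K by (simp add: field_simps)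
  finally show ?thesis .
qed

text \<open>Nonnegativity of the form at \<open>T f\<close> is nonnegativity of \<open>T\<close> at
  \<open>f\<close>.\<close>

sublocale positive_contraction "tree_measure b" S
proof
  fix f g assume f: "f \<in> tree_L2 b"
  show "S f \<in> tree_L2 b" unfolding S_def[abs_def] by (rule L2_scale[OF T_L2[OF f]])
  have "Re (tree_inner b (S f) f) = Re (tree_inner b (T f) f) / (K + 1)"
    unfolding S_def[abs_def] inner_scale_left by (simp add: Re_divide_of_real)
  moreover have "0 \<le> Re (tree_inner b (T f) f)"
    using laplacian_nonneg[OF T[OF f]] laplacian_symmetric[OF T[OF f] T[OF f]] by simp
  ultimately show "0 \<le> Re (tree_inner b (S f) f)" using K by simp
  have "Re (tree_inner b (S f) f) \<le> tree_norm b (S f) * tree_norm b f"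
    using l2_Cauchy_Schwarz[OF \<open>S f \<in> tree_L2 b\<close> f] complex_Re_le_cmod order_trans by blast
  also have "\<dots> \<le> (tree_norm b f)^2"
    unfolding power2_eq_square by (intro mult_right_mono S_norm_le f) simp
  finally show "Re (tree_inner b (S f) f) \<le> (tree_norm b f)^2" .
  assume g: "g \<in> tree_L2 b"
  show "tree_inner b (S f) g = tree_inner b f (S g)"
    unfolding S_def[abs_def] inner_scale_left inner_scale_right
    using laplacian_symmetric[OF T[OF f] T[OF g]] by simp
qed

text \<open>Equal classes have equal images, by the contraction estimate for differences.\<close>

lemma S_cong_AE:
  assumes "f \<in> tree_L2 b" "g \<in> tree_L2 b" "AE x in tree_measure b. f x = g x"
  shows "AE x in tree_measure b. S f x = S g x"
proof -
  have "tree_norm b (\<lambda>x. f x - g x) = 0" using assms by (subst l2_norm_eq_0_iff) auto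
  then have "tree_norm b (\<lambda>x. S f x - S g x) = 0"
    using S_diff[OF assms(1,2)] l2_norm_nonneg[of "tree_measure b" "\<lambda>x. S f x - S g x"] by linarith
  then show ?thesis using S_L2[OF assms(1)] S_L2[OF assms(2)] by (subst (asm) l2_norm_eq_0_iff) auto
qed

text \<open>If \<open>T f\<close> vanishes, then \<open>f\<close> is orthogonal to every
  \<open>\<phi>\<close> in the domain, because \<open>(f, \<phi>) = (T f, - \<phi>'')\<close>. Bumps
  on one edge then annihilate all exponential moments of the coefficient of \<open>f\<close> times
  \<open>(t (1 - t))^2\<close>.\<close>

lemma T_injective:
  assumes f: "f \<in> tree_L2 b" and 0: "tree_norm b (T f) = 0"
  shows "tree_norm b f = 0"
proof (rule coef_zero[OF b f])
  fix p k assume p: "p \<in> heads b"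
  define c where "c = coef b f (p @ replicate k 0)"
  have cL: "c \<in> L2 unit_lebesgue" unfolding c_def by (rule coef_L2[OF f])
  have qc: "continuous_on {0..1} (\<lambda>t::real. (t * (1 - t))^2)" by (intro continuous_intros)
  have qb: "\<bar>(t * (1 - t))\<^sup>2\<bar> \<le> 1" if "t \<in> {0..1}" for t :: real
    using that by (auto intro!: power_le_one mult_le_one)
  have "AE t in unit_lebesgue. c t * of_real ((t * (1 - t))^2) = 0"
  proof (rule exponential_moments_zero[where C=0])
    show "integrable unit_lebesgue (\<lambda>t. c t * of_real ((t * (1 - t))^2))"
      by (rule unit_inner_bound(2)[OF cL qc qb]) auto
    fix n :: nat
    obtain B B1 B2 :: "real \<Rightarrow> real" where d: "\<And>t. (B has_real_derivative B1 t) (at t)" "\<And>t. (B1 has_real_derivative B2 t) (at t)"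
      and B2c: "continuous_on UNIV B2" and ends: "B 0 = 0" "B 1 = 0" "B1 0 = 0" "B1 1 = 0"
      and B: "\<And>t. B t = (t * (1 - t))^2 * exp (real n * (1 - t))"
      using bump[of "real n"] by blast
    define D where "D F j t = complex_of_real (if j = k then F t else 0)" for F :: "real \<Rightarrow> real" and j :: nat and t :: real
    have B2': "continuous_on {0..1} B2" by (rule continuous_on_subset[OF B2c]) simp
    then have "continuous_on {0..1} (\<lambda>t. - B2 t)" by (rule continuous_on_minus)
    moreover have "continuous_on {0..1} B" "continuous_on {0..1} B1"
      by (rule DERIV_continuous_on, rule has_field_derivative_at_within, rule d)+
    ultimately have c: "continuous_on {0..1} B" "continuous_on {0..1} B1" "continuous_on {0..1} (\<lambda>t. - B2 t)" by blast+
    have DL: "D F j \<in> L2 unit_lebesgue" if "continuous_on {0..1} F" for F j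
    proof -
      have "continuous_on {0..1} (\<lambda>t. complex_of_real (F t))" by (rule continuous_on_of_real[OF that])
      from continuous_unit_L2[OF this] show ?thesis by (cases "j = k") (simp_all add: D_def[abs_def])
    qed
    have Ds: "summable (\<lambda>j. (unit_norm (D F j))^2)" for F
      by (rule summable_finite[of "{k}"]) (auto simp: D_def[abs_def])
    have Dp: "primitive (D F j) (D F' j)"
      if "\<And>t. (F has_real_derivative F' t) (at t)" "continuous_on {0..1} F'" for F F' j
    proof -
      have "primitive (\<lambda>t. complex_of_real (F t)) (\<lambda>t. complex_of_real (F' t))"
        by (intro primitive_C1 has_vector_derivative_of_real has_field_derivative_at_within[OF that(1)] continuous_on_of_real[OF that(2)])
      then show ?thesis using primitive_const[of 0] by (cases "j = k") (simp_all add: D_def[abs_def])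
    qed
    have neg: "(\<lambda>t. - D (\<lambda>t. - B2 t) j t) = D B2 j" for j by (simp add: D_def fun_eq_iff)
    have "radial_pair b (D B) (D (\<lambda>t. - B2 t))"
      unfolding radial_pair_def neg
      by (intro conjI allI exI[of _ "D B1"] DL c Ds Dp d B2') (auto simp: D_def ends)
    note P = this
    let ?g = "ext b p (D (\<lambda>t. - B2 t))"
    have g: "?g \<in> tree_L2 b" by (rule ext_L2(1)[OF b p DL[OF c(3)] Ds])
    have "tree_inner b f (ext b p (D B)) = tree_inner b (T f) ?g"
      by (rule laplacian_symmetric[OF T[OF f] radial_pair_laplacian[OF b p P]])
    also have "\<dots> = 0" using l2_Cauchy_Schwarz[OF T_L2[OF f] g] 0 by simp
    finally have "(\<lambda>j. LINT t|unit_lebesgue. coef b f (p @ replicate j 0) t * cnj (D B j t)) sums 0"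
      using ext_inner_sums[OF b p DL[OF c(1)] Ds f] by metis
    moreover have "(\<lambda>j. LINT t|unit_lebesgue. coef b f (p @ replicate j 0) t * cnj (D B j t)) =
      (\<lambda>j. if j = k then LINT t|unit_lebesgue. coef b f (p @ replicate j 0) t * of_real (B t) else 0)"
      by (auto simp: D_def fun_eq_iff)
    ultimately have "(LINT t|unit_lebesgue. c t * of_real (B t)) = 0"
      unfolding c_def using sums_unique2[OF sums_single[of k "\<lambda>j. LINT t|unit_lebesgue. coef b f (p @ replicate j 0) t * of_real (B t)"]] by simp
    then have "(LINT t|unit_lebesgue. of_real (exp (real n * (1 - t))) * (c t * of_real ((t * (1 - t))^2))) = 0"
      unfolding B of_real_mult by (simp only: mult_ac)
    then show "cmod (LINT t|unit_lebesgue. of_real (exp (real n * (1 - t))) * (c t * of_real ((t * (1 - t))^2))) \<le> 0" by simp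
  qed
  then show "AE t in unit_lebesgue. c t = 0"
    by (rule AE_mp) (rule AE_I2, auto)
qed

definition generator :: "nat list \<Rightarrow> tree_point \<Rightarrow> complex" where
  "generator p = ext b p (wave (1 / sqrt b) 1 (affine b))"

lemma affine_cont: "continuous_on {0..1} (affine b)"
  unfolding affine_def[abs_def] using b by (intro continuous_intros) auto

lemma m0: "\<bar>1 / sqrt (real b)\<bar> < 1"
  using b by simp

lemma generator_L2: "p \<in> heads b \<Longrightarrow> generator p \<in> tree_L2 b"
  unfolding generator_def by (intro ext_L2(1)[OF b] wave_L2 affine_cont m0)

text \<open>The profile \<open>\<gamma>\<close> does not depend on the chain, which is why all
  generators have the same spectral moments. The induction solves one half-line problem and
  transports it to every head.\<close>

lemma generator_power:
  "\<exists>\<gamma>. (\<forall>k. \<gamma> k \<in> L2 unit_lebesgue) \<and> square_summable \<gamma> \<and>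
     (\<forall>p\<in>heads b. AE x in tree_measure b. (S ^^ i) (generator p) x = ext b p \<gamma> x)"
proof (induction i)
  case 0
  show ?case unfolding generator_def
    by (intro exI[of _ "wave (1 / sqrt b) 1 (affine b)"] conjI allI wave_L2 affine_cont m0) simp
next
  case (Suc i)
  then obtain \<gamma> where \<gamma>: "\<And>k. \<gamma> k \<in> L2 unit_lebesgue" "square_summable \<gamma>"
    and eq: "\<And>p. p \<in> heads b \<Longrightarrow> AE x in tree_measure b. (S ^^ i) (generator p) x = ext b p \<gamma> x" by blast
  obtain \<phi> where \<phi>: "radial_pair b \<phi> \<gamma>" using radial_pair_exists[OF b \<gamma>] by blast
  note \<phi>L = radial_pair_L2[OF \<phi>]
  have \<phi>s: "square_summable \<phi>" using \<phi> unfolding radial_pair_def by blast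
  let ?\<psi> = "\<lambda>k t. of_real (1 / (K + 1)) * \<phi> k t + 0 * \<phi> k t"
  have "AE x in tree_measure b. (S ^^ Suc i) (generator p) x = ext b p ?\<psi> x" if p: "p \<in> heads b" for p
  proof -
    have "AE x in tree_measure b. (S ^^ Suc i) (generator p) x = S (ext b p \<gamma>) x"
      using S_cong_AE[OF pow_L2[OF generator_L2[OF p]] ext_L2(1)[OF b p \<gamma>] eq[OF p]] by simp
    moreover have "AE x in tree_measure b. ext b p \<phi> x = T (ext b p \<gamma>) x"
      by (rule T_unique[OF radial_pair_laplacian[OF b p \<phi>]])
    ultimately show ?thesis unfolding ext_add by eventually_elim (simp add: S_def)
  qed
  moreover have "?\<psi> k \<in> L2 unit_lebesgue" for k by (intro L2_add L2_scale \<phi>L)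
  moreover have "square_summable ?\<psi>" by (intro summable_l2_comb \<phi>L \<phi>s)
  ultimately show ?case by (intro exI[of _ ?\<psi>] conjI allI ballI)
qed

lemma generator_gram:
  "\<exists>c. \<forall>p\<in>heads b. \<forall>q\<in>heads b. tree_inner b ((S ^^ i) (generator p)) (generator q) = (if p = q then c else 0)"
proof -
  obtain \<gamma> where \<gamma>: "\<And>k. \<gamma> k \<in> L2 unit_lebesgue" "square_summable \<gamma>"
    and eq: "\<And>p. p \<in> heads b \<Longrightarrow> AE x in tree_measure b. (S ^^ i) (generator p) x = ext b p \<gamma> x"
    using generator_power[of i] by blast
  let ?c = "\<Sum>k. LINT t|unit_lebesgue. \<gamma> k t * cnj (wave (1 / sqrt b) 1 (affine b) k t)"
  have "tree_inner b ((S ^^ i) (generator p)) (generator q) = (if p = q then ?c else 0)"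
    if p: "p \<in> heads b" and q: "q \<in> heads b" for p q
  proof -
    note L = ext_L2(1)[OF b p \<gamma>]
    have "tree_inner b ((S ^^ i) (generator p)) (generator q) = tree_inner b (ext b p \<gamma>) (generator q)"
      by (rule inner_cong_AE[OF eq[OF p] pow_L2[OF generator_L2[OF p]] L generator_L2[OF q]])
    moreover have "coef b (ext b p \<gamma>) (q @ replicate k 0) t = (if p = q then \<gamma> k t else 0)" for k t
      using coef_ext[OF b p chain_word[OF b q]] strip_head[OF q] by (auto simp: strip_append)
    then have "(\<lambda>k. LINT t|unit_lebesgue. (if p = q then \<gamma> k t else 0) * cnj (wave (1 / sqrt b) 1 (affine b) k t))
       sums tree_inner b (ext b p \<gamma>) (generator q)"
      using ext_inner_sums[OF b q wave_L2(1)[OF m0 affine_cont] wave_L2(2)[OF m0 affine_cont] L] unfolding generator_def by simp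
    ultimately show ?thesis by (auto simp: sums_iff split: if_splits)
  qed
  then show ?thesis by blast
qed

lemma generator_nonzero:
  assumes p: "p \<in> heads b" shows "tree_inner b (generator p) (generator p) \<noteq> 0"
proof
  assume "tree_inner b (generator p) (generator p) = 0"
  then have "tree_norm b (generator p) = 0" unfolding inner_self by simp
  then have "(unit_norm (\<lambda>t. complex_of_real (1 * affine b t)))^2 / (1 - (1 / sqrt b)\<^sup>2) = 0"
    using ext_L2(2)[OF b p wave_L2(1)[OF m0 affine_cont] wave_L2(2)[OF m0 affine_cont], of 1] wave_L2(3)[OF m0 affine_cont, of 1]
    unfolding generator_def by simp
  moreover have "(1 / sqrt b)^2 < 1" using b by (simp add: power_divide)
  ultimately have "unit_norm (\<lambda>t. complex_of_real (1 * affine b t)) = 0" by simp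
  then have "complex_of_real (1 * affine b 0) = 0"
    by (rule continuous_l2_norm_0[rotated]) (simp, intro continuous_intros affine_cont)
  then show False by (simp add: affine_def)
qed

text \<open>\<open>f\<close> is orthogonal to the cyclic spaces, hence, by
  \<open>orthogonal_resolvent\<close>, to the decaying waves for all \<open>n\<close>; along each
  chain this is the hypothesis of \<open>chain_zero\<close>.\<close>

lemma generator_total:
  assumes f: "f \<in> tree_L2 b"
    and orth: "\<And>p i. p \<in> heads b \<Longrightarrow> tree_inner b f ((S ^^ i) (generator p)) = 0"
  shows "tree_norm b f = 0"
proof (rule coef_zero[OF b f])
  fix p k assume p: "p \<in> heads b"
  define R where "R = (sqrt b + 1 / sqrt b) / 2"
  interpret P: tree_parameters b R "arccos (1 / R)" by unfold_locales (use b in \<open>simp_all add: R_def\<close>)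
  have R1: "R > 1" by (rule P.R_gt)
  show "AE t in unit_lebesgue. coef b f (p @ replicate k 0) t = 0"
  proof (rule chain_zero[where f="\<lambda>k. coef b f (p @ replicate k 0)" and R=R and \<beta>="1 / sqrt b" and N="tree_norm b f"])
    show "coef b f (p @ replicate k 0) \<in> L2 unit_lebesgue" for k by (rule coef_L2[OF f])
    show "unit_norm (coef b f (p @ replicate k 0)) \<le> tree_norm b f" for k
      by (rule coef_norm_le[OF b f chain_word[OF b p]])
    show "R > 1" by (rule R1)
    show "0 \<le> 1 / sqrt b" "1 / sqrt b \<le> 1" using b by auto
    fix n :: nat assume n: "n \<ge> 1"
    have "1 * 1 < R * cosh (real n)" using R1 cosh_real_ge_1[of "real n"] by (intro mult_less_le_imp_less) auto
    then obtain m where m: "0 < m" "m < 1" "m + 1 / m = 2 * (R * cosh (real n))" "m * (R * cosh (real n)) \<le> 1"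
      using multiplier[of "R * cosh (real n)"] by auto
    have m3: "m + 1 / m = (sqrt b + 1 / sqrt b) * cosh (real n)" using m(3) by (simp add: R_def)
    have n0: "real n > 0" and sn: "sinh (real n) > 0" using n by auto
    let ?h = "decaying b m (real n)"
    let ?H = "wave m (1 / sinh (real n)) ?h"
    have hc: "continuous_on {0..1} ?h" unfolding decaying_def[abs_def] by (intro continuous_intros)
    have m': "\<bar>m\<bar> < 1" using m by simp
    note HL = wave_L2[OF m' hc, of "1 / sinh (real n)"]
    have L: "ext b p ?H \<in> tree_L2 b" by (rule ext_L2(1)[OF b p HL(1) HL(2)])
    have P: "radial_pair b (\<lambda>k t. of_real (1 / (real n)^2) * wave (1 / sqrt b) 1 (affine b) k t +
      of_real (- 1 / (real n)^2) * ?H k t) ?H" by (rule decaying_pair[OF b n0 m(1,2) m3])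
    \<comment> \<open>Solves the identity \<open>T H = (G - H) / r\<close> for \<open>G\<close>; it
      exhibits the decaying wave \<open>H\<close> as \<open>(1 + r T)^(-1) G\<close>.\<close>
    have alg: "G = H + of_real (r * (K + 1)) * x" if "of_real (1 / r) * G + of_real (- 1 / r) * H = of_real (K + 1) * x" "r > 0"
      for G H x :: complex and r :: real
    proof -
      have "of_real r * (of_real (1 / r) * G + of_real (- 1 / r) * H) = G - H" using that(2) by (simp add: algebra_simps)
      then show ?thesis unfolding that(1) by (simp add: algebra_simps)
    qed
    from T_unique[OF radial_pair_laplacian[OF b p P]]
    have "AE x in tree_measure b. generator p x = ext b p ?H x + of_real ((real n)^2 * (K + 1)) * S (ext b p ?H) x"
    proof (rule eventually_mono)
      fix x
      assume "ext b p (\<lambda>k t. of_real (1 / (real n)^2) * wave (1 / sqrt b) 1 (affine b) k t + of_real (- 1 / (real n)^2) * ?H k t) x =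
        T (ext b p ?H) x"
      then have "of_real (1 / (real n)^2) * generator p x + of_real (- 1 / (real n)^2) * ext b p ?H x = of_real (K + 1) * S (ext b p ?H) x"
        by (simp only: ext_add S_T generator_def)
      then show "generator p x = ext b p ?H x + of_real ((real n)^2 * (K + 1)) * S (ext b p ?H) x"
        by (rule alg) (use n0 in simp)
    qed
    then have "tree_inner b f (ext b p ?H) = 0"
      by (rule orthogonal_resolvent[OF generator_L2[OF p] L _ _ f orth[OF p]]) (use n0 K in simp)
    then have "(\<lambda>k. LINT t|unit_lebesgue. coef b f (p @ replicate k 0) t * cnj (?H k t)) sums 0"
      using ext_inner_sums[OF b p HL(1) HL(2) f] by metis
    \<comment> \<open>Removes the normalisation \<open>1 / sinh n\<close> of the wave.\<close>
    from sums_mult[OF this, of "of_real (sinh (real n))"]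
    have s: "(\<lambda>k. of_real (sinh (real n)) * (LINT t|unit_lebesgue. coef b f (p @ replicate k 0) t * cnj (?H k t))) sums 0" by simp
    have "of_real (sinh (real n)) * (LINT t|unit_lebesgue. coef b f (p @ replicate k 0) t * cnj (?H k t)) =
      (LINT t|unit_lebesgue. coef b f (p @ replicate k 0) t * of_real (m ^ k * (sinh (real n * (1 - t)) + m * (1 / sqrt b) * sinh (real n * t))))" for k
    proof -
      have "of_real (sinh (real n)) * (LINT t|unit_lebesgue. coef b f (p @ replicate k 0) t * cnj (?H k t)) =
        (LINT t|unit_lebesgue. of_real (sinh (real n)) * (coef b f (p @ replicate k 0) t * cnj (?H k t)))" by simp
      also have "\<dots> = (LINT t|unit_lebesgue. coef b f (p @ replicate k 0) t * of_real (m ^ k * ?h t))"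
      proof (intro Bochner_Integration.integral_cong refl)
        fix t
        have "sinh (real n) * (m ^ k * (1 / sinh (real n) * ?h t)) = m ^ k * ?h t" using sn by simp
        then have "complex_of_real (sinh (real n)) * ?H k t = of_real (m ^ k * ?h t)" unfolding wave_def by (metis of_real_mult)
        then show "of_real (sinh (real n)) * (coef b f (p @ replicate k 0) t * cnj (?H k t)) = coef b f (p @ replicate k 0) t * of_real (m ^ k * ?h t)"
          unfolding wave_def complex_cnj_complex_of_real by (metis mult.left_commute)
      qed
      finally show ?thesis by (simp only: decaying_def)
    qed
    with s show "\<exists>m>0. m * (R * cosh (real n)) \<le> 1 \<and> (\<lambda>k. LINT t|unit_lebesgue. coef b f (p @ replicate k 0) t *
        of_real (m ^ k * (sinh (real n * (1 - t)) + m * (1 / sqrt b) * sinh (real n * t)))) sums 0"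
      using m(1,4) by (intro exI[of _ m] conjI) simp_all
  qed
qed

text \<open>The heads are countably infinite and index the copies of the measure;
  \<open>graph_T\<close> translates membership in the graph into \<open>u = (K + 1) S h\<close>, the
  form in which \<open>spectral_model\<close> describes the unbounded operator.\<close>

theorem laplacian_infinite_multiplicity: "infinite_multiplicity (tree_measure b) (dirichlet_laplacian b)"
proof -
  let ?v = "\<lambda>n. generator (from_nat_into (heads b) n)"
  have bij: "bij_betw (from_nat_into (heads b)) UNIV (heads b)"
    by (rule bij_betw_from_nat_into[OF countableI_type heads_infinite[OF b]])
  have e: "from_nat_into (heads b) n \<in> heads b" for n using bij by (auto simp: bij_betw_def)
  have e_eq: "from_nat_into (heads b) m = from_nat_into (heads b) n \<longleftrightarrow> m = n" for m n
    using bij by (auto simp: bij_betw_def inj_eq)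
  obtain c where c: "\<And>i p q. p \<in> heads b \<Longrightarrow> q \<in> heads b \<Longrightarrow>
      tree_inner b ((S ^^ i) (generator p)) (generator q) = (if p = q then c i else 0)"
    using generator_gram by metis
  have "\<exists>\<mu> :: real measure. sets \<mu> = sets borel \<and> finite_measure \<mu> \<and>
     (\<exists>U. l2_unitary (tree_measure b) (\<mu> \<Otimes>\<^sub>M count_space (UNIV :: nat set)) U \<and>
       (\<forall>u\<in>tree_L2 b. \<forall>h\<in>tree_L2 b. (AE x in tree_measure b. u x = of_real (K + 1) * S h x) \<longleftrightarrow>
         (U u, U h) \<in> multiplication_op (\<mu> \<Otimes>\<^sub>M count_space UNIV) (\<lambda>(s, n). complex_of_real s)))"
  proof (rule spectral_model[of ?v c])
    show "?v n \<in> tree_L2 b" for n by (rule generator_L2[OF e])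
    show "tree_inner b ((S ^^ i) (?v m)) (?v n) = (if m = n then c i else 0)" for i m n
      using c[OF e e] by (simp add: e_eq)
    show "c 0 \<noteq> 0" using c[OF e e, of 0 0 0] generator_nonzero[OF e] by auto
    fix f assume f: "f \<in> tree_L2 b"
    {
      assume o: "\<And>i n. tree_inner b f ((S ^^ i) (?v n)) = 0"
      show "tree_norm b f = 0"
      proof (rule generator_total[OF f])
        fix p i assume "p \<in> heads b"
        then obtain n where "p = from_nat_into (heads b) n" using bij by (auto simp: bij_betw_def)
        then show "tree_inner b f ((S ^^ i) (generator p)) = 0" using o by simp
      qed
    next
      assume "tree_norm b (S f) = 0"
      then have "tree_norm b (T f) = 0"
        unfolding S_def[abs_def] l2_norm_scale norm_of_real using K by simp
      then show "tree_norm b f = 0" by (rule T_injective[OF f])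
    }
  qed (use K in simp)
  then obtain \<mu> :: "real measure" and U where "sets \<mu> = sets borel" "finite_measure \<mu>"
    "l2_unitary (tree_measure b) (\<mu> \<Otimes>\<^sub>M count_space (UNIV :: nat set)) U"
    "\<forall>u\<in>tree_L2 b. \<forall>h\<in>tree_L2 b. (AE x in tree_measure b. u x = T h x) \<longleftrightarrow>
         (U u, U h) \<in> multiplication_op (\<mu> \<Otimes>\<^sub>M count_space UNIV) (\<lambda>(s, n). complex_of_real s)"
    unfolding S_T by (elim exE conjE)
  then show ?thesis unfolding infinite_multiplicity_def unitarily_equivalent_def
    by (intro exI[of _ \<mu>] exI[of _ U] conjI) (simp_all add: graph_T)
qed

end

lemma tree_Green_exists:
  assumes b: "b \<ge> 2" shows "\<exists>T K. tree_Green b T K"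
proof -
  obtain K where K: "K \<ge> 0" and sol: "\<forall>g\<in>tree_L2 b. \<exists>u\<in>tree_L2 b.
     (u, \<lambda>x. 0 * u x + g x) \<in> dirichlet_laplacian b \<and> tree_norm b u \<le> K * tree_norm b g"
    using tree_solution[OF b good_0[OF b]] by blast
  from bchoice[OF sol[unfolded Bex_def]] obtain T where
    "\<forall>g\<in>tree_L2 b. T g \<in> tree_L2 b \<and> (T g, \<lambda>x. 0 * T g x + g x) \<in> dirichlet_laplacian b \<and>
      tree_norm b (T g) \<le> K * tree_norm b g" by blast
  then have "tree_Green b T K" using b K by unfold_locales auto
  then show ?thesis by blast
qed

theorem theorem3p3:
  fixes b :: nat and R \<theta> :: real
  assumes "b \<ge> 2"
    and "R = (real b powr (1/2) + real b powr (-1/2)) / 2"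
    and "\<theta> = arccos (1 / R)"
  shows "infinite_multiplicity (tree_measure b) (dirichlet_laplacian b) \<and>
         spectrum (tree_measure b) (dirichlet_laplacian b) =
           complex_of_real `
             ((\<Union>l\<in>{1::nat..}. {(pi * (real l - 1) + \<theta>)\<^sup>2 .. (pi * real l - \<theta>)\<^sup>2}) \<union>
              {(pi * real l)\<^sup>2 | l. l \<ge> (1::nat)}) \<and>
         (\<forall>l\<ge>1::nat. eigenvalue (tree_measure b) (dirichlet_laplacian b)
                        (complex_of_real ((pi * real l)\<^sup>2)))"
proof -
  have "R = (sqrt b + 1 / sqrt b) / 2"
    using assms(1,2) powr_minus_divide[of "real b" "1 / 2"] by (simp add: powr_half_sqrt)
  then interpret tree_parameters b R \<theta> by unfold_locales (use assms in auto)
  obtain T K where "tree_Green b T K" using tree_Green_exists[OF assms(1)] by blast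
  then show ?thesis
    using tree_Green.laplacian_infinite_multiplicity spectrum_eq[unfolded spec_def] eigenvalue_point[OF assms(1)] by blast
qed

end
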